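(* Let $\mu$ be a doubling measure in $\mathbb{R}^n$, denote by $\Sigma$ its support, and set $$\Sigma_0=\Big\{x\in\Sigma\ :\ \int_0^1\alpha(x,r)\,\frac{dr}{r}<+\infty\Big\}.$$ Then there are disjoint Borel sets $\Sigma_0(d)\subset\Sigma$, $0\le d\le n$, such that $\Sigma_0=\bigcup_{d=0}^n\Sigma_0(d)$, with the following properties. (1) $\Sigma_0(0)$ is the set of points of $\Sigma$ where $\mu$ has an atom; it is at most countable and each of its points is an isolated point of $\Sigma$. (2) For $1\le d\le n$ and $x\in\Sigma_0(d)$, the limit $\theta_d(x):=\lim_{r\to0}r^{-d}\mu(B(x,r))$ exists, and $0<\theta_d(x)<\infty$. (3) For $1\le d\le n$ and $x\in\Sigma_0(d)$, $\Sigma$ has a tangent $d$-plane $W$ at $x$, i.e. $W$ is a $d$-dimensional affine plane through $x$ such that $$\lim_{r\to0}\frac1r\sup\{\operatorname{dist}(y,W)\ :\ y\in\Sigma\cap B(x,r)\}=0 .$$ Set $W^*=W-x$ (the corresponding vector space). Then $\operatorname{Tan}(\mu,x)=\{c\,\mathcal{H}^d|_{W^*}\ :\ c\ge0\}$. In addition, the measures $\mu_{x,r}$ converge weakly to $\mathcal{H}^d|_{W^*}$ as $r\to 0$. (4) For $1\le d\le n$ and $k\in\mathbb{Z}$ set $\Sigma_0(d,k)=\{x\in\Sigma_0(d)\ :\ 2^k\le\theta_d(x)<2^{k+1}\}$. Then each $\Sigma_0(d,k)$ is a rectifiable set of dimension $d$, with $\mathcal{H}^d(\Sigma_0(d,k)\cap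 B(0,R))<\infty$ for every $R>0$, $\mu$ and $\mathcal{H}^d$ are mutually absolutely continuous on $\Sigma_0(d,k)$, and $\mu=\theta_d\,\mathcal{H}^d$ there.
   Context: $B(x,r)$ is the open ball, $\mathbb{B}=B(0,1)\subset\mathbb{R}^n$. $\mu$ is a Radon measure on $\mathbb{R}^n$ (locally finite positive Borel measure) with support $\Sigma=\{x:\mu(B(x,r))>0\ \forall r>0\}$; $\mu$ is doubling if there is a constant $C_\delta>0$ with $\mu(B(x,2r))\le C_\delta\,\mu(B(x,r))$ for all $x\in\Sigma$, $r>0$. $\mathcal{H}^d$ is $d$-dimensional Hausdorff measure normalized so that $\mathcal{H}^d(\mathbb{R}^d\cap B(0,1))=1$. For measures $\mu,\nu$ on $\mathbb{R}^n$ whose restrictions to $\mathbb{B}$ are probability measures, $\mathbb{W}_1(\mu,\nu)=\sup_\psi\left|\int\psi\,d\mu-\int\psi\,d\nu\right|$, the supremum over all $1$-Lipschitz $\psi:\mathbb{R}^n\to\mathbb{R}$ supported on $\mathbb{B}$ (vanishing outside $\mathbb{B}$). For $x\in\Sigma$, $r>0$, $\mu_{x,r}(A)=\mu(x+rA)/\mu(B(x,r))$ for Borel $A\subset\mathbb{R}^n$. $A'(d,n)$ is the set of $d$-dimensional affine planes of $\mathbb{R}^n$ meeting $B(0,1/2)$. For $V\in A'(d,n)$, $\nu_V=c_V\mathcal{H}^d|_V$ with $c_V=\mathcal{H}^d(V\cap\mathbb{B})^{-1}$ (when $d=0$, $\nu_V$ is a Dirac mass at a point of $B(0,1/2)$).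 Then $\alpha_d(x,r)=\inf\{\mathbb{W}_1(\mu_{x,r},\nu_V):V\in A'(d,n)\}$ and $\alpha(x,r)=\min_{d=0,1,\dots,n}\alpha_d(x,r)$. $\operatorname{Tan}(\mu,x)$ is the set of Radon measures $\nu$ that are weak limits of sequences $\{\mu_k\}$ with $\mu_k(A)=c_k\,\mu(x+r_kA)$, where $c_k\ge0$, $r_k>0$, $r_k\to0$. Weak convergence is tested against continuous functions with compact support. $\mu$ has an atom at $x$ if $\mu(\{x\})>0$. A set is rectifiable of dimension $d$ if it can be covered, up to an $\mathcal{H}^d$-null set, by countably many $d$-dimensional Lipschitz graphs. *)

theory Defs
  imports "HOL-Analysis.Analysis"
begin

section \<open>Hausdorff measure\<close>

text \<open>Countable covers by bounded sets of diameter at most \<open>\<delta>\<close>.  Boundedness is explicit because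
  \<^const>\<open>diameter\<close> is only meaningful on bounded sets; the empty set gets weight 0 because
  \<open>0 ^ 0 = 1\<close>, so that \<open>d = 0\<close> yields the counting measure.\<close>

definition hausdorff_pre :: "nat \<Rightarrow> real \<Rightarrow> 'a::metric_space set \<Rightarrow> ennreal" where
  "hausdorff_pre d \<delta> A =
     (INF E \<in> {E :: nat \<Rightarrow> 'a set. (\<forall>i. bounded (E i) \<and> diameter (E i) \<le> \<delta>) \<and> A \<subseteq> (\<Union>i. E i)}.
        \<Sum>i. if E i = {} then 0 else ennreal (diameter (E i) ^ d))"

definition hausdorff_unnormalized :: "nat \<Rightarrow> 'a::metric_space set \<Rightarrow> ennreal" where
  "hausdorff_unnormalized d A = (SUP \<delta>\<in>{0<..}. hausdorff_pre d \<delta> A)"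

text \<open>The normalization gives measure 1 to the open unit ball of \<open>\<real>\<^sup>d\<close>.  Here \<open>\<real>\<^sup>d\<close> is realized
  as some \<open>d\<close>-dimensional linear subspace of the ambient space (so \<open>d\<close> must be at most its dimension);
  all of them are isometric, hence the choice is immaterial.\<close>

definition hausdorff_outer :: "nat \<Rightarrow> 'a::euclidean_space set \<Rightarrow> ennreal" where
  "hausdorff_outer d A =
     hausdorff_unnormalized d A /
     hausdorff_unnormalized d ((SOME P :: 'a set. subspace P \<and> dim P = d) \<inter> ball 0 1)"

text \<open>By Caratheodory's criterion the metric outer measure above is countably additive on the Borel
  sets, so the emeasure of the following measure coincides with it there.\<close>

definition hausdorff_measure :: "nat \<Rightarrow> 'a::euclidean_space measure" where
  "hausdorff_measure d = measure_of UNIV (sets borel) (hausdorff_outer d)"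

text \<open>The restriction \<open>M|\<^sub>E\<close>, as a measure on the whole space: \<open>A \<mapsto> M (A \<inter> E)\<close>
  (unlike \<^const>\<open>restrict_space\<close>, which changes the underlying space).\<close>

definition measure_on :: "'a measure \<Rightarrow> 'a set \<Rightarrow> 'a measure" where
  "measure_on M E = density M (indicator E)"


section \<open>Radon and doubling measures, weak convergence, tangent measures\<close>

definition radon_measure :: "'a::euclidean_space measure \<Rightarrow> bool" where
  "radon_measure M \<longleftrightarrow>
     sets M = sets borel \<and> (\<forall>x. \<exists>U. open U \<and> x \<in> U \<and> emeasure M U < \<infinity>)"

definition msupport :: "'a::euclidean_space measure \<Rightarrow> 'a set" where
  "msupport M = {x. \<forall>r>0. emeasure M (ball x r) > 0}"

definition doubling_measure :: "'a::euclidean_space measure \<Rightarrow> bool" where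
  "doubling_measure M \<longleftrightarrow>
     (\<exists>C>0. \<forall>x\<in>msupport M. \<forall>r>0.
        emeasure M (ball x (2 * r)) \<le> ennreal C * emeasure M (ball x r))"

definition weakly_converges ::
    "('i \<Rightarrow> 'a::euclidean_space measure) \<Rightarrow> 'a measure \<Rightarrow> 'i filter \<Rightarrow> bool" where
  "weakly_converges M N F \<longleftrightarrow>
     (\<forall>\<phi>::'a \<Rightarrow> real. continuous_on UNIV \<phi> \<and> compact (closure {y. \<phi> y \<noteq> 0}) \<longrightarrow>
        ((\<lambda>i. integral\<^sup>L (M i) \<phi>) \<longlongrightarrow> integral\<^sup>L N \<phi>) F)"

text \<open>The measure \<open>A \<mapsto> M (x + r A)\<close>, as the image of \<open>M\<close> under \<open>y \<mapsto> (y - x) / r\<close>.\<close>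

definition dilated_measure ::
    "'a::euclidean_space measure \<Rightarrow> 'a \<Rightarrow> real \<Rightarrow> 'a measure" where
  "dilated_measure M x r = distr M borel (\<lambda>y. (1 / r) *\<^sub>R (y - x))"

definition blowup :: "'a::euclidean_space measure \<Rightarrow> 'a \<Rightarrow> real \<Rightarrow> 'a measure" where
  "blowup M x r = scale_measure (1 / emeasure M (ball x r)) (dilated_measure M x r)"

definition tangent_measures :: "'a::euclidean_space measure \<Rightarrow> 'a \<Rightarrow> 'a measure set" where
  "tangent_measures M x =
     {N. radon_measure N \<and>
         (\<exists>(c :: nat \<Rightarrow> real) (r :: nat \<Rightarrow> real).
            (\<forall>k. c k \<ge> 0) \<and> (\<forall>k. r k > 0) \<and> r \<longlonglongrightarrow> 0 \<and>
            weakly_converges (\<lambda>k. scale_measure (ennreal (c k)) (dilated_measure M x (r k)))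
              N sequentially)}"


section \<open>The Wasserstein distance and the numbers \<open>\<alpha>\<close>\<close>

definition wasserstein1 :: "'a::euclidean_space measure \<Rightarrow> 'a measure \<Rightarrow> ennreal" where
  "wasserstein1 M N =
     (SUP \<psi> \<in> {\<psi> :: 'a \<Rightarrow> real. 1-lipschitz_on UNIV \<psi> \<and> (\<forall>y. y \<notin> ball 0 1 \<longrightarrow> \<psi> y = 0)}.
        ennreal \<bar>integral\<^sup>L M \<psi> - integral\<^sup>L N \<psi>\<bar>)"

definition planes_near :: "nat \<Rightarrow> 'a::euclidean_space set set" where
  "planes_near d = {V. affine V \<and> aff_dim V = int d \<and> V \<inter> ball 0 (1/2) \<noteq> {}}"

definition flat_measure :: "nat \<Rightarrow> 'a::euclidean_space set \<Rightarrow> 'a measure" where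
  "flat_measure d V =
     scale_measure (1 / hausdorff_outer d (V \<inter> ball 0 1)) (measure_on (hausdorff_measure d) V)"

definition alpha_dim :: "'a::euclidean_space measure \<Rightarrow> nat \<Rightarrow> 'a \<Rightarrow> real \<Rightarrow> ennreal" where
  "alpha_dim M d x r = (INF V \<in> planes_near d. wasserstein1 (blowup M x r) (flat_measure d V))"

definition alpha :: "'a::euclidean_space measure \<Rightarrow> 'a \<Rightarrow> real \<Rightarrow> ennreal" where
  "alpha M x r = Min ((\<lambda>d. alpha_dim M d x r) ` {0..DIM('a)})"

definition Sigma0 :: "'a::euclidean_space measure \<Rightarrow> 'a set" where
  "Sigma0 M =
     {x \<in> msupport M. (\<integral>\<^sup>+ r \<in> {0<..1}. (alpha M x r / ennreal r) \<partial>lborel) < \<infinity>}"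


section \<open>Density, tangent planes, rectifiability\<close>

definition theta :: "'a::euclidean_space measure \<Rightarrow> nat \<Rightarrow> 'a \<Rightarrow> real" where
  "theta M d x = Lim (at_right 0) (\<lambda>r. measure M (ball x r) / r ^ d)"

definition tangent_plane :: "nat \<Rightarrow> 'a::euclidean_space set \<Rightarrow> 'a \<Rightarrow> 'a set \<Rightarrow> bool" where
  "tangent_plane d S x W \<longleftrightarrow>
     affine W \<and> aff_dim W = int d \<and> x \<in> W \<and>
     ((\<lambda>r. (1 / r) * (SUP y \<in> S \<inter> ball x r. infdist y W)) \<longlongrightarrow> 0) (at_right 0)"

definition lipschitz_graph :: "nat \<Rightarrow> 'a::euclidean_space set \<Rightarrow> bool" where
  "lipschitz_graph d G \<longleftrightarrow>
     (\<exists>(P :: 'a set) (f :: 'a \<Rightarrow> 'a) L.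
        subspace P \<and> dim P = d \<and> L-lipschitz_on P f \<and> f ` P \<subseteq> orthogonal_comp P \<and>
        G = (\<lambda>p. p + f p) ` P)"

definition rectifiable :: "nat \<Rightarrow> 'a::euclidean_space set \<Rightarrow> bool" where
  "rectifiable d E \<longleftrightarrow>
     (\<exists>G :: nat \<Rightarrow> 'a set.
        (\<forall>i. lipschitz_graph d (G i)) \<and> hausdorff_outer d (E - (\<Union>i. G i)) = 0)"

definition density_layer ::
    "'a::euclidean_space measure \<Rightarrow> nat \<Rightarrow> 'a set \<Rightarrow> int \<Rightarrow> 'a set" where
  "density_layer M d S k = {x \<in> S. 2 powi k \<le> theta M d x \<and> theta M d x < 2 powi (k + 1)}"

end

theory Submission
  imports Defs
begin

text \<open>
  Fix a point \<open>x\<close> with finite integral.  Choosing in each dyadic interval a scale at which \<open>\<alpha>(x, r)\<close> is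
  nearly minimal, one obtains planes \<open>V\<^sub>k\<close> and multiples \<open>c\<^sub>k\<close> of Hausdorff measure on them that approximate
  \<open>\<mu>\<close> near \<open>x\<close> with summable errors.  Since \<open>\<mu>\<close> is doubling and charges every neighbourhood of \<open>x\<close>, the
  planes approach \<open>x\<close>, and comparing the approximations on a common ball shows that eventually all have
  the same dimension \<open>d\<close> and that the ratios \<open>c\<^sub>k\<^sub>+\<^sub>1 / c\<^sub>k\<close> and the directions converge summably fast.  Hence the
  rescaled measures \<open>r\<^sup>-\<^sup>d \<mu>(x + r \<cdot>)\<close>, tested against compactly supported Lipschitz functions, converge to
  \<open>\<theta>\<close> times Hausdorff measure on a vector space \<open>W\<close>.  The density, the tangent plane and the
  tangent measures are read off this single convergence, and \<open>d\<close> is determined by the limit \<open>2\<^sup>-\<^sup>d\<close> of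
  the ratios of the measures of consecutive dyadic balls, which makes the decomposition Borel.

  For (4) a density layer is cut into countably many Borel pieces on which, with uniform constants, \<open>\<theta>\<close> is
  almost constant, \<open>\<mu>(B(x, r))\<close> is comparable to \<open>\<theta> r\<^sup>d\<close> up to a factor close to 1, and the directions between
  points stay in a narrow cone around one plane.  Each piece lies on a Lipschitz graph by McShane extension.
  As the orthogonal projection to the plane is nearly isometric on the piece, \<open>\<mu>\<close> and \<open>\<theta>\<close> times Hausdorff
  measure agree there up to a factor close to 1, by two applications of the Vitali covering argument;
  refining the pieces gives equality.
\<close>

subsection \<open>Hausdorff measure as a metric outer measure\<close>

text \<open>The dimension is read off from tents: the integral of a tent of radius s over a linear
  d-plane is a constant times \<open>s ^ (d + 1)\<close>, so near agreement of two flat measures at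
  radii s and s/2 excludes different dimensions. The directions need no metric on planes: for each
  test function the numbers \<open>c k\<close> times its plane integral have summable increments,
  hence converge, and a convergent subsequence of linear isometric parametrizations names the limit
  plane. The definition of \<alpha> contains an infimum over planes and a supremum over Lipschitz
  functions, both uncountable; nets found by pigeonhole replace them by countable families, and this
  makes \<open>Sigma0\<close> Borel. Covers by sets of given diameter compare \<mu> with Hausdorff
  measure only up to factors like \<open>10 ^ d\<close>. These serve as a priori bounds for a
  covering argument in which the dominating measure must be doubling. Therefore Hausdorff measure is
  bounded by \<mu> in the ambient space, where \<mu> doubles, and \<mu> by Hausdorff measure on the
  plane, where Hausdorff measure doubles.\<close>

definition hausdorff_weight :: "nat \<Rightarrow> 'a::metric_space set \<Rightarrow> ennreal" where
  "hausdorff_weight d E = (if E = {} then 0 else ennreal (diameter E ^ d))"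

lemma hausdorff_weight_empty [simp]: "hausdorff_weight d {} = 0"
  by (simp add: hausdorff_weight_def)

lemma hausdorff_pre_le:
  assumes "\<And>i. bounded (E i)" "\<And>i. diameter (E i) \<le> \<delta>" "A \<subseteq> (\<Union>i. E i)"
  shows "hausdorff_pre d \<delta> A \<le> (\<Sum>i. hausdorff_weight d (E i))"
  unfolding hausdorff_pre_def hausdorff_weight_def using assms by (intro INF_lower) auto

lemma hausdorff_pre_approx:
  assumes "hausdorff_pre d \<delta> A < b"
  obtains E where "\<And>i. bounded (E i)" "\<And>i. diameter (E i) \<le> \<delta>" "A \<subseteq> (\<Union>i. E i)"
    "(\<Sum>i. hausdorff_weight d (E i)) < b"
  using assms unfolding hausdorff_pre_def INF_less_iff hausdorff_weight_def by auto

lemma hausdorff_pre_mono: "A \<subseteq> B \<Longrightarrow> hausdorff_pre d \<delta> A \<le> hausdorff_pre d \<delta> B"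
  unfolding hausdorff_pre_def by (rule INF_superset_mono) auto

lemma hausdorff_pre_antimono: "\<delta> \<le> \<delta>' \<Longrightarrow> hausdorff_pre d \<delta>' A \<le> hausdorff_pre d \<delta> A"
  unfolding hausdorff_pre_def by (rule INF_superset_mono) (auto intro: order_trans)

lemma hausdorff_pre_countably_subadditive:
  "hausdorff_pre d \<delta> (\<Union>i. A i) \<le> (\<Sum>i. hausdorff_pre d \<delta> (A i))"
proof (rule ennreal_le_epsilon)
  fix e :: real
  assume fin: "(\<Sum>i. hausdorff_pre d \<delta> (A i)) < top" and e: "0 < e"
  have fin': "hausdorff_pre d \<delta> (A i) < top" for i
    using sum_le_suminf[OF summableI, of "{i}" "\<lambda>i. hausdorff_pre d \<delta> (A i)"] fin by simp
  have "\<exists>E. (\<forall>n. bounded (E n) \<and> diameter (E n) \<le> \<delta>) \<and> A i \<subseteq> (\<Union>n. E n) \<and>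
      (\<Sum>n. hausdorff_weight d (E n)) < hausdorff_pre d \<delta> (A i) + ennreal (e * (1/2) ^ Suc i)" for i
  proof -
    have "hausdorff_pre d \<delta> (A i) < hausdorff_pre d \<delta> (A i) + ennreal (e * (1/2) ^ Suc i)"
      using fin'[of i] e
      by (simp add: ennreal_add_left_cancel_less[of _ 0, simplified] ennreal_zero_less_mult_iff)
    then show ?thesis
      by (rule hausdorff_pre_approx) blast
  qed
  then obtain E where E: "\<And>i n. bounded (E i n)" "\<And>i n. diameter (E i n) \<le> \<delta>"
      "\<And>i. A i \<subseteq> (\<Union>n. E i n)"
      "\<And>i. (\<Sum>n. hausdorff_weight d (E i n)) < hausdorff_pre d \<delta> (A i) + ennreal (e * (1/2) ^ Suc i)"
    by metis
  have "hausdorff_pre d \<delta> (\<Union>i. A i)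
      \<le> (\<Sum>k. hausdorff_weight d (case prod_decode k of (i, n) \<Rightarrow> E i n))"
  proof (rule hausdorff_pre_le)
    show "(\<Union>i. A i) \<subseteq> (\<Union>k. case prod_decode k of (i, n) \<Rightarrow> E i n)"
    proof clarify
      fix x i assume "x \<in> A i"
      then obtain n where "x \<in> E i n" using E(3) by blast
      then show "x \<in> (\<Union>k. case prod_decode k of (i, n) \<Rightarrow> E i n)"
        by (intro UN_I[of "prod_encode (i, n)"]) auto
    qed
  qed (auto simp: E split: prod.split)
  also have "\<dots> = (\<Sum>i. \<Sum>n. hausdorff_weight d (E i n))"
    using suminf_ennreal_2dimen[of "\<lambda>i. \<Sum>n. hausdorff_weight d (E i n)"
        "\<lambda>p. hausdorff_weight d (case p of (i, n) \<Rightarrow> E i n)"] by simp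
  also have "\<dots> \<le> (\<Sum>i. hausdorff_pre d \<delta> (A i) + ennreal (e * (1/2) ^ Suc i))"
    using E(4) by (intro suminf_le) (auto intro: less_imp_le)
  also have "\<dots> = (\<Sum>i. hausdorff_pre d \<delta> (A i)) + (\<Sum>i. ennreal (e * (1/2) ^ Suc i))"
    by (intro suminf_add[symmetric]) auto
  also have "(\<Sum>i. ennreal (e * (1/2) ^ Suc i)) = ennreal e"
    using sums_mult[OF power_half_series, of e] e by (intro suminf_ennreal_eq) auto
  finally show "hausdorff_pre d \<delta> (\<Union>i. A i) \<le> (\<Sum>i. hausdorff_pre d \<delta> (A i)) + ennreal e" .
qed

lemma hausdorff_unnormalized_mono:
  "A \<subseteq> B \<Longrightarrow> hausdorff_unnormalized d A \<le> hausdorff_unnormalized d B"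
  unfolding hausdorff_unnormalized_def by (intro SUP_mono') (auto intro: hausdorff_pre_mono)

lemma hausdorff_pre_le_unnormalized: "0 < \<delta> \<Longrightarrow> hausdorff_pre d \<delta> A \<le> hausdorff_unnormalized d A"
  unfolding hausdorff_unnormalized_def by (intro SUP_upper) auto

lemma hausdorff_unnormalized_empty [simp]: "hausdorff_unnormalized d {} = 0"
proof -
  have "hausdorff_pre d \<delta> {} \<le> 0" if "\<delta> > 0" for \<delta>
    using hausdorff_pre_le[of "\<lambda>_. {}" \<delta> "{}"] that by auto
  then show ?thesis unfolding hausdorff_unnormalized_def by (auto simp: SUP_eq_iff)
qed

lemma hausdorff_unnormalized_countably_subadditive:
  "hausdorff_unnormalized d (\<Union>i. A i) \<le> (\<Sum>i. hausdorff_unnormalized d (A i))"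
  unfolding hausdorff_unnormalized_def[of d "\<Union>i. A i"]
proof (rule SUP_least)
  fix \<delta> :: real assume "\<delta> \<in> {0<..}"
  then show "hausdorff_pre d \<delta> (\<Union>i. A i) \<le> (\<Sum>i. hausdorff_unnormalized d (A i))"
    by (intro order_trans[OF hausdorff_pre_countably_subadditive] suminf_le)
      (auto intro: hausdorff_pre_le_unnormalized)
qed

text \<open>A set of diameter below s cannot meet both A and B, so every fine cover of the union
  splits into a cover of A and a cover of B that share no member.\<close>

lemma hausdorff_pre_separated:
  assumes s: "\<And>a b. a \<in> A \<Longrightarrow> b \<in> B \<Longrightarrow> s \<le> dist a b" and \<delta>: "0 < \<delta>" "\<delta> < s"
  shows "hausdorff_pre d \<delta> A + hausdorff_pre d \<delta> B \<le> hausdorff_pre d \<delta> (A \<union> B)"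
  unfolding hausdorff_pre_def[of d \<delta> "A \<union> B"] hausdorff_weight_def[symmetric]
proof (rule INF_greatest, clarify)
  fix E :: "nat \<Rightarrow> 'a set"
  assume E: "\<forall>i. bounded (E i) \<and> diameter (E i) \<le> \<delta>" and cover: "A \<union> B \<subseteq> (\<Union>i. E i)"
  \<comment> \<open>Members that miss C are replaced by the empty set, of weight 0, so that the
    cover stays indexed by all natural numbers.\<close>
  define F where "F C i = (if E i \<inter> C = {} then {} else E i)" for C i
  have F: "hausdorff_pre d \<delta> C \<le> (\<Sum>i. hausdorff_weight d (F C i))" if "C \<subseteq> A \<union> B" for C
  proof (rule hausdorff_pre_le)
    show "C \<subseteq> (\<Union>i. F C i)"
    proof
      fix x assume x: "x \<in> C"
      then have "x \<in> (\<Union>i. E i)" using that cover by (meson subsetD)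
      then obtain i where "x \<in> E i" by blast
      then show "x \<in> (\<Union>i. F C i)" using x unfolding F_def by (intro UN_I[of i]) auto
    qed
  qed (use E \<delta> in \<open>auto simp: F_def\<close>)
  have w: "hausdorff_weight d (F A i) + hausdorff_weight d (F B i) \<le> hausdorff_weight d (E i)" for i
  proof (cases "E i \<inter> A = {} \<or> E i \<inter> B = {}")
    case False
    then obtain a b where "a \<in> E i" "a \<in> A" "b \<in> E i" "b \<in> B" by blast
    then have "s \<le> \<delta>"
      using s[of a b] diameter_bounded_bound[of "E i" a b] E by (meson order_trans)
    then show ?thesis using \<delta> by simp
  qed (auto simp: F_def)
  have "hausdorff_pre d \<delta> A + hausdorff_pre d \<delta> B
      \<le> (\<Sum>i. hausdorff_weight d (F A i)) + (\<Sum>i. hausdorff_weight d (F B i))"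
    by (intro add_mono F) auto
  also have "\<dots> = (\<Sum>i. hausdorff_weight d (F A i) + hausdorff_weight d (F B i))"
    by (intro suminf_add) auto
  also have "\<dots> \<le> (\<Sum>i. hausdorff_weight d (E i))"
    by (intro suminf_le w) auto
  finally show "hausdorff_pre d \<delta> A + hausdorff_pre d \<delta> B \<le> (\<Sum>i. hausdorff_weight d (E i))" .
qed

lemma hausdorff_unnormalized_separated:
  assumes s: "\<And>a b. a \<in> A \<Longrightarrow> b \<in> B \<Longrightarrow> s \<le> dist a b" "0 < s"
  shows "hausdorff_unnormalized d A + hausdorff_unnormalized d B \<le> hausdorff_unnormalized d (A \<union> B)"
proof -
  have "hausdorff_pre d \<delta>1 A + hausdorff_pre d \<delta>2 B \<le> hausdorff_unnormalized d (A \<union> B)"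
    if "0 < \<delta>1" "0 < \<delta>2" for \<delta>1 \<delta>2
  proof -
    \<comment> \<open>The premeasures grow as the scale shrinks, so two different scales can be
      lowered to a common one below the separation s.\<close>
    define \<delta> where "\<delta> = min (min \<delta>1 \<delta>2) (s/2)"
    have \<delta>: "0 < \<delta>" "\<delta> \<le> \<delta>1" "\<delta> \<le> \<delta>2" "\<delta> < s" using that s by (auto simp: \<delta>_def)
    have "hausdorff_pre d \<delta>1 A + hausdorff_pre d \<delta>2 B \<le> hausdorff_pre d \<delta> A + hausdorff_pre d \<delta> B"
      by (intro add_mono hausdorff_pre_antimono \<delta>)
    also have "\<dots> \<le> hausdorff_pre d \<delta> (A \<union> B)"
      by (rule hausdorff_pre_separated[OF s(1)]) (use \<delta> in auto)
    also have "\<dots> \<le> hausdorff_unnormalized d (A \<union> B)"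
      by (rule hausdorff_pre_le_unnormalized) fact
    finally show ?thesis .
  qed
  then show ?thesis
    unfolding hausdorff_unnormalized_def[of d A] hausdorff_unnormalized_def[of d B]
    by (subst ennreal_SUP_add_left[symmetric])
      (auto intro!: SUP_least simp: ennreal_SUP_add_right)
qed

text \<open>Caratheodory's criterion.  The layers \<open>R k\<close> at distance about \<open>1/k\<close> from \<open>F\<close> are separated
  from each other two indices apart, so their measures are summable.\<close>

lemma metric_outer_measure_closed:
  fixes m :: "'a::metric_space set \<Rightarrow> ennreal"
  assumes mono: "\<And>A B. A \<subseteq> B \<Longrightarrow> m A \<le> m B" and empty: "m {} = 0"
    and subadd: "\<And>A :: nat \<Rightarrow> 'a set. m (\<Union>i. A i) \<le> (\<Sum>i. m (A i))"
    and sep: "\<And>A B s. (\<And>a b. a \<in> A \<Longrightarrow> b \<in> B \<Longrightarrow> s \<le> dist a b) \<Longrightarrow> 0 < s \<Longrightarrow> m A + m B \<le> m (A \<union> B)"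
    and F: "closed F"
  shows "m (X \<inter> F) + m (X - F) \<le> m X"
proof (cases "m X = \<infinity> \<or> F = {}")
  case True
  then show ?thesis using empty by auto
next
  case False
  then have F0: "F \<noteq> {}" and fin: "m X < \<infinity>" by (auto simp: less_top)
  define f where "f x = infdist x F" for x
  have f_dist: "f a \<le> f b + dist a b" for a b
    unfolding f_def by (rule infdist_triangle)
  have f0: "f x = 0 \<longleftrightarrow> x \<in> F" for x
    unfolding f_def using in_closed_iff_infdist_zero[OF F F0] by blast
  have f_ge0: "f x \<ge> 0" for x unfolding f_def by (rule infdist_nonneg)
  define R where "R k = {x \<in> X. 1 / (real k + 2) \<le> f x \<and> f x < 1 / (real k + 1)}" for k
  define Xn where "Xn n = {x \<in> X. 1 / (real n + 1) \<le> f x}" for n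
  have near: "m (X \<inter> F) + m (Xn n) \<le> m X" for n
  proof -
    have "m (X \<inter> F) + m (Xn n) \<le> m (X \<inter> F \<union> Xn n)"
    proof (rule sep[of _ _ "1 / (real n + 1)"])
      fix a b assume "a \<in> X \<inter> F" "b \<in> Xn n"
      then show "1 / (real n + 1) \<le> dist a b"
        using f_dist[of b a] f0[of a] by (auto simp: Xn_def dist_commute)
    qed auto
    also have "\<dots> \<le> m X" by (rule mono) (auto simp: Xn_def)
    finally show ?thesis .
  qed
  have parity: "(\<Sum>j<N. m (R (2*j+p))) \<le> m X" for N p
  proof -
    have "(\<Sum>j<N. m (R (2*j+p))) \<le> m (\<Union>j<N. R (2*j+p))"
    proof (induction N)
      case 0 show ?case by simp
    next
      case (Suc N)
      have "m (\<Union>j<N. R (2*j+p)) + m (R (2*N+p)) \<le> m ((\<Union>j<N. R (2*j+p)) \<union> R (2*N+p))"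
      \<comment> \<open>The separation used below is not positive for N = p = 0, since 1/0 = 0; for
        N = 0 the union is empty anyway.\<close>
      proof (cases "N = 0")
        case True then show ?thesis by (simp add: empty)
      next
        case False
        show ?thesis
        proof (rule sep[of _ _ "1 / (real (2*N+p)) - 1 / (real (2*N+p) + 1)"])
          show "0 < 1 / (real (2*N+p)) - 1 / (real (2*N+p) + 1)"
            using False by (intro diff_gt_0_iff_gt[THEN iffD2] divide_strict_left_mono) auto
          fix a b assume "a \<in> (\<Union>j<N. R (2*j+p))" "b \<in> R (2*N+p)"
          then obtain j where j: "j < N" "1 / (real (2*j+p) + 2) \<le> f a" and b: "f b < 1 / (real (2*N+p) + 1)"
            by (auto simp: R_def)
          have "1 / real (2*N+p) \<le> 1 / (real (2*j+p) + 2)"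
            using j(1) by (intro divide_left_mono) auto
          then show "1 / (real (2*N+p)) - 1 / (real (2*N+p) + 1) \<le> dist a b"
            using f_dist[of a b] j b by linarith
        qed
      qed
      also have "(\<Union>j<N. R (2*j+p)) \<union> R (2*N+p) = (\<Union>j<Suc N. R (2*j+p))"
        by (auto simp: less_Suc_eq)
      finally have "m (\<Union>j<N. R (2*j+p)) + m (R (2*N+p)) \<le> m (\<Union>j<Suc N. R (2*j+p))" .
      from order_trans[OF add_right_mono[OF Suc] this] show ?case by simp
    qed
    also have "\<dots> \<le> m X" by (rule mono) (auto simp: R_def)
    finally show ?thesis .
  qed
  have Rsum: "(\<Sum>k. m (R k)) \<le> 2 * m X"
  proof (rule suminf_le_const)
    fix n
    have "(\<Sum>k<n. m (R k)) \<le> (\<Sum>k<2*n. m (R k))" by (intro sum_mono2) auto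
    also have "(\<Sum>k<2*n. m (R k)) = (\<Sum>j<n. m (R (2*j+0))) + (\<Sum>j<n. m (R (2*j+1)))"
      by (induction n) (auto simp: algebra_simps)
    also have "\<dots> \<le> m X + m X" by (intro add_mono parity)
    finally show "(\<Sum>k<n. m (R k)) \<le> 2 * m X" by (simp add: mult_2)
  qed auto
  \<comment> \<open>As F is closed, each point of X - F has positive distance to it. That distance
    is at least 1/(n+1) or falls into one of the layers from index n on.\<close>
  have split: "m (X - F) \<le> m (Xn n) + (\<Sum>k. m (R (k + n)))" for n
  proof -
    define A where "A = case_nat (Xn n) (\<lambda>k. R (k + n))"
    have "X - F \<subseteq> (\<Union>i. A i)"
    proof
      fix x assume x: "x \<in> X - F"
      then have fx: "f x > 0" using f0[of x] f_ge0[of x] by (auto simp: less_le)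
      show "x \<in> (\<Union>i. A i)"
      proof (cases "1 / (real n + 1) \<le> f x")
        case True
        then show ?thesis using x by (intro UN_I[of 0]) (auto simp: A_def Xn_def)
      next
        case False
        obtain N where N: "1 / real (Suc N) < f x" using nat_approx_posE[OF fx] .
        define K where "K = (LEAST K. 1 / (real K + 1) \<le> f x)"
        have K: "1 / (real K + 1) \<le> f x"
          unfolding K_def by (rule LeastI[of _ N]) (use N in \<open>auto simp: add.commute\<close>)
        have Km: "j < K \<Longrightarrow> f x < 1 / (real j + 1)" for j
          using not_less_Least[of j "\<lambda>K. 1 / (real K + 1) \<le> f x"] unfolding K_def by auto
        have "n < K"
        proof (rule ccontr)
          assume "\<not> n < K"
          then have "1 / (real n + 1) \<le> 1 / (real K + 1)" by (intro divide_left_mono) auto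
          then show False using K False by linarith
        qed
        then obtain k where k: "K = Suc (k + n)" using less_iff_Suc_add[of n K] by (auto simp: add.commute)
        then have "x \<in> R (k + n)" using K Km[of "k+n"] x by (auto simp: R_def add.commute add.left_commute)
        then show ?thesis by (intro UN_I[of "Suc k"]) (auto simp: A_def)
      qed
    qed
    then have "m (X - F) \<le> (\<Sum>i. m (A i))" using mono subadd order_trans by blast
    also have "\<dots> = (\<Sum>i. m (A (i + 1))) + (\<Sum>i<1. m (A i))" by (rule suminf_offset) simp
    finally show ?thesis by (simp add: A_def add.commute)
  qed
  define S where "S = (\<Sum>k. m (R k))"
  have Sfin: "S \<noteq> \<infinity>"
  proof -
    have "2 * m X < \<infinity>" using fin by (simp add: ennreal_mult_less_top)
    then show ?thesis using Rsum unfolding S_def by auto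
  qed
  \<comment> \<open>No limit of the tail is taken: adding the first n layers completes the tail to
    the constant S. The bound then passes to the supremum over n, and the finite S cancels.\<close>
  have "(\<Sum>j<n. m (R j)) + (m (X \<inter> F) + m (X - F)) \<le> S + m X" for n
  proof -
    have "(\<Sum>j<n. m (R j)) + (m (X \<inter> F) + m (X - F))
        \<le> (\<Sum>j<n. m (R j)) + (m (X \<inter> F) + (m (Xn n) + (\<Sum>k. m (R (k + n)))))"
      by (intro add_left_mono split)
    also have "\<dots> = ((\<Sum>k. m (R (k + n))) + (\<Sum>j<n. m (R j))) + (m (X \<inter> F) + m (Xn n))"
      by (simp add: ac_simps)
    also have "(\<Sum>k. m (R (k + n))) + (\<Sum>j<n. m (R j)) = S"
      unfolding S_def by (rule suminf_offset[symmetric]) simp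
    also have "S + (m (X \<inter> F) + m (Xn n)) \<le> S + m X" by (intro add_left_mono near)
    finally show ?thesis .
  qed
  then have "S + (m (X \<inter> F) + m (X - F)) \<le> S + m X"
    unfolding S_def by (rule ennreal_suminf_bound_add)
  then show ?thesis using Sfin by (simp add: ennreal_add_left_cancel_le)
qed

text \<open>It suffices to test closed sets: the sets in \<open>lambda_system\<close> form a
  sigma-algebra on which m is countably additive, and the closed sets generate the Borel
  sets.\<close>

lemma metric_outer_measure_space:
  fixes m :: "'a::metric_space set \<Rightarrow> ennreal"
  assumes mono: "\<And>A B. A \<subseteq> B \<Longrightarrow> m A \<le> m B" and empty: "m {} = 0"
    and subadd: "\<And>A :: nat \<Rightarrow> 'a set. m (\<Union>i. A i) \<le> (\<Sum>i. m (A i))"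
    and sep: "\<And>A B s. (\<And>a b. a \<in> A \<Longrightarrow> b \<in> B \<Longrightarrow> s \<le> dist a b) \<Longrightarrow> 0 < s \<Longrightarrow> m A + m B \<le> m (A \<union> B)"
  shows "measure_space UNIV (sets borel) m"
proof -
  interpret P: sigma_algebra UNIV "Pow UNIV :: 'a set set" by (rule sigma_algebra_Pow)
  have "outer_measure_space (Pow UNIV) m"
    using mono empty subadd
    by (auto simp: outer_measure_space_def positive_def increasing_def countably_subadditive_def)
  then have ms: "measure_space UNIV (lambda_system UNIV (Pow UNIV) m) m"
    by (rule P.caratheodory_lemma)
  then interpret L: sigma_algebra UNIV "lambda_system UNIV (Pow UNIV) m"
    by (simp add: measure_space_def)
  have subadd2: "m (A \<union> B) \<le> m A + m B" for A B
    using subadd[of "binaryset A B"] suminf_binaryset_eq[of m A B, OF empty] by (simp add: UN_binaryset_eq)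
  have "F \<in> lambda_system UNIV (Pow UNIV) m" if "closed F" for F
  proof -
    have "m (F \<inter> X) + m ((UNIV - F) \<inter> X) = m X" for X
    proof (rule antisym)
      have "m (X \<inter> F) + m (X - F) \<le> m X"
        by (rule metric_outer_measure_closed[OF mono empty subadd sep that])
      also have "X - F = (UNIV - F) \<inter> X" by auto
      finally show "m (F \<inter> X) + m ((UNIV - F) \<inter> X) \<le> m X" by (simp add: Int_commute)
      have "m X = m (F \<inter> X \<union> (UNIV - F) \<inter> X)" by (rule arg_cong[of _ _ m]) auto
      also have "\<dots> \<le> m (F \<inter> X) + m ((UNIV - F) \<inter> X)" by (rule subadd2)
      finally show "m X \<le> m (F \<inter> X) + m ((UNIV - F) \<inter> X)" .
    qed
    then show ?thesis by (auto simp: lambda_system_def)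
  qed
  then have closed: "Collect closed \<subseteq> lambda_system UNIV (Pow UNIV) m" by auto
  have "sets (borel :: 'a measure) = sigma_sets UNIV (Collect closed)"
    by (metis borel_eq_closed Pow_UNIV sets_measure_of subset_UNIV)
  also have "\<dots> \<subseteq> lambda_system UNIV (Pow UNIV) m"
    using closed by (rule L.sigma_sets_subset)
  finally show ?thesis
    by (intro measure_down[OF ms]) (metis sets.sigma_algebra_axioms space_borel)
qed

section \<open>Hausdorff measure under Lipschitz maps, isometries and dilations\<close>

lemma hausdorff_unnormalized_lipschitz_image:
  fixes f :: "'a::euclidean_space \<Rightarrow> 'b::euclidean_space"
  assumes f: "\<And>x y. x \<in> A \<Longrightarrow> y \<in> A \<Longrightarrow> dist (f x) (f y) \<le> L * dist x y" and L: "0 < L"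
  shows "hausdorff_unnormalized d (f ` A) \<le> ennreal (L ^ d) * hausdorff_unnormalized d A"
  unfolding hausdorff_unnormalized_def[of d "f ` A"]
proof (rule SUP_least)
  fix \<delta> :: real assume "\<delta> \<in> {0<..}"
  then have \<delta>: "0 < \<delta>" by simp
  let ?X = "hausdorff_pre d \<delta> (f ` A)"
  have inv: "ennreal (L ^ d) * ennreal (1 / L ^ d) = 1"
    using L by (simp add: ennreal_mult[symmetric])
  \<comment> \<open>The factor \<open>L ^ d\<close> is moved to the left, so that the infimum over
    the covers of A stands alone on the right.\<close>
  have "?X * ennreal (1 / L ^ d) \<le> hausdorff_pre d (\<delta> / L) A"
    unfolding hausdorff_pre_def[of d "\<delta> / L" A] hausdorff_weight_def[symmetric]
  proof (rule INF_greatest, clarify)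
    fix E :: "nat \<Rightarrow> 'a set"
    assume E: "\<forall>i. bounded (E i) \<and> diameter (E i) \<le> \<delta> / L" and cover: "A \<subseteq> (\<Union>i. E i)"
    \<comment> \<open>The map is controlled on A only, so the covering sets are cut down to A before
      taking images.\<close>
    define F where "F i = f ` (E i \<inter> A)" for i
    have Fd: "dist x y \<le> L * diameter (E i)" if xy: "x \<in> F i" "y \<in> F i" for x y i
    proof -
      obtain a b where ab: "a \<in> E i" "b \<in> E i" "a \<in> A" "b \<in> A" "x = f a" "y = f b"
        using xy unfolding F_def by blast
      have "dist x y \<le> L * dist a b" using f ab by auto
      also have "\<dots> \<le> L * diameter (E i)"
        using E ab L by (intro mult_left_mono diameter_bounded_bound) auto
      finally show ?thesis .
    qed
    have E0: "0 \<le> diameter (E i)" for i using E by (intro diameter_ge_0) auto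
    have Fdiam: "diameter (F i) \<le> L * diameter (E i)" for i
      using Fd[of _ i] E0[of i] L by (intro diameter_le) (auto simp: dist_norm)
    have Fb: "bounded (F i)" for i
    proof (cases "F i = {}")
      case False
      then obtain x where "x \<in> F i" by blast
      then show ?thesis unfolding bounded_def using Fd by blast
    qed simp
    have w: "hausdorff_weight d (F i) \<le> ennreal (L ^ d) * hausdorff_weight d (E i)" for i
    proof (cases "F i = {}")
      case False
      then have "E i \<noteq> {}" by (auto simp: F_def)
      moreover have "diameter (F i) ^ d \<le> (L * diameter (E i)) ^ d"
        using Fdiam Fb by (intro power_mono diameter_ge_0)
      ultimately show ?thesis using False L E0
        by (simp add: hausdorff_weight_def ennreal_mult[symmetric] power_mult_distrib)
    qed simp
    have "?X \<le> (\<Sum>i. hausdorff_weight d (F i))"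
    proof (rule hausdorff_pre_le)
      show "diameter (F i) \<le> \<delta>" for i
      proof -
        have "L * diameter (E i) \<le> L * (\<delta> / L)" using E L by (intro mult_left_mono) auto
        then show ?thesis using Fdiam[of i] L by simp
      qed
      show "f ` A \<subseteq> (\<Union>i. F i)" using cover by (fastforce simp: F_def)
    qed (rule Fb)
    also have "\<dots> \<le> (\<Sum>i. ennreal (L ^ d) * hausdorff_weight d (E i))"
      by (intro suminf_le w) auto
    finally have "?X * ennreal (1 / L ^ d)
        \<le> (ennreal (L ^ d) * (\<Sum>i. hausdorff_weight d (E i))) * ennreal (1 / L ^ d)"
      by (intro mult_right_mono) auto
    also have "\<dots> = (ennreal (L ^ d) * ennreal (1 / L ^ d)) * (\<Sum>i. hausdorff_weight d (E i))"
      by (simp add: mult_ac)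
    also have "\<dots> = (\<Sum>i. hausdorff_weight d (E i))" by (simp only: inv mult_1)
    finally show "?X * ennreal (1 / L ^ d) \<le> (\<Sum>i. hausdorff_weight d (E i))" .
  qed
  also have "\<dots> \<le> hausdorff_unnormalized d A"
    using \<delta> L by (intro hausdorff_pre_le_unnormalized) auto
  finally have "ennreal (L ^ d) * (?X * ennreal (1 / L ^ d)) \<le> ennreal (L ^ d) * hausdorff_unnormalized d A"
    by (intro mult_left_mono) auto
  moreover have "ennreal (L ^ d) * (?X * ennreal (1 / L ^ d)) = (ennreal (L ^ d) * ennreal (1 / L ^ d)) * ?X"
    by (simp add: mult_ac)
  ultimately show "?X \<le> ennreal (L ^ d) * hausdorff_unnormalized d A" by (simp only: inv mult_1)
qed

lemma hausdorff_unnormalized_isometric_image: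
  fixes f :: "'a::euclidean_space \<Rightarrow> 'b::euclidean_space"
  assumes "\<And>x y. x \<in> A \<Longrightarrow> y \<in> A \<Longrightarrow> dist (f x) (f y) = dist x y"
  shows "hausdorff_unnormalized d (f ` A) = hausdorff_unnormalized d A"
proof (rule antisym)
  show "hausdorff_unnormalized d (f ` A) \<le> hausdorff_unnormalized d A"
    using hausdorff_unnormalized_lipschitz_image[of A f 1 d] assms by simp
  have inj: "inj_on f A" using assms by (metis dist_eq_0_iff inj_onI)
  then have "inv_into A f ` f ` A = A" by simp
  moreover have "dist (inv_into A f x) (inv_into A f y) \<le> 1 * dist x y" if "x \<in> f ` A" "y \<in> f ` A" for x y
    using that assms inj by (force simp: inv_into_f_f)
  ultimately show "hausdorff_unnormalized d A \<le> hausdorff_unnormalized d (f ` A)"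
    using hausdorff_unnormalized_lipschitz_image[of "f ` A" "inv_into A f" 1 d] by simp
qed

lemma hausdorff_unnormalized_scale:
  fixes A :: "'a::euclidean_space set"
  assumes "0 < r"
  shows "hausdorff_unnormalized d ((\<lambda>x. r *\<^sub>R x) ` A) = ennreal (r ^ d) * hausdorff_unnormalized d A"
proof (rule antisym)
  show "hausdorff_unnormalized d ((\<lambda>x. r *\<^sub>R x) ` A) \<le> ennreal (r ^ d) * hausdorff_unnormalized d A"
    using assms by (intro hausdorff_unnormalized_lipschitz_image)
      (auto simp: dist_norm scaleR_right_diff_distrib[symmetric])
  have "hausdorff_unnormalized d ((\<lambda>x. (1/r) *\<^sub>R x) ` (\<lambda>x. r *\<^sub>R x) ` A)
      \<le> ennreal ((1/r) ^ d) * hausdorff_unnormalized d ((\<lambda>x. r *\<^sub>R x) ` A)"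
    using assms by (intro hausdorff_unnormalized_lipschitz_image)
      (auto simp: dist_norm scaleR_right_diff_distrib[symmetric])
  moreover have "(\<lambda>x. (1/r) *\<^sub>R x) ` (\<lambda>x. r *\<^sub>R x) ` A = A"
    using assms by (simp add: image_image)
  ultimately have "ennreal (r ^ d) * hausdorff_unnormalized d A
      \<le> ennreal (r ^ d) * (ennreal ((1/r) ^ d) * hausdorff_unnormalized d ((\<lambda>x. r *\<^sub>R x) ` A))"
    by (intro mult_left_mono) auto
  also have "\<dots> = hausdorff_unnormalized d ((\<lambda>x. r *\<^sub>R x) ` A)"
    using assms by (simp add: mult.assoc[symmetric] ennreal_mult[symmetric] power_mult_distrib[symmetric])
  finally show "ennreal (r ^ d) * hausdorff_unnormalized d A \<le> hausdorff_unnormalized d ((\<lambda>x. r *\<^sub>R x) ` A)" .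
qed

section \<open>Vitali coverings and comparison with measures of controlled ball growth\<close>

text \<open>The radius 0 marks the unused indices: the corresponding balls are empty.\<close>

lemma Vitali_covering_sequence:
  fixes A :: "'a::euclidean_space set"
  assumes \<rho>: "\<And>x. x \<in> A \<Longrightarrow> 0 < \<rho> x \<and> \<rho> x \<le> B"
  obtains a :: "nat \<Rightarrow> 'a" and R :: "nat \<Rightarrow> real"
  where "\<And>i. R i = 0 \<or> (a i \<in> A \<and> R i = \<rho> (a i))"
    "disjoint_family (\<lambda>i. ball (a i) (R i))" "A \<subseteq> (\<Union>i. ball (a i) (5 * R i))"
proof -
  have "A \<subseteq> (\<Union>x\<in>A. ball x (\<rho> x))" using \<rho> by force
  then obtain C where C: "countable C" "C \<subseteq> A" "pairwise (\<lambda>i j. disjnt (ball i (\<rho> i)) (ball j (\<rho> j))) C"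
      "A \<subseteq> (\<Union>i\<in>C. ball i (5 * \<rho> i))"
    using Vitali_covering_lemma_balls[where S = A and K = A and a = "\<lambda>x. x" and r = \<rho> and B = B] \<rho>
    by blast
  define I where "I = to_nat_on C ` C"
  define a where "a = from_nat_into C"
  define R where "R i = (if i \<in> I then \<rho> (a i) else 0)" for i
  have aI: "a (to_nat_on C x) = x" if "x \<in> C" for x
    unfolding a_def using C(1) that by simp
  have aC: "i \<in> I \<Longrightarrow> a i \<in> C" for i unfolding I_def using aI by auto
  show ?thesis
  proof
    show "R i = 0 \<or> (a i \<in> A \<and> R i = \<rho> (a i))" for i
      using aC C(2) by (auto simp: R_def)
    show "disjoint_family (\<lambda>i. ball (a i) (R i))"
      unfolding disjoint_family_on_def
    proof (intro ballI impI)
      fix i j :: nat assume ij: "i \<noteq> j"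
      show "ball (a i) (R i) \<inter> ball (a j) (R j) = {}"
      proof (cases "i \<in> I \<and> j \<in> I")
        case True
        then have "a i \<noteq> a j" using ij aI by (auto simp: I_def)
        then show ?thesis using True C(3) aC by (auto simp: pairwise_def disjnt_def R_def)
      qed (auto simp: R_def)
    qed
    show "A \<subseteq> (\<Union>i. ball (a i) (5 * R i))"
    proof
      fix x assume "x \<in> A"
      then obtain c where c: "c \<in> C" "x \<in> ball c (5 * \<rho> c)" using C(4) by blast
      then show "x \<in> (\<Union>i. ball (a i) (5 * R i))"
        using aI[of c] by (intro UN_I[of "to_nat_on C c"]) (auto simp: R_def I_def)
    qed
  qed
qed

text \<open>Disjoint Vitali balls inside U, enlarged five times, cover A. Each enlarged ball has
  diameter at most 10 times the original radius, which the lower density bound pays for; hence the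
  factor \<open>10 ^ d / c\<close>. The constant is crude and serves only as an a priori bound for
  \<open>measure_le_of_ball_ratios\<close> and for finiteness.\<close>

lemma hausdorff_unnormalized_density_bound:
  fixes A :: "'a::euclidean_space set"
  assumes \<nu>: "sets \<nu> = sets borel" and U: "open U" "A \<subseteq> U" and c: "0 < c" and \<delta>: "0 < \<delta>"
    and dens: "\<And>x r. x \<in> A \<Longrightarrow> 0 < r \<Longrightarrow> r < \<delta> \<Longrightarrow> ennreal (c * r ^ d) \<le> emeasure \<nu> (ball x r)"
  shows "hausdorff_unnormalized d A \<le> ennreal (10 ^ d / c) * emeasure \<nu> U"
  unfolding hausdorff_unnormalized_def
proof (rule SUP_least)
  fix \<epsilon> :: real assume "\<epsilon> \<in> {0<..}"
  then have \<epsilon>: "0 < \<epsilon>" by simp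
  have "\<exists>\<rho>. x \<in> A \<longrightarrow> (0 < \<rho> \<and> \<rho> < \<delta> \<and> 10 * \<rho> \<le> \<epsilon> \<and> ball x \<rho> \<subseteq> U)" for x
  proof (cases "x \<in> A")
    case True
    then obtain e where e: "e > 0" "ball x e \<subseteq> U" using U openE by blast
    define \<rho> where "\<rho> = min e (min (\<delta>/2) (\<epsilon>/10))"
    have "ball x \<rho> \<subseteq> ball x e" by (rule subset_ball) (auto simp: \<rho>_def)
    then show ?thesis using e \<delta> \<epsilon> by (intro exI[of _ \<rho>]) (auto simp: \<rho>_def)
  qed simp
  then obtain \<rho> where \<rho>: "\<And>x. x \<in> A \<Longrightarrow> 0 < \<rho> x" "\<And>x. x \<in> A \<Longrightarrow> \<rho> x < \<delta>"
      "\<And>x. x \<in> A \<Longrightarrow> 10 * \<rho> x \<le> \<epsilon>" "\<And>x. x \<in> A \<Longrightarrow> ball x (\<rho> x) \<subseteq> U"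
    by metis
  obtain a :: "nat \<Rightarrow> 'a" and R :: "nat \<Rightarrow> real"
    where aR: "\<And>i. R i = 0 \<or> (a i \<in> A \<and> R i = \<rho> (a i))"
      and disj: "disjoint_family (\<lambda>i. ball (a i) (R i))" and cover: "A \<subseteq> (\<Union>i. ball (a i) (5 * R i))"
  proof (rule Vitali_covering_sequence[of A \<rho> \<delta>])
show "0 < \<rho> x \<and> \<rho> x \<le> \<delta>" if "x \<in> A" for x
      using \<rho>(1,2)[OF that] by simp
  qed blast
  have R0: "0 \<le> R i" for i using aR[of i] \<rho>(1) by (auto intro: less_imp_le)
  have diam: "diameter (ball (a i) (5 * R i)) \<le> 10 * R i" for i
  proof (rule diameter_le)
    show "norm (x - y) \<le> 10 * R i" if "x \<in> ball (a i) (5 * R i)" "y \<in> ball (a i) (5 * R i)" for x y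
      using dist_triangle_less_add[of x "a i" "5 * R i" y "5 * R i"] that
      by (auto simp: dist_norm norm_minus_commute)
  qed (use R0[of i] in auto)
  have w: "hausdorff_weight d (ball (a i) (5 * R i)) \<le> ennreal (10 ^ d / c) * emeasure \<nu> (ball (a i) (R i))" for i
  proof (cases "R i = 0")
    case False
    then have i: "a i \<in> A" "R i = \<rho> (a i)" using aR[of i] by auto
    have "hausdorff_weight d (ball (a i) (5 * R i)) \<le> ennreal ((10 * R i) ^ d)"
      using diam[of i] by (auto simp: hausdorff_weight_def intro!: power_mono diameter_ge_0)
    also have "\<dots> = ennreal (10 ^ d / c) * ennreal (c * R i ^ d)"
      using c R0[of i] by (simp add: ennreal_mult[symmetric] power_mult_distrib)
    also have "\<dots> \<le> ennreal (10 ^ d / c) * emeasure \<nu> (ball (a i) (R i))"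
      using i \<rho>(1,2)[of "a i"] by (intro mult_left_mono dens) auto
    finally show ?thesis .
  qed simp
  have "hausdorff_pre d \<epsilon> A \<le> (\<Sum>i. hausdorff_weight d (ball (a i) (5 * R i)))"
  proof (rule hausdorff_pre_le[OF _ _ cover])
    show "diameter (ball (a i) (5 * R i)) \<le> \<epsilon>" for i
    proof (cases "R i = 0")
      case True
      then show ?thesis using \<epsilon> by simp
    next
      case False
      then have "10 * R i \<le> \<epsilon>" using aR[of i] \<rho>(3)[of "a i"] by auto
      with diam[of i] show ?thesis by linarith
    qed
  qed simp
  also have "\<dots> \<le> (\<Sum>i. ennreal (10 ^ d / c) * emeasure \<nu> (ball (a i) (R i)))"
    by (intro suminf_le w) auto
  also have "\<dots> = ennreal (10 ^ d / c) * emeasure \<nu> (\<Union>i. ball (a i) (R i))"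
    unfolding ennreal_suminf_cmult
    by (rule arg_cong[where f = "(*) _"], rule suminf_emeasure) (use disj \<nu> in \<open>simp_all add: image_subset_iff\<close>)
  also have "\<dots> \<le> ennreal (10 ^ d / c) * emeasure \<nu> U"
  proof (intro mult_left_mono emeasure_mono)
    have "ball (a i) (R i) \<subseteq> U" for i
    proof (cases "R i = 0")
      case False
      then show ?thesis using aR[of i] \<rho>(4)[of "a i"] by simp
    qed simp
    then show "(\<Union>i. ball (a i) (R i)) \<subseteq> U" by blast
  qed (use U \<nu> in auto)
  finally show "hausdorff_pre d \<epsilon> A \<le> ennreal (10 ^ d / c) * emeasure \<nu> U" .
qed

text \<open>A covering set that meets A lies in the closed ball about one of its points in A whose
  radius is its diameter. Passing from the closed ball to an open ball of twice the radius costs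
  \<open>2 ^ d\<close>.\<close>

lemma mass_distribution_principle:
  fixes A :: "'a::euclidean_space set"
  assumes \<nu>: "sets \<nu> = sets borel" and A: "A \<in> sets borel" and c: "0 < c" and \<delta>: "0 < \<delta>"
    and dens: "\<And>x r. x \<in> A \<Longrightarrow> 0 < r \<Longrightarrow> r < \<delta> \<Longrightarrow> emeasure \<nu> (ball x r) \<le> ennreal (c * r ^ d)"
  shows "emeasure \<nu> A \<le> ennreal (c * 2 ^ d) * hausdorff_unnormalized d A"
proof -
  have cb: "emeasure \<nu> (cball x r) \<le> ennreal (c * 2 ^ d * r ^ d)" if x: "x \<in> A" and r: "0 \<le> r" "r < \<delta> / 2" for x r
  proof (cases "r = 0")
    case False
    have "emeasure \<nu> (cball x r) \<le> emeasure \<nu> (ball x (2 * r))"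
      using False r \<nu> by (intro emeasure_mono) (auto simp: cball_subset_ball_iff)
    also have "\<dots> \<le> ennreal (c * (2 * r) ^ d)" using False r by (intro dens x) auto
    finally show ?thesis by (simp add: power_mult_distrib mult_ac)
  next
    case True
    \<comment> \<open>A covering set may be a single point, of diameter 0, and then no open ball of
      radius 2r contains it. Letting the radius s decrease to 0 gives the bound
      \<open>c * 0 ^ d\<close>, which is c for d = 0 and 0 otherwise.\<close>
    have "((\<lambda>s. ennreal (c * s ^ d)) \<longlongrightarrow> ennreal (c * 0 ^ d)) (at_right 0)"
      by (intro tendsto_ennrealI tendsto_intros)
    moreover have "\<forall>\<^sub>F s in at_right 0. emeasure \<nu> {x} \<le> ennreal (c * s ^ d)"
      unfolding eventually_at_right_field
    proof (intro exI[of _ \<delta>] conjI allI impI)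
      fix s assume "0 < s" "s < \<delta>"
      then show "emeasure \<nu> {x} \<le> ennreal (c * s ^ d)"
        using \<nu> by (intro order_trans[OF emeasure_mono dens[OF x]]) auto
    qed (rule \<delta>)
    ultimately have "emeasure \<nu> {x} \<le> ennreal (c * 0 ^ d)"
      by (intro tendsto_lowerbound[of _ _ "at_right (0::real)"]) auto
    also have "\<dots> \<le> ennreal (c * 2 ^ d * r ^ d)" using True c by (intro ennreal_leI) (cases d; auto)
    finally show ?thesis using True by simp
  qed
  let ?k = "ennreal (c * 2 ^ d)"
  \<comment> \<open>At scale \<delta>/3 every diameter is strictly below \<delta>/2, as
    \<open>cb\<close> requires.\<close>
  have "emeasure \<nu> A * ennreal (1 / (c * 2 ^ d)) \<le> hausdorff_pre d (\<delta> / 3) A"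
    unfolding hausdorff_pre_def hausdorff_weight_def[symmetric]
  proof (rule INF_greatest, clarify)
    fix E :: "nat \<Rightarrow> 'a set"
    assume E: "\<forall>i. bounded (E i) \<and> diameter (E i) \<le> \<delta> / 3" and cover: "A \<subseteq> (\<Union>i. E i)"
    define p where "p i = (SOME x. x \<in> E i \<inter> A)" for i
    define F where "F i = (if E i \<inter> A = {} then {} else cball (p i) (diameter (E i)))" for i
    have p: "p i \<in> E i" "p i \<in> A" if "E i \<inter> A \<noteq> {}" for i
      using that someI_ex[of "\<lambda>x. x \<in> E i \<inter> A"] unfolding p_def by auto
    have "A \<subseteq> (\<Union>i. F i)"
    proof
      fix x assume x: "x \<in> A"
      then have "x \<in> (\<Union>i. E i)" using cover by (meson subsetD)
      then obtain i where i: "x \<in> E i" by blast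
      then have ne: "E i \<inter> A \<noteq> {}" using x by blast
      have "dist (p i) x \<le> diameter (E i)" using E p[OF ne] i by (intro diameter_bounded_bound) auto
      then show "x \<in> (\<Union>i. F i)" using ne by (intro UN_I[of i]) (auto simp: F_def)
    qed
    moreover have Fm: "F i \<in> sets \<nu>" for i unfolding \<nu> F_def by simp
    ultimately have "emeasure \<nu> A \<le> emeasure \<nu> (\<Union>i. F i)"
      by (intro emeasure_mono sets.countable_UN) blast+
    also have "\<dots> \<le> (\<Sum>i. emeasure \<nu> (F i))"
      by (intro emeasure_subadditive_countably) (use Fm in blast)
    also have "\<dots> \<le> (\<Sum>i. ?k * hausdorff_weight d (E i))"
    proof (intro suminf_le)
      fix i
      show "emeasure \<nu> (F i) \<le> ?k * hausdorff_weight d (E i)"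
      proof (cases "E i \<inter> A = {}")
        case False
        have E0: "0 \<le> diameter (E i)" using E by (intro diameter_ge_0) auto
        have "emeasure \<nu> (cball (p i) (diameter (E i))) \<le> ennreal (c * 2 ^ d * diameter (E i) ^ d)"
          using E[rule_format, of i] E0 \<delta> p[OF False] by (intro cb) auto
        then show ?thesis using False E0 c by (auto simp: F_def hausdorff_weight_def ennreal_mult[symmetric])
      qed (simp add: F_def)
    qed auto
    also have "\<dots> = ?k * (\<Sum>i. hausdorff_weight d (E i))" by simp
    finally have "emeasure \<nu> A * ennreal (1 / (c * 2 ^ d))
        \<le> (?k * (\<Sum>i. hausdorff_weight d (E i))) * ennreal (1 / (c * 2 ^ d))"
      by (intro mult_right_mono) auto
    also have "\<dots> = (ennreal (1 / (c * 2 ^ d)) * ?k) * (\<Sum>i. hausdorff_weight d (E i))" by (simp add: mult_ac)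
    also have "ennreal (1 / (c * 2 ^ d)) * ?k = 1" using c by (simp add: ennreal_mult[symmetric])
    finally show "emeasure \<nu> A * ennreal (1 / (c * 2 ^ d)) \<le> (\<Sum>i. hausdorff_weight d (E i))" by simp
  qed
  also have "\<dots> \<le> hausdorff_unnormalized d A" using \<delta> by (intro hausdorff_pre_le_unnormalized) auto
  finally have "?k * (emeasure \<nu> A * ennreal (1 / (c * 2 ^ d))) \<le> ?k * hausdorff_unnormalized d A"
    by (intro mult_left_mono) auto
  moreover have "?k * (emeasure \<nu> A * ennreal (1 / (c * 2 ^ d))) = (?k * ennreal (1 / (c * 2 ^ d))) * emeasure \<nu> A"
    by (simp add: mult_ac)
  moreover have "?k * ennreal (1 / (c * 2 ^ d)) = 1" using c by (simp add: ennreal_mult[symmetric])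
  ultimately show ?thesis by (metis mult_1)
qed

text \<open>Comparison with the image under the projection of Lebesgue measure on the slab whose
  remaining coordinates lie in \<open>[0,1]\<close>.\<close>

lemma hausdorff_unnormalized_coordinate_ball:
  fixes B :: "'a::euclidean_space set"
  assumes B: "B \<subseteq> Basis"
  shows "0 < hausdorff_unnormalized (card B) (span B \<inter> ball 0 1)"
    and "hausdorff_unnormalized (card B) (span B \<inter> ball 0 1) < \<infinity>"
proof -
  let ?d = "card B"
  have finB: "finite B" using B finite_Basis finite_subset by blast
  define pr :: "'a \<Rightarrow> 'a" where "pr y = (\<Sum>b\<in>B. (y \<bullet> b) *\<^sub>R b)" for y
  define S :: "'a set" where "S = {y. \<forall>b\<in>Basis - B. 0 \<le> y \<bullet> b \<and> y \<bullet> b \<le> 1}"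
  define \<nu> where "\<nu> = distr (density lborel (indicator S)) borel pr"
  have cpr: "continuous_on UNIV pr" unfolding pr_def by (intro continuous_intros)
  have mpr: "pr \<in> borel_measurable borel" using cpr by (rule borel_measurable_continuous_onI)
  have mS: "S \<in> sets borel"
  proof -
    have "S = (\<Inter>b\<in>Basis - B. {y. 0 \<le> y \<bullet> b} \<inter> {y. y \<bullet> b \<le> 1})" by (auto simp: S_def)
    moreover have "closed (\<Inter>b\<in>Basis - B. {y. 0 \<le> y \<bullet> b} \<inter> {y::'a. y \<bullet> b \<le> 1})"
      by (intro closed_INT ballI closed_Int closed_Collect_le continuous_intros)
    ultimately show ?thesis by simp
  qed
  have sets\<nu>: "sets \<nu> = sets borel" by (simp add: \<nu>_def)
  have \<nu>: "emeasure \<nu> X = emeasure lborel (pr -` X \<inter> S)" if "X \<in> sets borel" for X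
  proof -
    have "pr -` X \<in> sets borel" using measurable_sets_borel[OF mpr that] .
    then show ?thesis
      unfolding \<nu>_def using mpr that mS
      by (subst emeasure_distr) (auto simp: emeasure_restricted Int_commute)
  qed
  have pr_Basis: "pr y \<bullet> b = (if b \<in> B then y \<bullet> b else 0)" if "b \<in> Basis" for y b
  proof -
    have "pr y \<bullet> b = (\<Sum>c\<in>B. (y \<bullet> c) * (c \<bullet> b))" by (simp add: pr_def inner_sum_left)
    also have "\<dots> = (\<Sum>c\<in>B. if c = b then y \<bullet> b else 0)"
      using B that by (intro sum.cong) (auto simp: inner_Basis)
    finally show ?thesis using finB by simp
  qed
  have pr_span: "pr y \<in> span B" for y
    unfolding pr_def by (intro span_sum span_scale span_base)
  have span_coord: "x \<bullet> b = 0" if "x \<in> span B" "b \<in> Basis - B" for x b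
    using that(1)
  proof (induction rule: span_induct_alt)
    case (step c y z)
    then have "c \<bullet> b = 0" if "c = y" for c using B \<open>b \<in> Basis - B\<close> that by (intro inner_not_same_Basis) auto
    then show ?case using step by (simp add: inner_add_left)
  qed simp
  \<comment> \<open>The box between \<open>lo x s\<close> and \<open>hi x s\<close> has side 2s in
    the directions of B and side 1 in the others, so its volume is
    \<open>(2 * s) ^ card B\<close>.\<close>
  define lo where "lo x s = (\<Sum>b\<in>Basis. (if b \<in> B then x \<bullet> b - s else 0) *\<^sub>R b)" for x :: 'a and s :: real
  define hi where "hi x s = (\<Sum>b\<in>Basis. (if b \<in> B then x \<bullet> b + s else 1) *\<^sub>R b)" for x :: 'a and s :: real
  have lo: "lo x s \<bullet> b = (if b \<in> B then x \<bullet> b - s else 0)" if "b \<in> Basis" for x b s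
    unfolding lo_def using that by simp
  have hi: "hi x s \<bullet> b = (if b \<in> B then x \<bullet> b + s else 1)" if "b \<in> Basis" for x b s
    unfolding hi_def using that by simp
  have vol: "emeasure lborel (cbox (lo x s) (hi x s)) = ennreal ((2 * s) ^ ?d)" if "0 \<le> s" for x s
  proof -
    have "emeasure lborel (cbox (lo x s) (hi x s)) = ennreal (\<Prod>b\<in>Basis. (hi x s - lo x s) \<bullet> b)"
      using that by (subst emeasure_lborel_cbox_eq) (auto simp: lo hi)
    also have "(\<Prod>b\<in>Basis. (hi x s - lo x s) \<bullet> b) = (\<Prod>b\<in>Basis. if b \<in> B then 2 * s else 1)"
      by (intro prod.cong) (auto simp: inner_diff_left lo hi)
    also have "\<dots> = (\<Prod>b\<in>B. 2 * s)"
      using B by (subst prod.inter_restrict[symmetric]) (auto simp: Int_absorb1)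
    finally show ?thesis by simp
  qed
  have upper: "emeasure \<nu> (ball x r) \<le> ennreal (2 ^ ?d * r ^ ?d)" if r: "0 < r" for x r
  proof -
    have "pr -` ball x r \<inter> S \<subseteq> cbox (lo x r) (hi x r)"
    proof
      fix y assume y: "y \<in> pr -` ball x r \<inter> S"
      show "y \<in> cbox (lo x r) (hi x r)"
        unfolding mem_box
      proof
        fix b :: 'a assume b: "b \<in> Basis"
        have "\<bar>(pr y - x) \<bullet> b\<bar> \<le> norm (pr y - x)" using Basis_le_norm[OF b] by blast
        then show "lo x r \<bullet> b \<le> y \<bullet> b \<and> y \<bullet> b \<le> hi x r \<bullet> b"
          using y b pr_Basis[OF b, of y]
          by (auto simp: dist_norm norm_minus_commute inner_diff_left S_def lo hi)
      qed
    qed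
    then have "emeasure lborel (pr -` ball x r \<inter> S) \<le> emeasure lborel (cbox (lo x r) (hi x r))"
      by (intro emeasure_mono) auto
    then show ?thesis using r by (simp add: \<nu> vol power_mult_distrib)
  qed
  \<comment> \<open>A cube of half-side r/(card B + 1) in the directions of B has l1-radius less
    than r, so it projects into the ball. Its full side is k r. The summand 1 also keeps the
    denominator positive when B is empty.\<close>
  define k where "k = 2 / (real ?d + 1)"
  have k: "0 < k" by (simp add: k_def)
  have lower: "ennreal (k ^ ?d * r ^ ?d) \<le> emeasure \<nu> (ball x r)" if x: "x \<in> span B" and r: "0 < r" for x r
  proof -
    let ?s = "r / (real ?d + 1)"
    have s: "0 < ?s" using r by simp
    have "cbox (lo x ?s) (hi x ?s) \<subseteq> pr -` ball x r \<inter> S"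
    proof
      fix y assume "y \<in> cbox (lo x ?s) (hi x ?s)"
      then have yb: "(if b \<in> B then x \<bullet> b - ?s else 0) \<le> y \<bullet> b" "y \<bullet> b \<le> (if b \<in> B then x \<bullet> b + ?s else 1)"
        if "b \<in> Basis" for b
        using that lo[OF that, of x ?s] hi[OF that, of x ?s] by (auto simp: mem_box)
      have y1: "\<bar>(y - x) \<bullet> b\<bar> \<le> ?s" if "b \<in> B" for b
        using yb[of b] that B by (simp add: inner_diff_left abs_le_iff subset_iff)
      have "0 \<le> y \<bullet> b \<and> y \<bullet> b \<le> 1" if "b \<in> Basis - B" for b
        using yb[of b] that by simp
      then have y2: "y \<in> S" by (simp add: S_def)
      have "norm (pr y - x) \<le> (\<Sum>b\<in>Basis. \<bar>(pr y - x) \<bullet> b\<bar>)" by (rule norm_le_l1)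
      also have "\<dots> \<le> (\<Sum>b\<in>Basis. if b \<in> B then ?s else 0)"
        using y1 pr_Basis span_coord[OF x] by (intro sum_mono) (auto simp: inner_diff_left)
      also have "\<dots> = real ?d * ?s"
        using B by (subst sum.inter_restrict[symmetric]) (auto simp: Int_absorb1)
      also have "\<dots> < r" using r by (simp add: field_simps)
      finally show "y \<in> pr -` ball x r \<inter> S" using y2 by (simp add: dist_norm norm_minus_commute)
    qed
    moreover have "pr -` ball x r \<inter> S \<in> sets lborel"
      using measurable_sets_borel[OF mpr] mS by auto
    ultimately have "emeasure lborel (cbox (lo x ?s) (hi x ?s)) \<le> emeasure lborel (pr -` ball x r \<inter> S)"
      by (intro emeasure_mono)
    then show ?thesis using s by (simp add: \<nu> vol power_mult_distrib[symmetric] k_def)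
  qed
  have sp: "closed (span B)" by (rule closed_subspace) simp
  let ?A = "span B \<inter> ball 0 1"
  have mA: "?A \<in> sets borel" using borel_closed[OF sp] borel_open[OF open_ball] by (rule sets.Int)
  have "0 < emeasure \<nu> (ball 0 1)"
    using lower[of 0 1] k by (auto simp: span_zero less_le_trans[rotated])
  also have "emeasure \<nu> (ball 0 1) = emeasure \<nu> ?A"
    using sp pr_span by (subst (1 2) \<nu>) (auto intro!: arg_cong[where f = "emeasure lborel"])
  also have "\<dots> \<le> ennreal (2 ^ ?d * 2 ^ ?d) * hausdorff_unnormalized ?d ?A"
  proof (rule mass_distribution_principle[where \<delta> = 1])
    show "sets \<nu> = sets borel" by fact
    show "emeasure \<nu> (ball x r) \<le> ennreal (2 ^ ?d * r ^ ?d)" if "0 < r" for x r by (rule upper) fact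
  qed (rule mA, simp_all)
  finally show "0 < hausdorff_unnormalized ?d ?A"
    unfolding ennreal_zero_less_mult_iff by blast
  have "hausdorff_unnormalized ?d ?A \<le> ennreal (10 ^ ?d / k ^ ?d) * emeasure \<nu> (ball 0 1)"
  proof (rule hausdorff_unnormalized_density_bound[where \<delta> = 1])
    show "sets \<nu> = sets borel" by fact
    show "ennreal (k ^ ?d * r ^ ?d) \<le> emeasure \<nu> (ball x r)" if "x \<in> ?A" "0 < r" for x r
      using that by (intro lower) auto
  qed (use k in auto)
  also have "\<dots> \<le> ennreal (10 ^ ?d / k ^ ?d) * ennreal (2 ^ ?d * 1 ^ ?d)"
    by (intro mult_left_mono upper) auto
  also have "\<dots> < \<infinity>" by (simp add: ennreal_mult_less_top)
  finally show "hausdorff_unnormalized ?d ?A < \<infinity>" .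
qed

section \<open>The normalizing constant and Hausdorff measure of balls in affine planes\<close>

lemma hausdorff_unnormalized_subspace_ball:
  fixes P Q :: "'a::euclidean_space set"
  assumes "subspace P" "subspace Q" "dim P = dim Q"
  shows "hausdorff_unnormalized d (P \<inter> ball 0 1) = hausdorff_unnormalized d (Q \<inter> ball 0 1)"
proof -
  obtain f g where f: "linear f" "f ` P = Q" "\<And>x. x \<in> P \<Longrightarrow> norm (f x) = norm x"
    using isometries_subspaces[OF assms] by metis
  have "f ` (P \<inter> ball 0 1) = Q \<inter> ball 0 1" using f by auto
  moreover have "dist (f x) (f y) = dist x y" if "x \<in> P \<inter> ball 0 1" "y \<in> P \<inter> ball 0 1" for x y
    using that f(3)[of "x - y"] assms(1) by (simp add: dist_norm linear_diff[OF f(1), symmetric] subspace_diff)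
  ultimately show ?thesis using hausdorff_unnormalized_isometric_image[of "P \<inter> ball 0 1" f d] by simp
qed

definition model_subspace :: "nat \<Rightarrow> 'a::euclidean_space set" where
  "model_subspace d = (SOME P. subspace P \<and> dim P = d)"

lemma model_subspace:
  assumes "d \<le> DIM('a::euclidean_space)"
  shows "subspace (model_subspace d :: 'a set)" "dim (model_subspace d :: 'a set) = d"
proof -
  obtain B :: "'a set" where B: "B \<subseteq> Basis" "card B = d"
    using obtain_subset_with_card_n[OF assms] by metis
  then have "subspace (span B) \<and> dim (span B) = d"
    using dim_span_eq_card_independent[OF independent_mono[OF independent_Basis B(1)]] by simp
  then have "subspace (model_subspace d :: 'a set) \<and> dim (model_subspace d :: 'a set) = d"
    unfolding model_subspace_def by (rule someI)
  then show "subspace (model_subspace d :: 'a set)" "dim (model_subspace d :: 'a set) = d" by auto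
qed

definition hausdorff_const :: "'a::euclidean_space itself \<Rightarrow> nat \<Rightarrow> ennreal" where
  "hausdorff_const TYPE('a) d = hausdorff_unnormalized d (model_subspace d \<inter> ball (0::'a) 1)"

lemma hausdorff_outer_eq:
  "hausdorff_outer d (A :: 'a::euclidean_space set)
     = hausdorff_unnormalized d A * inverse (hausdorff_const TYPE('a) d)"
  by (simp add: hausdorff_outer_def hausdorff_const_def model_subspace_def divide_ennreal_def)

text \<open>The coordinate computation transfers to the chosen model subspace because all subspaces
  of one dimension are isometric. Positivity and finiteness are what make the division in
  \<open>hausdorff_outer\<close> a genuine normalization.\<close>

lemma hausdorff_const:
  assumes "d \<le> DIM('a::euclidean_space)"
  shows "0 < hausdorff_const TYPE('a) d" "hausdorff_const TYPE('a) d < \<infinity>"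
proof -
  obtain B :: "'a set" where B: "B \<subseteq> Basis" "card B = d"
    using obtain_subset_with_card_n[OF assms] by metis
  have "dim (span B) = d"
    using B dim_span_eq_card_independent[OF independent_mono[OF independent_Basis B(1)]] by simp
  then have "hausdorff_const TYPE('a) d = hausdorff_unnormalized d (span B \<inter> ball 0 1)"
    unfolding hausdorff_const_def using model_subspace[OF assms]
    by (intro hausdorff_unnormalized_subspace_ball) auto
  then show "0 < hausdorff_const TYPE('a) d" "hausdorff_const TYPE('a) d < \<infinity>"
    using hausdorff_unnormalized_coordinate_ball[OF B(1)] B(2) by auto
qed

lemma hausdorff_outer_mono: "A \<subseteq> B \<Longrightarrow> hausdorff_outer d A \<le> hausdorff_outer d B"
  unfolding hausdorff_outer_eq by (intro mult_right_mono hausdorff_unnormalized_mono) auto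

lemma hausdorff_outer_empty [simp]: "hausdorff_outer d {} = 0"
  by (simp add: hausdorff_outer_eq)

lemma hausdorff_outer_lipschitz_image:
  fixes f :: "'a::euclidean_space \<Rightarrow> 'a"
  assumes "\<And>x y. x \<in> A \<Longrightarrow> y \<in> A \<Longrightarrow> dist (f x) (f y) \<le> L * dist x y" "0 < L"
  shows "hausdorff_outer d (f ` A) \<le> ennreal (L ^ d) * hausdorff_outer d A"
  unfolding hausdorff_outer_eq mult.assoc[symmetric]
  by (intro mult_right_mono hausdorff_unnormalized_lipschitz_image assms) auto

lemma hausdorff_outer_isometric_image:
  fixes f :: "'a::euclidean_space \<Rightarrow> 'a"
  assumes "\<And>x y. x \<in> A \<Longrightarrow> y \<in> A \<Longrightarrow> dist (f x) (f y) = dist x y"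
  shows "hausdorff_outer d (f ` A) = hausdorff_outer d A"
  unfolding hausdorff_outer_eq using hausdorff_unnormalized_isometric_image[of A f d] assms by simp

lemma hausdorff_outer_scale:
  assumes "0 < r"
  shows "hausdorff_outer d ((\<lambda>x. r *\<^sub>R x) ` A) = ennreal (r ^ d) * hausdorff_outer d A"
  unfolding hausdorff_outer_eq hausdorff_unnormalized_scale[OF assms] by (simp add: mult_ac)

lemma sets_hausdorff_measure [simp, measurable_cong]:
  "sets (hausdorff_measure d :: 'a::euclidean_space measure) = sets borel"
  unfolding hausdorff_measure_def by (metis sets.sets_measure_of_eq space_borel)

text \<open>\<open>measure_of\<close> returns the given set function only if that function is
  countably additive on the sigma-algebra, so the Caratheodory argument enters here.\<close>

lemma emeasure_hausdorff_measure:
  fixes A :: "'a::euclidean_space set"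
  assumes A: "A \<in> sets borel"
  shows "emeasure (hausdorff_measure d) A = hausdorff_outer d A"
proof -
  have "measure_space UNIV (sets (borel :: 'a measure)) (hausdorff_outer d)"
  proof (rule metric_outer_measure_space)
    show "hausdorff_outer d (\<Union>i. A i) \<le> (\<Sum>i. hausdorff_outer d (A i))" for A :: "nat \<Rightarrow> 'a set"
      unfolding hausdorff_outer_eq ennreal_suminf_multc
      by (intro mult_right_mono hausdorff_unnormalized_countably_subadditive) auto
    show "hausdorff_outer d A + hausdorff_outer d B \<le> hausdorff_outer d (A \<union> B)"
      if "\<And>a b. a \<in> A \<Longrightarrow> b \<in> B \<Longrightarrow> s \<le> dist a b" "0 < s" for A B :: "'a set" and s
      unfolding hausdorff_outer_eq distrib_right[symmetric]
      by (intro mult_right_mono hausdorff_unnormalized_separated[OF that]) auto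
  qed (auto intro: hausdorff_outer_mono)
  then show ?thesis
    unfolding hausdorff_measure_def using A
    by (intro emeasure_measure_of_sigma) (auto simp: measure_space_def)
qed

lemma hausdorff_outer_affine_ball:
  fixes V :: "'a::euclidean_space set"
  assumes V: "affine V" "aff_dim V = int d" and v: "v \<in> V" and r: "0 < r"
  shows "hausdorff_outer d (V \<inter> ball v r) = ennreal (r ^ d)"
proof -
  define L where "L = (\<lambda>x. - v + x) ` V"
  have L: "subspace L" unfolding L_def using V v affine_diffs_subspace[of V v] by (simp add: add.commute)
  have dimL: "dim L = d"
    using V(2) aff_dim_eq_dim[OF hull_inc[OF v]] by (simp add: L_def)
  have d: "d \<le> DIM('a)" using dimL dim_subset_UNIV[of L] by simp
  have "V \<inter> ball v r = (\<lambda>x. v + r *\<^sub>R x) ` (L \<inter> ball 0 1)"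
  proof (intro equalityI subsetI)
    fix y assume y: "y \<in> V \<inter> ball v r"
    then have "(1/r) *\<^sub>R (y - v) \<in> L"
      using L by (intro subspace_scale) (auto simp: L_def)
    moreover have "(1/r) *\<^sub>R (y - v) \<in> ball 0 1" using y r by (simp add: dist_norm norm_minus_commute)
    ultimately show "y \<in> (\<lambda>x. v + r *\<^sub>R x) ` (L \<inter> ball 0 1)"
      using r by (intro image_eqI[of _ _ "(1/r) *\<^sub>R (y - v)"]) auto
  next
    fix y assume "y \<in> (\<lambda>x. v + r *\<^sub>R x) ` (L \<inter> ball 0 1)"
    then obtain x where x: "x \<in> L" "norm x < 1" "y = v + r *\<^sub>R x" by auto
    then have "r *\<^sub>R x \<in> L" using L by (simp add: subspace_scale)
    then show "y \<in> V \<inter> ball v r" using x r by (auto simp: L_def dist_norm)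
  qed
  also have "\<dots> = (\<lambda>x. v + x) ` (\<lambda>x. r *\<^sub>R x) ` (L \<inter> ball 0 1)" by (simp add: image_image)
  also have "hausdorff_outer d \<dots> = ennreal (r ^ d) * hausdorff_outer d (L \<inter> ball 0 1)"
    by (subst hausdorff_outer_isometric_image) (auto simp: hausdorff_outer_scale[OF r])
  also have "hausdorff_outer d (L \<inter> ball 0 1) = hausdorff_const TYPE('a) d * inverse (hausdorff_const TYPE('a) d)"
    unfolding hausdorff_outer_eq hausdorff_const_def
    using L dimL model_subspace[OF d] by (subst hausdorff_unnormalized_subspace_ball[of L "model_subspace d"]) auto
  also have "\<dots> = 1"
    using hausdorff_const[where 'a = 'a, OF d] by (simp add: ennreal_divide_self divide_ennreal_def[symmetric])
  finally show ?thesis by simp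
qed

subsection \<open>Radon measures and compactly supported Lipschitz functions\<close>

lemma radon_sets: "radon_measure N \<Longrightarrow> sets N = sets borel"
  by (simp add: radon_measure_def)

lemma radon_space: "radon_measure N \<Longrightarrow> space N = UNIV"
  using sets_eq_imp_space_eq[of N borel] by (simp add: radon_measure_def)

lemma radon_emeasure_bounded_finite:
  fixes A :: "'a::euclidean_space set"
  assumes N: "radon_measure N" and A: "bounded A"
  shows "emeasure N A < \<infinity>"
proof -
  obtain U where U: "\<And>x. open (U x)" "\<And>x. x \<in> U x" "\<And>x. emeasure N (U x) < \<infinity>"
    using N unfolding radon_measure_def by metis
  have "compact (closure A)" using A by simp
  then obtain C where C: "finite C" "closure A \<subseteq> (\<Union>x\<in>C. U x)"
    using compactE_image[of "closure A" UNIV U] U by (metis UNIV_I UN_I subsetI)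
  have Us: "U x \<in> sets N" for x using U(1) radon_sets[OF N] by simp
  have "emeasure N A \<le> emeasure N (\<Union>x\<in>C. U x)"
    using C Us closure_subset[of A] by (intro emeasure_mono) auto
  also have "\<dots> \<le> (\<Sum>x\<in>C. emeasure N (U x))"
    using C(1) Us by (intro emeasure_subadditive_finite) auto
  also have "\<dots> < \<infinity>" using U(3) C(1) by (simp add: less_top)
  finally show ?thesis .
qed

lemma radon_emeasure_eq_measure:
  assumes "radon_measure N" "bounded A"
  shows "emeasure N A = ennreal (measure N A)"
  using radon_emeasure_bounded_finite[OF assms] by (simp add: emeasure_eq_ennreal_measure less_top)

lemma radon_sigma_finite:
  fixes N :: "'a::euclidean_space measure"
  assumes N: "radon_measure N"
  shows "sigma_finite_measure N"
proof
  have "(\<Union>n::nat. ball (0::'a) (real n)) = UNIV" using reals_Archimedean2 by auto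
  then show "\<exists>A. countable A \<and> A \<subseteq> sets N \<and> \<Union>A = space N \<and> (\<forall>a\<in>A. emeasure N a \<noteq> \<infinity>)"
    using radon_emeasure_bounded_finite[OF N, of "ball (0::'a) _"] radon_space[OF N] radon_sets[OF N]
    by (intro exI[of _ "range (\<lambda>n::nat. ball (0::'a) (real n))"]) (auto simp: less_top)
qed

lemma radon_measure_mono:
  assumes N: "radon_measure N" and "A \<subseteq> B" "bounded B" "B \<in> sets borel"
  shows "measure N A \<le> measure N B"
proof -
  have "emeasure N A \<le> emeasure N B" using assms radon_sets[OF N] by (intro emeasure_mono) auto
  then show ?thesis
    using radon_emeasure_eq_measure[OF N] assms(2,3) bounded_subset by (metis ennreal_le_iff measure_nonneg)
qed

lemma radon_borel_measurable:
  "radon_measure N \<Longrightarrow> \<psi> \<in> borel_measurable borel \<Longrightarrow> \<psi> \<in> borel_measurable N"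
  using measurable_cong_sets[OF radon_sets refl] by blast

lemma radon_integrable:
  fixes \<psi> :: "'a::euclidean_space \<Rightarrow> real"
  assumes N: "radon_measure N" and m: "\<psi> \<in> borel_measurable borel"
    and b: "\<And>y. \<bar>\<psi> y\<bar> \<le> M" and s: "\<And>y. y \<notin> S \<Longrightarrow> \<psi> y = 0" and S: "bounded S"
  shows "integrable N \<psi>"
proof -
  \<comment> \<open>The set S need not be measurable; its closure is, and it is still
    bounded.\<close>
  have "bounded (closure S)" using S by (rule bounded_closure)
  then show ?thesis
    using s closure_subset[of S] b radon_sets[OF N] radon_emeasure_bounded_finite[OF N]
    by (intro integrableI_bounded_set[where A = "closure S" and B = M] radon_borel_measurable[OF N m]) auto
qed

lemma radon_integral_bound:
  fixes \<psi> :: "'a::euclidean_space \<Rightarrow> real"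
  assumes N: "radon_measure N" and m: "\<psi> \<in> borel_measurable borel"
    and b: "\<And>y. \<bar>\<psi> y\<bar> \<le> M" and s: "\<And>y. y \<notin> S \<Longrightarrow> \<psi> y = 0" and S: "bounded S" "S \<in> sets borel"
  shows "\<bar>integral\<^sup>L N \<psi>\<bar> \<le> M * measure N S"
proof -
  have M0: "0 \<le> M" using b[of undefined] by linarith
  have int: "integrable N \<psi>" by (rule radon_integrable[OF N m b s S(1)])
  have fin: "emeasure N S < \<infinity>" using radon_emeasure_bounded_finite[OF N S(1)] .
  have ind: "integrable N (\<lambda>y. M * indicator S y)"
    using fin S radon_sets[OF N] by (intro integrable_mult_right integrable_real_indicator) auto
  have "\<bar>integral\<^sup>L N \<psi>\<bar> \<le> (\<integral>y. \<bar>\<psi> y\<bar> \<partial>N)" using integral_norm_bound[of N \<psi>] by simp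
  also have "\<dots> \<le> (\<integral>y. M * indicator S y \<partial>N)"
    using b s by (intro integral_mono ind integrable_abs int) (auto simp: indicator_def)
  also have "\<dots> = M * measure N S" using S radon_sets[OF N] radon_space[OF N] by simp
  finally show ?thesis .
qed

lemma radon_integral_ge:
  fixes \<psi> :: "'a::euclidean_space \<Rightarrow> real"
  assumes N: "radon_measure N" and int: "integrable N \<psi>"
    and nn: "\<And>y. 0 \<le> \<psi> y" and b: "\<And>y. y \<in> S \<Longrightarrow> c \<le> \<psi> y" and S: "bounded S" "S \<in> sets borel"
  shows "c * measure N S \<le> integral\<^sup>L N \<psi>"
proof -
  have fin: "emeasure N S < \<infinity>" using radon_emeasure_bounded_finite[OF N S(1)] .
  have ind: "integrable N (\<lambda>y. c * indicator S y)"
    using fin S radon_sets[OF N] by (intro integrable_mult_right integrable_real_indicator) auto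
  have "c * measure N S = (\<integral>y. c * indicator S y \<partial>N)"
    using S radon_sets[OF N] radon_space[OF N] by simp
  also have "\<dots> \<le> integral\<^sup>L N \<psi>"
    using nn b by (intro integral_mono ind int) (auto simp: indicator_def)
  finally show ?thesis .
qed

section \<open>Lipschitz test functions supported in a ball about the origin\<close>

definition lip_test :: "real \<Rightarrow> real \<Rightarrow> ('a::euclidean_space \<Rightarrow> real) \<Rightarrow> bool" where
  "lip_test L R \<psi> \<longleftrightarrow> L-lipschitz_on UNIV \<psi> \<and> (\<forall>y. R \<le> norm y \<longrightarrow> \<psi> y = 0)"

lemma lip_test_diff:
  assumes "lip_test L R \<psi>"
  shows "\<bar>\<psi> x - \<psi> y\<bar> \<le> L * norm (x - y)" "0 \<le> L"
  using assms lipschitz_onD[of L UNIV \<psi> x y] lipschitz_on_nonneg[of L UNIV \<psi>]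
  by (auto simp: lip_test_def dist_norm)

lemma lip_test_zero: "lip_test L R \<psi> \<Longrightarrow> R \<le> norm y \<Longrightarrow> \<psi> y = 0"
  by (simp add: lip_test_def)

lemma lip_testI:
  assumes "\<And>x y. \<bar>\<psi> x - \<psi> y\<bar> \<le> L * norm (x - y)" "\<And>y. R \<le> norm y \<Longrightarrow> \<psi> y = 0" "0 \<le> L"
  shows "lip_test L R \<psi>"
  using assms by (auto simp: lip_test_def dist_norm intro!: lipschitz_onI)

lemma lip_test_bound:
  fixes \<psi> :: "'a::euclidean_space \<Rightarrow> real"
  assumes \<psi>: "lip_test L R \<psi>" and R: "0 \<le> R"
  shows "\<bar>\<psi> y\<bar> \<le> L * R"
proof (cases "R \<le> norm y")
  case True
  then show ?thesis using lip_test_zero[OF \<psi>] lip_test_diff(2)[OF \<psi>] R by simp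
next
  case False
  obtain b :: 'a where b: "norm b = 1" using nonempty_Basis norm_Basis by blast
  \<comment> \<open>The nearest point of the sphere of radius R, where \<psi> vanishes. At y = 0
    every point of the sphere is nearest, and a multiple of a basis vector is taken.\<close>
  define z where "z = (if y = 0 then R *\<^sub>R b else (R / norm y) *\<^sub>R y)"
  have z: "norm z = R" "norm (y - z) \<le> R"
  proof -
    show "norm z = R" using R b by (auto simp: z_def)
    show "norm (y - z) \<le> R"
    proof (cases "y = 0")
      case False
      have "norm (y - z) = norm ((1 - R / norm y) *\<^sub>R y)" using False by (simp add: z_def scaleR_left_diff_distrib)
      also have "\<dots> = \<bar>(1 - R / norm y) * norm y\<bar>" by (simp add: abs_mult)
      also have "\<dots> = \<bar>norm y - R\<bar>" using False by (simp add: left_diff_distrib)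
      finally show ?thesis using \<open>\<not> R \<le> norm y\<close> by simp
    qed (use R b in \<open>simp add: z_def\<close>)
  qed
  have "\<bar>\<psi> y\<bar> = \<bar>\<psi> y - \<psi> z\<bar>" using lip_test_zero[OF \<psi>, of z] z by simp
  also have "\<dots> \<le> L * norm (y - z)" by (rule lip_test_diff[OF \<psi>])
  also have "\<dots> \<le> L * R" using z lip_test_diff(2)[OF \<psi>] by (intro mult_left_mono)
  finally show ?thesis .
qed

lemma lip_test_continuous: "lip_test L R \<psi> \<Longrightarrow> continuous_on UNIV \<psi>"
  by (auto simp: lip_test_def intro: lipschitz_on_continuous_on)

lemma lip_test_measurable: "lip_test L R \<psi> \<Longrightarrow> \<psi> \<in> borel_measurable borel"
  by (intro borel_measurable_continuous_onI lip_test_continuous)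

lemma lip_test_mono:
  assumes "lip_test L R \<psi>" "L \<le> L'" "R \<le> R'"
  shows "lip_test L' R' \<psi>"
  using assms lipschitz_on_le[of L UNIV \<psi> L'] by (auto simp: lip_test_def)

lemma lip_test_shift:
  assumes \<psi>: "lip_test L R \<psi>" and R: "norm v + R \<le> R'"
  shows "lip_test L R' (\<lambda>y. \<psi> (y - v))"
proof (rule lip_testI)
  show "\<bar>\<psi> (x - v) - \<psi> (y - v)\<bar> \<le> L * norm (x - y)" for x y
    using lip_test_diff(1)[OF \<psi>, of "x - v" "y - v"] by simp
  show "\<psi> (y - v) = 0" if "R' \<le> norm y" for y
    using norm_triangle_ineq2[of y v] that R by (intro lip_test_zero[OF \<psi>]) linarith
qed (rule lip_test_diff(2)[OF \<psi>])

lemma lip_test_scale: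
  assumes \<psi>: "lip_test L R \<psi>" and r: "0 < r"
  shows "lip_test (L / r) (R * r) (\<lambda>y. \<psi> ((1/r) *\<^sub>R y))"
proof (rule lip_testI)
  show "\<bar>\<psi> ((1/r) *\<^sub>R x) - \<psi> ((1/r) *\<^sub>R y)\<bar> \<le> L / r * norm (x - y)" for x y
    using lip_test_diff(1)[OF \<psi>, of "(1/r) *\<^sub>R x" "(1/r) *\<^sub>R y"] r
    by (simp add: scaleR_right_diff_distrib[symmetric])
  show "\<psi> ((1/r) *\<^sub>R y) = 0" if "R * r \<le> norm y" for y
    using that r by (intro lip_test_zero[OF \<psi>]) (simp add: pos_le_divide_eq)
qed (use lip_test_diff(2)[OF \<psi>] r in simp)

lemma lip_test_cmult:
  assumes \<psi>: "lip_test L R \<psi>" and c: "0 \<le> c"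
  shows "lip_test (c * L) R (\<lambda>y. c * \<psi> y)"
proof (rule lip_testI)
  show "\<bar>c * \<psi> x - c * \<psi> y\<bar> \<le> c * L * norm (x - y)" for x y
    using mult_left_mono[OF lip_test_diff(1)[OF \<psi>, of x y] c] c
    by (simp add: right_diff_distrib[symmetric] abs_mult mult.assoc)
qed (use lip_test_diff(2)[OF \<psi>] lip_test_zero[OF \<psi>] c in auto)

lemma lip_test_integrable:
  assumes N: "radon_measure N" and \<psi>: "lip_test L R \<psi>" and R: "0 \<le> R"
  shows "integrable N \<psi>"
  using lip_test_zero[OF \<psi>]
  by (intro radon_integrable[OF N lip_test_measurable[OF \<psi>] lip_test_bound[OF \<psi> R], of "ball 0 R"]) auto

lemma lip_test_integral_bound:
  assumes N: "radon_measure N" and \<psi>: "lip_test L R \<psi>" and R: "0 \<le> R"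
  shows "\<bar>integral\<^sup>L N \<psi>\<bar> \<le> L * R * measure N (ball 0 R)"
  using lip_test_zero[OF \<psi>]
  by (intro radon_integral_bound[OF N lip_test_measurable[OF \<psi>] lip_test_bound[OF \<psi> R]]) auto

definition tent :: "real \<Rightarrow> 'a::euclidean_space \<Rightarrow> real" where
  "tent s y = max 0 (s - norm y)"

lemma lip_test_tent: "lip_test 1 s (tent s)"
proof (rule lip_testI)
  show "\<bar>tent s x - tent s y\<bar> \<le> 1 * norm (x - y)" for x y :: 'a
    unfolding tent_def using norm_triangle_ineq3[of x y] by linarith
qed (auto simp: tent_def)

text \<open>This function vanishes on V and far from the origin, and is positive elsewhere; it
  detects mass that lies off a plane.\<close>

lemma lip_test_min_infdist:
  "lip_test 1 s (\<lambda>y. min (infdist y V) (tent s y))"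
proof (rule lip_testI)
  show "\<bar>min (infdist x V) (tent s x) - min (infdist y V) (tent s y)\<bar> \<le> 1 * norm (x - y)" for x y :: 'a
    using lip_test_diff(1)[OF lip_test_tent, of s x y] infdist_triangle_abs[of x V y]
    by (simp add: dist_norm min_def) linarith
  show "min (infdist y V) (tent s y) = 0" if "s \<le> norm y" for y
    using that infdist_nonneg[of y V] by (simp add: tent_def)
qed simp

lemma integral_scale_measure:
  fixes f :: "'b \<Rightarrow> real"
  assumes c: "0 \<le> c" and f: "f \<in> borel_measurable M"
  shows "integral\<^sup>L (scale_measure (ennreal c) M) f = c * integral\<^sup>L M f"
proof -
  have "scale_measure (ennreal c) M = density M (\<lambda>_. ennreal c)"
    by (rule measure_eqI) (auto simp: emeasure_density_const)
  then show ?thesis using c f by (simp add: integral_density)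
qed

subsection \<open>Hausdorff measure on planes\<close>

abbreviation (input) plane_measure :: "nat \<Rightarrow> 'a::euclidean_space set \<Rightarrow> 'a measure" where
  "plane_measure d V \<equiv> measure_on (hausdorff_measure d) V"

definition dplane :: "nat \<Rightarrow> 'a::euclidean_space set \<Rightarrow> bool" where
  "dplane d V \<longleftrightarrow> affine V \<and> aff_dim V = int d"

lemma sets_measure_on [simp, measurable_cong]: "sets (measure_on M E) = sets M"
  by (simp add: measure_on_def)

lemma space_measure_on [simp]: "space (measure_on M E) = space M"
  by (simp add: measure_on_def)

lemma emeasure_measure_on:
  "E \<in> sets M \<Longrightarrow> A \<in> sets M \<Longrightarrow> emeasure (measure_on M E) A = emeasure M (A \<inter> E)"
  by (simp add: measure_on_def emeasure_restricted Int_commute)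

lemma dplane_borel: "dplane d V \<Longrightarrow> V \<in> sets borel"
  by (simp add: dplane_def affine_closed)

lemma dplane_nonempty: "dplane d V \<Longrightarrow> V \<noteq> {}"
  by (auto simp: dplane_def)

lemma dplane_subspace:
  assumes "subspace L" "dim L = d" shows "dplane d L"
  using assms by (simp add: dplane_def subspace_imp_affine aff_dim_subspace)

lemma dplane_translate:
  assumes L: "subspace L" "dim L = d" shows "dplane d ((+) v ` L)"
  using assms by (simp add: dplane_def affine_translation[symmetric] subspace_imp_affine aff_dim_translation_eq aff_dim_subspace)

lemma dplane_direction:
  assumes V: "dplane d V" and v: "v \<in> V"
  obtains L where "subspace L" "dim L = d" "V = (+) v ` L"
proof
  let ?L = "(\<lambda>x. - v + x) ` V"
  show "subspace ?L" using V v affine_diffs_subspace[of V v] by (simp add: add.commute dplane_def)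
  show "dim ?L = d" using V aff_dim_eq_dim[OF hull_inc[OF v]] by (simp add: dplane_def)
  show "V = (+) v ` ?L" by (simp add: image_image)
qed

lemma emeasure_plane_measure:
  "dplane d V \<Longrightarrow> A \<in> sets borel \<Longrightarrow> emeasure (plane_measure d V) A = hausdorff_outer d (A \<inter> V)"
  using dplane_borel[of d V] by (simp add: emeasure_measure_on emeasure_hausdorff_measure)

lemma emeasure_plane_ball:
  assumes "dplane d V" "v \<in> V" "0 < r"
  shows "emeasure (plane_measure d V) (ball v r) = ennreal (r ^ d)"
  using assms hausdorff_outer_affine_ball[of V d v r]
  by (simp add: emeasure_plane_measure dplane_def Int_commute)

text \<open>The centre need not lie on V. A ball that meets V is contained in one of twice the
  radius about a point of V, whence the factor 2.\<close>

lemma emeasure_plane_ball_le: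
  assumes V: "dplane d V" and r: "0 < r"
  shows "emeasure (plane_measure d V) (ball x r) \<le> ennreal ((2 * r) ^ d)"
proof (cases "V \<inter> ball x r = {}")
  case True
  then show ?thesis by (simp add: emeasure_plane_measure[OF V] Int_commute)
next
  case False
  then obtain v where v: "v \<in> V" "v \<in> ball x r" by blast
  then have "dist v x + r \<le> 2 * r" by (simp add: dist_commute)
  then have "ball x r \<subseteq> ball v (2 * r)" by (simp add: ball_subset_ball_iff dist_commute)
  then have "emeasure (plane_measure d V) (ball x r) \<le> emeasure (plane_measure d V) (ball v (2 * r))"
    by (intro emeasure_mono) auto
  then show ?thesis using emeasure_plane_ball[OF V v(1), of "2 * r"] r by simp
qed

lemma radon_plane_measure: "dplane d V \<Longrightarrow> radon_measure (plane_measure d V)"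
  unfolding radon_measure_def
proof (intro conjI allI)
  fix x assume V: "dplane d V"
  show "\<exists>U. open U \<and> x \<in> U \<and> emeasure (plane_measure d V) U < \<infinity>"
    using emeasure_plane_ball_le[OF V, of 1 x]
    by (intro exI[of _ "ball x 1"]) (auto intro: le_less_trans)
qed simp

lemma measure_plane_ball:
  assumes "dplane d V" "v \<in> V" "0 < r"
  shows "measure (plane_measure d V) (ball v r) = r ^ d"
  using emeasure_plane_ball[OF assms] assms(3) by (simp add: measure_def)

lemma measure_plane_ball_le:
  assumes "dplane d V" "0 < r"
  shows "measure (plane_measure d V) (ball x r) \<le> (2 * r) ^ d"
  using emeasure_plane_ball_le[OF assms] assms(2)
  by (simp add: radon_emeasure_eq_measure[OF radon_plane_measure[OF assms(1)]])

lemma plane_measure_isometry: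
  fixes g :: "'a::euclidean_space \<Rightarrow> 'a"
  assumes V: "dplane d V" and W: "dplane d W" and g: "g \<in> borel_measurable borel" "g ` V = W"
    and iso: "\<And>x y. x \<in> V \<Longrightarrow> y \<in> V \<Longrightarrow> dist (g x) (g y) = dist x y"
  shows "distr (plane_measure d V) borel g = plane_measure d W"
proof (rule measure_eqI)
  fix X assume "X \<in> sets (distr (plane_measure d V) borel g)"
  then have X: "X \<in> sets borel" by simp
  have gX: "g -` X \<in> sets borel" using measurable_sets_borel[OF g(1) X] .
  have "emeasure (distr (plane_measure d V) borel g) X = hausdorff_outer d (g -` X \<inter> V)"
    using X gX g(1) by (subst emeasure_distr) (simp_all add: emeasure_plane_measure[OF V])
  also have "\<dots> = hausdorff_outer d (g ` (g -` X \<inter> V))"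
    by (rule hausdorff_outer_isometric_image[symmetric]) (use iso in auto)
  also have "g ` (g -` X \<inter> V) = X \<inter> W" using g(2) by auto
  finally show "emeasure (distr (plane_measure d V) borel g) X = emeasure (plane_measure d W) X"
    using X by (simp add: emeasure_plane_measure[OF W])
qed simp

lemma integral_plane_isometry:
  fixes g :: "'a::euclidean_space \<Rightarrow> 'a" and \<psi> :: "'a \<Rightarrow> real"
  assumes "dplane d V" "dplane d W" "g \<in> borel_measurable borel" "g ` V = W"
    "\<And>x y. x \<in> V \<Longrightarrow> y \<in> V \<Longrightarrow> dist (g x) (g y) = dist x y" "\<psi> \<in> borel_measurable borel"
  shows "integral\<^sup>L (plane_measure d W) \<psi> = (\<integral>p. \<psi> (g p) \<partial>plane_measure d V)"
proof -
  have "plane_measure d W = distr (plane_measure d V) borel g"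
    by (rule plane_measure_isometry[symmetric]) (fact assms)+
  moreover have "integral\<^sup>L (distr (plane_measure d V) borel g) \<psi> = (\<integral>p. \<psi> (g p) \<partial>plane_measure d V)"
    by (rule integral_distr) (use assms(3,6) in simp_all)
  ultimately show ?thesis by simp
qed

lemma integral_plane_translate:
  fixes \<psi> :: "'a::euclidean_space \<Rightarrow> real"
  assumes L: "subspace L" "dim L = d" and m: "\<psi> \<in> borel_measurable borel"
  shows "integral\<^sup>L (plane_measure d ((+) v ` L)) \<psi> = (\<integral>p. \<psi> (v + p) \<partial>plane_measure d L)"
  by (rule integral_plane_isometry[OF dplane_subspace[OF L] dplane_translate[OF L] _ refl _ m])
    (auto intro: borel_measurable_continuous_onI continuous_intros)

lemma integral_plane_scale:
  fixes \<psi> :: "'a::euclidean_space \<Rightarrow> real"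
  assumes L: "subspace L" "dim L = d" and m: "\<psi> \<in> borel_measurable borel" and r: "0 < r"
  shows "(\<integral>p. \<psi> ((1/r) *\<^sub>R p) \<partial>plane_measure d L) = r ^ d * integral\<^sup>L (plane_measure d L) \<psi>"
proof -
  note V = dplane_subspace[OF L]
  let ?g = "\<lambda>p::'a. (1/r) *\<^sub>R p"
  have g: "?g \<in> borel_measurable borel" by (intro borel_measurable_continuous_onI continuous_intros)
  have "distr (plane_measure d L) borel ?g = scale_measure (ennreal (r ^ d)) (plane_measure d L)"
  proof (rule measure_eqI)
    fix X assume "X \<in> sets (distr (plane_measure d L) borel ?g)"
    then have X: "X \<in> sets borel" by simp
    have gX: "?g -` X \<in> sets borel" using measurable_sets_borel[OF g X] .
    have "?g -` X \<inter> L = (\<lambda>p. r *\<^sub>R p) ` (X \<inter> L)"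
    proof (intro equalityI subsetI)
      fix p assume "p \<in> ?g -` X \<inter> L"
      then show "p \<in> (\<lambda>p. r *\<^sub>R p) ` (X \<inter> L)"
        using r L(1) by (intro image_eqI[of _ _ "?g p"]) (auto simp: subspace_scale)
    qed (use r L(1) in \<open>auto simp: subspace_scale\<close>)
    then show "emeasure (distr (plane_measure d L) borel ?g) X
        = emeasure (scale_measure (ennreal (r ^ d)) (plane_measure d L)) X"
      using X gX g
      by (subst emeasure_distr) (simp_all add: emeasure_plane_measure[OF V] hausdorff_outer_scale[OF r])
  qed simp
  then have "integral\<^sup>L (scale_measure (ennreal (r ^ d)) (plane_measure d L)) \<psi>
      = (\<integral>p. \<psi> (?g p) \<partial>plane_measure d L)"
    using integral_distr[of ?g "plane_measure d L" borel \<psi>] g m by simp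
  moreover have "integral\<^sup>L (scale_measure (ennreal (r ^ d)) (plane_measure d L)) \<psi>
      = r ^ d * integral\<^sup>L (plane_measure d L) \<psi>"
    using m r by (intro integral_scale_measure) simp_all
  ultimately show ?thesis by simp
qed

text \<open>All subspaces of one dimension become images of a fixed P under linear maps in a bounded
  set of operators. This supplies the compactness behind \<open>subspace_limit\<close> and the
  probes of \<open>subspaces_countable_net\<close>.\<close>

lemma subspace_isometric_param:
  fixes L P :: "'a::euclidean_space set"
  assumes P: "subspace P" and L: "subspace L" and dims: "dim P = dim L"
  obtains A :: "'a \<Rightarrow>\<^sub>L 'a" where "\<And>p. p \<in> P \<Longrightarrow> norm (A p) = norm p" "A ` P = L" "norm A \<le> real DIM('a)"
proof -
  obtain f where f: "linear f" "f ` P = L" "\<And>x. x \<in> P \<Longrightarrow> norm (f x) = norm x"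
    using isometries_subspaces[OF P L dims] by metis
  obtain B where B: "B \<subseteq> P" "pairwise orthogonal B" "\<And>x. x \<in> B \<Longrightarrow> norm x = 1"
      "independent B" "card B = dim P" "span B = P"
    using orthonormal_basis_subspace[OF P] by metis
  have finB: "finite B" using B(4) by (rule independent_imp_finite)
  \<comment> \<open>The isometry f is controlled on P only. Its expansion in an orthonormal basis
    agrees with f on P, kills the orthogonal complement, and is therefore bounded on the whole
    space.\<close>
  define A0 where "A0 x = (\<Sum>b\<in>B. (x \<bullet> b) *\<^sub>R f b)" for x
  have A0f: "A0 p = f p" if "p \<in> P" for p
  proof -
    have "f p = f (\<Sum>b\<in>B. (p \<bullet> b) *\<^sub>R b)"
      using orthonormal_basis_expand[OF B(2,3) _ finB, of p] that B(6) by simp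
    also have "\<dots> = A0 p" by (simp add: A0_def linear_sum[OF f(1)] linear_scale[OF f(1)])
    finally show ?thesis ..
  qed
  have bl: "bounded_linear A0"
    unfolding A0_def by (intro bounded_linear_sum bounded_linear_scaleR_const bounded_linear_inner_left)
  have nA: "norm (A0 x) \<le> real DIM('a) * norm x" for x
  proof -
    have "norm (A0 x) \<le> (\<Sum>b\<in>B. norm x)"
      unfolding A0_def
    proof (rule sum_norm_le)
      fix b assume b: "b \<in> B"
      then have "norm (f b) = 1" using f(3) B by auto
      then show "norm ((x \<bullet> b) *\<^sub>R f b) \<le> norm x"
        using Cauchy_Schwarz_ineq2[of x b] B(3)[OF b] by simp
    qed
    also have "\<dots> = real (dim P) * norm x" using B(5) by simp
    also have "\<dots> \<le> real DIM('a) * norm x" using dim_subset_UNIV[of P] by (intro mult_right_mono) auto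
    finally show ?thesis .
  qed
  show ?thesis
  proof (rule that[of "Blinfun A0"])
    note [simp] = bounded_linear_Blinfun_apply[OF bl]
    show "norm (Blinfun A0 p) = norm p" if "p \<in> P" for p using that A0f f(3) by simp
    show "Blinfun A0 ` P = L" using A0f f(2) by simp
    show "norm (Blinfun A0) \<le> real DIM('a)" using nA by (intro norm_blinfun_bound) auto
  qed
qed

lemma integral_plane_param:
  fixes \<psi> :: "'a::euclidean_space \<Rightarrow> real" and A :: "'a \<Rightarrow>\<^sub>L 'a"
  assumes P: "subspace P" "dim P = d" and A: "\<And>p. p \<in> P \<Longrightarrow> norm (A p) = norm p"
    and m: "\<psi> \<in> borel_measurable borel"
  shows "subspace (A ` P)" "dim (A ` P) = d"
    "integral\<^sup>L (plane_measure d (A ` P)) \<psi> = (\<integral>p. \<psi> (A p) \<partial>plane_measure d P)"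
proof -
  have lin: "linear A" using blinfun.bounded_linear_right[of A] bounded_linear.linear by blast
  show s: "subspace (A ` P)" using linear_subspace_image[OF lin P(1)] .
  have inj: "inj_on A P"
  proof (rule inj_onI)
    fix x y assume "x \<in> P" "y \<in> P" "A x = A y"
    then show "x = y" using A[of "x - y"] P(1) by (simp add: subspace_diff blinfun.diff_right)
  qed
  show di: "dim (A ` P) = d" using dim_image_eq[OF lin, of P] inj P by (metis span_eq_iff)
  show "integral\<^sup>L (plane_measure d (A ` P)) \<psi> = (\<integral>p. \<psi> (A p) \<partial>plane_measure d P)"
  proof (rule integral_plane_isometry[OF dplane_subspace[OF P] dplane_subspace[OF s di] _ refl _ m])
    show "blinfun_apply A \<in> borel_measurable borel"
      by (intro borel_measurable_continuous_onI linear_continuous_on blinfun.bounded_linear_right)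
    show "dist (A x) (A y) = dist x y" if "x \<in> P" "y \<in> P" for x y
      using that A[of "x - y"] P(1) by (simp add: dist_norm blinfun.diff_right[symmetric] subspace_diff)
  qed
qed

subsection \<open>Blow-ups and flat approximations of a doubling measure\<close>

lemma AE_measure_on:
  assumes "E \<in> sets M" shows "AE x in measure_on M E. x \<in> E"
  unfolding measure_on_def using assms by (subst AE_density) (auto simp: indicator_def)

lemma integral_plane_zero:
  assumes V: "dplane d V" and f: "\<And>p. p \<in> V \<Longrightarrow> f p = (0::real)"
  shows "integral\<^sup>L (plane_measure d V) f = 0"
proof -
  have "AE p in plane_measure d V. f p = 0"
    using AE_measure_on[of V "hausdorff_measure d"] dplane_borel[OF V] f by auto
  then show ?thesis by (rule integral_eq_zero_AE)
qed

lemma measure_plane_ball_Int: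
  assumes "dplane d V" "v \<in> V" "0 < r"
  shows "measure (plane_measure d V) (ball v r \<inter> V) = r ^ d"
proof -
  have "emeasure (plane_measure d V) (ball v r \<inter> V) = emeasure (plane_measure d V) (ball v r)"
    using dplane_borel[OF assms(1)] by (simp add: emeasure_plane_measure[OF assms(1)])
  then show ?thesis using measure_plane_ball[OF assms] by (simp add: measure_def)
qed

lemma integral_plane_translate_self:
  fixes \<psi> :: "'a::euclidean_space \<Rightarrow> real"
  assumes L: "subspace L" "dim L = d" and m: "\<psi> \<in> borel_measurable borel" and u: "u - v \<in> L"
  shows "(\<integral>p. \<psi> (u + p) \<partial>plane_measure d L) = (\<integral>p. \<psi> (v + p) \<partial>plane_measure d L)"
proof -
  have "(+) u ` L = (+) v ` L"
  proof (intro equalityI image_subsetI)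
    fix p assume p: "p \<in> L"
    show "u + p \<in> (+) v ` L"
      using subspace_add[OF L(1) u p] by (intro image_eqI[of _ _ "u - v + p"]) auto
    have "p - (u - v) \<in> L" using subspace_diff[OF L(1) p u] .
    then show "v + p \<in> (+) u ` L" by (intro image_eqI[of _ _ "p - (u - v)"]) auto
  qed
  then show ?thesis by (simp add: integral_plane_translate[OF L m, symmetric])
qed

text \<open>A plane that meets the ball of radius 1/2 contains a point v with
  \<open>ball v (1/2)\<close> inside the unit ball, whence the lower bound. Two-sided control of the
  normalizing factor h keeps all later constants independent of V.\<close>

lemma flat_measure_eq:
  fixes V :: "'a::euclidean_space set"
  assumes V: "V \<in> planes_near d"
  defines "h \<equiv> measure (plane_measure d V) (ball 0 1)"
  shows "(1/2) ^ d \<le> h" "h \<le> 2 ^ d" "flat_measure d V = scale_measure (ennreal (1 / h)) (plane_measure d V)"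
proof -
  have dV: "dplane d V" using V by (simp add: planes_near_def dplane_def)
  obtain v where v: "v \<in> V" "norm v < 1/2" using V by (auto simp: planes_near_def)
  have rad: "radon_measure (plane_measure d V)" by (rule radon_plane_measure[OF dV])
  show "h \<le> 2 ^ d" unfolding h_def using measure_plane_ball_le[OF dV, of 1] by simp
  have "(1/2) ^ d = measure (plane_measure d V) (ball v (1/2))" using measure_plane_ball[OF dV v(1), of "1/2"] by simp
  also have "\<dots> \<le> h" unfolding h_def using v by (intro radon_measure_mono[OF rad]) (auto simp: ball_subset_ball_iff)
  finally show h2: "(1/2) ^ d \<le> h" .
  then have h3: "0 < h" by (rule less_le_trans[rotated]) simp
  have "hausdorff_outer d (V \<inter> ball 0 1) = ennreal h"
    using radon_emeasure_eq_measure[OF rad, of "ball 0 1"]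
    by (simp add: emeasure_plane_measure[OF dV] Int_commute h_def)
  then show "flat_measure d V = scale_measure (ennreal (1 / h)) (plane_measure d V)"
    unfolding flat_measure_def using h3 by (simp add: divide_ennreal[symmetric])
qed

text \<open>Balls have finite measure, so doubling is stated for real-valued \<open>measure\<close>;
  a constant of at least 1 keeps its powers at least 1.\<close>

locale doubling_radon =
  fixes \<mu> :: "'a::euclidean_space measure" and C :: real
  assumes radon: "radon_measure \<mu>" and C: "1 \<le> C"
    and doubling: "\<And>x r. x \<in> msupport \<mu> \<Longrightarrow> 0 < r \<Longrightarrow> measure \<mu> (ball x (2 * r)) \<le> C * measure \<mu> (ball x r)"
begin

abbreviation "\<Sigma> \<equiv> msupport \<mu>"

lemma sets_mu: "sets \<mu> = sets borel" and space_mu: "space \<mu> = UNIV"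
  using radon by (auto simp: radon_sets radon_space)

lemma emeasure_ball: "emeasure \<mu> (ball x r) = ennreal (measure \<mu> (ball x r))"
  by (rule radon_emeasure_eq_measure[OF radon bounded_ball])

lemma measure_ball_pos: "x \<in> \<Sigma> \<Longrightarrow> 0 < r \<Longrightarrow> 0 < measure \<mu> (ball x r)"
  using emeasure_ball[of x r] by (auto simp: msupport_def)

lemma measure_ball_mono: "r \<le> s \<Longrightarrow> measure \<mu> (ball x r) \<le> measure \<mu> (ball x s)"
  by (intro radon_measure_mono[OF radon]) auto

lemma doubling_iterate:
  assumes x: "x \<in> \<Sigma>" and r: "0 < r"
  shows "measure \<mu> (ball x (2 ^ k * r)) \<le> C ^ k * measure \<mu> (ball x r)"
proof (induction k)
  case (Suc k)
  have "measure \<mu> (ball x (2 ^ Suc k * r)) \<le> C * measure \<mu> (ball x (2 ^ k * r))"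
    using doubling[OF x, of "2 ^ k * r"] r by (simp add: mult.assoc)
  also have "\<dots> \<le> C * (C ^ k * measure \<mu> (ball x r))" using C Suc by (intro mult_left_mono) auto
  finally show ?case by (simp add: mult.assoc)
qed simp

lemma doubling_ratio:
  assumes t: "0 < t"
  obtains K where "1 \<le> K" "\<And>x r. x \<in> \<Sigma> \<Longrightarrow> 0 < r \<Longrightarrow> measure \<mu> (ball x r) \<le> K * measure \<mu> (ball x (t * r))"
proof -
  obtain k :: nat where k: "1 / t < 2 ^ k" using real_arch_pow[of 2 "1/t"] by auto
  show ?thesis
  proof
    show "1 \<le> C ^ k" using C by simp
    fix x and r :: real assume x: "x \<in> \<Sigma>" and r: "0 < r"
    have "r \<le> 2 ^ k * (t * r)"
      using mult_right_mono[of 1 "2 ^ k * t" r] k t r by (simp add: field_simps)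
    then have "measure \<mu> (ball x r) \<le> measure \<mu> (ball x (2 ^ k * (t * r)))" by (rule measure_ball_mono)
    also have "\<dots> \<le> C ^ k * measure \<mu> (ball x (t * r))" using x r t by (intro doubling_iterate) auto
    finally show "measure \<mu> (ball x r) \<le> C ^ k * measure \<mu> (ball x (t * r))" .
  qed
qed

definition centered_integral :: "'a \<Rightarrow> ('a \<Rightarrow> real) \<Rightarrow> real" where
  "centered_integral x \<psi> = (\<integral>y. \<psi> (y - x) \<partial>\<mu>)"

lemma lip_test_shift_integrable:
  assumes \<psi>: "lip_test M R \<psi>" and R: "0 \<le> R"
  shows "integrable \<mu> (\<lambda>y. \<psi> (y - x))"
  using lip_test_integrable[OF radon lip_test_shift[OF \<psi> order_refl, of x]] R by simp

text \<open>On the ball of radius \<open>\<rho>\<close> about \<open>x\<close> the measure is close, in the flat Wasserstein sense, to the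
  multiple \<open>c\<close> of Hausdorff measure on the plane \<open>x + u + L\<close>.  The estimate is stated at the scale of
  \<open>\<mu>\<close> itself rather than after a blow-up, whence the factor \<open>\<rho> ^ (d + 1)\<close>.\<close>

definition flat_approx :: "'a \<Rightarrow> nat \<Rightarrow> real \<Rightarrow> real \<Rightarrow> 'a \<Rightarrow> 'a set \<Rightarrow> real \<Rightarrow> bool" where
  "flat_approx x d c \<rho> u L \<epsilon> \<longleftrightarrow>
     subspace L \<and> dim L = d \<and> 0 < c \<and> 0 < \<rho> \<and>
     measure \<mu> (ball x \<rho>) \<le> 2 ^ DIM('a) * (c * \<rho> ^ d) \<and>
     c * \<rho> ^ d \<le> 2 ^ DIM('a) * measure \<mu> (ball x \<rho>) \<and>
     (\<forall>M \<psi>. lip_test M \<rho> \<psi> \<longrightarrow>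
        \<bar>centered_integral x \<psi> - c * (\<integral>p. \<psi> (u + p) \<partial>plane_measure d L)\<bar> \<le> c * \<rho> ^ (d + 1) * M * \<epsilon>)"

lemma integral_blowup:
  fixes \<phi> :: "'a \<Rightarrow> real"
  assumes x: "x \<in> \<Sigma>" and r: "0 < r" and m: "\<phi> \<in> borel_measurable borel"
  shows "integral\<^sup>L (blowup \<mu> x r) \<phi> = (1 / measure \<mu> (ball x r)) * centered_integral x (\<lambda>z. \<phi> ((1/r) *\<^sub>R z))"
proof -
  have pos: "0 < measure \<mu> (ball x r)" using measure_ball_pos[OF x r] .
  have "blowup \<mu> x r = scale_measure (ennreal (1 / measure \<mu> (ball x r))) (dilated_measure \<mu> x r)"
    unfolding blowup_def emeasure_ball using pos by (simp add: divide_ennreal[symmetric])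
  then have "integral\<^sup>L (blowup \<mu> x r) \<phi> = (1 / measure \<mu> (ball x r)) * integral\<^sup>L (dilated_measure \<mu> x r) \<phi>"
    using m by (simp only:, intro integral_scale_measure) (simp_all add: dilated_measure_def)
  also have "integral\<^sup>L (dilated_measure \<mu> x r) \<phi> = centered_integral x (\<lambda>z. \<phi> ((1/r) *\<^sub>R z))"
    unfolding dilated_measure_def centered_integral_def
    by (intro integral_distr m radon_borel_measurable[OF radon] borel_measurable_continuous_onI continuous_intros)
  finally show ?thesis .
qed

text \<open>The minimum over d is attained, and a plane nearly attaining the infimum is scaled back
  from the unit ball to \<open>ball x \<rho>\<close>. The factor \<open>2 ^ DIM('a)\<close>
  throughout is the uniform form of the bounds on the mass h of the plane in the unit ball.\<close>

lemma flat_approx_of_alpha: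
  assumes x: "x \<in> \<Sigma>" and \<rho>: "0 < \<rho>" and e: "alpha \<mu> x \<rho> < ennreal e"
  obtains d c u L where "d \<le> DIM('a)" "norm u < \<rho>" "flat_approx x d c \<rho> u L (2 ^ DIM('a) * e)"
proof -
  let ?n = "DIM('a)"
  have "Min ((\<lambda>d. alpha_dim \<mu> d x \<rho>) ` {0..?n}) \<in> (\<lambda>d. alpha_dim \<mu> d x \<rho>) ` {0..?n}"
    by (intro Min_in) auto
  then obtain d where "d \<in> {0..?n}" "alpha \<mu> x \<rho> = alpha_dim \<mu> d x \<rho>"
    unfolding alpha_def by blast
  with e have d: "d \<le> ?n" "alpha_dim \<mu> d x \<rho> < ennreal e" by auto
  then obtain V where V: "V \<in> planes_near d" "wasserstein1 (blowup \<mu> x \<rho>) (flat_measure d V) < ennreal e"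
    unfolding alpha_dim_def INF_less_iff by blast
  have e0: "0 < e" using V(2) by (metis ennreal_less_zero_iff not_gr_zero order_less_trans zero_less_iff_neq_zero less_le_not_le zero_le)
  have dV: "dplane d V" using V by (simp add: planes_near_def dplane_def)
  obtain v where v: "v \<in> V" "norm v < 1/2" using V by (auto simp: planes_near_def)
  obtain L where L: "subspace L" "dim L = d" "V = (+) v ` L" using dplane_direction[OF dV v(1)] .
  let ?m = "measure \<mu> (ball x \<rho>)"
  have m0: "0 < ?m" using measure_ball_pos[OF x \<rho>] .
  define h where "h = measure (plane_measure d V) (ball 0 1)"
  note hV = flat_measure_eq[OF V(1), folded h_def]
  have h1: "h \<le> 2 ^ d" and h2: "(1/2) ^ d \<le> h" using hV by auto
  then have h3: "0 < h" by (intro less_le_trans[OF _ h2]) simp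
  have flat: "integral\<^sup>L (flat_measure d V) \<phi> = (1/h) * integral\<^sup>L (plane_measure d V) \<phi>"
    if "\<phi> \<in> borel_measurable borel" for \<phi> :: "'a \<Rightarrow> real"
    unfolding hV(3) using that h3 by (intro integral_scale_measure) simp_all
  \<comment> \<open>With this choice the flat measure on the plane, scaled back, has the mass of
    \<open>ball x \<rho>\<close> inside that ball.\<close>
  define c where "c = ?m / h / \<rho> ^ d"
  have c: "0 < c" using m0 h3 \<rho> by (simp add: c_def)
  have cm: "c * \<rho> ^ d = ?m / h" using \<rho> by (simp add: c_def)
  have two: "(2::real) ^ d \<le> 2 ^ ?n" using d(1) by (intro power_increasing) auto
  have "1 / h \<le> 2 ^ d" using h2 h3 by (simp add: field_simps power_divide)
  then have two1: "1 / h \<le> 2 ^ ?n" using two by (rule order_trans)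
  have two2: "h \<le> 2 ^ ?n" using h1 two by (rule order_trans)
  have c1: "c * \<rho> ^ d \<le> 2 ^ ?n * ?m"
    unfolding cm using m0 mult_right_mono[OF two1, of ?m] by simp
  have m1: "?m \<le> 2 ^ ?n * (c * \<rho> ^ d)"
    unfolding cm using h3 m0 mult_right_mono[OF two2, of "?m / h"] by simp
  show ?thesis
  proof (rule that[of d "\<rho> *\<^sub>R v" c L])
    show "norm (\<rho> *\<^sub>R v) < \<rho>"
    proof -
      have "\<rho> * norm v < \<rho> * 1" using v(2) \<rho> by (intro mult_strict_left_mono) auto
      then show ?thesis using \<rho> by simp
    qed
    show "flat_approx x d c \<rho> (\<rho> *\<^sub>R v) L (2 ^ ?n * e)"
      unfolding flat_approx_def
    proof (intro conjI allI impI L c \<rho> c1 m1)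
      fix M and \<psi> :: "'a \<Rightarrow> real" assume \<psi>: "lip_test M \<rho> \<psi>"
      have M0: "0 \<le> M" using lip_test_diff(2)[OF \<psi>] .
      show "\<bar>centered_integral x \<psi> - c * (\<integral>p. \<psi> (\<rho> *\<^sub>R v + p) \<partial>plane_measure d L)\<bar> \<le> c * \<rho> ^ (d + 1) * M * (2 ^ ?n * e)"
      proof (cases "M = 0")
        case True
        then have "\<psi> = (\<lambda>_. 0)" using lip_test_bound[OF \<psi>] \<rho> by (auto simp: fun_eq_iff)
        then show ?thesis using True by (simp add: centered_integral_def)
      next
        case False
        then have M: "0 < M" using M0 by simp
        \<comment> \<open>Dilating by \<rho> and dividing by M \<rho> turns \<psi> into a competitor
          in \<open>wasserstein1\<close>, whose test functions are exactly those with
          \<open>lip_test 1 1\<close>. The division is why M = 0 is treated apart.\<close>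
        define \<phi> where "\<phi> z = (1 / (M * \<rho>)) * \<psi> ((1 / (1/\<rho>)) *\<^sub>R z)" for z
        have lt: "lip_test 1 1 \<phi>"
          unfolding \<phi>_def
          using lip_test_cmult[OF lip_test_scale[OF \<psi>, of "1/\<rho>"], of "1 / (M * \<rho>)"] \<rho> M by simp
        have \<phi>m: "\<phi> \<in> borel_measurable borel" by (rule lip_test_measurable[OF lt])
        have "ennreal \<bar>integral\<^sup>L (blowup \<mu> x \<rho>) \<phi> - integral\<^sup>L (flat_measure d V) \<phi>\<bar>
            \<le> wasserstein1 (blowup \<mu> x \<rho>) (flat_measure d V)"
          unfolding wasserstein1_def using lt by (intro SUP_upper) (auto simp: lip_test_def)
        then have "ennreal \<bar>integral\<^sup>L (blowup \<mu> x \<rho>) \<phi> - integral\<^sup>L (flat_measure d V) \<phi>\<bar> < ennreal e"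
          using V(2) by (rule le_less_trans)
        then have main: "\<bar>integral\<^sup>L (blowup \<mu> x \<rho>) \<phi> - integral\<^sup>L (flat_measure d V) \<phi>\<bar> < e"
          by (simp add: ennreal_less_iff)
        have "integral\<^sup>L (blowup \<mu> x \<rho>) \<phi> = (1 / ?m) * centered_integral x (\<lambda>z. (1 / (M * \<rho>)) * \<psi> z)"
          using integral_blowup[OF x \<rho> \<phi>m] \<rho> by (simp add: \<phi>_def)
        also have "centered_integral x (\<lambda>z. (1 / (M * \<rho>)) * \<psi> z) = (1 / (M * \<rho>)) * centered_integral x \<psi>"
          unfolding centered_integral_def by (rule integral_mult_right_zero)
        finally have b: "integral\<^sup>L (blowup \<mu> x \<rho>) \<phi> = centered_integral x \<psi> / (?m * M * \<rho>)" by (simp add: field_simps)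
        let ?I = "\<integral>p. \<psi> (\<rho> *\<^sub>R v + p) \<partial>plane_measure d L"
        have "integral\<^sup>L (plane_measure d V) \<phi> = (\<integral>p. \<phi> (v + p) \<partial>plane_measure d L)"
          unfolding L(3) by (rule integral_plane_translate[OF L(1,2) \<phi>m])
        also have "\<dots> = (\<integral>p. (1 / (M * \<rho>)) * \<psi> (\<rho> *\<^sub>R v + (1 / (1/\<rho>)) *\<^sub>R p) \<partial>plane_measure d L)"
          by (simp add: \<phi>_def scaleR_add_right)
        also have "\<dots> = (1 / (M * \<rho>)) * (\<integral>p. \<psi> (\<rho> *\<^sub>R v + (1 / (1/\<rho>)) *\<^sub>R p) \<partial>plane_measure d L)"
          by (rule integral_mult_right_zero)
        also have "(\<integral>p. \<psi> (\<rho> *\<^sub>R v + (1 / (1/\<rho>)) *\<^sub>R p) \<partial>plane_measure d L) = (1/\<rho>) ^ d * ?I"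
        proof (rule integral_plane_scale[OF L(1,2)])
          show "(\<lambda>p. \<psi> (\<rho> *\<^sub>R v + p)) \<in> borel_measurable borel"
            using lip_test_measurable[OF lip_test_shift[OF \<psi> order_refl, of "- (\<rho> *\<^sub>R v)"]] by (simp add: add.commute)
        qed (use \<rho> in simp)
        finally have f: "integral\<^sup>L (flat_measure d V) \<phi> = ?I / (h * M * \<rho> * \<rho> ^ d)"
          by (simp add: flat[OF \<phi>m] power_divide field_simps)
        have "centered_integral x \<psi> - c * ?I = (?m * M * \<rho>) * (centered_integral x \<psi> / (?m * M * \<rho>) - ?I / (h * M * \<rho> * \<rho> ^ d))"
          using m0 M \<rho> h3 by (simp add: c_def field_simps)
        then have "\<bar>centered_integral x \<psi> - c * ?I\<bar> = (?m * M * \<rho>) * \<bar>centered_integral x \<psi> / (?m * M * \<rho>) - ?I / (h * M * \<rho> * \<rho> ^ d)\<bar>"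
          using m0 M \<rho> by (simp add: abs_mult)
        also have "\<dots> \<le> (?m * M * \<rho>) * e"
          using main m0 M \<rho> unfolding b f by (intro mult_left_mono) auto
        also have "\<dots> \<le> (2 ^ ?n * (c * \<rho> ^ d)) * (M * \<rho> * e)"
          using mult_right_mono[OF m1, of "M * \<rho> * e"] M \<rho> e0 by (simp add: mult_ac)
        finally show ?thesis by (simp add: mult_ac)
      qed
    qed
  qed (rule d(1))
qed

lemma flat_approx_recenter:
  assumes F: "flat_approx x d c \<rho> u L \<epsilon>" and u: "u - u' \<in> L"
  shows "flat_approx x d c \<rho> u' L \<epsilon>"
proof -
  have L: "subspace L" "dim L = d" using F by (auto simp: flat_approx_def)
  have "(\<integral>p. \<psi> (u + p) \<partial>plane_measure d L) = (\<integral>p. \<psi> (u' + p) \<partial>plane_measure d L)"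
    if "lip_test M \<rho> \<psi>" for M and \<psi> :: "'a \<Rightarrow> real"
    by (rule integral_plane_translate_self[OF L lip_test_measurable[OF that] u])
  then show ?thesis using F unfolding flat_approx_def by metis
qed

text \<open>If the plane missed the ball of radius \<eta> \<rho>, a tent of that radius would
  integrate to 0 over it. But \<mu> charges half of that ball by a fixed fraction of
  \<open>ball x \<rho>\<close>, because x lies in the support and \<mu> doubles.\<close>

lemma flat_approx_near_center:
  assumes \<eta>: "0 < \<eta>" "\<eta> \<le> 1"
  obtains e where "0 < e"
    "\<And>x d c \<rho> u L \<epsilon>. \<lbrakk>x \<in> \<Sigma>; flat_approx x d c \<rho> u L \<epsilon>; \<epsilon> \<le> e\<rbrakk> \<Longrightarrow> \<exists>u'. norm u' < \<eta> * \<rho> \<and> flat_approx x d c \<rho> u' L \<epsilon>"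
proof -
  let ?N = "(2::real) ^ DIM('a)"
  obtain K where K: "1 \<le> K" "\<And>x r. x \<in> \<Sigma> \<Longrightarrow> 0 < r \<Longrightarrow> measure \<mu> (ball x r) \<le> K * measure \<mu> (ball x (\<eta>/2 * r))"
    using doubling_ratio[of "\<eta>/2"] \<eta> by auto
  \<comment> \<open>With this threshold a plane far from the centre leads to \<eta>/2 \<le>
    \<eta>/4, up to a common positive factor.\<close>
  define e where "e = \<eta> / (4 * K * ?N)"
  show ?thesis
  proof
    show "0 < e" using \<eta> K by (simp add: e_def)
    fix x d c \<rho> u L \<epsilon>
    assume x: "x \<in> \<Sigma>" and F: "flat_approx x d c \<rho> u L \<epsilon>" and \<epsilon>: "\<epsilon> \<le> e"
    have L: "subspace L" "dim L = d" and c: "0 < c" and \<rho>: "0 < \<rho>"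
      and cm: "c * \<rho> ^ d \<le> ?N * measure \<mu> (ball x \<rho>)"
      using F by (auto simp: flat_approx_def)
    have "\<exists>p\<in>L. norm (u + p) < \<eta> * \<rho>"
    proof (rule ccontr)
      assume far: "\<not> (\<exists>p\<in>L. norm (u + p) < \<eta> * \<rho>)"
      let ?\<psi> = "tent (\<eta> * \<rho>)"
      have lt: "lip_test 1 \<rho> ?\<psi>"
        using mult_right_mono[OF \<eta>(2), of \<rho>] \<rho> by (intro lip_test_mono[OF lip_test_tent]) auto
      have "(\<integral>p. ?\<psi> (u + p) \<partial>plane_measure d L) = 0"
        using far by (intro integral_plane_zero[OF dplane_subspace[OF L]]) (auto simp: tent_def not_less)
      then have "\<bar>centered_integral x ?\<psi>\<bar> \<le> c * \<rho> ^ (d + 1) * 1 * \<epsilon>"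
        using F lt unfolding flat_approx_def by fastforce
      also have "\<dots> \<le> c * \<rho> ^ (d + 1) * 1 * e" using \<epsilon> c \<rho> by (intro mult_left_mono) auto
      finally have up: "centered_integral x ?\<psi> \<le> (c * \<rho> ^ d) * (\<rho> * e)" by (simp add: mult_ac)
      have lo: "(\<eta> * \<rho> / 2) * measure \<mu> (ball x (\<eta>/2 * \<rho>)) \<le> centered_integral x ?\<psi>"
        unfolding centered_integral_def
      proof (rule radon_integral_ge[OF radon])
        show "integrable \<mu> (\<lambda>y. ?\<psi> (y - x))" using lip_test_shift_integrable[OF lt] \<rho> by simp
        show "\<eta> * \<rho> / 2 \<le> ?\<psi> (y - x)" if "y \<in> ball x (\<eta>/2 * \<rho>)" for y
          using that by (simp add: tent_def dist_norm norm_minus_commute max_def)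
      qed (auto simp: tent_def)
      have "(\<eta> * \<rho> / 2) * (c * \<rho> ^ d) \<le> (\<eta> * \<rho> / 2) * (?N * (K * measure \<mu> (ball x (\<eta>/2 * \<rho>))))"
        using cm K(2)[OF x \<rho>] \<eta> \<rho> by (intro mult_left_mono) (auto elim: order_trans)
      also have "\<dots> = (?N * K) * ((\<eta> * \<rho> / 2) * measure \<mu> (ball x (\<eta>/2 * \<rho>)))" by (simp add: mult_ac)
      also have "\<dots> \<le> (?N * K) * ((c * \<rho> ^ d) * (\<rho> * e))"
        using lo up K by (intro mult_left_mono) auto
      also have "\<dots> = (c * \<rho> ^ d) * (\<rho> * (?N * K * e))" by (simp add: mult_ac)
      also have "?N * K * e = \<eta> / 4" using K by (simp add: e_def)
      finally have "(c * \<rho> ^ d * \<rho> * \<eta>) / 2 \<le> (c * \<rho> ^ d * \<rho> * \<eta>) / 4" by (simp add: mult_ac)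
      moreover have "0 < c * \<rho> ^ d * \<rho> * \<eta>" using c \<rho> \<eta> by simp
      ultimately show False by linarith
    qed
    then obtain p where p: "p \<in> L" "norm (u + p) < \<eta> * \<rho>" by blast
    then show "\<exists>u'. norm u' < \<eta> * \<rho> \<and> flat_approx x d c \<rho> u' L \<epsilon>"
      using flat_approx_recenter[OF F, of "u + p"] subspace_neg[OF L(1)] by auto
  qed
qed

end

text \<open>The value is the same for every d-dimensional subspace. Together with the scaling
  \<open>s ^ (d + 1)\<close> in \<open>integral_tent\<close> it makes the dimension visible:
  comparing tents of two radii determines d.\<close>

definition tent_const :: "'a::euclidean_space itself \<Rightarrow> nat \<Rightarrow> real" where
  "tent_const TYPE('a) d = integral\<^sup>L (plane_measure d (model_subspace d)) (tent 1 :: 'a \<Rightarrow> real)"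

lemma integral_plane_isometric_subspaces:
  fixes L P :: "'a::euclidean_space set" and \<psi> :: "real \<Rightarrow> real"
  assumes "subspace P" "dim P = d" "subspace L" "dim L = d" and m: "(\<lambda>x::'a. \<psi> (norm x)) \<in> borel_measurable borel"
  shows "(\<integral>p. \<psi> (norm p) \<partial>plane_measure d L) = (\<integral>p. \<psi> (norm p) \<partial>plane_measure d P)"
proof -
  obtain A :: "'a \<Rightarrow>\<^sub>L 'a" where A: "\<And>p. p \<in> P \<Longrightarrow> norm (A p) = norm p" "A ` P = L"
    using subspace_isometric_param[of P L] assms by metis
  have "(\<integral>p. \<psi> (norm p) \<partial>plane_measure d L) = (\<integral>p. \<psi> (norm (A p)) \<partial>plane_measure d P)"
    using integral_plane_param(3)[OF assms(1,2) A(1) m] A(2) by simp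
  also have "\<dots> = (\<integral>p. \<psi> (norm p) \<partial>plane_measure d P)"
  proof (rule integral_cong_AE)
    have "continuous_on UNIV (blinfun_apply A)" by (intro linear_continuous_on blinfun.bounded_linear_right)
    then have "blinfun_apply A \<in> borel_measurable borel" by (rule borel_measurable_continuous_onI)
    from measurable_compose[OF this m]
    show "(\<lambda>p. \<psi> (norm (A p))) \<in> borel_measurable (plane_measure d P)" by simp
    show "(\<lambda>p. \<psi> (norm p)) \<in> borel_measurable (plane_measure d P)" using m by simp
    show "AE p in plane_measure d P. \<psi> (norm (A p)) = \<psi> (norm p)"
      using AE_measure_on[of P "hausdorff_measure d"] dplane_borel[OF dplane_subspace[OF assms(1,2)]] A(1) by auto
  qed
  finally show ?thesis .
qed

lemma tent_measurable: "(tent s :: 'a::euclidean_space \<Rightarrow> real) \<in> borel_measurable borel"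
  by (rule lip_test_measurable[OF lip_test_tent])

lemma integral_tent:
  fixes L :: "'a::euclidean_space set"
  assumes L: "subspace L" "dim L = d" and s: "0 < s"
  shows "integral\<^sup>L (plane_measure d L) (tent s) = s ^ (d + 1) * tent_const TYPE('a) d"
proof -
  have d: "d \<le> DIM('a)" using L(2) dim_subset_UNIV[of L] by simp
  have m: "(tent 1 :: 'a \<Rightarrow> real) \<in> borel_measurable borel" by (rule tent_measurable)
  have "tent s p = s * tent 1 ((1/s) *\<^sub>R p)" for p :: 'a
    using s by (auto simp: tent_def max_def field_simps)
  then have "tent s = (\<lambda>p::'a. s * tent 1 ((1/s) *\<^sub>R p))" by (rule ext)
  then have "integral\<^sup>L (plane_measure d L) (tent s) = (\<integral>p. s * tent 1 ((1/s) *\<^sub>R p) \<partial>plane_measure d L)"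
    by (rule arg_cong)
  also have "\<dots> = s * (\<integral>p. tent 1 ((1/s) *\<^sub>R p) \<partial>plane_measure d L)" by (rule integral_mult_right_zero)
  also have "\<dots> = s * (s ^ d * integral\<^sup>L (plane_measure d L) (tent 1))"
    by (subst integral_plane_scale[OF L m s]) simp
  also have "integral\<^sup>L (plane_measure d L) (tent 1) = tent_const TYPE('a) d"
    using integral_plane_isometric_subspaces[OF model_subspace[OF d] L, of "\<lambda>t. max 0 (1 - t)"] m
    by (simp add: tent_const_def tent_def[abs_def])
  finally show ?thesis by simp
qed

lemma tent_const_bounds:
  assumes d: "d \<le> DIM('a::euclidean_space)"
  shows "(1/2) ^ (DIM('a) + 1) \<le> tent_const TYPE('a) d" "tent_const TYPE('a) d \<le> 1"
proof -
  let ?P = "model_subspace d :: 'a set"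
  note P = dplane_subspace[OF model_subspace[OF d]]
  have z: "(0::'a) \<in> ?P" using model_subspace(1)[OF d] by (rule subspace_0)
  note rad = radon_plane_measure[OF P]
  have "(1/2) ^ (DIM('a) + 1) \<le> (1/2) * (1/2::real) ^ d" using d by (simp add: power_decreasing)
  also have "\<dots> = (1/2) * measure (plane_measure d ?P) (ball 0 (1/2))" using measure_plane_ball[OF P z, of "1/2"] by simp
  also have "\<dots> \<le> tent_const TYPE('a) d"
    unfolding tent_const_def
    by (intro radon_integral_ge[OF rad] lip_test_integrable[OF rad lip_test_tent]) (auto simp: tent_def)
  finally show "(1/2) ^ (DIM('a) + 1) \<le> tent_const TYPE('a) d" .
  have "\<bar>tent_const TYPE('a) d\<bar> \<le> 1 * 1 * measure (plane_measure d ?P) (ball 0 1)"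
    unfolding tent_const_def by (rule lip_test_integral_bound[OF rad lip_test_tent]) simp
  also have "\<dots> = 1" using measure_plane_ball[OF P z, of 1] by simp
  finally show "tent_const TYPE('a) d \<le> 1" by simp
qed

section \<open>Comparison of flat approximations at neighbouring scales\<close>

context doubling_radon begin

text \<open>Comparison of the planes at two nearby scales.  A point of \<open>x + u' + L'\<close> very close to
  \<open>x + u + L\<close> is found by testing with the distance to the first plane; recentering test functions at
  such points compares the two linear measures \<open>c H|L\<close> and \<open>c' H|L'\<close>.\<close>

lemma flat_approx_compare_aux:
  obtains K e0 where "0 < K" "0 < e0"
    "\<And>x d c \<rho> u L \<epsilon> d' c' \<rho>' u' L' \<epsilon>' M \<psi>.
      \<lbrakk>x \<in> \<Sigma>; flat_approx x d c \<rho> u L \<epsilon>; flat_approx x d' c' \<rho>' u' L' \<epsilon>'; \<rho>' \<le> \<rho>; \<rho> \<le> 4 * \<rho>';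
       norm u' < \<rho>' / 16; 0 < \<epsilon>; 0 < \<epsilon>'; \<epsilon> + \<epsilon>' \<le> e0; lip_test M (\<rho>'/2) \<psi>\<rbrakk>
      \<Longrightarrow> \<bar>c * integral\<^sup>L (plane_measure d L) \<psi> - c' * integral\<^sup>L (plane_measure d' L') \<psi>\<bar>
          \<le> K * measure \<mu> (ball x \<rho>') * \<rho>' * M * (\<epsilon> + \<epsilon>')"
proof -
  let ?n = "DIM('a)" let ?N = "(2::real) ^ DIM('a)"
  \<comment> \<open>\<open>K1\<close> collects the costs of expressing both errors through the mass
    m of the smaller ball: 4 from \<rho> \<le> 4 \<rho>', \<open>C\<^sup>2\<close> from doubling
    twice, and the power of 2 from \<open>flat_approx\<close>. In \<open>K2\<close> the 16 comes
    from the radius \<rho>'/16 of a ball about u', and the summand 1 makes the final contradiction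
    strict.\<close>
  define K1 where "K1 = 4 * ?N * C\<^sup>2"
  define K2 where "K2 = 16 ^ ?n * K1 * ?N + 1"
  have "1 \<le> C\<^sup>2" using C by (rule one_le_power)
  then have "4 * ?N * 1 \<le> 4 * ?N * C\<^sup>2" by (intro mult_left_mono) auto
  then have "?N \<le> K1" unfolding K1_def by (rule order_trans[rotated]) simp
  then have K1: "0 < K1" "?N \<le> K1" by (auto intro: less_le_trans[rotated])
  have K2: "0 < K2" "16 ^ ?n * K1 * ?N < K2" using K1 by (auto simp: K2_def intro: add_nonneg_pos)
  show ?thesis
  proof (rule that[of "K1 + K2" "1 / (8 * K2)"])
    fix x d c \<rho> u L \<epsilon> d' c' \<rho>' u' L' \<epsilon>' M and \<psi> :: "'a \<Rightarrow> real"
    assume x: "x \<in> \<Sigma>" and F: "flat_approx x d c \<rho> u L \<epsilon>" and F': "flat_approx x d' c' \<rho>' u' L' \<epsilon>'"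
      and \<rho>\<rho>': "\<rho>' \<le> \<rho>" "\<rho> \<le> 4 * \<rho>'" and u': "norm u' < \<rho>' / 16" and \<epsilon>: "0 < \<epsilon>" "0 < \<epsilon>'"
      and small: "\<epsilon> + \<epsilon>' \<le> 1 / (8 * K2)" and \<psi>: "lip_test M (\<rho>'/2) \<psi>"
    define e where "e = \<epsilon> + \<epsilon>'"
    have e: "0 < e" "K2 * e \<le> 1/8" using \<epsilon> small K2 by (auto simp: e_def field_simps)
    define m where "m = measure \<mu> (ball x \<rho>')"
    have L: "subspace L" "dim L = d" and L': "subspace L'" "dim L' = d'" and c: "0 < c" "0 < c'" and \<rho>: "0 < \<rho>" "0 < \<rho>'"
      and cm: "c * \<rho> ^ d \<le> ?N * measure \<mu> (ball x \<rho>)" "c' * \<rho>' ^ d' \<le> ?N * m" "m \<le> ?N * (c' * \<rho>' ^ d')"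
      using F F' by (auto simp: flat_approx_def m_def)
    have d': "d' \<le> ?n" using L'(2) dim_subset_UNIV[of L'] by simp
    have m0: "0 < m" unfolding m_def by (rule measure_ball_pos[OF x \<rho>(2)])
    have "measure \<mu> (ball x \<rho>) \<le> measure \<mu> (ball x (2 ^ 2 * \<rho>'))" using \<rho>\<rho>' by (intro measure_ball_mono) simp
    also have "\<dots> \<le> C\<^sup>2 * m" unfolding m_def by (rule doubling_iterate[OF x \<rho>(2)])
    finally have cm2: "c * \<rho> ^ d \<le> ?N * (C\<^sup>2 * m)" using cm(1) by (auto elim: order_trans)
    have err: "\<bar>centered_integral x \<phi> - c * (\<integral>p. \<phi> (u + p) \<partial>plane_measure d L)\<bar> \<le> K1 * m * \<rho>' * M * \<epsilon>"
      "\<bar>centered_integral x \<phi> - c' * (\<integral>p. \<phi> (u' + p) \<partial>plane_measure d' L')\<bar> \<le> K1 * m * \<rho>' * M * \<epsilon>'"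
      if \<phi>: "lip_test M \<rho>' \<phi>" for M \<phi>
    proof -
      have M: "0 \<le> M" using lip_test_diff(2)[OF \<phi>] .
      have "\<bar>centered_integral x \<phi> - c * (\<integral>p. \<phi> (u + p) \<partial>plane_measure d L)\<bar> \<le> c * \<rho> ^ (d + 1) * M * \<epsilon>"
        using F lip_test_mono[OF \<phi> order_refl \<rho>\<rho>'(1)] by (auto simp: flat_approx_def)
      also have "\<dots> = (c * \<rho> ^ d) * \<rho> * (M * \<epsilon>)" by (simp add: mult_ac)
      also have "\<dots> \<le> (?N * (C\<^sup>2 * m)) * (4 * \<rho>') * (M * \<epsilon>)"
        using M \<epsilon> \<rho> m0 C by (intro mult_right_mono mult_mono[OF cm2 \<rho>\<rho>'(2)]) auto
      finally show "\<bar>centered_integral x \<phi> - c * (\<integral>p. \<phi> (u + p) \<partial>plane_measure d L)\<bar> \<le> K1 * m * \<rho>' * M * \<epsilon>"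
        by (simp add: K1_def mult_ac)
      have "\<bar>centered_integral x \<phi> - c' * (\<integral>p. \<phi> (u' + p) \<partial>plane_measure d' L')\<bar> \<le> c' * \<rho>' ^ (d' + 1) * M * \<epsilon>'"
        using F' \<phi> by (auto simp: flat_approx_def)
      also have "\<dots> = (c' * \<rho>' ^ d') * (\<rho>' * M * \<epsilon>')" by (simp add: mult_ac)
      also have "\<dots> \<le> (K1 * m) * (\<rho>' * M * \<epsilon>')"
        using order_trans[OF cm(2) mult_right_mono[OF K1(2), of m]] M \<epsilon> \<rho> m0 by (intro mult_right_mono) auto
      finally show "\<bar>centered_integral x \<phi> - c' * (\<integral>p. \<phi> (u' + p) \<partial>plane_measure d' L')\<bar> \<le> K1 * m * \<rho>' * M * \<epsilon>'"
        by (simp add: mult_ac)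
    qed
    let ?V = "(+) u ` L" and ?V' = "(+) u' ` L'"
    have V: "dplane d ?V" and V': "dplane d' ?V'" by (rule dplane_translate[OF L], rule dplane_translate[OF L'])
    \<comment> \<open>The distance the two planes may have near the centre: were it larger, the
      errors could not account for it. The smallness of e keeps it below \<rho>'/8, so the near
      points found next stay well inside the ball.\<close>
    define \<tau> where "\<tau> = K2 * e * \<rho>'"
    have \<tau>: "0 < \<tau>" "\<tau> \<le> \<rho>' / 8"
      using e K2 \<rho> mult_right_mono[OF e(2), of \<rho>'] by (auto simp: \<tau>_def)
    have "\<exists>v'\<in>?V'. norm v' < \<rho>'/8 \<and> infdist v' ?V \<le> \<tau>"
    proof (rule ccontr)
      assume "\<not> ?thesis"
      then have far: "\<tau> < infdist v' ?V" if "v' \<in> ?V'" "norm v' < \<rho>'/8" for v' using that by force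
      \<comment> \<open>It vanishes on the first plane, so \<mu> gives it almost no integral; if the
        second plane stayed away from the first, it would be at least \<tau> on the part of the
        second plane within \<rho>'/16 of u'.\<close>
      define g where "g z = min (infdist z ?V) (tent (\<rho>'/4) z)" for z
      have g1: "lip_test 1 (\<rho>'/4) g" unfolding g_def[abs_def] by (rule lip_test_min_infdist)
      have g: "lip_test 1 \<rho>' g" using g1 \<rho> by (intro lip_test_mono[OF g1]) auto
      have "(\<integral>p. g (u + p) \<partial>plane_measure d L) = 0"
        by (rule integral_plane_zero[OF dplane_subspace[OF L]]) (simp add: g_def tent_def)
      then have Tg: "\<bar>centered_integral x g\<bar> \<le> K1 * m * \<rho>' * \<epsilon>" using err(1)[OF g] by simp
      have "\<tau> * (\<rho>'/16) ^ d' = \<tau> * measure (plane_measure d' ?V') (ball u' (\<rho>'/16) \<inter> ?V')"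
        using \<rho> subspace_0[OF L'(1)] by (subst measure_plane_ball_Int[OF V']) force+
      also have "\<dots> \<le> integral\<^sup>L (plane_measure d' ?V') g"
      proof (rule radon_integral_ge[OF radon_plane_measure[OF V'] lip_test_integrable[OF radon_plane_measure[OF V'] g]])
        show "0 \<le> g y" for y unfolding g_def by (simp add: infdist_nonneg tent_def)
        show "\<tau> \<le> g y" if y: "y \<in> ball u' (\<rho>'/16) \<inter> ?V'" for y
        proof -
          have "norm y < \<rho>'/8"
            using y u' norm_triangle_ineq2[of y u'] by (simp add: dist_norm norm_minus_commute)
          then show ?thesis using far[of y] y \<tau> by (simp add: g_def tent_def)
        qed
        show "bounded (ball u' (\<rho>'/16) \<inter> ?V')" by (intro bounded_Int) simp
        show "ball u' (\<rho>'/16) \<inter> ?V' \<in> sets borel" using dplane_borel[OF V'] by simp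
      qed (use \<rho> in simp)
      also have "\<dots> = (\<integral>p. g (u' + p) \<partial>plane_measure d' L')"
        by (rule integral_plane_translate[OF L' lip_test_measurable[OF g]])
      finally have "c' * (\<tau> * (\<rho>'/16) ^ d') \<le> c' * (\<integral>p. g (u' + p) \<partial>plane_measure d' L')"
        using c by (intro mult_left_mono) auto
      also have "\<dots> \<le> K1 * m * \<rho>' * \<epsilon> + K1 * m * \<rho>' * \<epsilon>'" using err(2)[OF g] Tg by simp
      also have "\<dots> = K1 * m * \<rho>' * e" by (simp add: e_def algebra_simps)
      also have "\<dots> \<le> K1 * (?N * (c' * \<rho>' ^ d')) * \<rho>' * e"
        using cm(3) K1 \<rho> e by (intro mult_right_mono mult_left_mono) auto
      finally have "(c' * \<rho>' ^ d' * \<rho>' * e) * K2 \<le> (c' * \<rho>' ^ d' * \<rho>' * e) * (16 ^ d' * K1 * ?N)"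
        by (simp add: \<tau>_def power_divide field_simps)
      then have "K2 \<le> 16 ^ d' * K1 * ?N" using c \<rho> e by (subst (asm) mult_le_cancel_left_pos) auto
      also have "\<dots> \<le> 16 ^ ?n * K1 * ?N" using d' K1 by (intro mult_right_mono power_increasing) auto
      finally show False using K2(2) by linarith
    qed
    then obtain v' where v': "v' \<in> ?V'" "norm v' < \<rho>'/8" "infdist v' ?V \<le> \<tau>" by blast
    obtain v where v: "v \<in> ?V" "infdist v' ?V = dist v' v"
      using infdist_attains_inf[of ?V v'] dplane_nonempty[OF V] V
      unfolding dplane_def by (metis affine_closed)
    have nv: "norm v \<le> \<rho>'/4" "norm (v - v') \<le> \<tau>"
      using v(2) v' \<tau>(2) norm_triangle_ineq2[of v v'] by (auto simp: dist_norm norm_minus_commute)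
    \<comment> \<open>Centring \<psi> at v and at v' turns both plane integrals into integrals over
      the direction spaces. The two functions differ by at most M \<tau> pointwise, which is the
      price of using different centres.\<close>
    let ?\<psi> = "\<lambda>y. \<psi> (y - v)" and ?\<psi>' = "\<lambda>y. \<psi> (y - v')"
    have M: "0 \<le> M" using lip_test_diff(2)[OF \<psi>] .
    have lt: "lip_test M \<rho>' ?\<psi>" "lip_test M \<rho>' ?\<psi>'"
      using nv v'(2) \<rho> by (auto intro!: lip_test_shift[OF \<psi>])
    have mm: "\<psi> \<in> borel_measurable borel" by (rule lip_test_measurable[OF \<psi>])
    have "(\<integral>p. ?\<psi> (u + p) \<partial>plane_measure d L) = (\<integral>p. \<psi> ((u - v) + p) \<partial>plane_measure d L)"
      by (simp add: algebra_simps)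
    also have "\<dots> = (\<integral>p. \<psi> (0 + p) \<partial>plane_measure d L)"
      by (rule integral_plane_translate_self[OF L mm]) (use v(1) subspace_neg[OF L(1)] in auto)
    finally have I: "(\<integral>p. ?\<psi> (u + p) \<partial>plane_measure d L) = integral\<^sup>L (plane_measure d L) \<psi>" by simp
    have "(\<integral>p. ?\<psi>' (u' + p) \<partial>plane_measure d' L') = (\<integral>p. \<psi> ((u' - v') + p) \<partial>plane_measure d' L')"
      by (simp add: algebra_simps)
    also have "\<dots> = (\<integral>p. \<psi> (0 + p) \<partial>plane_measure d' L')"
      by (rule integral_plane_translate_self[OF L' mm]) (use v'(1) subspace_neg[OF L'(1)] in auto)
    finally have I': "(\<integral>p. ?\<psi>' (u' + p) \<partial>plane_measure d' L') = integral\<^sup>L (plane_measure d' L') \<psi>" by simp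
    have "centered_integral x ?\<psi> - centered_integral x ?\<psi>' = (\<integral>y. ?\<psi> (y - x) - ?\<psi>' (y - x) \<partial>\<mu>)"
      unfolding centered_integral_def using lip_test_shift_integrable[OF lt(1)] lip_test_shift_integrable[OF lt(2)] \<rho> by simp
    also have "\<bar>\<dots>\<bar> \<le> (M * \<tau>) * measure \<mu> (ball x \<rho>')"
    proof (rule radon_integral_bound[OF radon])
      show "(\<lambda>y. ?\<psi> (y - x) - ?\<psi>' (y - x)) \<in> borel_measurable borel"
        using lip_test_measurable[OF lip_test_shift[OF lt(1) order_refl, of x]]
          lip_test_measurable[OF lip_test_shift[OF lt(2) order_refl, of x]] by simp
      show "\<bar>?\<psi> (y - x) - ?\<psi>' (y - x)\<bar> \<le> M * \<tau>" for y
        using lip_test_diff(1)[OF \<psi>, of "y - x - v" "y - x - v'"] nv(2) M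
        by (auto simp: norm_minus_commute intro: order_trans mult_left_mono)
      show "?\<psi> (y - x) - ?\<psi>' (y - x) = 0" if "y \<notin> ball x \<rho>'" for y
        using that lip_test_zero[OF lt(1), of "y - x"] lip_test_zero[OF lt(2), of "y - x"]
        by (simp add: dist_norm norm_minus_commute)
    qed auto
    finally have "\<bar>centered_integral x ?\<psi> - centered_integral x ?\<psi>'\<bar> \<le> K2 * m * \<rho>' * M * e" by (simp add: \<tau>_def m_def mult_ac)
    then have "\<bar>c * integral\<^sup>L (plane_measure d L) \<psi> - c' * integral\<^sup>L (plane_measure d' L') \<psi>\<bar>
        \<le> K1 * m * \<rho>' * M * \<epsilon> + K1 * m * \<rho>' * M * \<epsilon>' + K2 * m * \<rho>' * M * e"
      using err(1)[OF lt(1)] err(2)[OF lt(2)] unfolding I I' by linarith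
    then show "\<bar>c * integral\<^sup>L (plane_measure d L) \<psi> - c' * integral\<^sup>L (plane_measure d' L') \<psi>\<bar>
        \<le> (K1 + K2) * measure \<mu> (ball x \<rho>') * \<rho>' * M * (\<epsilon> + \<epsilon>')"
      by (simp add: e_def m_def algebra_simps)
  qed (use K1 K2 in auto)
qed

text \<open>Tents of radius \<rho>'/2 and \<rho>'/4 yield two relations between the tent masses of
  the flat measures, incompatible unless d = d'. Once the dimensions agree, linear planes are
  invariant under dilation, and the estimate for support radius \<rho>'/2 extends to every
  R.\<close>

lemma flat_approx_compare:
  obtains K e0 where "0 < K" "0 < e0"
    "\<And>x d c \<rho> u L \<epsilon> d' c' \<rho>' u' L' \<epsilon>'.
      \<lbrakk>x \<in> \<Sigma>; flat_approx x d c \<rho> u L \<epsilon>; flat_approx x d' c' \<rho>' u' L' \<epsilon>'; \<rho>' \<le> \<rho>; \<rho> \<le> 4 * \<rho>';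
       norm u' < \<rho>' / 16; 0 < \<epsilon>; 0 < \<epsilon>'; \<epsilon> + \<epsilon>' \<le> e0\<rbrakk>
      \<Longrightarrow> d = d' \<and> \<bar>c - c'\<bar> \<le> K * c' * (\<epsilon> + \<epsilon>') \<and>
         (\<forall>M R \<psi>. 0 < R \<longrightarrow> lip_test M R \<psi> \<longrightarrow>
           \<bar>c * integral\<^sup>L (plane_measure d L) \<psi> - c' * integral\<^sup>L (plane_measure d' L') \<psi>\<bar>
             \<le> K * c' * M * (2 * R) ^ (d + 1) * (\<epsilon> + \<epsilon>'))"
proof -
  let ?n = "DIM('a)" let ?N = "(2::real) ^ DIM('a)"
  obtain K3 e3 where K3: "0 < K3" and e3: "0 < e3" and
    main: "\<And>x d c \<rho> u L \<epsilon> d' c' \<rho>' u' L' \<epsilon>' M \<psi>.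
      \<lbrakk>x \<in> \<Sigma>; flat_approx x d c \<rho> u L \<epsilon>; flat_approx x d' c' \<rho>' u' L' \<epsilon>'; \<rho>' \<le> \<rho>; \<rho> \<le> 4 * \<rho>';
       norm u' < \<rho>' / 16; 0 < \<epsilon>; 0 < \<epsilon>'; \<epsilon> + \<epsilon>' \<le> e3; lip_test M (\<rho>'/2) \<psi>\<rbrakk>
      \<Longrightarrow> \<bar>c * integral\<^sup>L (plane_measure d L) \<psi> - c' * integral\<^sup>L (plane_measure d' L') \<psi>\<bar>
          \<le> K3 * measure \<mu> (ball x \<rho>') * \<rho>' * M * (\<epsilon> + \<epsilon>')"
    using flat_approx_compare_aux by blast
  \<comment> \<open>The lower bound for X/m proved in \<open>Xlow\<close>, times the least gap
    between two distinct powers \<open>(1/2) ^ d\<close> and \<open>(1/2) ^ d'\<close> with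
    exponents at most the dimension. Errors below q/12 thus exclude different dimensions.\<close>
  define q where "q = 1 / (?N * 2 ^ (?n + 1) * 8 ^ ?n * ?N)"
  have q: "0 < q" by (simp add: q_def)
  define e0 where "e0 = min e3 (q / (12 * K3))"
  define K where "K = K3 * ?N * (2 ^ (?n + 1) * 2 ^ (?n + 1))"
  have Kge: "K3 * ?N \<le> K"
    unfolding K_def using K3 mult_left_mono[of 1 "2 ^ (?n + 1) * 2 ^ (?n + 1) :: real" "K3 * ?N"]
    by (simp add: mult_ge1_I del: power_Suc)
  have K: "0 < K" using K3 by (simp add: K_def)
  show ?thesis
  proof (rule that[OF K])
    show "0 < e0" using e3 q K3 by (simp add: e0_def)
    fix x d c \<rho> u L \<epsilon> d' c' \<rho>' u' L' \<epsilon>'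
    assume x: "x \<in> \<Sigma>" and F: "flat_approx x d c \<rho> u L \<epsilon>" and F': "flat_approx x d' c' \<rho>' u' L' \<epsilon>'"
      and \<rho>\<rho>': "\<rho>' \<le> \<rho>" "\<rho> \<le> 4 * \<rho>'" and u': "norm u' < \<rho>' / 16" and \<epsilon>: "0 < \<epsilon>" "0 < \<epsilon>'"
      and small: "\<epsilon> + \<epsilon>' \<le> e0"
    define e where "e = \<epsilon> + \<epsilon>'"
    have e: "0 < e" "e \<le> e3" "12 * K3 * e \<le> q"
      using \<epsilon> small K3 by (auto simp: e_def e0_def field_simps)
    define m where "m = measure \<mu> (ball x \<rho>')"
    have L: "subspace L" "dim L = d" and L': "subspace L'" "dim L' = d'" and c: "0 < c" "0 < c'" and \<rho>: "0 < \<rho>" "0 < \<rho>'"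
      and cm: "measure \<mu> (ball x \<rho>) \<le> ?N * (c * \<rho> ^ d)" "m \<le> ?N * (c' * \<rho>' ^ d')"
      using F F' by (auto simp: flat_approx_def m_def)
    have d: "d \<le> ?n" "d' \<le> ?n" using L(2) L'(2) dim_subset_UNIV[of L] dim_subset_UNIV[of L'] by auto
    have m0: "0 < m" unfolding m_def by (rule measure_ball_pos[OF x \<rho>(2)])
    have main': "\<bar>c * integral\<^sup>L (plane_measure d L) \<psi> - c' * integral\<^sup>L (plane_measure d' L') \<psi>\<bar> \<le> K3 * m * \<rho>' * M * e"
      if "lip_test M (\<rho>'/2) \<psi>" for M \<psi>
      using main[OF x F F' \<rho>\<rho>' u' \<epsilon> _ that] e(2) by (simp add: e_def m_def)
    let ?k = "tent_const TYPE('a)"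
    have k: "0 < ?k d" "(1/2) ^ (?n + 1) \<le> ?k d"
      using tent_const_bounds(1)[OF d(1)] less_le_trans[of 0 "(1/2) ^ (?n + 1)" "?k d"] by auto
    \<comment> \<open>The tent integral of radius \<rho>'/2 divided by \<rho>'/2. Halving the radius
      multiplies the quotient by \<open>(1/2) ^ d\<close>, and X' correspondingly by
      \<open>(1/2) ^ d'\<close>.\<close>
    define X where "X = c * ?k d * (\<rho>'/2) ^ d"
    define X' where "X' = c' * ?k d' * (\<rho>'/2) ^ d'"
    have "\<bar>c * ((\<rho>'/2) ^ (d + 1) * ?k d) - c' * ((\<rho>'/2) ^ (d' + 1) * ?k d')\<bar> \<le> K3 * m * \<rho>' * 1 * e"
      using main'[OF lip_test_tent] \<rho> by (simp add: integral_tent[OF L] integral_tent[OF L'])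
    moreover have "c * ((\<rho>'/2) ^ (d + 1) * ?k d) - c' * ((\<rho>'/2) ^ (d' + 1) * ?k d') = (\<rho>'/2) * (X - X')"
      by (simp add: X_def X'_def algebra_simps)
    ultimately have "\<bar>(\<rho>'/2) * (X - X')\<bar> \<le> K3 * m * \<rho>' * 1 * e" by (simp only:)
    then have "(\<rho>'/2) * \<bar>X - X'\<bar> \<le> (\<rho>'/2) * (2 * K3 * m * e)"
      using \<rho> by (simp only: abs_mult) (simp add: mult_ac)
    then have X1: "\<bar>X - X'\<bar> \<le> 2 * K3 * m * e" using \<rho> by (simp only: mult_le_cancel_left_pos)
    have "\<bar>c * ((\<rho>'/4) ^ (d + 1) * ?k d) - c' * ((\<rho>'/4) ^ (d' + 1) * ?k d')\<bar> \<le> K3 * m * \<rho>' * 1 * e"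
      using main'[OF lip_test_mono[OF lip_test_tent[of "\<rho>'/4"] order_refl]] \<rho>
      by (simp add: integral_tent[OF L] integral_tent[OF L'])
    moreover have "c * ((\<rho>'/4) ^ (d + 1) * ?k d) - c' * ((\<rho>'/4) ^ (d' + 1) * ?k d') = (\<rho>'/4) * (X * (1/2) ^ d - X' * (1/2) ^ d')"
    proof -
      have "(\<rho>'/4) ^ j = (\<rho>'/2) ^ j * (1/2) ^ j" for j by (simp add: power_mult_distrib[symmetric])
      then show ?thesis by (simp add: X_def X'_def algebra_simps)
    qed
    ultimately have "\<bar>(\<rho>'/4) * (X * (1/2) ^ d - X' * (1/2) ^ d')\<bar> \<le> K3 * m * \<rho>' * 1 * e" by (simp only:)
    then have "(\<rho>'/4) * \<bar>X * (1/2) ^ d - X' * (1/2) ^ d'\<bar> \<le> (\<rho>'/4) * (4 * K3 * m * e)"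
      using \<rho> by (simp only: abs_mult) (simp add: mult_ac)
    then have X2: "\<bar>X * (1/2) ^ d - X' * (1/2) ^ d'\<bar> \<le> 4 * K3 * m * e" using \<rho> by (simp only: mult_le_cancel_left_pos)
    have Xlow: "m / (?N * 2 ^ (?n + 1) * 8 ^ ?n) \<le> X"
    proof -
      have "m \<le> measure \<mu> (ball x \<rho>)" unfolding m_def using \<rho>\<rho>' by (intro measure_ball_mono)
      also have "\<dots> \<le> ?N * (c * \<rho> ^ d)" by (rule cm(1))
      also have "\<dots> \<le> ?N * (c * (8 * (\<rho>'/2)) ^ d)" using \<rho>\<rho>' \<rho> c by (intro mult_left_mono power_mono) auto
      also have "\<dots> = ?N * (c * (\<rho>'/2) ^ d) * 8 ^ d" by (simp only: power_mult_distrib mult_ac)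
      also have "\<dots> \<le> ?N * (c * (\<rho>'/2) ^ d) * 8 ^ ?n"
        using d \<rho> c by (intro mult_left_mono power_increasing) auto
      finally have "m / (?N * 8 ^ ?n) \<le> c * (\<rho>'/2) ^ d" by (simp add: field_simps)
      then have "m / (?N * 8 ^ ?n) * (1/2) ^ (?n + 1) \<le> c * (\<rho>'/2) ^ d * ?k d"
        using k c \<rho> by (intro mult_mono) auto
      then show ?thesis by (simp add: X_def power_divide mult_ac)
    qed
    have dd: "d = d'"
    proof (rule ccontr)
      assume ne: "d \<noteq> d'"
      \<comment> \<open>X and X' are close, and so are their multiples by the two powers of 1/2.
        Hence X times the difference of the powers is small, whereas X is bounded below by a
        multiple of m.\<close>
      have gap: "1 / ?N \<le> \<bar>(1/2::real) ^ d - (1/2) ^ d'\<bar>"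
      proof -
        have *: "1 / ?N \<le> (1/2::real) ^ a - (1/2) ^ b" if "a < b" "b \<le> ?n" for a b
        proof -
          have "(1/2::real) ^ b \<le> (1/2) ^ Suc a" using that by (intro power_decreasing) auto
          moreover have "(1/2::real) ^ ?n \<le> (1/2) ^ Suc a" using that by (intro power_decreasing) auto
          ultimately show ?thesis by (simp add: power_divide)
        qed
        show ?thesis using *[of d d'] *[of d' d] d ne by (cases "d < d'") auto
      qed
      have "X * ((1/2) ^ d - (1/2) ^ d') = (X * (1/2) ^ d - X' * (1/2) ^ d') + (X' - X) * (1/2) ^ d'"
        by (simp add: algebra_simps)
      then have "\<bar>X * ((1/2) ^ d - (1/2) ^ d')\<bar> \<le> \<bar>X * (1/2) ^ d - X' * (1/2) ^ d'\<bar> + \<bar>(X' - X) * (1/2) ^ d'\<bar>"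
        by (simp only: abs_triangle_ineq)
      also have "\<bar>(X' - X) * (1/2) ^ d'\<bar> \<le> \<bar>X' - X\<bar> * 1"
        unfolding abs_mult by (intro mult_left_mono) (auto simp: power_le_one)
      finally have up: "\<bar>X\<bar> * \<bar>(1/2) ^ d - (1/2) ^ d'\<bar> \<le> 6 * K3 * m * e"
        using X1 X2 by (simp add: abs_mult abs_minus_commute)
      have "m * q = m / (?N * 2 ^ (?n + 1) * 8 ^ ?n) * (1 / ?N)" by (simp add: q_def)
      also have "\<dots> \<le> \<bar>X\<bar> * \<bar>(1/2) ^ d - (1/2) ^ d'\<bar>" using Xlow gap m0 by (intro mult_mono) auto
      also note up
      finally have "m * q \<le> m * (6 * K3 * e)" by (simp add: mult_ac)
      then have "q \<le> 6 * K3 * e" using m0 by (simp only: mult_le_cancel_left_pos)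
      moreover have "6 * K3 * e + 6 * K3 * e \<le> q" using e(3) by simp
      ultimately show False using mult_pos_pos[OF K3 e(1)] by linarith
    qed
    show "d = d' \<and> \<bar>c - c'\<bar> \<le> K * c' * (\<epsilon> + \<epsilon>') \<and>
         (\<forall>M R \<psi>. 0 < R \<longrightarrow> lip_test M R \<psi> \<longrightarrow>
           \<bar>c * integral\<^sup>L (plane_measure d L) \<psi> - c' * integral\<^sup>L (plane_measure d' L') \<psi>\<bar>
             \<le> K * c' * M * (2 * R) ^ (d + 1) * (\<epsilon> + \<epsilon>'))"
    proof (intro conjI allI impI dd)
      have "\<bar>X - X'\<bar> = \<bar>c - c'\<bar> * (?k d * (\<rho>'/2) ^ d)"
        using k \<rho> by (simp add: X_def X'_def dd left_diff_distrib[symmetric] abs_mult mult.assoc)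
      then have "\<bar>c - c'\<bar> * (?k d * (\<rho>'/2) ^ d) \<le> 2 * K3 * m * e" using X1 by simp
      also have "\<dots> \<le> 2 * K3 * (?N * (c' * (2 * (\<rho>'/2)) ^ d)) * e"
        using cm(2) K3 e dd by (intro mult_right_mono mult_left_mono) auto
      also have "\<dots> = (2 * K3 * ?N * c' * 2 ^ d * e) * (\<rho>'/2) ^ d" by (simp only: power_mult_distrib mult_ac)
      finally have "(\<bar>c - c'\<bar> * ?k d) * (\<rho>'/2) ^ d \<le> (2 * K3 * ?N * c' * 2 ^ d * e) * (\<rho>'/2) ^ d" by (simp add: mult_ac)
      then have "\<bar>c - c'\<bar> * ?k d \<le> 2 * K3 * ?N * c' * 2 ^ d * e" using \<rho> by (simp only: mult_le_cancel_right_pos zero_less_power half_gt_zero)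
      also have "\<dots> \<le> 2 * K3 * ?N * c' * ?N * e"
        using d K3 c e by (intro mult_right_mono mult_left_mono power_increasing) auto
      also have "\<dots> = K3 * ?N * c' * 2 ^ (?n + 1) * e" by simp
      finally have "\<bar>c - c'\<bar> * (1/2) ^ (?n + 1) \<le> K3 * ?N * c' * 2 ^ (?n + 1) * e"
        using mult_left_mono[OF k(2), of "\<bar>c - c'\<bar>"] by simp
      then have "\<bar>c - c'\<bar> * (1/2) ^ (?n + 1) * 2 ^ (?n + 1) \<le> K3 * ?N * c' * 2 ^ (?n + 1) * e * 2 ^ (?n + 1)"
        by (intro mult_right_mono) auto
      then show "\<bar>c - c'\<bar> \<le> K * c' * (\<epsilon> + \<epsilon>')"
        by (simp add: K_def e_def power_divide mult_ac)
      fix M R and \<psi> :: "'a \<Rightarrow> real" assume R: "0 < R" and \<psi>: "lip_test M R \<psi>"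
      \<comment> \<open>The dilation factor that brings the support radius R to \<rho>'/2.\<close>
      define t where "t = (\<rho>'/2) / R"
      have t: "0 < t" "R * t = \<rho>'/2" "\<rho>' / t = 2 * R" using R \<rho> by (auto simp: t_def)
      have M: "0 \<le> M" using lip_test_diff(2)[OF \<psi>] .
      let ?I = "integral\<^sup>L (plane_measure d L) \<psi>" and ?I' = "integral\<^sup>L (plane_measure d' L') \<psi>"
      have "lip_test (M / t) (\<rho>'/2) (\<lambda>y. \<psi> ((1/t) *\<^sub>R y))" using lip_test_scale[OF \<psi> t(1)] t(2) by simp
      note main'[OF this]
      also have "c * (\<integral>y. \<psi> ((1/t) *\<^sub>R y) \<partial>plane_measure d L) - c' * (\<integral>y. \<psi> ((1/t) *\<^sub>R y) \<partial>plane_measure d' L')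
          = t ^ d * (c * ?I - c' * ?I')"
        unfolding integral_plane_scale[OF L lip_test_measurable[OF \<psi>] t(1)] integral_plane_scale[OF L' lip_test_measurable[OF \<psi>] t(1)]
        by (simp add: dd algebra_simps)
      finally have "t ^ d * \<bar>c * ?I - c' * ?I'\<bar> \<le> K3 * m * \<rho>' * (M / t) * e" using t by (simp add: abs_mult)
      also have "\<dots> \<le> K3 * (?N * (c' * (t * (\<rho>'/t)) ^ d)) * \<rho>' * (M / t) * e"
      proof -
        have "m \<le> ?N * (c' * (t * (\<rho>'/t)) ^ d)" using cm(2) t(1) dd by simp
        then show ?thesis using K3 e \<rho> M t(1) by (intro mult_right_mono mult_left_mono) auto
      qed
      also have "\<dots> = t ^ d * (K3 * ?N * c' * M * (\<rho>'/t) ^ (d + 1) * e)"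
      proof -
        define w where "w = \<rho>'/t"
        have "\<rho>' * (M / t) = M * w" by (simp add: w_def)
        then have "K3 * (?N * (c' * (t * w) ^ d)) * (\<rho>' * (M / t)) * e = t ^ d * (K3 * ?N * c' * M * w ^ (d + 1) * e)"
          by (simp add: power_mult_distrib mult_ac)
        then show ?thesis by (simp only: w_def mult.assoc)
      qed
      finally have "\<bar>c * ?I - c' * ?I'\<bar> \<le> K3 * ?N * c' * M * (2 * R) ^ (d + 1) * e"
        using t by (simp only: mult_le_cancel_left_pos zero_less_power)
      also have "\<dots> \<le> K * c' * M * (2 * R) ^ (d + 1) * e"
        using Kge c M R e by (intro mult_right_mono) auto
      finally show "\<bar>c * ?I - c' * ?I'\<bar> \<le> K * c' * M * (2 * R) ^ (d + 1) * (\<epsilon> + \<epsilon>')" by (simp add: e_def)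
    qed
  qed
qed

end

subsection \<open>Convergence of the approximating planes\<close>

lemma convergent_of_summable_increments:
  fixes f :: "nat \<Rightarrow> real"
  assumes "summable (\<lambda>k. \<bar>f (Suc k) - f k\<bar>)"
  shows "convergent f"
proof -
  have "summable (\<lambda>k. f (Suc k) - f k)" using assms by (rule summable_rabs_cancel)
  then have "convergent (\<lambda>n. \<Sum>k<n. f (Suc k) - f k)" by (simp add: summable_iff_convergent)
  then have "convergent (\<lambda>n. f n - f 0)" by (simp add: sum_lessThan_telescope)
  then obtain l where "(\<lambda>n. f n - f 0) \<longlonglongrightarrow> l" by (auto simp: convergent_def)
  from tendsto_add[OF this tendsto_const[of "f 0"]] show ?thesis by (auto simp: convergent_def)
qed

text \<open>Increments that are summable relative to c make \<open>ln (c k)\<close> converge, and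
  exponentiating keeps the limit away from 0; absolute increments would not.\<close>

lemma positive_limit_of_summable_ratios:
  fixes c \<delta> :: "nat \<Rightarrow> real"
  assumes c: "\<And>k. 0 < c k" and \<delta>: "summable \<delta>" "\<And>k. 0 \<le> \<delta> k"
    and step: "\<And>k. \<bar>c k - c (Suc k)\<bar> \<le> c (Suc k) * \<delta> k"
  obtains \<theta> where "0 < \<theta>" "c \<longlonglongrightarrow> \<theta>"
proof -
  have "\<delta> \<longlonglongrightarrow> 0" using \<delta>(1) by (rule summable_LIMSEQ_zero)
  then have ev: "\<forall>\<^sub>F k in sequentially. \<delta> k < 1/2" by (rule order_tendstoD) simp
  have "summable (\<lambda>k. \<bar>ln (c (Suc k)) - ln (c k)\<bar>)"
  proof (rule summable_comparison_test_ev)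
    show "summable (\<lambda>k. 2 * \<delta> k)" using \<delta>(1) by (rule summable_mult)
    show "\<forall>\<^sub>F k in sequentially. norm \<bar>ln (c (Suc k)) - ln (c k)\<bar> \<le> 2 * \<delta> k"
      using ev
    proof eventually_elim
      case (elim k)
      define t where "t = c k / c (Suc k) - 1"
      have "t = (c k - c (Suc k)) / c (Suc k)" using c[of "Suc k"] by (simp add: t_def field_simps)
      then have t: "\<bar>t\<bar> \<le> \<delta> k" using step[of k] c[of "Suc k"] by (simp add: abs_divide divide_le_eq mult.commute)
      have "ln (c k) - ln (c (Suc k)) = ln (1 + t)" using c[of k] c[of "Suc k"] by (simp add: t_def ln_div)
      \<comment> \<open>For small t the quadratic remainder is absorbed by the linear term, which
        gives the factor 2 in front of \<delta>.\<close>
      moreover have "\<bar>ln (1 + t) - t\<bar> \<le> 2 * t\<^sup>2"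
        using t elim by (intro abs_ln_one_plus_x_minus_x_bound) simp
      moreover have "2 * t\<^sup>2 \<le> \<bar>t\<bar>"
        using mult_right_mono[of "2 * \<bar>t\<bar>" 1 "\<bar>t\<bar>"] t elim by (simp add: power2_eq_square abs_mult_self_eq)
      ultimately show ?case using t by simp
    qed
  qed
  then have "convergent (\<lambda>k. ln (c k))" by (rule convergent_of_summable_increments)
  then obtain l where "(\<lambda>k. ln (c k)) \<longlonglongrightarrow> l" by (auto simp: convergent_def)
  then have "(\<lambda>k. exp (ln (c k))) \<longlonglongrightarrow> exp l" by (rule tendsto_exp)
  then have "c \<longlonglongrightarrow> exp l" using c by simp
  then show ?thesis by (rule that[rotated]) simp
qed

lemma dyadic_scale_exists:
  fixes s :: real
  assumes s: "0 < s" "s \<le> (1/2) ^ K"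
  obtains k where "K \<le> k" "(1/2) ^ Suc k < s" "s \<le> (1/2) ^ k"
proof -
  obtain N where N: "(1/2::real) ^ N < s" using real_arch_pow_inv[of s "1/2"] s by auto
  define k where "k = (LEAST k. (1/2) ^ Suc k < s)"
  have "(1/2) ^ Suc N < s" using N by (rule le_less_trans[rotated]) simp
  then have k1: "(1/2) ^ Suc k < s" unfolding k_def by (rule LeastI)
  have kl: "s \<le> (1/2) ^ Suc j" if "j < k" for j
    using not_less_Least[of j "\<lambda>k. (1/2) ^ Suc k < s"] that unfolding k_def by (simp add: not_less)
  have "K \<le> k"
  proof (rule ccontr)
    assume "\<not> K \<le> k"
    then have "(1/2::real) ^ K \<le> (1/2) ^ Suc k" by (intro power_decreasing) auto
    then show False using k1 s by linarith
  qed
  moreover have "s \<le> (1/2) ^ k"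
  proof (cases k)
    case 0
    then show ?thesis using s power_le_one[of "1/2::real" K] by simp
  next
    case (Suc j)
    then show ?thesis using kl[of j] by simp
  qed
  ultimately show ?thesis using that k1 by blast
qed

section \<open>Selection of good scales and compactness of directions\<close>

context doubling_radon begin

text \<open>The infimum of \<open>\<alpha>\<close> over each dyadic interval is summable.  Passing to a step function below the
  integrand avoids any appeal to the measurability of \<open>\<alpha>\<close>.\<close>

lemma good_scales:
  assumes x: "x \<in> Sigma0 \<mu>"
  obtains r e :: "nat \<Rightarrow> real" where "\<And>k. (1/2) ^ Suc k < r k" "\<And>k. r k \<le> (1/2) ^ k"
    "\<And>k. 0 < e k" "summable e" "\<And>k. alpha \<mu> x (r k) < ennreal (e k)"
proof -
  define I where "I k = {(1/2::real) ^ Suc k <.. (1/2) ^ k}" for k :: nat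
  define i where "i k = (INF r\<in>I k. alpha \<mu> x r)" for k
  define f where "f r = alpha \<mu> x r / ennreal r * indicator {0<..1} r" for r :: real
  \<comment> \<open>On the k-th interval 1/r is at least \<open>2 ^ k\<close>, and the interval has
    length \<open>(1/2) ^ Suc k\<close>; so the step function contributes half of
    \<open>i k\<close>.\<close>
  define g where "g r = (\<Sum>k. (i k * ennreal (2 ^ k)) * indicator (I k) r)" for r :: real
  have fin: "(\<integral>\<^sup>+r. f r \<partial>lborel) < \<infinity>" using x by (simp add: Sigma0_def f_def)
  have disj: "disjoint_family I"
    unfolding disjoint_family_on_def
  proof (intro ballI impI)
    have *: "I a \<inter> I b = {}" if "a < b" for a b
    proof -
      have "(1/2::real) ^ b \<le> (1/2) ^ Suc a" using that by (intro power_decreasing) auto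
      then show ?thesis by (auto simp: I_def)
    qed
    show "I a \<inter> I b = {}" if "a \<noteq> b" for a b using *[of a b] *[of b a] that by (cases "a < b") auto
  qed
  have "g r \<le> f r" for r
  proof (cases "\<exists>k. r \<in> I k")
    case True
    then obtain k where k: "r \<in> I k" by blast
    have r: "0 < r" "r \<le> 1" "r \<le> (1/2) ^ k"
      using k power_le_one[of "1/2::real" k] less_trans[of 0 "(1/2) ^ Suc k" r] by (auto simp: I_def)
    have "g r = i k * ennreal (2 ^ k)"
      unfolding g_def by (rule suminf_cmult_indicator[OF disj k])
    also have "\<dots> \<le> alpha \<mu> x r * ennreal (1 / r)"
    proof (intro mult_mono)
      show "i k \<le> alpha \<mu> x r" unfolding i_def using k by (rule INF_lower)
      have "2 ^ k * r \<le> 2 ^ k * (1/2) ^ k" using r by (intro mult_left_mono) auto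
      also have "\<dots> = (1::real)" by (simp add: power_mult_distrib[symmetric])
      finally show "ennreal (2 ^ k) \<le> ennreal (1 / r)"
        using r by (intro ennreal_leI) (simp add: pos_le_divide_eq)
    qed auto
    also have "\<dots> = f r"
      unfolding f_def divide_ennreal_def using r by (simp add: inverse_ennreal inverse_eq_divide)
    finally show ?thesis .
  next
    case False
    then show ?thesis by (simp add: g_def)
  qed
  then have "(\<integral>\<^sup>+r. g r \<partial>lborel) \<le> (\<integral>\<^sup>+r. f r \<partial>lborel)" by (rule nn_integral_mono)
  then have "(\<integral>\<^sup>+r. g r \<partial>lborel) < \<infinity>" using fin by (rule le_less_trans)
  also have "(\<integral>\<^sup>+r. g r \<partial>lborel) = (\<Sum>k. i k * ennreal (1/2))"
    unfolding g_def
  proof (subst nn_integral_suminf)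
    show "(\<Sum>k. \<integral>\<^sup>+r. i k * ennreal (2 ^ k) * indicator (I k) r \<partial>lborel) = (\<Sum>k. i k * ennreal (1/2))"
    proof (rule suminf_cong)
      fix k
      have "(\<integral>\<^sup>+r. i k * ennreal (2 ^ k) * indicator (I k) r \<partial>lborel) = i k * ennreal (2 ^ k) * emeasure lborel (I k)"
        by (rule nn_integral_cmult_indicator) (simp add: I_def)
      also have "emeasure lborel (I k) = ennreal ((1/2) ^ k - (1/2) ^ Suc k)"
        unfolding I_def by (rule emeasure_lborel_Ioc) (simp add: power_decreasing)
      also have "i k * ennreal (2 ^ k) * \<dots> = i k * ennreal (2 ^ k * ((1/2) ^ k - (1/2) ^ Suc k))"
        by (simp add: mult.assoc ennreal_mult[symmetric])
      also have "2 ^ k * ((1/2) ^ k - (1/2) ^ Suc k) = (1/2::real)"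
        by (simp add: power_one_over right_diff_distrib)
      finally show "(\<integral>\<^sup>+r. i k * ennreal (2 ^ k) * indicator (I k) r \<partial>lborel) = i k * ennreal (1/2)" .
    qed
  qed (simp add: I_def)
  also have "(\<Sum>k. i k * ennreal (1/2)) = (\<Sum>k. i k) * ennreal (1/2)" by (rule ennreal_suminf_multc)
  finally have S: "(\<Sum>k. i k) < \<infinity>" by (auto simp: ennreal_mult_less_top)
  have ifin: "i k < \<infinity>" for k
    using sum_le_suminf[OF summableI, of "{k}" i] S by (auto intro: le_less_trans)
  define j where "j k = enn2real (i k)" for k
  have ij: "i k = ennreal (j k)" for k unfolding j_def using ifin[of k] by (simp add: less_top)
  have j0: "0 \<le> j k" for k by (simp add: j_def)
  have sj: "summable j" using S j0 unfolding ij by (intro summable_suminf_not_top) (auto simp: less_top)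
  \<comment> \<open>The infimum may be zero or not attained, so a summable slack is added.\<close>
  define e where "e k = j k + (1/2) ^ k" for k
  have ej: "j k < e k" "0 < e k" for k
    using j0[of k] zero_less_power[of "1/2::real" k] unfolding e_def by linarith+
  have "i k < ennreal (e k)" for k unfolding ij using ej by (intro ennreal_lessI)
  then have "\<exists>r\<in>I k. alpha \<mu> x r < ennreal (e k)" for k
    unfolding i_def INF_less_iff by blast
  then obtain r where r: "\<And>k. r k \<in> I k" "\<And>k. alpha \<mu> x (r k) < ennreal (e k)" by metis
  show ?thesis
  proof (rule that[OF _ _ _ _ r(2)])
    show "(1/2) ^ Suc k < r k" "r k \<le> (1/2) ^ k" for k using r(1)[of k] by (auto simp: I_def)
    show "0 < e k" for k by (rule ej)
    show "summable e" unfolding e_def by (intro summable_add sj summable_geometric) simp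
  qed
qed

text \<open>Test functions are Lipschitz because \<open>flat_approx\<close> controls only those;
  \<open>tangent_flat_lim_continuous\<close> later extends the limit to continuous functions of
  compact support.\<close>

definition tangent_flat :: "'a \<Rightarrow> nat \<Rightarrow> real \<Rightarrow> 'a set \<Rightarrow> bool" where
  "tangent_flat x d \<theta> W \<longleftrightarrow> subspace W \<and> dim W = d \<and> 0 < \<theta> \<and>
     (\<forall>M R \<psi>. 0 < R \<longrightarrow> lip_test M R \<psi> \<longrightarrow>
        ((\<lambda>r. centered_integral x (\<lambda>z. \<psi> ((1/r) *\<^sub>R z)) / r ^ d) \<longlongrightarrow> \<theta> * integral\<^sup>L (plane_measure d W) \<psi>) (at_right 0))"

lemma approximating_planes:
  assumes x: "x \<in> Sigma0 \<mu>"
  obtains r \<epsilon> c :: "nat \<Rightarrow> real" and d :: "nat \<Rightarrow> nat" and u :: "nat \<Rightarrow> 'a" and L :: "nat \<Rightarrow> 'a set"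
  where "\<And>k. (1/2) ^ Suc k < r k" "\<And>k. r k \<le> (1/2) ^ k" "\<And>k. 0 < \<epsilon> k" "summable \<epsilon>"
    "\<And>k. flat_approx x (d k) (c k) (r k) (u k) (L k) (\<epsilon> k)" "(\<lambda>k. norm (u k) / r k) \<longlonglongrightarrow> 0"
proof -
  have xS: "x \<in> \<Sigma>" using x by (simp add: Sigma0_def)
  obtain r e :: "nat \<Rightarrow> real" where r: "\<And>k. (1/2) ^ Suc k < r k" "\<And>k. r k \<le> (1/2) ^ k"
    and e: "\<And>k. 0 < e k" "summable e" "\<And>k. alpha \<mu> x (r k) < ennreal (e k)"
    using good_scales[OF x] by blast
  have r0: "0 < r k" for k using r(1)[of k] by (rule less_trans[rotated]) simp
  define \<epsilon> where "\<epsilon> k = 2 ^ DIM('a) * e k" for k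
  have \<epsilon>: "0 < \<epsilon> k" "summable \<epsilon>" for k using e by (auto simp: \<epsilon>_def[abs_def] intro: summable_mult)
  have "\<exists>d c u L. flat_approx x d c (r k) u L (\<epsilon> k)" for k
    using flat_approx_of_alpha[OF xS r0 e(3)] unfolding \<epsilon>_def by metis
  then obtain d c u0 L where F0: "\<And>k. flat_approx x (d k) (c k) (r k) (u0 k) (L k) (\<epsilon> k)" by metis
  \<comment> \<open>How far the plane can be recentred towards x depends on how small
    \<open>\<epsilon> k\<close> is. Choosing each offset within \<open>r k * (1/2) ^ k\<close> of
    the infimum of all admissible offsets yields one sequence that profits from every \<eta> at
    once.\<close>
  have "\<exists>u. flat_approx x (d k) (c k) (r k) u (L k) (\<epsilon> k) \<and>
      (\<forall>u'. flat_approx x (d k) (c k) (r k) u' (L k) (\<epsilon> k) \<longrightarrow> norm u < norm u' + r k * (1/2) ^ k)" for k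
  proof -
    let ?S = "norm ` {u. flat_approx x (d k) (c k) (r k) u (L k) (\<epsilon> k)}"
    have ne: "?S \<noteq> {}" using F0[of k] by blast
    have bd: "bdd_below ?S" by (rule bdd_belowI[of _ 0]) auto
    have "Inf ?S < Inf ?S + r k * (1/2) ^ k" using r0[of k] by simp
    then obtain s where "s \<in> ?S" "s < Inf ?S + r k * (1/2) ^ k" using cInf_lessD[OF ne] by blast
    then obtain u where "flat_approx x (d k) (c k) (r k) u (L k) (\<epsilon> k)" "norm u < Inf ?S + r k * (1/2) ^ k" by blast
    moreover have "Inf ?S \<le> norm u'" if "flat_approx x (d k) (c k) (r k) u' (L k) (\<epsilon> k)" for u'
      using that by (intro cInf_lower bd) auto
    ultimately show ?thesis by (meson add_right_mono less_le_trans)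
  qed
  then obtain u where F: "\<And>k. flat_approx x (d k) (c k) (r k) (u k) (L k) (\<epsilon> k)"
    and umin: "\<And>k u'. flat_approx x (d k) (c k) (r k) u' (L k) (\<epsilon> k) \<Longrightarrow> norm (u k) < norm u' + r k * (1/2) ^ k"
    by metis
  have "(\<lambda>k. norm (u k) / r k) \<longlonglongrightarrow> 0"
  proof (rule LIMSEQ_I)
    fix s :: real assume s: "0 < s"
    define \<eta> where "\<eta> = min 1 (s/2)"
    have \<eta>: "0 < \<eta>" "\<eta> \<le> 1" "\<eta> \<le> s/2" using s by (auto simp: \<eta>_def)
    obtain e1 where e1: "0 < e1"
      "\<And>x d c \<rho> u L \<epsilon>. \<lbrakk>x \<in> \<Sigma>; flat_approx x d c \<rho> u L \<epsilon>; \<epsilon> \<le> e1\<rbrakk> \<Longrightarrow> \<exists>u'. norm u' < \<eta> * \<rho> \<and> flat_approx x d c \<rho> u' L \<epsilon>"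
      using flat_approx_near_center[OF \<eta>(1,2)] by metis
    have "\<forall>\<^sub>F k in sequentially. \<epsilon> k < e1"
      using summable_LIMSEQ_zero[OF \<epsilon>(2)] e1(1) by (rule order_tendstoD)
    moreover have "\<forall>\<^sub>F k in sequentially. (1/2::real) ^ k < s/2"
      using LIMSEQ_power_zero[of "1/2::real"] s by (intro order_tendstoD) auto
    ultimately have "\<forall>\<^sub>F k in sequentially. norm (u k) / r k < s"
    proof eventually_elim
      case (elim k)
      obtain u' where u': "norm u' < \<eta> * r k" "flat_approx x (d k) (c k) (r k) u' (L k) (\<epsilon> k)"
        using e1(2)[OF xS F[of k]] elim(1) by auto
      have "norm (u k) < \<eta> * r k + (1/2) ^ k * r k" using umin[OF u'(2)] u'(1) by (simp add: mult.commute)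
      also have "\<dots> = (\<eta> + (1/2) ^ k) * r k" by (simp add: distrib_right)
      also have "\<dots> \<le> s * r k" using \<eta>(3) elim(2) r0[of k] by (intro mult_right_mono) auto
      finally show ?case using r0[of k] by (simp add: divide_less_eq)
    qed
    then show "\<exists>no. \<forall>k\<ge>no. norm (norm (u k) / r k - 0) < s"
      using r0 by (auto simp: eventually_sequentially less_imp_le)
  qed
  then show ?thesis by (rule that[OF r \<epsilon> F])
qed

text \<open>The isometric parametrizations over a model subspace are bounded in a finite-dimensional
  operator space. The limit B of a convergent subsequence is again isometric on the model, and
  uniform closeness on bounded sets carries over to integrals of Lipschitz functions.\<close>

lemma subspace_limit:
  fixes L :: "nat \<Rightarrow> 'a set"
  assumes L: "\<And>k. subspace (L k)" "\<And>k. dim (L k) = d"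
  obtains W s where "subspace W" "dim W = d" "strict_mono s"
    "\<And>M R \<psi>. 0 < R \<Longrightarrow> lip_test M R \<psi> \<Longrightarrow>
      (\<lambda>k. integral\<^sup>L (plane_measure d (L (s k))) \<psi>) \<longlonglongrightarrow> integral\<^sup>L (plane_measure d W) \<psi>"
proof -
  have d: "d \<le> DIM('a)" using L(2)[of 0] dim_subset_UNIV[of "L 0"] by simp
  let ?P = "model_subspace d :: 'a set"
  note P = model_subspace[where 'a = 'a, OF d]
  note dP = dplane_subspace[OF P]
  have "\<exists>A :: 'a \<Rightarrow>\<^sub>L 'a. (\<forall>p\<in>?P. norm (blinfun_apply A p) = norm p) \<and> blinfun_apply A ` ?P = L k \<and> norm A \<le> real DIM('a)" for k
    using subspace_isometric_param[OF P(1) L(1)[of k]] P(2) L(2) by metis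
  then obtain A :: "nat \<Rightarrow> 'a \<Rightarrow>\<^sub>L 'a" where A: "\<And>k p. p \<in> ?P \<Longrightarrow> norm (blinfun_apply (A k) p) = norm p"
    "\<And>k. blinfun_apply (A k) ` ?P = L k" "\<And>k. norm (A k) \<le> real DIM('a)" by metis
  have "bounded (range A)" using A(3) by (auto simp: bounded_iff)
  then obtain B s where s: "strict_mono s" and B: "(A \<circ> s) \<longlonglongrightarrow> B"
    using bounded_imp_convergent_subsequence by metis
  have Bn: "norm (B p) = norm p" if "p \<in> ?P" for p
  proof -
    have "(\<lambda>k. norm (A (s k) p)) \<longlonglongrightarrow> norm (B p)"
      using B by (intro tendsto_norm blinfun.tendsto tendsto_const) (simp add: o_def)
    then show ?thesis using A(1)[OF that] by (simp add: LIMSEQ_const_iff)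
  qed
  show ?thesis
  proof (rule that[of "B ` ?P" s])
    show "subspace (B ` ?P)" "dim (B ` ?P) = d"
      using integral_plane_param(1,2)[OF P Bn, of "\<lambda>_. 0"] by auto
    fix M R and \<psi> :: "'a \<Rightarrow> real" assume R: "0 < R" and \<psi>: "lip_test M R \<psi>"
    have m: "\<psi> \<in> borel_measurable borel" by (rule lip_test_measurable[OF \<psi>])
    have M: "0 \<le> M" using lip_test_diff(2)[OF \<psi>] .
    have Am: "(\<lambda>p. \<psi> (A' p)) \<in> borel_measurable borel" for A' :: "'a \<Rightarrow>\<^sub>L 'a"
    proof (rule measurable_compose[OF _ m])
      show "blinfun_apply A' \<in> borel_measurable borel"
        by (intro borel_measurable_continuous_onI linear_continuous_on blinfun.bounded_linear_right)
    qed
    have AEP: "AE p in plane_measure d ?P. p \<in> ?P"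
      using dplane_borel[OF dP] by (intro AE_measure_on) simp
    note rad = radon_plane_measure[OF dP]
    let ?Z = "measure (plane_measure d ?P) (ball 0 R)"
    have est: "\<bar>integral\<^sup>L (plane_measure d (L (s k))) \<psi> - integral\<^sup>L (plane_measure d (B ` ?P)) \<psi>\<bar>
        \<le> M * (norm (A (s k) - B) * R) * ?Z" for k
    proof -
      \<comment> \<open>Norms are preserved on the model subspace only; off it,
        \<open>\<psi> (A' p)\<close> may have unbounded support. The indicator removes those points,
        which carry no plane measure.\<close>
      have ind: "integrable (plane_measure d ?P) (\<lambda>p. indicator ?P p * \<psi> (A' p))"
        "(\<integral>p. indicator ?P p * \<psi> (A' p) \<partial>plane_measure d ?P) = integral\<^sup>L (plane_measure d (A' ` ?P)) \<psi>"
        if A': "\<And>p. p \<in> ?P \<Longrightarrow> norm (A' p) = norm p" for A' :: "'a \<Rightarrow>\<^sub>L 'a"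
      proof -
        show "integrable (plane_measure d ?P) (\<lambda>p. indicator ?P p * \<psi> (A' p))"
        proof (rule radon_integrable[OF rad])
          show "(\<lambda>p. indicator ?P p * \<psi> (A' p)) \<in> borel_measurable borel"
            using dplane_borel[OF dP] Am by simp
          show "\<bar>indicator ?P p * \<psi> (A' p)\<bar> \<le> M * R" for p
            using lip_test_bound[OF \<psi>, of "A' p"] R M by (auto simp: indicator_def)
          show "indicator ?P p * \<psi> (A' p) = 0" if "p \<notin> ball 0 R" for p
            using that A'[of p] lip_test_zero[OF \<psi>, of "A' p"] by (auto simp: indicator_def)
        qed simp
        show "(\<integral>p. indicator ?P p * \<psi> (A' p) \<partial>plane_measure d ?P) = integral\<^sup>L (plane_measure d (A' ` ?P)) \<psi>"
        proof -
          have "(\<integral>p. indicator ?P p * \<psi> (A' p) \<partial>plane_measure d ?P) = (\<integral>p. \<psi> (A' p) \<partial>plane_measure d ?P)"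
          proof (rule integral_cong_AE)
            show "AE p in plane_measure d ?P. indicator ?P p * \<psi> (A' p) = \<psi> (A' p)" using AEP by auto
          qed (use dplane_borel[OF dP] Am in simp_all)
          also have "\<dots> = integral\<^sup>L (plane_measure d (A' ` ?P)) \<psi>"
            by (rule integral_plane_param(3)[OF P A' m, symmetric])
          finally show ?thesis .
        qed
      qed
      have "integral\<^sup>L (plane_measure d (L (s k))) \<psi> - integral\<^sup>L (plane_measure d (B ` ?P)) \<psi>
          = (\<integral>p. indicator ?P p * \<psi> (A (s k) p) - indicator ?P p * \<psi> (B p) \<partial>plane_measure d ?P)"
        using ind[of "A (s k)"] ind[of B] A(1,2) Bn by (simp add: Bochner_Integration.integral_diff)
      also have "\<bar>\<dots>\<bar> \<le> M * (norm (A (s k) - B) * R) * ?Z"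
      proof (rule radon_integral_bound[OF rad])
        show "(\<lambda>p. indicator ?P p * \<psi> (A (s k) p) - indicator ?P p * \<psi> (B p)) \<in> borel_measurable borel"
          using dplane_borel[OF dP] Am by simp
        have zero: "indicator ?P p * \<psi> (A (s k) p) - indicator ?P p * \<psi> (B p) = 0" if "p \<notin> ball 0 R" for p
          using that A(1)[of p "s k"] Bn[of p] lip_test_zero[OF \<psi>, of "A (s k) p"] lip_test_zero[OF \<psi>, of "B p"]
          by (auto simp: indicator_def)
        then show "\<And>p. p \<notin> ball 0 R \<Longrightarrow> indicator ?P p * \<psi> (A (s k) p) - indicator ?P p * \<psi> (B p) = 0" .
        show "\<bar>indicator ?P p * \<psi> (A (s k) p) - indicator ?P p * \<psi> (B p)\<bar> \<le> M * (norm (A (s k) - B) * R)" for p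
        proof (cases "p \<in> ?P \<and> p \<in> ball 0 R")
          case True
          have "\<bar>\<psi> (A (s k) p) - \<psi> (B p)\<bar> \<le> M * norm (A (s k) p - B p)" by (rule lip_test_diff(1)[OF \<psi>])
          also have "norm (A (s k) p - B p) = norm ((A (s k) - B) p)" by (simp add: blinfun.diff_left)
          also have "M * \<dots> \<le> M * (norm (A (s k) - B) * norm p)"
            using M by (intro mult_left_mono norm_blinfun)
          also have "\<dots> \<le> M * (norm (A (s k) - B) * R)" using True M by (intro mult_left_mono) auto
          finally show ?thesis using True by simp
        next
          case False
          then show ?thesis using zero[of p] M R by (cases "p \<in> ?P") auto
        qed
      qed auto
      finally show ?thesis .
    qed
    have "(\<lambda>k. norm (A (s k) - B)) \<longlonglongrightarrow> 0"
      using B LIM_zero[of "A \<circ> s" B sequentially] by (auto simp: o_def intro: tendsto_norm_zero)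
    then have "(\<lambda>k. M * (norm (A (s k) - B) * R) * ?Z) \<longlonglongrightarrow> M * (0 * R) * ?Z" by (intro tendsto_intros)
    then have lim0: "(\<lambda>k. M * (norm (A (s k) - B) * R) * ?Z) \<longlonglongrightarrow> 0" by simp
    have "(\<lambda>k. integral\<^sup>L (plane_measure d (L (s k))) \<psi> - integral\<^sup>L (plane_measure d (B ` ?P)) \<psi>) \<longlonglongrightarrow> 0"
      by (rule tendsto_rabs_zero_cancel, rule tendsto_sandwich[OF _ _ tendsto_const lim0]) (use est in auto)
    then show "(\<lambda>k. integral\<^sup>L (plane_measure d (L (s k))) \<psi>) \<longlonglongrightarrow> integral\<^sup>L (plane_measure d (B ` ?P)) \<psi>"
      by (rule LIM_zero_cancel)
  qed (rule s)
qed

end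

lemma integral_plane_near_translate:
  fixes L :: "'a::euclidean_space set" and \<psi> :: "'a \<Rightarrow> real"
  assumes L: "subspace L" "dim L = d" and \<psi>: "lip_test M R \<psi>" and R: "0 < R"
  shows "\<bar>(\<integral>p. \<psi> (w + p) \<partial>plane_measure d L) - integral\<^sup>L (plane_measure d L) \<psi>\<bar>
    \<le> M * norm w * (R + norm w) ^ d"
proof -
  note dL = dplane_subspace[OF L]
  note rad = radon_plane_measure[OF dL]
  have M: "0 \<le> M" using lip_test_diff(2)[OF \<psi>] .
  have \<psi>w: "lip_test M (R + norm w) (\<lambda>p. \<psi> (w + p))"
    using lip_test_shift[OF \<psi>, of "- w" "R + norm w"] by (simp add: add.commute)
  have \<psi>0: "lip_test M (R + norm w) \<psi>" by (rule lip_test_mono[OF \<psi>]) auto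
  have Rw: "0 \<le> R + norm w" "0 < R + norm w" using R norm_ge_zero[of w] by linarith+
  have "(\<integral>p. \<psi> (w + p) \<partial>plane_measure d L) - integral\<^sup>L (plane_measure d L) \<psi>
      = (\<integral>p. \<psi> (w + p) - \<psi> p \<partial>plane_measure d L)"
    by (rule Bochner_Integration.integral_diff[symmetric])
      (rule lip_test_integrable[OF rad \<psi>w Rw(1)], rule lip_test_integrable[OF rad \<psi>0 Rw(1)])
  also have "\<bar>\<dots>\<bar> \<le> (M * norm w) * measure (plane_measure d L) (ball 0 (R + norm w))"
  proof (rule radon_integral_bound[OF rad])
    show "(\<lambda>p. \<psi> (w + p) - \<psi> p) \<in> borel_measurable borel"
      using lip_test_measurable[OF \<psi>w] lip_test_measurable[OF \<psi>0] by simp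
    show "\<bar>\<psi> (w + p) - \<psi> p\<bar> \<le> M * norm w" for p
      using lip_test_diff(1)[OF \<psi>, of "w + p" p] by simp
    show "\<psi> (w + p) - \<psi> p = 0" if "p \<notin> ball 0 (R + norm w)" for p
      using that lip_test_zero[OF \<psi>w, of p] lip_test_zero[OF \<psi>0, of p] by simp
  qed auto
  also have "measure (plane_measure d L) (ball 0 (R + norm w)) = (R + norm w) ^ d"
    using measure_plane_ball[OF dL subspace_0[OF L(1)] Rw(2)] .
  finally show ?thesis .
qed

section \<open>From the selected scales to all small scales\<close>

context doubling_radon begin

lemma flat_approxD:
  assumes "flat_approx x d c \<rho> u L \<epsilon>" "lip_test M \<rho> \<psi>"
  shows "\<bar>centered_integral x \<psi> - c * (\<integral>p. \<psi> (u + p) \<partial>plane_measure d L)\<bar> \<le> c * \<rho> ^ (d + 1) * M * \<epsilon>"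
  using assms by (simp only: flat_approx_def)

text \<open>One approximation at radius \<rho> serves all scales r for which R r and \<rho> are
  comparable. The first error term is that of the approximation; the second comes from replacing the
  plane through u by the parallel one through 0, and w bounds the rescaled offset.\<close>

lemma flat_approx_at_scale:
  assumes F: "flat_approx x d c \<rho> u L \<epsilon>" and \<psi>: "lip_test M R \<psi>" and R: "0 < R" and r: "0 < r"
    and rR: "R * r \<le> \<rho>" "\<rho> \<le> 4 * (R * r)" and \<epsilon>: "0 < \<epsilon>"
  defines "w \<equiv> 4 * R * (norm u / \<rho>)"
  shows "\<bar>centered_integral x (\<lambda>z. \<psi> ((1/r) *\<^sub>R z)) / r ^ d - c * integral\<^sup>L (plane_measure d L) \<psi>\<bar>
     \<le> c * (M * (4 * R) ^ (d + 1) * \<epsilon> + M * w * (R + w) ^ d)"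
proof -
  have L: "subspace L" "dim L = d" and c: "0 < c" and \<rho>: "0 < \<rho>" using F by (auto simp: flat_approx_def)
  have M: "0 \<le> M" using lip_test_diff(2)[OF \<psi>] .
  let ?\<psi> = "\<lambda>z. \<psi> ((1/r) *\<^sub>R z)"
  have lt: "lip_test (M / r) \<rho> ?\<psi>"
    using lip_test_mono[OF lip_test_scale[OF \<psi> r] order_refl rR(1)] .
  have m: "\<psi> \<in> borel_measurable borel" by (rule lip_test_measurable[OF \<psi>])
  define v where "v = (1/r) *\<^sub>R u"
  have wv: "norm v \<le> w"
  proof -
    have "norm v = norm u / r" using r by (simp add: v_def)
    also have "\<dots> \<le> norm u * (4 * R / \<rho>)"
      using rR(2) r \<rho> mult_left_mono[of "1 / r" "4 * R / \<rho>" "norm u"] by (simp add: field_simps)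
    finally show ?thesis by (simp add: w_def mult_ac)
  qed
  have vm: "(\<lambda>p. \<psi> (v + p)) \<in> borel_measurable borel"
    using lip_test_measurable[OF lip_test_shift[OF \<psi> order_refl, of "- v"]] by (simp add: add.commute)
  have "(\<integral>p. ?\<psi> (u + p) \<partial>plane_measure d L) = (\<integral>p. \<psi> (v + (1/r) *\<^sub>R p) \<partial>plane_measure d L)"
    by (simp add: v_def scaleR_add_right)
  also have "\<dots> = r ^ d * (\<integral>p. \<psi> (v + p) \<partial>plane_measure d L)"
    by (rule integral_plane_scale[OF L vm r])
  finally have I: "(\<integral>p. ?\<psi> (u + p) \<partial>plane_measure d L) = r ^ d * (\<integral>p. \<psi> (v + p) \<partial>plane_measure d L)" .
  have "\<bar>centered_integral x ?\<psi> - c * (r ^ d * (\<integral>p. \<psi> (v + p) \<partial>plane_measure d L))\<bar> \<le> c * \<rho> ^ (d + 1) * (M / r) * \<epsilon>"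
    using flat_approxD[OF F lt] unfolding I .
  also have "\<dots> \<le> c * (4 * (R * r)) ^ (d + 1) * (M / r) * \<epsilon>"
    using rR c M r \<epsilon> \<rho> by (intro mult_right_mono mult_left_mono power_mono) auto
  also have "\<dots> = r ^ d * (c * (M * (4 * R) ^ (d + 1) * \<epsilon>))"
  proof -
    have "(4 * (R * r)) ^ (d + 1) * (M / r) = (4 * R) ^ (d + 1) * r ^ d * M"
      using r by (simp add: power_mult_distrib mult_ac)
    then show ?thesis by (simp only: mult_ac)
  qed
  finally have "\<bar>centered_integral x ?\<psi> - c * (r ^ d * (\<integral>p. \<psi> (v + p) \<partial>plane_measure d L))\<bar> / r ^ d
      \<le> c * (M * (4 * R) ^ (d + 1) * \<epsilon>)" using r by (simp add: divide_le_eq mult.commute)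
  also have "\<bar>centered_integral x ?\<psi> - c * (r ^ d * (\<integral>p. \<psi> (v + p) \<partial>plane_measure d L))\<bar> / r ^ d
      = \<bar>(centered_integral x ?\<psi> - c * (r ^ d * (\<integral>p. \<psi> (v + p) \<partial>plane_measure d L))) / r ^ d\<bar>"
    using r by (simp add: abs_divide)
  also have "(centered_integral x ?\<psi> - c * (r ^ d * (\<integral>p. \<psi> (v + p) \<partial>plane_measure d L))) / r ^ d
      = centered_integral x ?\<psi> / r ^ d - c * (\<integral>p. \<psi> (v + p) \<partial>plane_measure d L)"
    using r by (simp add: field_simps)
  finally have A: "\<bar>centered_integral x ?\<psi> / r ^ d - c * (\<integral>p. \<psi> (v + p) \<partial>plane_measure d L)\<bar> \<le> c * (M * (4 * R) ^ (d + 1) * \<epsilon>)" .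
  have "\<bar>(\<integral>p. \<psi> (v + p) \<partial>plane_measure d L) - integral\<^sup>L (plane_measure d L) \<psi>\<bar> \<le> M * norm v * (R + norm v) ^ d"
    by (rule integral_plane_near_translate[OF L \<psi> R])
  also have "\<dots> \<le> M * w * (R + w) ^ d"
    using M wv R order_trans[OF norm_ge_zero[of v] wv] by (intro mult_mono power_mono mult_left_mono) auto
  finally have "c * \<bar>(\<integral>p. \<psi> (v + p) \<partial>plane_measure d L) - integral\<^sup>L (plane_measure d L) \<psi>\<bar> \<le> c * (M * w * (R + w) ^ d)"
    using c by (intro mult_left_mono) auto
  then have B: "\<bar>c * (\<integral>p. \<psi> (v + p) \<partial>plane_measure d L) - c * integral\<^sup>L (plane_measure d L) \<psi>\<bar> \<le> c * (M * w * (R + w) ^ d)"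
    using c by (simp only: right_diff_distrib[symmetric] abs_mult abs_of_pos)
  show ?thesis using A B unfolding distrib_left by linarith
qed

theorem tangent_flat_exists:
  assumes x: "x \<in> Sigma0 \<mu>"
  obtains d \<theta> W where "d \<le> DIM('a)" "tangent_flat x d \<theta> W"
proof -
  have xS: "x \<in> \<Sigma>" using x by (simp add: Sigma0_def)
  obtain r0 \<epsilon>0 c0 :: "nat \<Rightarrow> real" and d0 :: "nat \<Rightarrow> nat" and u0 :: "nat \<Rightarrow> 'a" and L0 :: "nat \<Rightarrow> 'a set"
    where r0: "\<And>k. (1/2) ^ Suc k < r0 k" "\<And>k. r0 k \<le> (1/2) ^ k"
    and \<epsilon>0: "\<And>k. 0 < \<epsilon>0 k" "summable \<epsilon>0"
    and F0: "\<And>k. flat_approx x (d0 k) (c0 k) (r0 k) (u0 k) (L0 k) (\<epsilon>0 k)"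
    and u0: "(\<lambda>k. norm (u0 k) / r0 k) \<longlonglongrightarrow> 0"
    by (rule approximating_planes[OF x]) (rule that; assumption)
  obtain K e0 where K: "0 < K" and e0: "0 < e0" and comp:
    "\<And>x d c \<rho> u L \<epsilon> d' c' \<rho>' u' L' \<epsilon>'.
      \<lbrakk>x \<in> \<Sigma>; flat_approx x d c \<rho> u L \<epsilon>; flat_approx x d' c' \<rho>' u' L' \<epsilon>'; \<rho>' \<le> \<rho>; \<rho> \<le> 4 * \<rho>';
       norm u' < \<rho>' / 16; 0 < \<epsilon>; 0 < \<epsilon>'; \<epsilon> + \<epsilon>' \<le> e0\<rbrakk>
      \<Longrightarrow> d = d' \<and> \<bar>c - c'\<bar> \<le> K * c' * (\<epsilon> + \<epsilon>') \<and>
         (\<forall>M R \<psi>. 0 < R \<longrightarrow> lip_test M R \<psi> \<longrightarrow>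
           \<bar>c * integral\<^sup>L (plane_measure d L) \<psi> - c' * integral\<^sup>L (plane_measure d' L') \<psi>\<bar>
             \<le> K * c' * M * (2 * R) ^ (d + 1) * (\<epsilon> + \<epsilon>'))"
    using flat_approx_compare by blast
  have "\<forall>\<^sub>F k in sequentially. \<epsilon>0 k < e0/2"
    using summable_LIMSEQ_zero[OF \<epsilon>0(2)] e0 by (intro order_tendstoD) auto
  moreover have "\<forall>\<^sub>F k in sequentially. norm (u0 k) / r0 k < 1/16"
    using u0 by (rule order_tendstoD) simp
  ultimately have "\<forall>\<^sub>F k in sequentially. \<epsilon>0 k < e0/2 \<and> norm (u0 k) / r0 k < 1/16" by (rule eventually_conj)
  \<comment> \<open>From \<open>k0\<close> on, both hypotheses of \<open>flat_approx_compare\<close>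
    hold for consecutive scales: the errors add up to at most \<open>e0\<close>, and the offset is
    below a sixteenth of the radius. The sequences are shifted to start there.\<close>
  then obtain k0 where k0: "\<And>k. k0 \<le> k \<Longrightarrow> \<epsilon>0 k < e0/2 \<and> norm (u0 k) / r0 k < 1/16"
    by (auto simp: eventually_sequentially)
  define r where "r k = r0 (k + k0)" for k
  define \<epsilon> where "\<epsilon> k = \<epsilon>0 (k + k0)" for k
  define c where "c k = c0 (k + k0)" for k
  define u where "u k = u0 (k + k0)" for k
  define L where "L k = L0 (k + k0)" for k
  have r: "(1/2) ^ Suc (k + k0) < r k" "r k \<le> (1/2) ^ (k + k0)" for k using r0 by (auto simp: r_def)
  have rpos: "0 < r k" for k using r(1)[of k] by (rule less_trans[rotated]) simp
  have \<epsilon>: "0 < \<epsilon> k" "\<epsilon> k < e0/2" for k using \<epsilon>0 k0 by (auto simp: \<epsilon>_def)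
  have sum\<epsilon>: "summable \<epsilon>" unfolding \<epsilon>_def[abs_def] using \<epsilon>0(2) by (rule summable_ignore_initial_segment)
  have u: "norm (u k) < r k / 16" for k
    using k0[of "k + k0"] rpos[of k] by (simp add: u_def r_def field_simps)
  have ulim: "(\<lambda>k. norm (u k) / r k) \<longlonglongrightarrow> 0"
    unfolding u_def r_def using LIMSEQ_ignore_initial_segment[OF u0, of k0] .
  have F: "flat_approx x (d0 (k + k0)) (c k) (r k) (u k) (L k) (\<epsilon> k)" for k
    using F0[of "k + k0"] by (simp add: c_def r_def u_def L_def \<epsilon>_def)
  define \<delta> where "\<delta> k = \<epsilon> k + \<epsilon> (Suc k)" for k
  have \<delta>0: "0 < \<delta> k" for k using \<epsilon>(1)[of k] \<epsilon>(1)[of "Suc k"] by (simp add: \<delta>_def)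
  have sum\<delta>: "summable \<delta>" unfolding \<delta>_def[abs_def] using sum\<epsilon> by (intro summable_add) (auto simp: summable_Suc_iff)
  have step: "d0 (k + k0) = d0 (Suc k + k0) \<and> \<bar>c k - c (Suc k)\<bar> \<le> K * c (Suc k) * \<delta> k \<and>
     (\<forall>M R \<psi>. 0 < R \<longrightarrow> lip_test M R \<psi> \<longrightarrow>
       \<bar>c k * integral\<^sup>L (plane_measure (d0 (k + k0)) (L k)) \<psi>
          - c (Suc k) * integral\<^sup>L (plane_measure (d0 (Suc k + k0)) (L (Suc k))) \<psi>\<bar>
         \<le> K * c (Suc k) * M * (2 * R) ^ (d0 (k + k0) + 1) * \<delta> k)" for k
    unfolding \<delta>_def
  proof (rule comp[OF xS F[of k] F[of "Suc k"] _ _ u \<epsilon>(1) \<epsilon>(1)])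
    show "r (Suc k) \<le> r k" using r(2)[of "Suc k"] r(1)[of k] by simp
    show "r k \<le> 4 * r (Suc k)" using r(2)[of k] r(1)[of "Suc k"] by simp
    show "\<epsilon> k + \<epsilon> (Suc k) \<le> e0" using \<epsilon>(2)[of k] \<epsilon>(2)[of "Suc k"] by linarith
  qed
  define d where "d = d0 k0"
  have dconst: "d0 (k + k0) = d" for k
    by (induction k) (use step in \<open>auto simp: d_def\<close>)
  have F': "flat_approx x d (c k) (r k) (u k) (L k) (\<epsilon> k)" for k using F[of k] by (simp add: dconst)
  have L: "subspace (L k)" "dim (L k) = d" and c: "0 < c k" for k
    using F'[of k] by (auto simp: flat_approx_def)
  have d: "d \<le> DIM('a)" using L(2)[of 0] dim_subset_UNIV[of "L 0"] by simp
  obtain \<theta> where \<theta>: "0 < \<theta>" "c \<longlonglongrightarrow> \<theta>"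
  proof (rule positive_limit_of_summable_ratios[OF c])
    show "summable (\<lambda>k. K * \<delta> k)" using sum\<delta> by (rule summable_mult)
    show "0 \<le> K * \<delta> k" for k using K \<delta>0[of k] by simp
    show "\<bar>c k - c (Suc k)\<bar> \<le> c (Suc k) * (K * \<delta> k)" for k using step[of k] by (simp add: mult_ac)
  qed
  obtain Cb where Cb: "\<And>k. c k \<le> Cb"
    using convergent_imp_Bseq[OF convergentI[OF \<theta>(2)]] by (auto simp: Bseq_def abs_le_iff)
  obtain W s where W: "subspace W" "dim W = d" and s: "strict_mono s"
    and Wlim: "\<And>M R \<psi>. 0 < R \<Longrightarrow> lip_test M R \<psi> \<Longrightarrow>
      (\<lambda>k. integral\<^sup>L (plane_measure d (L (s k))) \<psi>) \<longlonglongrightarrow> integral\<^sup>L (plane_measure d W) \<psi>"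
    using subspace_limit[of L d] L by blast
  \<comment> \<open>Summable increments give convergence of the whole sequence but not the form of
    the limit; the subsequence of planes converging to W identifies it.\<close>
  have J: "(\<lambda>k. c k * integral\<^sup>L (plane_measure d (L k)) \<psi>) \<longlonglongrightarrow> \<theta> * integral\<^sup>L (plane_measure d W) \<psi>"
    if R: "0 < R" and \<psi>: "lip_test M R \<psi>" for M R \<psi>
  proof -
    let ?a = "\<lambda>k. c k * integral\<^sup>L (plane_measure d (L k)) \<psi>"
    have M: "0 \<le> M" using lip_test_diff(2)[OF \<psi>] .
    have "summable (\<lambda>k. \<bar>?a (Suc k) - ?a k\<bar>)"
    proof (rule summable_comparison_test_ev)
      show "summable (\<lambda>k. (K * Cb * M * (2 * R) ^ (d + 1)) * \<delta> k)" using sum\<delta> by (rule summable_mult)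
      have "norm \<bar>?a (Suc k) - ?a k\<bar> \<le> (K * Cb * M * (2 * R) ^ (d + 1)) * \<delta> k" for k
      proof -
        have "\<bar>?a k - ?a (Suc k)\<bar> \<le> K * c (Suc k) * M * (2 * R) ^ (d + 1) * \<delta> k"
          using step[of k] R \<psi> by (simp add: dconst dconst[of "Suc k", simplified])
        also have "\<dots> \<le> K * Cb * M * (2 * R) ^ (d + 1) * \<delta> k"
          using Cb K M R \<delta>0[of k] by (intro mult_right_mono mult_left_mono) auto
        finally show ?thesis by (simp add: abs_minus_commute)
      qed
      then show "\<forall>\<^sub>F k in sequentially. norm \<bar>?a (Suc k) - ?a k\<bar> \<le> (K * Cb * M * (2 * R) ^ (d + 1)) * \<delta> k"
        by (intro always_eventually allI)
    qed
    then have "convergent ?a" by (rule convergent_of_summable_increments)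
    then obtain l where l: "?a \<longlonglongrightarrow> l" by (auto simp: convergent_def)
    have "(\<lambda>k. ?a (s k)) \<longlonglongrightarrow> l" using LIMSEQ_subseq_LIMSEQ[OF l s] by (simp add: o_def)
    moreover have "(\<lambda>k. c (s k)) \<longlonglongrightarrow> \<theta>" using LIMSEQ_subseq_LIMSEQ[OF \<theta>(2) s] by (simp add: o_def)
    then have "(\<lambda>k. ?a (s k)) \<longlonglongrightarrow> \<theta> * integral\<^sup>L (plane_measure d W) \<psi>"
      by (intro tendsto_mult Wlim[OF R \<psi>])
    ultimately have "l = \<theta> * integral\<^sup>L (plane_measure d W) \<psi>" by (rule LIMSEQ_unique)
    then show ?thesis using l by simp
  qed
  have "tangent_flat x d \<theta> W"
    unfolding tangent_flat_def
  proof (intro conjI allI impI W \<theta>(1))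
    fix M R and \<psi> :: "'a \<Rightarrow> real" assume R: "0 < R" and \<psi>: "lip_test M R \<psi>"
    have M: "0 \<le> M" using lip_test_diff(2)[OF \<psi>] .
    let ?l = "\<theta> * integral\<^sup>L (plane_measure d W) \<psi>"
    let ?a = "\<lambda>k. c k * integral\<^sup>L (plane_measure d (L k)) \<psi>"
    define w where "w k = 4 * R * (norm (u k) / r k)" for k
    define B where "B k = c k * (M * (4 * R) ^ (d + 1) * \<epsilon> k + M * w k * (R + w k) ^ d)" for k
    have wlim: "w \<longlonglongrightarrow> 0" unfolding w_def using tendsto_mult_left[OF ulim, of "4 * R"] by simp
    have "B \<longlonglongrightarrow> \<theta> * (M * (4 * R) ^ (d + 1) * 0 + M * 0 * (R + 0) ^ d)"
      unfolding B_def by (intro tendsto_intros \<theta>(2) wlim summable_LIMSEQ_zero[OF sum\<epsilon>])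
    then have Blim: "B \<longlonglongrightarrow> 0" by simp
    show "((\<lambda>r. centered_integral x (\<lambda>z. \<psi> ((1/r) *\<^sub>R z)) / r ^ d) \<longlongrightarrow> ?l) (at_right 0)"
    proof (rule tendstoI)
      fix e :: real assume e: "0 < e"
      have "\<forall>\<^sub>F k in sequentially. dist (?a k) ?l < e/2 \<and> B k < e/2"
        using J[OF R \<psi>] Blim e by (intro eventually_conj tendstoD order_tendstoD) auto
      then obtain N where N: "\<And>k. N \<le> k \<Longrightarrow> dist (?a k) ?l < e/2" "\<And>k. N \<le> k \<Longrightarrow> B k < e/2"
        by (auto simp: eventually_sequentially)
      \<comment> \<open>Below b the number 2 R t lies in a dyadic interval of index at least N +
        \<open>k0\<close>. The selected radius of that interval then lies between R t and 4 R
        t.\<close>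
      define b where "b = (1/2) ^ (N + k0) / (2 * R)"
      have b: "0 < b" using R by (simp add: b_def)
      show "\<forall>\<^sub>F t in at_right 0. dist (centered_integral x (\<lambda>z. \<psi> ((1/t) *\<^sub>R z)) / t ^ d) ?l < e"
        unfolding eventually_at_right_field
      proof (intro exI[of _ b] conjI allI impI b)
        fix t assume t: "0 < t" "t < b"
        have "2 * R * t \<le> (1/2) ^ (N + k0)" using t R by (simp add: b_def pos_less_divide_eq mult.commute)
        then obtain k' where k': "N + k0 \<le> k'" "(1/2) ^ Suc k' < 2 * R * t" "2 * R * t \<le> (1/2) ^ k'"
          using dyadic_scale_exists[of "2 * R * t" "N + k0"] t R by auto
        define k where "k = k' - k0"
        have k: "N \<le> k" "k' = k + k0" using k'(1) by (auto simp: k_def)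
        have "R * t \<le> r k" "r k \<le> 4 * (R * t)" using r(1)[of k] r(2)[of k] k'(2,3) k(2) by auto
        from flat_approx_at_scale[OF F'[of k] \<psi> R t(1) this \<epsilon>(1)]
        have "\<bar>centered_integral x (\<lambda>z. \<psi> ((1/t) *\<^sub>R z)) / t ^ d - ?a k\<bar> \<le> B k" by (simp add: B_def w_def)
        then show "dist (centered_integral x (\<lambda>z. \<psi> ((1/t) *\<^sub>R z)) / t ^ d) ?l < e"
          using N[OF k(1)] unfolding dist_real_def by linarith
      qed
    qed
  qed
  then show ?thesis using that d by blast
qed

end

subsection \<open>Density, tangent plane and tangent measures\<close>

definition plateau :: "real \<Rightarrow> real \<Rightarrow> 'a::euclidean_space \<Rightarrow> real" where
  "plateau \<tau> s y = min 1 (tent s y / \<tau>)"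

lemma lip_test_plateau:
  assumes "0 < \<tau>"
  shows "lip_test (1/\<tau>) s (plateau \<tau> s)"
proof (rule lip_testI)
  show "\<bar>plateau \<tau> s x - plateau \<tau> s y\<bar> \<le> 1/\<tau> * norm (x - y)" for x y :: 'a
  proof -
    have "\<bar>plateau \<tau> s x - plateau \<tau> s y\<bar> \<le> \<bar>tent s x / \<tau> - tent s y / \<tau>\<bar>"
      unfolding plateau_def by linarith
    also have "\<dots> = \<bar>tent s x - tent s y\<bar> / \<tau>" using assms by (simp add: diff_divide_distrib[symmetric])
    also have "\<dots> \<le> norm (x - y) / \<tau>"
      using lip_test_diff(1)[OF lip_test_tent, of s x y] assms by (intro divide_right_mono) auto
    finally show ?thesis by simp
  qed
qed (use assms in \<open>auto simp: plateau_def tent_def\<close>)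

lemma plateau_bounds:
  assumes "0 < \<tau>"
  shows "0 \<le> plateau \<tau> s y" "plateau \<tau> s y \<le> 1" "norm y \<le> s - \<tau> \<Longrightarrow> plateau \<tau> s y = 1" "s \<le> norm y \<Longrightarrow> plateau \<tau> s y = 0"
  using assms by (auto simp: plateau_def tent_def min_def field_simps)

text \<open>The inf-convolution of \<phi> with a steep cone is Lipschitz, lies below \<phi>, and is
  uniformly close to it once the slope exceeds what uniform continuity requires.\<close>

lemma lipschitz_approximation:
  fixes \<phi> :: "'a::euclidean_space \<Rightarrow> real"
  assumes c: "continuous_on UNIV \<phi>" and z: "\<And>y. R \<le> norm y \<Longrightarrow> \<phi> y = 0" and R: "0 < R" and e: "0 < e"
  obtains M \<psi> where "lip_test M (R + 1) \<psi>" "\<And>y. \<bar>\<phi> y - \<psi> y\<bar> \<le> e"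
proof -
  have "compact (\<phi> ` cball 0 R)"
    using c by (intro compact_continuous_image) (auto intro: continuous_on_subset)
  then have "bounded (\<phi> ` cball 0 R)" by (rule compact_imp_bounded)
  then obtain B0 where "\<forall>y\<in>cball 0 R. \<bar>\<phi> y\<bar> \<le> B0"
    unfolding bounded_iff by auto
  note B0 = this[rule_format]
  define B where "B = max B0 1"
  have B: "\<bar>\<phi> y\<bar> \<le> B" "0 < B" for y
    using B0[of y] z[of y] by (cases "norm y \<le> R"; auto simp: B_def)+
  have "uniformly_continuous_on (cball 0 (R + 1)) \<phi>"
    using c by (intro compact_uniformly_continuous) (auto intro: continuous_on_subset)
  then obtain \<delta>0 where \<delta>0: "0 < \<delta>0" "\<And>y y'. \<lbrakk>y \<in> cball 0 (R + 1); y' \<in> cball 0 (R + 1); dist y' y < \<delta>0\<rbrakk> \<Longrightarrow> dist (\<phi> y') (\<phi> y) < e"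
    using e unfolding uniformly_continuous_on_def by metis
  define \<delta> where "\<delta> = min \<delta>0 1"
  have \<delta>: "0 < \<delta>" "\<delta> \<le> 1" "\<delta> \<le> \<delta>0" using \<delta>0 by (auto simp: \<delta>_def)
  have unif: "\<bar>\<phi> y - \<phi> w\<bar> \<le> e" if "norm (y - w) < \<delta>" for y w
  proof (cases "norm y \<le> R \<or> norm w \<le> R")
    case True
    have "norm y \<le> norm w + norm (y - w)" "norm w \<le> norm y + norm (y - w)"
      using norm_triangle_ineq2[of y w] norm_triangle_ineq2[of w y] by (simp_all add: norm_minus_commute)
    then have "norm y \<le> R + 1" "norm w \<le> R + 1" using True that \<delta>(2) by linarith+
    then show ?thesis using \<delta>0(2)[of w y] that \<delta>(3) by (auto simp: dist_norm)
  next
    case False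
    then show ?thesis using z[of y] z[of w] e by simp
  qed
  \<comment> \<open>At distance \<delta> or more the cone costs at least 2 B, so such points give
    values of at least B and never push the infimum below \<phi>. As \<delta> \<le> 1, the support
    grows by at most 1.\<close>
  define m where "m = 2 * B / \<delta>"
  have m: "0 < m" "m * \<delta> = 2 * B" using B(2) \<delta> by (auto simp: m_def)
  define \<psi> where "\<psi> y = (INF w. \<phi> w + m * norm (y - w))" for y
  have bd: "bdd_below (range (\<lambda>w. \<phi> w + m * norm (y - w)))" for y
  proof (rule bdd_belowI2)
    show "- B \<le> \<phi> w + m * norm (y - w)" for w using B(1)[of w] m(1) by (simp add: abs_le_iff add_increasing2)
  qed
  have up: "\<psi> y \<le> \<phi> w + m * norm (y - w)" for y w
    unfolding \<psi>_def by (rule cINF_lower[OF bd]) simp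
  have far: "B \<le> \<phi> w + m * norm (y - w)" if "\<delta> \<le> norm (y - w)" for y w
    using mult_left_mono[OF that, of m] m B(1)[of w] by (simp add: abs_le_iff)
  have low: "\<phi> y - e \<le> \<psi> y" for y
    unfolding \<psi>_def
  proof (rule cINF_greatest)
    fix w
    show "\<phi> y - e \<le> \<phi> w + m * norm (y - w)"
    proof (cases "norm (y - w) < \<delta>")
      case True
      have "0 \<le> m * norm (y - w)" using m by simp
      then show ?thesis using unif[OF True] by linarith
    next
      case False
      then show ?thesis using far[of y w] B(1)[of y] e by linarith
    qed
  qed simp
  show ?thesis
  proof (rule that[of m \<psi>])
    show "\<bar>\<phi> y - \<psi> y\<bar> \<le> e" for y using low[of y] up[of y y] e by simp
    show "lip_test m (R + 1) \<psi>"
    proof (rule lip_testI)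
      have half: "\<psi> x - m * norm (x - y) \<le> \<psi> y" for x y
        unfolding \<psi>_def[of y]
      proof (rule cINF_greatest)
        fix w
        have "m * norm (x - w) \<le> m * (norm (x - y) + norm (y - w))"
          using m norm_triangle_ineq[of "x - y" "y - w"] by (intro mult_left_mono) auto
        then show "\<psi> x - m * norm (x - y) \<le> \<phi> w + m * norm (y - w)"
          using up[of x w] by (simp add: distrib_left)
      qed simp
      show "\<bar>\<psi> x - \<psi> y\<bar> \<le> m * norm (x - y)" for x y
        using half[of x y] half[of y x] by (simp add: norm_minus_commute abs_le_iff)
      show "\<psi> y = 0" if y: "R + 1 \<le> norm y" for y
      proof (rule antisym)
        show "\<psi> y \<le> 0" using up[of y y] z[of y] y by simp
        show "0 \<le> \<psi> y" unfolding \<psi>_def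
        proof (rule cINF_greatest)
          fix w
          show "0 \<le> \<phi> w + m * norm (y - w)"
          proof (cases "norm (y - w) < \<delta>")
            case True
            have "R \<le> norm w" using norm_triangle_ineq2[of y w] True \<delta>(2) y by linarith
            then show ?thesis using z[of w] m by simp
          next
            case False
            then show ?thesis using far[of y w] B(2) by linarith
          qed
        qed simp
      qed
    qed (use m in simp)
  qed
qed

lemma compact_support_radius:
  fixes \<phi> :: "'a::euclidean_space \<Rightarrow> real"
  assumes "compact (closure {y. \<phi> y \<noteq> 0})"
  obtains R where "0 < R" "\<And>y. R \<le> norm y \<Longrightarrow> \<phi> y = 0"
proof -
  obtain b where b: "0 < b" "\<And>y. y \<in> closure {y. \<phi> y \<noteq> 0} \<Longrightarrow> norm y \<le> b"
    using compact_imp_bounded[OF assms] unfolding bounded_pos by blast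
  show ?thesis
  proof (rule that[of "b + 1"])
    show "\<phi> y = 0" if "b + 1 \<le> norm y" for y
      using b(2)[of y] closure_subset[of "{y. \<phi> y \<noteq> 0}"] that by (cases "\<phi> y = 0") auto
  qed (use b in simp)
qed

section \<open>Density, blow-ups and the tangent plane\<close>

context doubling_radon begin

lemma tangent_flatD:
  assumes "tangent_flat x d \<theta> W"
  shows "subspace W" "dim W = d" "0 < \<theta>" "dplane d W"
  using assms by (auto simp: tangent_flat_def dplane_subspace)

lemma tangent_flat_lim:
  assumes "tangent_flat x d \<theta> W" "lip_test M R \<psi>" "0 < R"
  shows "((\<lambda>r. centered_integral x (\<lambda>z. \<psi> ((1/r) *\<^sub>R z)) / r ^ d) \<longlongrightarrow> \<theta> * integral\<^sup>L (plane_measure d W) \<psi>) (at_right 0)"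
  using assms unfolding tangent_flat_def by blast

text \<open>The indicator of the unit ball is squeezed between \<open>plateau \<tau> 1\<close> and
  \<open>plateau \<tau> (1 + \<tau>)\<close>. Their plane integrals are at least
  \<open>(1 - \<tau>) ^ d\<close> and at most \<open>(1 + \<tau>) ^ d\<close>, and \<tau> is then
  taken small.\<close>

lemma tangent_flat_density:
  assumes F: "tangent_flat x d \<theta> W"
  shows "((\<lambda>r. measure \<mu> (ball x r) / r ^ d) \<longlongrightarrow> \<theta>) (at_right 0)"
proof (rule order_tendstoI)
  note W = tangent_flatD[OF F]
  note rad = radon_plane_measure[OF W(4)]
  have z: "0 \<in> W" using W(1) by (rule subspace_0)
  have int: "integrable \<mu> (\<lambda>y. plateau \<tau> s ((1/r) *\<^sub>R (y - x)))" if "0 < \<tau>" "0 < s" "0 < r" for \<tau> s r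
    using lip_test_shift_integrable[OF lip_test_scale[OF lip_test_plateau]] that by simp
  have lim1: "((\<lambda>\<tau>::real. \<theta> * (1 - \<tau>) ^ d) \<longlongrightarrow> \<theta> * (1 - 0) ^ d) (at_right 0)"
    "((\<lambda>\<tau>::real. \<theta> * (1 + \<tau>) ^ d) \<longlongrightarrow> \<theta> * (1 + 0) ^ d) (at_right 0)"
    by (intro tendsto_intros)+
  fix a assume a: "a < \<theta>"
  have "\<forall>\<^sub>F \<tau> in at_right 0. a < \<theta> * (1 - \<tau>) ^ d" using order_tendstoD(1)[OF lim1(1), of a] a by simp
  then obtain b where b: "0 < b" "\<And>\<tau>. 0 < \<tau> \<Longrightarrow> \<tau> < b \<Longrightarrow> a < \<theta> * (1 - \<tau>) ^ d"
    by (auto simp: eventually_at_right_field)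
  define \<tau> where "\<tau> = min (b/2) (1/2)"
  have \<tau>: "0 < \<tau>" "\<tau> < 1" "a < \<theta> * (1 - \<tau>) ^ d" using b by (auto simp: \<tau>_def)
  have "1 * measure (plane_measure d W) (ball 0 (1 - \<tau>)) \<le> integral\<^sup>L (plane_measure d W) (plateau \<tau> 1)"
  proof (rule radon_integral_ge[OF rad lip_test_integrable[OF rad lip_test_plateau[OF \<tau>(1)]]])
    show "1 \<le> plateau \<tau> 1 y" if "y \<in> ball 0 (1 - \<tau>)" for y :: 'a
      using that by (subst plateau_bounds(3)[OF \<tau>(1)]) auto
  qed (use plateau_bounds(1)[OF \<tau>(1)] in auto)
  then have "(1 - \<tau>) ^ d \<le> integral\<^sup>L (plane_measure d W) (plateau \<tau> 1)"
    using measure_plane_ball[OF W(4) z, of "1 - \<tau>"] \<tau> by simp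
  then have "a < \<theta> * integral\<^sup>L (plane_measure d W) (plateau \<tau> 1)"
    using \<tau>(3) W(3) by (meson less_le_trans mult_left_mono less_imp_le)
  then have "\<forall>\<^sub>F r in at_right 0. a < centered_integral x (\<lambda>z. plateau \<tau> 1 ((1/r) *\<^sub>R z)) / r ^ d"
    by (intro order_tendstoD(1)[OF tangent_flat_lim[OF F lip_test_plateau[OF \<tau>(1)]]]) auto
  moreover have "\<forall>\<^sub>F r in at_right (0::real). 0 < r" by (rule eventually_at_right_less)
  ultimately show "\<forall>\<^sub>F r in at_right 0. a < measure \<mu> (ball x r) / r ^ d"
  proof eventually_elim
    case (elim r)
    have "\<bar>centered_integral x (\<lambda>z. plateau \<tau> 1 ((1/r) *\<^sub>R z))\<bar> \<le> 1 * measure \<mu> (ball x r)"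
      unfolding centered_integral_def
    proof (rule radon_integral_bound[OF radon])
      show "(\<lambda>y. plateau \<tau> 1 ((1/r) *\<^sub>R (y - x))) \<in> borel_measurable borel"
        using lip_test_measurable[OF lip_test_shift[OF lip_test_scale[OF lip_test_plateau[OF \<tau>(1)] elim(2)] order_refl]] .
      show "plateau \<tau> 1 ((1/r) *\<^sub>R (y - x)) = 0" if "y \<notin> ball x r" for y
        using that elim(2) by (intro plateau_bounds(4)[OF \<tau>(1)]) (simp add: dist_norm norm_minus_commute)
      show "\<bar>plateau \<tau> 1 ((1/r) *\<^sub>R (y - x))\<bar> \<le> 1" for y
        using plateau_bounds(1,2)[OF \<tau>(1), of 1 "(1/r) *\<^sub>R (y - x)"] by simp
    qed auto
    then have "centered_integral x (\<lambda>z. plateau \<tau> 1 ((1/r) *\<^sub>R z)) / r ^ d \<le> measure \<mu> (ball x r) / r ^ d"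
      using elim(2) by (intro divide_right_mono) auto
    then show ?case using elim(1) by linarith
  qed
next
  note W = tangent_flatD[OF F]
  note rad = radon_plane_measure[OF W(4)]
  have z: "0 \<in> W" using W(1) by (rule subspace_0)
  have lim1: "((\<lambda>\<tau>::real. \<theta> * (1 + \<tau>) ^ d) \<longlongrightarrow> \<theta> * (1 + 0) ^ d) (at_right 0)"
    by (intro tendsto_intros)
  fix a assume a: "\<theta> < a"
  have "\<forall>\<^sub>F \<tau> in at_right 0. \<theta> * (1 + \<tau>) ^ d < a" using order_tendstoD(2)[OF lim1, of a] a by simp
  then obtain b where b: "0 < b" "\<And>\<tau>. 0 < \<tau> \<Longrightarrow> \<tau> < b \<Longrightarrow> \<theta> * (1 + \<tau>) ^ d < a"
    by (auto simp: eventually_at_right_field)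
  define \<tau> where "\<tau> = b/2"
  have \<tau>: "0 < \<tau>" "\<theta> * (1 + \<tau>) ^ d < a" using b by (auto simp: \<tau>_def)
  have "\<bar>integral\<^sup>L (plane_measure d W) (plateau \<tau> (1 + \<tau>))\<bar> \<le> 1 * measure (plane_measure d W) (ball 0 (1 + \<tau>))"
  proof (rule radon_integral_bound[OF rad lip_test_measurable[OF lip_test_plateau[OF \<tau>(1)]]])
    show "\<bar>plateau \<tau> (1 + \<tau>) y\<bar> \<le> 1" for y :: 'a
      using plateau_bounds(1,2)[OF \<tau>(1), of "1 + \<tau>" y] by simp
    show "plateau \<tau> (1 + \<tau>) y = 0" if "y \<notin> ball 0 (1 + \<tau>)" for y :: 'a
      using that by (intro plateau_bounds(4)[OF \<tau>(1)]) simp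
  qed auto
  then have "integral\<^sup>L (plane_measure d W) (plateau \<tau> (1 + \<tau>)) \<le> (1 + \<tau>) ^ d"
    using measure_plane_ball[OF W(4) z, of "1 + \<tau>"] \<tau> by simp
  then have "\<theta> * integral\<^sup>L (plane_measure d W) (plateau \<tau> (1 + \<tau>)) < a"
    using \<tau>(2) W(3) by (meson le_less_trans mult_left_mono less_imp_le)
  then have "\<forall>\<^sub>F r in at_right 0. centered_integral x (\<lambda>z. plateau \<tau> (1 + \<tau>) ((1/r) *\<^sub>R z)) / r ^ d < a"
    using \<tau> by (intro order_tendstoD(2)[OF tangent_flat_lim[OF F lip_test_plateau[OF \<tau>(1)]]]) auto
  moreover have "\<forall>\<^sub>F r in at_right (0::real). 0 < r" by (rule eventually_at_right_less)
  ultimately show "\<forall>\<^sub>F r in at_right 0. measure \<mu> (ball x r) / r ^ d < a"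
  proof eventually_elim
    case (elim r)
    have "1 * measure \<mu> (ball x r) \<le> centered_integral x (\<lambda>z. plateau \<tau> (1 + \<tau>) ((1/r) *\<^sub>R z))"
      unfolding centered_integral_def
    proof (rule radon_integral_ge[OF radon])
      show "integrable \<mu> (\<lambda>y. plateau \<tau> (1 + \<tau>) ((1/r) *\<^sub>R (y - x)))"
        using lip_test_shift_integrable[OF lip_test_scale[OF lip_test_plateau[OF \<tau>(1)] elim(2)]] \<tau> elim(2) by simp
      show "1 \<le> plateau \<tau> (1 + \<tau>) ((1/r) *\<^sub>R (y - x))" if "y \<in> ball x r" for y
        using that elim(2) by (subst plateau_bounds(3)[OF \<tau>(1)]) (simp_all add: dist_norm norm_minus_commute)
    qed (use plateau_bounds[OF \<tau>(1)] in auto)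
    then have "measure \<mu> (ball x r) / r ^ d \<le> centered_integral x (\<lambda>z. plateau \<tau> (1 + \<tau>) ((1/r) *\<^sub>R z)) / r ^ d"
      using elim(2) by (intro divide_right_mono) auto
    then show ?case using elim(1) by linarith
  qed
qed

text \<open>Uniform approximation by a Lipschitz function costs at most e times the rescaled mass of
  a fixed ball, and the density limit keeps that mass bounded as r tends to 0.\<close>

lemma tangent_flat_lim_continuous:
  fixes \<phi> :: "'a \<Rightarrow> real"
  assumes F: "tangent_flat x d \<theta> W" and c: "continuous_on UNIV \<phi>" and s: "compact (closure {y. \<phi> y \<noteq> 0})"
  shows "((\<lambda>r. centered_integral x (\<lambda>z. \<phi> ((1/r) *\<^sub>R z)) / r ^ d) \<longlongrightarrow> \<theta> * integral\<^sup>L (plane_measure d W) \<phi>) (at_right 0)"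
proof (rule tendstoI)
  fix \<eta> :: real assume \<eta>: "0 < \<eta>"
  note W = tangent_flatD[OF F]
  note rad = radon_plane_measure[OF W(4)]
  have z: "0 \<in> W" using W(1) by (rule subspace_0)
  obtain R where R: "0 < R" "\<And>y. R \<le> norm y \<Longrightarrow> \<phi> y = 0"
    using compact_support_radius[OF s] by blast
  let ?S = "R + 1"
  \<comment> \<open>A common bound for \<theta> times the plane measure of the ball of radius R + 1
    and, eventually, for the rescaled \<mu>-mass of the corresponding ball.\<close>
  define q where "q = (\<theta> + 1) * ?S ^ d"
  have q: "0 < q" using W(3) R(1) by (simp add: q_def)
  define e where "e = \<eta> / 4 / q"
  have "0 < e" "e * q = \<eta>/4" using \<eta> q unfolding e_def by simp_all
  note e = this[unfolded q_def]
  obtain M \<psi> where \<psi>: "lip_test M ?S \<psi>" "\<And>y. \<bar>\<phi> y - \<psi> y\<bar> \<le> e"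
    using lipschitz_approximation[OF c R(2) R(1) e(1)] by blast
  have \<phi>m: "\<phi> \<in> borel_measurable borel" using c by (rule borel_measurable_continuous_onI)
  have \<psi>m: "\<psi> \<in> borel_measurable borel" by (rule lip_test_measurable[OF \<psi>(1)])
  have S: "0 < ?S" using R by simp
  have \<phi>b: "\<bar>\<phi> y\<bar> \<le> e + M * ?S" for y using \<psi>(2)[of y] lip_test_bound[OF \<psi>(1), of y] S by linarith
  have zero: "\<phi> y = 0" "\<psi> y = 0" if "?S \<le> norm y" for y
    using R(2)[of y] lip_test_zero[OF \<psi>(1), of y] that by auto
  have "\<bar>integral\<^sup>L (plane_measure d W) \<phi> - integral\<^sup>L (plane_measure d W) \<psi>\<bar> = \<bar>\<integral>p. \<phi> p - \<psi> p \<partial>plane_measure d W\<bar>"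
  proof (subst Bochner_Integration.integral_diff)
    show "integrable (plane_measure d W) \<phi>"
      by (rule radon_integrable[OF rad \<phi>m \<phi>b, of "ball 0 ?S"]) (use zero in auto)
    show "integrable (plane_measure d W) \<psi>" by (rule lip_test_integrable[OF rad \<psi>(1)]) (use S in simp)
  qed simp
  also have "\<dots> \<le> e * measure (plane_measure d W) (ball 0 ?S)"
    using \<phi>m \<psi>m \<psi>(2) zero by (intro radon_integral_bound[OF rad]) auto
  also have "\<dots> = e * ?S ^ d" using measure_plane_ball[OF W(4) z S] by simp
  finally have "\<theta> * \<bar>integral\<^sup>L (plane_measure d W) \<phi> - integral\<^sup>L (plane_measure d W) \<psi>\<bar> \<le> \<theta> * (e * ?S ^ d)"
    using W(3) by (intro mult_left_mono) auto
  also have "\<dots> \<le> e * ((\<theta> + 1) * ?S ^ d)" using e(1) S by (simp add: algebra_simps)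
  finally have J: "\<bar>\<theta> * integral\<^sup>L (plane_measure d W) \<phi> - \<theta> * integral\<^sup>L (plane_measure d W) \<psi>\<bar> \<le> \<eta>/4"
    using W(3) e(2) by (simp only: right_diff_distrib[symmetric] abs_mult abs_of_pos)
  have "((\<lambda>r. measure \<mu> (ball x (?S * r)) / (?S * r) ^ d) \<longlongrightarrow> \<theta>) (at_right 0)"
  proof (rule filterlim_compose[OF tangent_flat_density[OF F]])
    show "filterlim (\<lambda>r. ?S * r) (at_right 0) (at_right 0)"
      using S filterlim_times_pos[of "\<lambda>x::real. x" 0 "at_right 0" ?S 0] by (simp add: filterlim_ident)
  qed
  then have "\<forall>\<^sub>F r in at_right 0. measure \<mu> (ball x (?S * r)) / (?S * r) ^ d < \<theta> + 1"
    by (rule order_tendstoD) simp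
  moreover have "\<forall>\<^sub>F r in at_right 0. dist (centered_integral x (\<lambda>z. \<psi> ((1/r) *\<^sub>R z)) / r ^ d) (\<theta> * integral\<^sup>L (plane_measure d W) \<psi>) < \<eta>/4"
    using tangent_flat_lim[OF F \<psi>(1) S] \<eta> by (intro tendstoD) auto
  moreover have "\<forall>\<^sub>F r in at_right (0::real). 0 < r" by (rule eventually_at_right_less)
  ultimately show "\<forall>\<^sub>F r in at_right 0. dist (centered_integral x (\<lambda>z. \<phi> ((1/r) *\<^sub>R z)) / r ^ d) (\<theta> * integral\<^sup>L (plane_measure d W) \<phi>) < \<eta>"
  proof eventually_elim
    case (elim r)
    have r: "0 < r" using elim by simp
    let ?\<phi> = "\<lambda>y. \<phi> ((1/r) *\<^sub>R (y - x))" and ?\<psi> = "\<lambda>y. \<psi> ((1/r) *\<^sub>R (y - x))"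
    have zr: "?\<phi> y = 0" "?\<psi> y = 0" if "y \<notin> ball x (?S * r)" for y
    proof -
      have "?S \<le> norm ((1/r) *\<^sub>R (y - x))" using that r by (simp add: dist_norm norm_minus_commute pos_le_divide_eq)
      then show "?\<phi> y = 0" "?\<psi> y = 0" using zero by auto
    qed
    have mg: "(\<lambda>y. (1/r) *\<^sub>R (y - x)) \<in> borel_measurable borel"
      by (intro borel_measurable_continuous_onI continuous_intros)
    note mr = measurable_compose[OF mg \<phi>m] measurable_compose[OF mg \<psi>m]
    have "\<bar>centered_integral x (\<lambda>z. \<phi> ((1/r) *\<^sub>R z)) - centered_integral x (\<lambda>z. \<psi> ((1/r) *\<^sub>R z))\<bar> = \<bar>\<integral>y. ?\<phi> y - ?\<psi> y \<partial>\<mu>\<bar>"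
      unfolding centered_integral_def
    proof (subst Bochner_Integration.integral_diff)
      show "integrable \<mu> ?\<phi>"
        by (rule radon_integrable[OF radon mr(1) \<phi>b, of "ball x (?S * r)"]) (use zr in auto)
      show "integrable \<mu> ?\<psi>"
        by (rule radon_integrable[OF radon mr(2) lip_test_bound[OF \<psi>(1)], of "ball x (?S * r)"]) (use zr S in auto)
    qed simp
    also have "\<dots> \<le> e * measure \<mu> (ball x (?S * r))"
      using mr \<psi>(2) zr by (intro radon_integral_bound[OF radon]) auto
    also have "\<dots> \<le> e * ((\<theta> + 1) * (?S * r) ^ d)"
      using elim(1) e(1) S r by (intro mult_left_mono) (simp_all add: pos_divide_less_eq)
    also have "\<dots> = (\<eta>/4) * r ^ d" using e(2) by (simp add: power_mult_distrib mult_ac)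
    finally have "\<bar>centered_integral x (\<lambda>z. \<phi> ((1/r) *\<^sub>R z)) / r ^ d - centered_integral x (\<lambda>z. \<psi> ((1/r) *\<^sub>R z)) / r ^ d\<bar> \<le> \<eta>/4"
      using r by (simp add: diff_divide_distrib[symmetric] abs_divide pos_divide_le_eq)
    then show ?case using J elim(2) \<eta> unfolding dist_real_def by linarith
  qed
qed

lemma tangent_flat_blowup:
  assumes F: "tangent_flat x d \<theta> W" and x: "x \<in> \<Sigma>"
  shows "weakly_converges (blowup \<mu> x) (plane_measure d W) (at_right 0)"
  unfolding weakly_converges_def
proof (intro allI impI, elim conjE)
  fix \<phi> :: "'a \<Rightarrow> real" assume c: "continuous_on UNIV \<phi>" and s: "compact (closure {y. \<phi> y \<noteq> 0})"
  note W = tangent_flatD[OF F]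
  have "((\<lambda>r. (centered_integral x (\<lambda>z. \<phi> ((1/r) *\<^sub>R z)) / r ^ d) / (measure \<mu> (ball x r) / r ^ d)) \<longlongrightarrow>
      (\<theta> * integral\<^sup>L (plane_measure d W) \<phi>) / \<theta>) (at_right 0)"
    using W(3) by (intro tendsto_divide tangent_flat_lim_continuous[OF F c s] tangent_flat_density[OF F]) auto
  then have "((\<lambda>r. (centered_integral x (\<lambda>z. \<phi> ((1/r) *\<^sub>R z)) / r ^ d) / (measure \<mu> (ball x r) / r ^ d)) \<longlongrightarrow>
      integral\<^sup>L (plane_measure d W) \<phi>) (at_right 0)" using W(3) by simp
  then show "((\<lambda>r. integral\<^sup>L (blowup \<mu> x r) \<phi>) \<longlongrightarrow> integral\<^sup>L (plane_measure d W) \<phi>) (at_right 0)"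
  proof (rule Lim_transform_eventually)
    show "\<forall>\<^sub>F r in at_right 0. centered_integral x (\<lambda>z. \<phi> ((1/r) *\<^sub>R z)) / r ^ d / (measure \<mu> (ball x r) / r ^ d) = integral\<^sup>L (blowup \<mu> x r) \<phi>"
      using eventually_at_right_less[of "0::real"]
    proof eventually_elim
      case (elim r)
      show ?case
        using integral_blowup[OF x elim borel_measurable_continuous_onI[OF c]] elim by simp
    qed
  qed
qed

text \<open>A support point y in \<open>ball x r\<close> far from the plane would, by doubling,
  carry a fixed fraction of the mass of \<open>ball x r\<close> in a small ball around it. A test
  function vanishing on W sees this mass, while its rescaled integrals tend to 0.\<close>

lemma tangent_flat_tangent_plane:
  assumes F: "tangent_flat x d \<theta> W" and x: "x \<in> \<Sigma>"
  shows "tangent_plane d \<Sigma> x ((+) x ` W)"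
  unfolding tangent_plane_def
proof (intro conjI)
  note W = tangent_flatD[OF F]
  let ?V = "(+) x ` W"
  have V: "dplane d ?V" by (rule dplane_translate[OF W(1,2)])
  show "affine ?V" "aff_dim ?V = int d" using V by (auto simp: dplane_def)
  show xV: "x \<in> ?V" using subspace_0[OF W(1)] by force
  show "((\<lambda>r. (1/r) * (SUP y\<in>\<Sigma> \<inter> ball x r. infdist y ?V)) \<longlongrightarrow> 0) (at_right 0)"
  proof (rule tendstoI)
    fix e :: real assume e: "0 < e"
    define \<eta> where "\<eta> = min (e/2) 1"
    have \<eta>: "0 < \<eta>" "\<eta> \<le> 1" "\<eta> < e" using e by (auto simp: \<eta>_def)
    obtain K where K: "1 \<le> K" "\<And>y r. y \<in> \<Sigma> \<Longrightarrow> 0 < r \<Longrightarrow> measure \<mu> (ball y r) \<le> K * measure \<mu> (ball y (\<eta>/4 * r))"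
      using doubling_ratio[of "\<eta>/4"] \<eta> by auto
    \<comment> \<open>Radius 3 leaves the tent at least 1 on the rescaled points that matter, whose
      norm is at most 2, so there the distance to W is not cut off below \<eta>/2.\<close>
    define \<psi> where "\<psi> z = min (infdist z W) (tent 3 z)" for z
    have lt: "lip_test 1 3 \<psi>" unfolding \<psi>_def[abs_def] by (rule lip_test_min_infdist)
    have "integral\<^sup>L (plane_measure d W) \<psi> = 0"
      by (rule integral_plane_zero[OF W(4)]) (simp add: \<psi>_def tent_def)
    then have "((\<lambda>r. centered_integral x (\<lambda>z. \<psi> ((1/r) *\<^sub>R z)) / r ^ d) \<longlongrightarrow> 0) (at_right 0)"
      using tangent_flat_lim[OF F lt] by simp
    then have "\<forall>\<^sub>F r in at_right 0. centered_integral x (\<lambda>z. \<psi> ((1/r) *\<^sub>R z)) / r ^ d < \<eta> / 2 * (\<theta>/2) / K"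
      using W(3) \<eta> K by (intro order_tendstoD) auto
    moreover have "\<forall>\<^sub>F r in at_right 0. \<theta>/2 < measure \<mu> (ball x r) / r ^ d"
      using tangent_flat_density[OF F] W(3) by (intro order_tendstoD) auto
    moreover have "\<forall>\<^sub>F r in at_right (0::real). 0 < r" by (rule eventually_at_right_less)
    ultimately show "\<forall>\<^sub>F r in at_right 0. dist ((1/r) * (SUP y\<in>\<Sigma> \<inter> ball x r. infdist y ?V)) 0 < e"
    proof eventually_elim
      case (elim r)
      have r: "0 < r" using elim by simp
      have close: "infdist y ?V \<le> \<eta> * r" if y: "y \<in> \<Sigma> \<inter> ball x r" for y
      proof (rule ccontr)
        assume far: "\<not> infdist y ?V \<le> \<eta> * r"
        have "measure \<mu> (ball x r) \<le> measure \<mu> (ball y (2 * r))"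
          using y by (intro radon_measure_mono[OF radon]) (auto simp: ball_subset_ball_iff dist_commute)
        also have "\<dots> \<le> K * measure \<mu> (ball y (\<eta>/4 * (2 * r)))" using y r by (intro K) auto
        finally have A: "measure \<mu> (ball x r) \<le> K * measure \<mu> (ball y (\<eta> * r / 2))" by (simp add: mult_ac)
        have "(\<eta>/2) * measure \<mu> (ball y (\<eta> * r / 2)) \<le> centered_integral x (\<lambda>z. \<psi> ((1/r) *\<^sub>R z))"
          unfolding centered_integral_def
        proof (rule radon_integral_ge[OF radon])
          show "integrable \<mu> (\<lambda>y. \<psi> ((1/r) *\<^sub>R (y - x)))"
            using lip_test_shift_integrable[OF lip_test_scale[OF lt r]] r by simp
          show "0 \<le> \<psi> z" for z unfolding \<psi>_def by (simp add: infdist_nonneg tent_def)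
          show "\<eta>/2 \<le> \<psi> ((1/r) *\<^sub>R (z - x))" if z: "z \<in> ball y (\<eta> * r / 2)" for z
          proof -
            have zV: "\<eta> * r / 2 \<le> infdist z ?V"
              using far z infdist_triangle[of y ?V z] by simp
            have "\<eta>/2 \<le> dist ((1/r) *\<^sub>R (z - x)) p" if p: "p \<in> W" for p
            proof -
              have "x + r *\<^sub>R p \<in> ?V" using p W(1) by (simp add: subspace_scale)
              then have "infdist z ?V \<le> dist z (x + r *\<^sub>R p)" by (rule infdist_le)
              also have "\<dots> = norm (r *\<^sub>R ((1/r) *\<^sub>R (z - x) - p))"
                using r by (simp add: dist_norm scaleR_diff_right algebra_simps)
              also have "\<dots> = r * dist ((1/r) *\<^sub>R (z - x)) p" using r by (simp add: dist_norm)
              finally have "r * (\<eta>/2) \<le> r * dist ((1/r) *\<^sub>R (z - x)) p" using zV by (simp add: mult.commute)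
              then show ?thesis using r by (simp only: mult_le_cancel_left_pos)
            qed
            then have "\<eta>/2 \<le> infdist ((1/r) *\<^sub>R (z - x)) W"
              unfolding infdist_notempty[OF dplane_nonempty[OF W(4)]]
              by (rule cINF_greatest[OF dplane_nonempty[OF W(4)]])
            moreover have "norm ((1/r) *\<^sub>R (z - x)) \<le> 2"
            proof -
              have "norm (z - x) \<le> norm (z - y) + norm (y - x)" using norm_triangle_ineq[of "z - y" "y - x"] by simp
              also have "\<dots> \<le> \<eta> * r / 2 + r" using z y by (simp add: dist_norm norm_minus_commute)
              also have "\<dots> \<le> 2 * r" using \<eta>(2) mult_right_mono[OF \<eta>(2), of r] r by simp
              finally show ?thesis using r by (simp add: pos_divide_le_eq)
            qed
            ultimately show ?thesis using \<eta>(2) by (simp add: \<psi>_def tent_def)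
          qed
        qed auto
        also have "\<dots> < (\<eta> / 2 * (\<theta>/2) / K) * r ^ d" using elim(1) r by (simp add: pos_divide_less_eq)
        finally have "(\<eta>/2) * (K * measure \<mu> (ball y (\<eta> * r / 2))) < (\<eta>/2) * ((\<theta>/2) * r ^ d)"
          using K by (simp add: field_simps)
        then have "K * measure \<mu> (ball y (\<eta> * r / 2)) < (\<theta>/2) * r ^ d"
          using \<eta> by (simp only: mult_less_cancel_left_pos half_gt_zero)
        also have "\<dots> < measure \<mu> (ball x r)" using elim(2) r by (simp add: pos_less_divide_eq)
        finally show False using A by simp
      qed
      have ne: "\<Sigma> \<inter> ball x r \<noteq> {}" using x r by auto
      have "(SUP y\<in>\<Sigma> \<inter> ball x r. infdist y ?V) \<le> \<eta> * r" by (rule cSUP_least[OF ne close])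
      then have "(1/r) * (SUP y\<in>\<Sigma> \<inter> ball x r. infdist y ?V) \<le> \<eta>" using r by (simp add: pos_divide_le_eq)
      moreover have "infdist x ?V \<le> (SUP y\<in>\<Sigma> \<inter> ball x r. infdist y ?V)"
        using x r close by (intro cSUP_upper bdd_aboveI2) auto
      then have "0 \<le> (1/r) * (SUP y\<in>\<Sigma> \<inter> ball x r. infdist y ?V)" using infdist_nonneg[of x ?V] r by simp
      ultimately show ?case using \<eta>(3) unfolding dist_real_def by linarith
    qed
  qed
qed

end

text \<open>The indicator of a bounded open set is the increasing limit of the continuous functions
  \<open>min 1 (k * infdist y (- X))\<close>, and the open boxes form an intersection-stable
  generator.\<close>

lemma radon_measure_eqI:
  fixes N1 N2 :: "'a::euclidean_space measure"
  assumes N1: "radon_measure N1" and N2: "radon_measure N2"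
    and eq: "\<And>\<phi>::'a \<Rightarrow> real. continuous_on UNIV \<phi> \<Longrightarrow> compact (closure {y. \<phi> y \<noteq> 0}) \<Longrightarrow> integral\<^sup>L N1 \<phi> = integral\<^sup>L N2 \<phi>"
  shows "N1 = N2"
proof (rule measure_eqI_generator_eq[where A = "\<lambda>i::nat. box (- (real i *\<^sub>R One)) (real i *\<^sub>R One)" and E = "range (\<lambda>(a, b). box a b)" and \<Omega> = UNIV])
  show "Int_stable (range (\<lambda>(a, b). box a b) :: 'a set set)"
    by (auto simp: Int_stable_def box_Int_box)
  show "sets N1 = sigma_sets UNIV (range (\<lambda>(a, b). box a b))" "sets N2 = sigma_sets UNIV (range (\<lambda>(a, b). box a b))"
    using radon_sets[OF N1] radon_sets[OF N2] by (simp_all add: borel_eq_box)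
  show "emeasure N1 (box (- (real i *\<^sub>R One)) (real i *\<^sub>R One)) \<noteq> \<infinity>" for i
    using radon_emeasure_bounded_finite[OF N1, of "box (- (real i *\<^sub>R One)) (real i *\<^sub>R One)"] by simp
  show "(\<Union>i. box (- (real i *\<^sub>R One)) (real i *\<^sub>R One)) = (UNIV :: 'a set)" by (rule UN_box_eq_UNIV)
  fix X :: "'a set" assume "X \<in> range (\<lambda>(a, b). box a b)"
  then have X: "open X" "bounded X" by auto
  show "emeasure N1 X = emeasure N2 X"
  \<comment> \<open>For X = UNIV the complement is empty, and \<open>infdist\<close> to the empty
    set is 0 by convention, so the functions below would vanish.\<close>
  proof (cases "X = UNIV")
    case True
    then show ?thesis using X not_bounded_UNIV by auto
  next
    case False
    then have ne: "- X \<noteq> {}" by auto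
    define f where "f k y = min 1 (real k * infdist y (- X))" for k and y :: 'a
    have fc: "continuous_on UNIV (f k)" for k
      unfolding f_def by (intro continuous_intros)
    have f0: "f k y = 0" if "y \<notin> X" for k y using that by (simp add: f_def)
    have fb: "0 \<le> f k y" "f k y \<le> 1" "\<bar>f k y\<bar> \<le> 1" for k y by (auto simp: f_def infdist_nonneg)
    have fm: "f k \<in> borel_measurable borel" for k by (rule borel_measurable_continuous_onI[OF fc])
    have fs: "compact (closure {y. f k y \<noteq> 0})" for k
      using f0 by (intro compact_closure[THEN iffD2] bounded_subset[OF X(2)]) auto
    have em: "emeasure N X = (SUP k. ennreal (integral\<^sup>L N (f k)))" if N: "radon_measure N" for N
    proof -
      have "(SUP k. ennreal (f k y)) = indicator X y" for y
      proof (cases "y \<in> X")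
        case True
        have pos: "0 < infdist y (- X)"
          using True X(1) ne by (intro infdist_pos_not_in_closed) auto
        obtain k :: nat where k: "1 < real k * infdist y (- X)" using reals_Archimedean3[OF pos] by blast
        have "(SUP k. ennreal (f k y)) = 1"
        proof (rule antisym)
          show "(SUP k. ennreal (f k y)) \<le> 1" using fb(2) by (intro SUP_least) simp
          have "f k y = 1" using k by (simp add: f_def)
          then show "1 \<le> (SUP k. ennreal (f k y))" by (intro SUP_upper2[of k]) auto
        qed
        then show ?thesis using True by simp
      next
        case False
        then show ?thesis by (simp add: f0)
      qed
      then have "emeasure N X = (\<integral>\<^sup>+y. (SUP k. ennreal (f k y)) \<partial>N)"
        using X radon_sets[OF N] by simp
      also have "\<dots> = (SUP k. \<integral>\<^sup>+y. ennreal (f k y) \<partial>N)"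
      proof (rule nn_integral_monotone_convergence_SUP)
        show "incseq (\<lambda>k y. ennreal (f k y))"
          unfolding incseq_def le_fun_def f_def
          by (auto intro!: ennreal_leI min.mono mult_right_mono infdist_nonneg)
        show "(\<lambda>y. ennreal (f k y)) \<in> borel_measurable N" for k
          using radon_borel_measurable[OF N fm[of k]] by simp
      qed
      also have "\<dots> = (SUP k. ennreal (integral\<^sup>L N (f k)))"
      proof (rule SUP_cong[OF refl])
        fix k
        show "(\<integral>\<^sup>+y. ennreal (f k y) \<partial>N) = ennreal (integral\<^sup>L N (f k))"
          using fb(1) by (intro nn_integral_eq_integral radon_integrable[OF N fm fb(3) f0 X(2)]) auto
      qed
      finally show ?thesis .
    qed
    show ?thesis unfolding em[OF N1] em[OF N2] using eq[OF fc fs] by simp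
  qed
qed auto

lemma radon_scale_measure:
  assumes "radon_measure N"
  shows "radon_measure (scale_measure (ennreal c) N)"
  using assms unfolding radon_measure_def by (simp add: ennreal_mult_less_top) blast

section \<open>Tangent measures, dyadic ratios and atoms\<close>

context doubling_radon begin

lemma integral_dilated:
  fixes \<phi> :: "'a \<Rightarrow> real"
  assumes m: "\<phi> \<in> borel_measurable borel" and c: "0 \<le> c"
  shows "integral\<^sup>L (scale_measure (ennreal c) (dilated_measure \<mu> x r)) \<phi> = c * centered_integral x (\<lambda>z. \<phi> ((1/r) *\<^sub>R z))"
proof -
  have "integral\<^sup>L (dilated_measure \<mu> x r) \<phi> = centered_integral x (\<lambda>z. \<phi> ((1/r) *\<^sub>R z))"
    unfolding dilated_measure_def centered_integral_def
    by (intro integral_distr m radon_borel_measurable[OF radon] borel_measurable_continuous_onI continuous_intros)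
  then show ?thesis
    using integral_scale_measure[OF c, of \<phi> "dilated_measure \<mu> x r"] m by (simp add: dilated_measure_def)
qed

text \<open>The tent has positive integral over W, so testing with it forces
  \<open>c k * r k ^ d\<close> to converge; all other test functions then give the same multiple of
  plane measure. For the converse any null sequence of radii will do.\<close>

lemma tangent_flat_tangent_measures:
  assumes F: "tangent_flat x d \<theta> W"
  shows "tangent_measures \<mu> x = {scale_measure (ennreal c) (plane_measure d W) | c::real. c \<ge> 0}"
proof (intro equalityI subsetI)
  note W = tangent_flatD[OF F]
  note rad = radon_plane_measure[OF W(4)]
  fix N assume "N \<in> tangent_measures \<mu> x"
  then obtain c r where N: "radon_measure N" and c: "\<And>k. c k \<ge> 0" and r: "\<And>k. r k > 0" "r \<longlonglongrightarrow> 0"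
    and conv: "weakly_converges (\<lambda>k. scale_measure (ennreal (c k)) (dilated_measure \<mu> x (r k))) N sequentially"
    by (auto simp: tangent_measures_def)
  have rl: "filterlim r (at_right 0) sequentially"
    using r by (auto simp: filterlim_at less_imp_neq[THEN not_sym] intro!: always_eventually)
  have lim1: "(\<lambda>k. c k * centered_integral x (\<lambda>z. \<phi> ((1/r k) *\<^sub>R z))) \<longlonglongrightarrow> integral\<^sup>L N \<phi>"
    and lim2: "(\<lambda>k. centered_integral x (\<lambda>z. \<phi> ((1/r k) *\<^sub>R z)) / r k ^ d) \<longlonglongrightarrow> \<theta> * integral\<^sup>L (plane_measure d W) \<phi>"
    if \<phi>: "continuous_on UNIV \<phi>" "compact (closure {y. \<phi> y \<noteq> 0})" for \<phi> :: "'a \<Rightarrow> real"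
  proof -
    show "(\<lambda>k. centered_integral x (\<lambda>z. \<phi> ((1/r k) *\<^sub>R z)) / r k ^ d) \<longlonglongrightarrow> \<theta> * integral\<^sup>L (plane_measure d W) \<phi>"
      using filterlim_compose[OF tangent_flat_lim_continuous[OF F \<phi>] rl] .
    have "(\<lambda>k. integral\<^sup>L (scale_measure (ennreal (c k)) (dilated_measure \<mu> x (r k))) \<phi>) \<longlonglongrightarrow> integral\<^sup>L N \<phi>"
      using conv \<phi> unfolding weakly_converges_def by blast
    then show "(\<lambda>k. c k * centered_integral x (\<lambda>z. \<phi> ((1/r k) *\<^sub>R z))) \<longlonglongrightarrow> integral\<^sup>L N \<phi>"
      using integral_dilated[OF borel_measurable_continuous_onI[OF \<phi>(1)] c] by simp
  qed
  let ?t = "tent 1 :: 'a \<Rightarrow> real"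
  have tc: "continuous_on UNIV ?t" by (rule lip_test_continuous[OF lip_test_tent])
  have ts: "compact (closure {y. ?t y \<noteq> 0})"
    by (intro compact_closure[THEN iffD2] bounded_subset[OF bounded_ball[of 0 1]]) (auto simp: tent_def)
  have d: "d \<le> DIM('a)" using W(2) dim_subset_UNIV[of W] by simp
  define \<kappa> where "\<kappa> = \<theta> * integral\<^sup>L (plane_measure d W) ?t"
  have \<kappa>: "0 < \<kappa>"
  proof -
    have "0 < tent_const TYPE('a) d"
      using tent_const_bounds(1)[OF d] by (rule less_le_trans[rotated]) simp
    then show ?thesis using W(3) integral_tent[OF W(1,2), of 1] by (simp add: \<kappa>_def)
  qed
  have "(\<lambda>k. (c k * centered_integral x (\<lambda>z. ?t ((1/r k) *\<^sub>R z))) / (centered_integral x (\<lambda>z. ?t ((1/r k) *\<^sub>R z)) / r k ^ d)) \<longlonglongrightarrow> integral\<^sup>L N ?t / \<kappa>"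
    using \<kappa> lim2[OF tc ts] by (intro tendsto_divide lim1[OF tc ts]) (auto simp: \<kappa>_def)
  moreover have "\<forall>\<^sub>F k in sequentially. 0 < centered_integral x (\<lambda>z. ?t ((1/r k) *\<^sub>R z)) / r k ^ d"
    using lim2[OF tc ts] \<kappa> unfolding \<kappa>_def by (rule order_tendstoD)
  then have "\<forall>\<^sub>F k in sequentially. (c k * centered_integral x (\<lambda>z. ?t ((1/r k) *\<^sub>R z))) / (centered_integral x (\<lambda>z. ?t ((1/r k) *\<^sub>R z)) / r k ^ d) = c k * r k ^ d"
  proof eventually_elim
    case (elim k)
    then have "centered_integral x (\<lambda>z. ?t ((1/r k) *\<^sub>R z)) \<noteq> 0" by auto
    then show ?case by simp
  qed
  ultimately have lim3: "(\<lambda>k. c k * r k ^ d) \<longlonglongrightarrow> integral\<^sup>L N ?t / \<kappa>" by (rule Lim_transform_eventually)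
  define a where "a = integral\<^sup>L N ?t / \<kappa> * \<theta>"
  have "0 \<le> integral\<^sup>L N ?t" by (rule integral_nonneg_AE) (simp add: tent_def)
  then have a: "0 \<le> a" using \<kappa> W(3) by (simp add: a_def)
  have "N = scale_measure (ennreal a) (plane_measure d W)"
  proof (rule radon_measure_eqI[OF N radon_scale_measure[OF rad]])
    fix \<phi> :: "'a \<Rightarrow> real" assume \<phi>: "continuous_on UNIV \<phi>" "compact (closure {y. \<phi> y \<noteq> 0})"
    have "(\<lambda>k. (c k * r k ^ d) * (centered_integral x (\<lambda>z. \<phi> ((1/r k) *\<^sub>R z)) / r k ^ d)) \<longlonglongrightarrow>
        integral\<^sup>L N ?t / \<kappa> * (\<theta> * integral\<^sup>L (plane_measure d W) \<phi>)"
      by (intro tendsto_mult lim3 lim2[OF \<phi>])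
    moreover have "(c k * r k ^ d) * (centered_integral x (\<lambda>z. \<phi> ((1/r k) *\<^sub>R z)) / r k ^ d) = c k * centered_integral x (\<lambda>z. \<phi> ((1/r k) *\<^sub>R z))" for k
      using r(1)[of k] by simp
    ultimately have "integral\<^sup>L N \<phi> = integral\<^sup>L N ?t / \<kappa> * (\<theta> * integral\<^sup>L (plane_measure d W) \<phi>)"
      using LIMSEQ_unique[OF lim1[OF \<phi>]] by simp
    also have "\<dots> = integral\<^sup>L (scale_measure (ennreal a) (plane_measure d W)) \<phi>"
      using integral_scale_measure[OF a, of \<phi> "plane_measure d W"] borel_measurable_continuous_onI[OF \<phi>(1)]
      by (simp add: a_def)
    finally show "integral\<^sup>L N \<phi> = integral\<^sup>L (scale_measure (ennreal a) (plane_measure d W)) \<phi>" .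
  qed
  then show "N \<in> {scale_measure (ennreal c) (plane_measure d W) | c::real. c \<ge> 0}" using a by blast
next
  note W = tangent_flatD[OF F]
  note rad = radon_plane_measure[OF W(4)]
  fix N assume "N \<in> {scale_measure (ennreal c) (plane_measure d W) | c::real. c \<ge> 0}"
  then obtain a where a: "0 \<le> a" and N: "N = scale_measure (ennreal a) (plane_measure d W)" by blast
  define r where "r k = 1 / real (Suc k)" for k
  \<comment> \<open>This cancels both the factor \<open>r k ^ d\<close> lost by dilation and the
    density \<theta>.\<close>
  define c where "c k = a / (\<theta> * r k ^ d)" for k
  have r: "0 < r k" "r \<longlonglongrightarrow> 0" for k
    unfolding r_def using LIMSEQ_inverse_real_of_nat by (simp_all only: inverse_eq_divide) simp
  have rl: "filterlim r (at_right 0) sequentially"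
    using r by (auto simp: filterlim_at less_imp_neq[THEN not_sym] intro!: always_eventually)
  have c: "0 \<le> c k" for k using a W(3) r(1)[of k] unfolding c_def by (intro divide_nonneg_nonneg mult_nonneg_nonneg) auto
  have "weakly_converges (\<lambda>k. scale_measure (ennreal (c k)) (dilated_measure \<mu> x (r k))) N sequentially"
    unfolding weakly_converges_def
  proof (intro allI impI, elim conjE)
    fix \<phi> :: "'a \<Rightarrow> real" assume \<phi>: "continuous_on UNIV \<phi>" "compact (closure {y. \<phi> y \<noteq> 0})"
    note m = borel_measurable_continuous_onI[OF \<phi>(1)]
    have "(\<lambda>k. (a / \<theta>) * (centered_integral x (\<lambda>z. \<phi> ((1/r k) *\<^sub>R z)) / r k ^ d)) \<longlonglongrightarrow> (a / \<theta>) * (\<theta> * integral\<^sup>L (plane_measure d W) \<phi>)"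
      by (intro tendsto_mult_left filterlim_compose[OF tangent_flat_lim_continuous[OF F \<phi>] rl])
    moreover have "(a / \<theta>) * (centered_integral x (\<lambda>z. \<phi> ((1/r k) *\<^sub>R z)) / r k ^ d)
        = integral\<^sup>L (scale_measure (ennreal (c k)) (dilated_measure \<mu> x (r k))) \<phi>" for k
      unfolding integral_dilated[OF m c] by (simp add: c_def)
    moreover have "(a / \<theta>) * (\<theta> * integral\<^sup>L (plane_measure d W) \<phi>) = integral\<^sup>L N \<phi>"
      unfolding N using integral_scale_measure[OF a, of \<phi> "plane_measure d W"] m W(3) by simp
    ultimately show "(\<lambda>k. integral\<^sup>L (scale_measure (ennreal (c k)) (dilated_measure \<mu> x (r k))) \<phi>) \<longlonglongrightarrow> integral\<^sup>L N \<phi>" by simp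
  qed
  then show "N \<in> tangent_measures \<mu> x"
    unfolding tangent_measures_def using r c radon_scale_measure[OF rad, of a] N by blast
qed

lemma dyadic_at_right: "filterlim (\<lambda>k. (1/2::real) ^ k) (at_right 0) sequentially"
  using LIMSEQ_power_zero[of "1/2::real"] by (auto simp: filterlim_at intro: always_eventually)

lemma tangent_flat_ratio:
  assumes F: "tangent_flat x d \<theta> W"
  shows "(\<lambda>k. measure \<mu> (ball x ((1/2) ^ Suc k)) / measure \<mu> (ball x ((1/2) ^ k))) \<longlonglongrightarrow> (1/2) ^ d"
proof -
  note W = tangent_flatD[OF F]
  let ?f = "\<lambda>k. measure \<mu> (ball x ((1/2) ^ k)) / ((1/2) ^ k) ^ d"
  have f: "?f \<longlonglongrightarrow> \<theta>" using filterlim_compose[OF tangent_flat_density[OF F] dyadic_at_right] .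
  have "(\<lambda>k. (1/2) ^ d * (?f (Suc k) / ?f k)) \<longlonglongrightarrow> (1/2) ^ d * (\<theta> / \<theta>)"
    using W(3) by (intro tendsto_mult_left tendsto_divide f LIMSEQ_Suc[OF f]) auto
  moreover have "(1/2) ^ d * (?f (Suc k) / ?f k) = measure \<mu> (ball x ((1/2) ^ Suc k)) / measure \<mu> (ball x ((1/2) ^ k))" for k
    by (simp add: power_mult_distrib power_divide field_simps)
  ultimately show ?thesis using W(3) by simp
qed

lemma measure_singleton_limit:
  "((\<lambda>k. measure \<mu> (ball x ((1/2) ^ k))) \<longlonglongrightarrow> measure \<mu> {x})"
proof -
  have "(\<Inter>k. ball x ((1/2) ^ k)) = {x}"
  proof (intro equalityI subsetI)
    fix y assume y: "y \<in> (\<Inter>k. ball x ((1/2) ^ k))"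
    show "y \<in> {x}"
    proof (rule ccontr)
      assume "y \<notin> {x}"
      then obtain k where "(1/2) ^ k < dist x y" using real_arch_pow_inv[of "dist x y" "1/2"] by auto
      moreover have "dist x y < (1/2) ^ k" using y by auto
      ultimately show False by simp
    qed
  qed auto
  moreover have "(\<lambda>k. measure \<mu> (ball x ((1/2) ^ k))) \<longlonglongrightarrow> measure \<mu> (\<Inter>k. ball x ((1/2) ^ k))"
  proof (rule Lim_measure_decseq)
    show "range (\<lambda>k. ball x ((1/2) ^ k)) \<subseteq> sets \<mu>" using sets_mu by (auto simp: image_subset_iff)
    show "decseq (\<lambda>k. ball x ((1/2) ^ k))"
      by (intro decseq_SucI subset_ball) simp
    show "emeasure \<mu> (ball x ((1/2) ^ k)) \<noteq> \<infinity>" for k by (simp add: emeasure_ball)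
  qed
  ultimately show ?thesis by simp
qed

lemma tangent_flat_atom:
  assumes F: "tangent_flat x 0 \<theta> W"
  shows "0 < emeasure \<mu> {x}"
proof -
  have "(\<lambda>k. measure \<mu> (ball x ((1/2) ^ k))) \<longlonglongrightarrow> \<theta>"
    using filterlim_compose[OF tangent_flat_density[OF F] dyadic_at_right] by simp
  then have "measure \<mu> {x} = \<theta>" using LIMSEQ_unique[OF measure_singleton_limit] by blast
  then show ?thesis
    using tangent_flatD(3)[OF F] radon_emeasure_eq_measure[OF radon, of "{x}"] by simp
qed

text \<open>Suppose y in the support has distance t from x. The ball of radius 2t about y contains
  x, so doubling twice leaves at least \<mu>{x}/C^2 in the ball of radius t/2, which misses x. But
  punctured balls about x have mass tending to 0.\<close>

lemma atom_isolated:
  assumes a: "0 < emeasure \<mu> {x}"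
  obtains s where "0 < s" "\<Sigma> \<inter> ball x s \<subseteq> {x}" "\<And>r. 0 < r \<Longrightarrow> r \<le> s \<Longrightarrow> emeasure \<mu> (ball x r - {x}) = 0"
proof -
  have ma: "0 < measure \<mu> {x}" using a radon_emeasure_eq_measure[OF radon, of "{x}"] by simp
  have "(\<lambda>k. measure \<mu> (ball x ((1/2) ^ k)) - measure \<mu> {x}) \<longlonglongrightarrow> measure \<mu> {x} - measure \<mu> {x}"
    by (intro tendsto_diff measure_singleton_limit tendsto_const)
  then have "\<forall>\<^sub>F k in sequentially. measure \<mu> (ball x ((1/2) ^ k)) - measure \<mu> {x} < measure \<mu> {x} / C\<^sup>2"
    using ma C by (intro order_tendstoD) auto
  then obtain k where k: "measure \<mu> (ball x ((1/2) ^ k)) - measure \<mu> {x} < measure \<mu> {x} / C\<^sup>2"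
    by (auto simp: eventually_sequentially)
  define s where "s = (1/2::real) ^ k / 2"
  have s: "0 < s" by (simp add: s_def)
  have iso: "\<Sigma> \<inter> ball x s \<subseteq> {x}"
  proof (rule ccontr)
    assume "\<not> ?thesis"
    then have "\<exists>y. y \<in> \<Sigma> \<and> dist x y < s \<and> y \<noteq> x" by (auto simp: subset_iff)
    then obtain y where y: "y \<in> \<Sigma>" "dist x y < s" "y \<noteq> x" by blast
    define t where "t = dist x y"
    have t: "0 < t" "t < s" using y by (auto simp: t_def)
    have "measure \<mu> {x} \<le> measure \<mu> (ball y (2 ^ 2 * (t/2)))"
      using t by (intro radon_measure_mono[OF radon]) (auto simp: t_def dist_commute)
    also have "\<dots> \<le> C\<^sup>2 * measure \<mu> (ball y (t/2))" using t by (intro doubling_iterate y) auto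
    finally have A: "measure \<mu> {x} / C\<^sup>2 \<le> measure \<mu> (ball y (t/2))" using C by (simp add: divide_le_eq mult.commute)
    have sub: "ball y (t/2) \<subseteq> ball x ((1/2) ^ k) - {x}"
    proof
      fix z assume "z \<in> ball y (t/2)"
      then have "dist y z < t/2" by simp
      then have "dist x z < 2 * s" using dist_triangle[of x z y] t unfolding t_def by linarith
      moreover have "z \<noteq> x" using \<open>dist y z < t/2\<close> t by (auto simp: t_def dist_commute)
      ultimately have "dist x z < (1/2) ^ k" "z \<noteq> x" by (simp_all add: s_def)
      then show "z \<in> ball x ((1/2) ^ k) - {x}" by auto
    qed
    have "measure \<mu> (ball y (t/2)) \<le> measure \<mu> (ball x ((1/2) ^ k) - {x})"
      by (intro radon_measure_mono[OF radon sub]) (auto intro: bounded_subset[OF bounded_ball])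
    also have "\<dots> = measure \<mu> (ball x ((1/2) ^ k)) - measure \<mu> {x}"
      using sets_mu by (intro measure_Diff) (auto simp: emeasure_ball)
    finally show False using A k by linarith
  qed
  have "emeasure \<mu> (ball x r - {x}) = 0" if "0 < r" "r \<le> s" for r
  proof -
    \<comment> \<open>The punctured ball avoids the support, so each of its points has a null ball
      around it; by Lindelof countably many of these cover it.\<close>
    have loc: "\<exists>e>0. emeasure \<mu> (ball y e) = 0" if "y \<in> ball x r - {x}" for y
      using that \<open>r \<le> s\<close> iso by (force simp: msupport_def zero_less_iff_neq_zero)
    then obtain e where e: "\<And>y. y \<in> ball x r - {x} \<Longrightarrow> 0 < e y \<and> emeasure \<mu> (ball y (e y)) = 0" by metis
    obtain F' where F': "F' \<subseteq> (\<lambda>y. ball y (e y)) ` (ball x r - {x})" "countable F'" "\<Union>F' = \<Union>((\<lambda>y. ball y (e y)) ` (ball x r - {x}))"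
      using Lindelof[of "(\<lambda>y. ball y (e y)) ` (ball x r - {x})"] by (metis (no_types, lifting) image_iff open_ball)
    have "ball x r - {x} \<subseteq> \<Union>F'" unfolding F'(3) using e by force
    moreover have "\<Union>F' \<in> null_sets \<mu>"
    proof -
      have "B \<in> null_sets \<mu>" if "B \<in> F'" for B
      proof -
        obtain y where "y \<in> ball x r - {x}" "B = ball y (e y)" using F'(1) \<open>B \<in> F'\<close> by blast
        then show ?thesis using e[of y] sets_mu by (simp add: null_sets_def)
      qed
      then show ?thesis using null_sets_UN'[OF F'(2), of "\<lambda>B. B" \<mu>] by simp
    qed
    ultimately show ?thesis
      using sets_mu by (metis (no_types, lifting) emeasure_mono le_zero_eq null_setsD1 null_setsD2)
  qed
  then show ?thesis by (rule that[OF s iso])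
qed

end

subsection \<open>Measurability of the decomposition\<close>

text \<open>Pigeonhole: rounding the bounded values at finitely many probes leaves finitely many
  codes, and one representative per code is a net. It is used for test functions, for affine planes
  and for subspaces.\<close>

lemma finite_net_of_probes:
  fixes val :: "'x \<Rightarrow> 'p \<Rightarrow> real"
  assumes P: "finite P" and B: "\<And>x p. x \<in> X \<Longrightarrow> p \<in> P \<Longrightarrow> \<bar>val x p\<bar> \<le> B" and \<epsilon>: "0 < \<epsilon>"
  obtains F where "finite F" "F \<subseteq> X" "\<And>x. x \<in> X \<Longrightarrow> \<exists>y\<in>F. \<forall>p\<in>P. \<bar>val x p - val y p\<bar> \<le> \<epsilon>"
proof -
  define code where "code x = (\<lambda>p\<in>P. \<lfloor>val x p / \<epsilon>\<rfloor>)" for x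
  define K where "K = \<lceil>\<bar>B\<bar> / \<epsilon>\<rceil> + 1"
  have "code x \<in> P \<rightarrow>\<^sub>E {-K..K}" if "x \<in> X" for x
  proof -
    have "- K \<le> \<lfloor>val x p / \<epsilon>\<rfloor> \<and> \<lfloor>val x p / \<epsilon>\<rfloor> \<le> K" if "p \<in> P" for p
    proof -
      have "\<bar>val x p / \<epsilon>\<bar> \<le> \<bar>B\<bar> / \<epsilon>"
        using B[OF \<open>x \<in> X\<close> that] \<epsilon> by (simp add: abs_divide divide_right_mono)
      then show ?thesis unfolding K_def by linarith
    qed
    then show ?thesis by (auto simp: code_def)
  qed
  then have "code ` X \<subseteq> P \<rightarrow>\<^sub>E {-K..K}" by blast
  then have fin: "finite (code ` X)" using finite_PiE[OF P, of "\<lambda>_. {-K..K}"] finite_subset by blast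
  define F where "F = inv_into X code ` (code ` X)"
  show ?thesis
  proof (rule that[of F])
    show "finite F" unfolding F_def using fin by simp
    show "F \<subseteq> X" unfolding F_def by (auto intro: inv_into_into)
    fix x assume x: "x \<in> X"
    let ?y = "inv_into X code (code x)"
    have "code ?y = code x" using x by (intro f_inv_into_f) auto
    then have *: "\<lfloor>val ?y p / \<epsilon>\<rfloor> = \<lfloor>val x p / \<epsilon>\<rfloor>" if "p \<in> P" for p
      using that by (metis code_def restrict_apply')
    have "\<bar>val x p - val ?y p\<bar> \<le> \<epsilon>" if "p \<in> P" for p
    proof -
      have "\<bar>val x p / \<epsilon> - val ?y p / \<epsilon>\<bar> \<le> 1" using *[OF that] by linarith
      then have "\<bar>val x p - val ?y p\<bar> / \<epsilon> \<le> 1" using \<epsilon> by (simp add: diff_divide_distrib[symmetric] abs_divide)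
      then show ?thesis using \<epsilon> by (simp add: divide_le_eq)
    qed
    then show "\<exists>y\<in>F. \<forall>p\<in>P. \<bar>val x p - val y p\<bar> \<le> \<epsilon>" using x by (auto simp: F_def)
  qed
qed

lemma lip_tests_finite_net:
  assumes \<epsilon>: "0 < \<epsilon>"
  obtains F where "finite F" "F \<subseteq> {\<psi> :: 'a::euclidean_space \<Rightarrow> real. lip_test 1 1 \<psi>}"
    "\<And>\<psi> :: 'a \<Rightarrow> real. lip_test 1 1 \<psi> \<Longrightarrow> \<exists>\<phi>\<in>F. \<forall>y. \<bar>\<psi> y - \<phi> y\<bar> \<le> \<epsilon>"
proof -
  obtain P where P: "finite P" "P \<subseteq> cball (0::'a) 1" "cball (0::'a) 1 \<subseteq> (\<Union>p\<in>P. ball p (\<epsilon>/3))"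
    using seq_compact_imp_totally_bounded[of "cball (0::'a) 1"] \<epsilon> compact_cball compact_imp_seq_compact
    by (metis zero_less_divide_iff zero_less_numeral)
  obtain F where F: "finite F" "F \<subseteq> {\<psi> :: 'a \<Rightarrow> real. lip_test 1 1 \<psi>}"
    "\<And>\<psi> :: 'a \<Rightarrow> real. \<psi> \<in> {\<psi>. lip_test 1 1 \<psi>} \<Longrightarrow> \<exists>\<phi>\<in>F. \<forall>p\<in>P. \<bar>\<psi> p - \<phi> p\<bar> \<le> \<epsilon>/3"
  proof (rule finite_net_of_probes[OF P(1), of "{\<psi> :: 'a \<Rightarrow> real. lip_test 1 1 \<psi>}" "\<lambda>\<psi>. \<psi>" 1 "\<epsilon>/3"])
    show "\<bar>\<psi> p\<bar> \<le> 1" if "\<psi> \<in> {\<psi>. lip_test 1 1 \<psi>}" for \<psi> :: "'a \<Rightarrow> real" and p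
      using that lip_test_bound[of 1 1 \<psi> p] by simp
  qed (use \<epsilon> in auto)
  show ?thesis
  proof (rule that[OF F(1,2)])
    fix \<psi> :: "'a \<Rightarrow> real" assume \<psi>: "lip_test 1 1 \<psi>"
    then obtain \<phi> where \<phi>: "\<phi> \<in> F" "\<And>p. p \<in> P \<Longrightarrow> \<bar>\<psi> p - \<phi> p\<bar> \<le> \<epsilon>/3" using F(3)[of \<psi>] by auto
    have l\<phi>: "lip_test 1 1 \<phi>" using \<phi>(1) F(2) by auto
    have "\<bar>\<psi> y - \<phi> y\<bar> \<le> \<epsilon>" for y
    proof (cases "norm y \<le> 1")
      case True
      then obtain p where p: "p \<in> P" "dist p y < \<epsilon>/3" using P(3) by force
      then have "norm (y - p) < \<epsilon>/3" by (simp add: dist_norm norm_minus_commute)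
      then show ?thesis
        using lip_test_diff(1)[OF \<psi>, of y p] lip_test_diff(1)[OF l\<phi>, of y p] \<phi>(2)[OF p(1)] by linarith
    next
      case False
      then show ?thesis using lip_test_zero[OF \<psi>, of y] lip_test_zero[OF l\<phi>, of y] \<epsilon> by simp
    qed
    then show "\<exists>\<phi>\<in>F. \<forall>y. \<bar>\<psi> y - \<phi> y\<bar> \<le> \<epsilon>" using \<phi>(1) by blast
  qed
qed

text \<open>A fixed countable, uniformly dense family: a supremum over it of measurable functions is
  measurable, and it replaces the supremum over all test functions.\<close>

definition lip_tests :: "('a::euclidean_space \<Rightarrow> real) set" where
  "lip_tests = (SOME F. countable F \<and> F \<subseteq> {\<psi>. lip_test 1 1 \<psi>} \<and>
     (\<forall>\<psi> \<epsilon>. lip_test 1 1 \<psi> \<longrightarrow> 0 < \<epsilon> \<longrightarrow> (\<exists>\<phi>\<in>F. \<forall>y. \<bar>\<psi> y - \<phi> y\<bar> \<le> \<epsilon>)))"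

lemma lip_tests:
  shows "countable (lip_tests :: ('a::euclidean_space \<Rightarrow> real) set)"
    and "\<phi> \<in> (lip_tests :: ('a \<Rightarrow> real) set) \<Longrightarrow> lip_test 1 1 \<phi>"
    and "lip_test 1 1 (\<psi> :: 'a \<Rightarrow> real) \<Longrightarrow> 0 < \<epsilon> \<Longrightarrow> \<exists>\<phi>\<in>lip_tests. \<forall>y. \<bar>\<psi> y - \<phi> y\<bar> \<le> \<epsilon>"
proof -
  have "\<exists>F. finite F \<and> F \<subseteq> {\<psi> :: 'a \<Rightarrow> real. lip_test 1 1 \<psi>} \<and>
      (\<forall>\<psi>. lip_test 1 1 \<psi> \<longrightarrow> (\<exists>\<phi>\<in>F. \<forall>y. \<bar>\<psi> y - \<phi> y\<bar> \<le> 1 / real (Suc m)))" for m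
    by (rule lip_tests_finite_net[of "1 / real (Suc m)", where ?'a = 'a]) auto
  then obtain F where F: "\<And>m. finite (F m)" "\<And>m. F m \<subseteq> {\<psi> :: 'a \<Rightarrow> real. lip_test 1 1 \<psi>}"
    "\<And>m \<psi>. lip_test 1 1 \<psi> \<Longrightarrow> \<exists>\<phi>\<in>F m. \<forall>y. \<bar>\<psi> y - \<phi> y\<bar> \<le> 1 / real (Suc m)" by metis
  have "\<exists>\<phi>\<in>\<Union>(range F). \<forall>y. \<bar>\<psi> y - \<phi> y\<bar> \<le> \<epsilon>" if \<psi>: "lip_test 1 1 \<psi>" and \<epsilon>: "0 < \<epsilon>" for \<psi> \<epsilon>
  proof -
    obtain m where "1 / real (Suc m) < \<epsilon>" using nat_approx_posE[OF \<epsilon>] .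
    then show ?thesis using F(3)[OF \<psi>, of m] by (meson UN_I UNIV_I less_imp_le order_trans)
  qed
  then have "\<exists>F. countable F \<and> F \<subseteq> {\<psi> :: 'a \<Rightarrow> real. lip_test 1 1 \<psi>} \<and>
     (\<forall>\<psi> \<epsilon>. lip_test 1 1 \<psi> \<longrightarrow> 0 < \<epsilon> \<longrightarrow> (\<exists>\<phi>\<in>F. \<forall>y. \<bar>\<psi> y - \<phi> y\<bar> \<le> \<epsilon>))"
    using F(2) countable_UN[OF _ countable_finite[OF F(1)], of UNIV "\<lambda>m. m"]
    by (intro exI[of _ "\<Union>(range F)"] conjI UN_least allI impI) simp_all
  then have *: "countable (lip_tests :: ('a \<Rightarrow> real) set) \<and> lip_tests \<subseteq> {\<psi> :: 'a \<Rightarrow> real. lip_test 1 1 \<psi>} \<and>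
     (\<forall>(\<psi> :: 'a \<Rightarrow> real) \<epsilon>. lip_test 1 1 \<psi> \<longrightarrow> 0 < \<epsilon> \<longrightarrow> (\<exists>\<phi>\<in>lip_tests. \<forall>y. \<bar>\<psi> y - \<phi> y\<bar> \<le> \<epsilon>))"
    unfolding lip_tests_def by (rule someI_ex)
  show "countable (lip_tests :: ('a \<Rightarrow> real) set)" using * by blast
  show "lip_test 1 1 \<phi>" if "\<phi> \<in> (lip_tests :: ('a \<Rightarrow> real) set)" using * that by blast
  show "\<exists>\<phi>\<in>lip_tests. \<forall>y. \<bar>\<psi> y - \<phi> y\<bar> \<le> \<epsilon>" if "lip_test 1 1 (\<psi> :: 'a \<Rightarrow> real)" "0 < \<epsilon>" using * that by blast
qed

lemma flat_integral_diff:
  fixes V :: "'a::euclidean_space set"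
  assumes V: "V \<in> planes_near d" and \<psi>: "lip_test 1 1 \<psi>" and \<phi>: "lip_test 1 1 \<phi>"
    and d: "\<And>y. \<bar>\<psi> y - \<phi> y\<bar> \<le> \<epsilon>"
  shows "\<bar>integral\<^sup>L (flat_measure d V) \<psi> - integral\<^sup>L (flat_measure d V) \<phi>\<bar> \<le> \<epsilon>"
proof -
  have dV: "dplane d V" using V by (simp add: planes_near_def dplane_def)
  note rad = radon_plane_measure[OF dV]
  define h where "h = measure (plane_measure d V) (ball 0 1)"
  note h = flat_measure_eq[OF V, folded h_def]
  have h0: "0 < h" by (rule less_le_trans[OF _ h(1)]) simp
  have I: "integral\<^sup>L (flat_measure d V) f = (1/h) * integral\<^sup>L (plane_measure d V) f" if "lip_test 1 1 f" for f
    unfolding h(3) using h0 lip_test_measurable[OF that] by (intro integral_scale_measure) auto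
  have "integral\<^sup>L (flat_measure d V) \<psi> - integral\<^sup>L (flat_measure d V) \<phi>
      = (1/h) * (\<integral>p. \<psi> p - \<phi> p \<partial>plane_measure d V)"
    using lip_test_integrable[OF rad \<psi>] lip_test_integrable[OF rad \<phi>]
    by (simp add: I[OF \<psi>] I[OF \<phi>] Bochner_Integration.integral_diff right_diff_distrib diff_divide_distrib)
  moreover have "\<bar>\<integral>p. \<psi> p - \<phi> p \<partial>plane_measure d V\<bar> \<le> \<epsilon> * h"
    unfolding h_def
  proof (rule radon_integral_bound[OF rad _ d])
    show "(\<lambda>p. \<psi> p - \<phi> p) \<in> borel_measurable borel"
      using lip_test_measurable[OF \<psi>] lip_test_measurable[OF \<phi>] by simp
    show "\<psi> y - \<phi> y = 0" if "y \<notin> ball 0 1" for y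
      using that lip_test_zero[OF \<psi>, of y] lip_test_zero[OF \<phi>, of y] by simp
  qed auto
  ultimately show ?thesis using h0 by (simp add: abs_mult divide_le_eq)
qed

lemma flat_integral_bound:
  fixes V :: "'a::euclidean_space set"
  assumes V: "V \<in> planes_near d" and \<psi>: "lip_test 1 1 \<psi>"
  shows "\<bar>integral\<^sup>L (flat_measure d V) \<psi>\<bar> \<le> 1"
proof -
  have "lip_test 1 1 (\<lambda>_::'a. 0)" by (rule lip_testI) auto
  from flat_integral_diff[OF V \<psi> this, of 1] lip_test_bound[OF \<psi>] show ?thesis by simp
qed

text \<open>Planes are probed by a finite net of test functions, and closeness at the probes spreads
  to all test functions. The approximation is uniform in \<psi>, so it survives the supremum in the
  Wasserstein distance.\<close>

lemma planes_countable_net: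
  obtains D :: "'a::euclidean_space set set" where "countable D" "D \<subseteq> planes_near d"
    "\<And>V \<epsilon>. V \<in> planes_near d \<Longrightarrow> 0 < \<epsilon> \<Longrightarrow> \<exists>V'\<in>D. \<forall>\<psi>. lip_test 1 1 \<psi> \<longrightarrow>
       \<bar>integral\<^sup>L (flat_measure d V) \<psi> - integral\<^sup>L (flat_measure d V') \<psi>\<bar> \<le> \<epsilon>"
proof -
  let ?I = "\<lambda>V \<psi>. integral\<^sup>L (flat_measure d V) \<psi> :: real"
  have net: "\<exists>F. finite F \<and> F \<subseteq> (planes_near d :: 'a set set) \<and>
      (\<forall>V\<in>planes_near d. \<exists>V'\<in>F. \<forall>\<psi>. lip_test 1 1 \<psi> \<longrightarrow> \<bar>?I V \<psi> - ?I V' \<psi>\<bar> \<le> \<epsilon>)" if \<epsilon>: "0 < \<epsilon>" for \<epsilon>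
  proof -
    obtain P where P: "finite P" "P \<subseteq> {\<psi> :: 'a \<Rightarrow> real. lip_test 1 1 \<psi>}"
      "\<And>\<psi> :: 'a \<Rightarrow> real. lip_test 1 1 \<psi> \<Longrightarrow> \<exists>\<phi>\<in>P. \<forall>y. \<bar>\<psi> y - \<phi> y\<bar> \<le> \<epsilon>/3"
      using lip_tests_finite_net[of "\<epsilon>/3", where ?'a = 'a] \<epsilon> by (metis zero_less_divide_iff zero_less_numeral)
    obtain F where F: "finite F" "F \<subseteq> (planes_near d :: 'a set set)"
      "\<And>V. V \<in> planes_near d \<Longrightarrow> \<exists>V'\<in>F. \<forall>\<phi>\<in>P. \<bar>?I V \<phi> - ?I V' \<phi>\<bar> \<le> \<epsilon>/3"
    proof (rule finite_net_of_probes[OF P(1), of "planes_near d" ?I 1 "\<epsilon>/3"])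
      show "\<bar>?I V \<phi>\<bar> \<le> 1" if "V \<in> planes_near d" "\<phi> \<in> P" for V \<phi>
        using flat_integral_bound[OF that(1)] that(2) P(2) by auto
    qed (use \<epsilon> in auto)
    have "\<exists>V'\<in>F. \<forall>\<psi>. lip_test 1 1 \<psi> \<longrightarrow> \<bar>?I V \<psi> - ?I V' \<psi>\<bar> \<le> \<epsilon>" if V: "V \<in> planes_near d" for V
    proof -
      obtain V' where V': "V' \<in> F" "\<And>\<phi>. \<phi> \<in> P \<Longrightarrow> \<bar>?I V \<phi> - ?I V' \<phi>\<bar> \<le> \<epsilon>/3" using F(3)[OF V] by blast
      have V'n: "V' \<in> planes_near d" using V'(1) F(2) by blast
      have "\<bar>?I V \<psi> - ?I V' \<psi>\<bar> \<le> \<epsilon>" if \<psi>: "lip_test 1 1 \<psi>" for \<psi>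
      proof -
        obtain \<phi> where \<phi>: "\<phi> \<in> P" "\<And>y. \<bar>\<psi> y - \<phi> y\<bar> \<le> \<epsilon>/3" using P(3)[OF \<psi>] by blast
        have l\<phi>: "lip_test 1 1 \<phi>" using \<phi>(1) P(2) by auto
        show ?thesis
          using flat_integral_diff[OF V \<psi> l\<phi> \<phi>(2)] flat_integral_diff[OF V'n \<psi> l\<phi> \<phi>(2)] V'(2)[OF \<phi>(1)] by linarith
      qed
      then show ?thesis using V'(1) by blast
    qed
    then show ?thesis using F(1,2) by blast
  qed
  have "\<exists>F. finite F \<and> F \<subseteq> (planes_near d :: 'a set set) \<and>
      (\<forall>V\<in>planes_near d. \<exists>V'\<in>F. \<forall>\<psi>. lip_test 1 1 \<psi> \<longrightarrow> \<bar>?I V \<psi> - ?I V' \<psi>\<bar> \<le> 1 / real (Suc m))" for m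
    by (rule net) simp
  then obtain F where F: "\<And>m. finite (F m)" "\<And>m. F m \<subseteq> (planes_near d :: 'a set set)"
    "\<And>m V. V \<in> planes_near d \<Longrightarrow> \<exists>V'\<in>F m. \<forall>\<psi>. lip_test 1 1 \<psi> \<longrightarrow> \<bar>?I V \<psi> - ?I V' \<psi>\<bar> \<le> 1 / real (Suc m)"
    by metis
  show ?thesis
  proof (rule that[of "\<Union>(range F)"])
    show "countable (\<Union>(range F))" using F(1) by (auto intro: countable_finite)
    show "\<Union>(range F) \<subseteq> planes_near d" using F(2) by blast
    fix V :: "'a set" and \<epsilon> :: real assume V: "V \<in> planes_near d" and \<epsilon>: "0 < \<epsilon>"
    obtain m where m: "1 / real (Suc m) < \<epsilon>" using nat_approx_posE[OF \<epsilon>] .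
    obtain V' where "V' \<in> F m" "\<And>\<psi>. lip_test 1 1 \<psi> \<Longrightarrow> \<bar>?I V \<psi> - ?I V' \<psi>\<bar> \<le> 1 / real (Suc m)"
      using F(3)[OF V, of m] by blast
    then show "\<exists>V'\<in>\<Union>(range F). \<forall>\<psi>. lip_test 1 1 \<psi> \<longrightarrow> \<bar>?I V \<psi> - ?I V' \<psi>\<bar> \<le> \<epsilon>"
      using m by (intro bexI[of _ V']) (auto intro: order_trans[OF _ less_imp_le])
  qed
qed

section \<open>Borel measurability of the coefficients and of the integrability set\<close>

context doubling_radon begin

lemma msupport_closed: "closed \<Sigma>"
proof -
  have "open (- \<Sigma>)"
    unfolding open_contains_ball
  proof
    fix x assume "x \<in> - \<Sigma>"
    then obtain r where r: "0 < r" "emeasure \<mu> (ball x r) = 0" by (auto simp: msupport_def)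
    have "ball x (r/2) \<subseteq> - \<Sigma>"
    proof
      fix y assume y: "y \<in> ball x (r/2)"
      have "emeasure \<mu> (ball y (r/2)) \<le> emeasure \<mu> (ball x r)"
        using y sets_mu by (intro emeasure_mono) (auto simp: ball_subset_ball_iff dist_commute)
      then have "\<not> 0 < emeasure \<mu> (ball y (r/2))" using r by simp
      then show "y \<in> - \<Sigma>" using r(1) by (auto simp: msupport_def intro!: exI[of _ "r/2"])
    qed
    then show "\<exists>e>0. ball x e \<subseteq> - \<Sigma>" using r(1) by (intro exI[of _ "r/2"]) auto
  qed
  then show ?thesis by (simp add: closed_def)
qed

definition blowup_integral :: "'a \<Rightarrow> real \<Rightarrow> ('a \<Rightarrow> real) \<Rightarrow> real" where
  "blowup_integral x r \<psi> = centered_integral x (\<lambda>z. \<psi> ((1/r) *\<^sub>R z)) / measure \<mu> (ball x r)"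

lemma blowup_integral_eq:
  "x \<in> \<Sigma> \<Longrightarrow> 0 < r \<Longrightarrow> lip_test 1 1 \<psi> \<Longrightarrow> integral\<^sup>L (blowup \<mu> x r) \<psi> = blowup_integral x r \<psi>"
  by (simp add: blowup_integral_def integral_blowup lip_test_measurable)

lemma blowup_integral_diff:
  assumes x: "x \<in> \<Sigma>" and r: "0 < r" and \<psi>: "lip_test 1 1 \<psi>" and \<phi>: "lip_test 1 1 \<phi>"
    and d: "\<And>y. \<bar>\<psi> y - \<phi> y\<bar> \<le> \<epsilon>"
  shows "\<bar>blowup_integral x r \<psi> - blowup_integral x r \<phi>\<bar> \<le> \<epsilon>"
proof -
  have m: "0 < measure \<mu> (ball x r)" by (rule measure_ball_pos[OF x r])
  have i: "integrable \<mu> (\<lambda>y. f ((1/r) *\<^sub>R (y - x)))" and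
    b: "(\<lambda>y. f ((1/r) *\<^sub>R (y - x))) \<in> borel_measurable borel" if "lip_test 1 1 f" for f :: "'a \<Rightarrow> real"
    using lip_test_shift_integrable[OF lip_test_scale[OF that r]] r
      lip_test_measurable[OF lip_test_shift[OF lip_test_scale[OF that r] order_refl]] by auto
  have "centered_integral x (\<lambda>z. \<psi> ((1/r) *\<^sub>R z)) - centered_integral x (\<lambda>z. \<phi> ((1/r) *\<^sub>R z))
      = (\<integral>y. \<psi> ((1/r) *\<^sub>R (y - x)) - \<phi> ((1/r) *\<^sub>R (y - x)) \<partial>\<mu>)"
    unfolding centered_integral_def by (rule Bochner_Integration.integral_diff[symmetric]) (fact i[OF \<psi>] i[OF \<phi>])+
  also have "\<bar>\<dots>\<bar> \<le> \<epsilon> * measure \<mu> (ball x r)"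
  proof (rule radon_integral_bound[OF radon _ d])
    show "(\<lambda>y. \<psi> ((1/r) *\<^sub>R (y - x)) - \<phi> ((1/r) *\<^sub>R (y - x))) \<in> borel_measurable borel"
      using b[OF \<psi>] b[OF \<phi>] by simp
    show "\<psi> ((1/r) *\<^sub>R (y - x)) - \<phi> ((1/r) *\<^sub>R (y - x)) = 0" if "y \<notin> ball x r" for y
    proof -
      have "1 \<le> norm ((1/r) *\<^sub>R (y - x))" using that r by (simp add: dist_norm norm_minus_commute)
      then show ?thesis by (simp only: lip_test_zero[OF \<psi>] lip_test_zero[OF \<phi>])
    qed
  qed auto
  finally show ?thesis using m unfolding blowup_integral_def
    by (simp add: diff_divide_distrib[symmetric] abs_divide divide_le_eq)
qed

text \<open>Measurability is needed jointly in centre and radius, since the integral over the radius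
  must be a Borel function of the centre. Both numerator and denominator are integrals of jointly
  measurable kernels against a sigma-finite measure.\<close>

lemma blowup_integral_measurable:
  fixes \<psi> :: "'a \<Rightarrow> real"
  assumes \<psi>: "lip_test 1 1 \<psi>"
  shows "(\<lambda>p. blowup_integral (fst p) (snd p) \<psi>) \<in> borel_measurable (borel :: ('a \<times> real) measure)"
proof -
  interpret sigma_finite_measure \<mu> by (rule radon_sigma_finite[OF radon])
  have [measurable_cong]: "sets \<mu> = sets borel" by (rule sets_mu)
  have m[measurable]: "\<psi> \<in> borel_measurable borel" by (rule lip_test_measurable[OF \<psi>])
  have A: "(\<lambda>p. centered_integral (fst p) (\<lambda>z. \<psi> ((1/snd p) *\<^sub>R z))) \<in> borel_measurable (borel \<Otimes>\<^sub>M borel :: ('a \<times> real) measure)"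
    unfolding centered_integral_def by (rule borel_measurable_lebesgue_integral) measurable
  have Q: "{q. dist (fst (fst q)) (snd q) < snd (fst q)} \<in> sets ((borel \<Otimes>\<^sub>M borel) \<Otimes>\<^sub>M \<mu> :: (('a \<times> real) \<times> 'a) measure)"
  proof -
    have "Measurable.pred ((borel \<Otimes>\<^sub>M borel) \<Otimes>\<^sub>M \<mu> :: (('a \<times> real) \<times> 'a) measure) (\<lambda>q. dist (fst (fst q)) (snd q) < snd (fst q))"
      by measurable
    then show ?thesis by (simp add: pred_def space_pair_measure space_mu)
  qed
  have "(\<lambda>p. emeasure \<mu> (Pair p -` {q. dist (fst (fst q)) (snd q) < snd (fst q)})) \<in> borel_measurable (borel \<Otimes>\<^sub>M borel :: ('a \<times> real) measure)"
    using measurable_emeasure_Pair[OF Q] .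
  then have "(\<lambda>p. emeasure \<mu> (ball (fst p) (snd p))) \<in> borel_measurable (borel \<Otimes>\<^sub>M borel :: ('a \<times> real) measure)"
    by (simp add: ball_def vimage_def)
  then have B: "(\<lambda>p. measure \<mu> (ball (fst p) (snd p))) \<in> borel_measurable (borel \<Otimes>\<^sub>M borel :: ('a \<times> real) measure)"
    unfolding measure_def by measurable
  show ?thesis
    unfolding blowup_integral_def borel_prod[symmetric] using A B by measurable
qed

lemma measure_ball_measurable: "(\<lambda>x. measure \<mu> (ball x r)) \<in> borel_measurable borel"
proof -
  interpret sigma_finite_measure \<mu> by (rule radon_sigma_finite[OF radon])
  have [measurable_cong]: "sets \<mu> = sets borel" by (rule sets_mu)
  have Q: "{q. dist (fst q) (snd q) < r} \<in> sets (borel \<Otimes>\<^sub>M \<mu> :: ('a \<times> 'a) measure)"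
  proof -
    have "Measurable.pred (borel \<Otimes>\<^sub>M \<mu> :: ('a \<times> 'a) measure) (\<lambda>q. dist (fst q) (snd q) < r)"
      by measurable
    then show ?thesis by (simp add: pred_def space_pair_measure space_mu)
  qed
  have "(\<lambda>p. emeasure \<mu> (Pair p -` {q. dist (fst q) (snd q) < r})) \<in> borel_measurable (borel :: 'a measure)"
    using measurable_emeasure_Pair[OF Q] .
  then have "(\<lambda>p. emeasure \<mu> (ball p r)) \<in> borel_measurable borel"
    by (simp add: ball_def vimage_def)
  then show ?thesis unfolding measure_def by measurable
qed

text \<open>Countable nets of planes and of test functions change neither the infimum nor the
  supremum. Agreement is claimed only on the support and for positive radii, where the blow-up is a
  proper normalization; elsewhere G may be arbitrary.\<close>

lemma alpha_measurable_version:
  obtains G :: "'a \<times> real \<Rightarrow> ennreal" where "G \<in> borel_measurable borel"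
    "\<And>x r. x \<in> \<Sigma> \<Longrightarrow> 0 < r \<Longrightarrow> alpha \<mu> x r = G (x, r)"
proof -
  have "\<exists>D :: 'a set set. countable D \<and> D \<subseteq> planes_near d \<and>
    (\<forall>V\<in>planes_near d. \<forall>\<epsilon>>0. \<exists>V'\<in>D. \<forall>\<psi>. lip_test 1 1 \<psi> \<longrightarrow>
       \<bar>integral\<^sup>L (flat_measure d V) \<psi> - integral\<^sup>L (flat_measure d V') \<psi>\<bar> \<le> \<epsilon>)" for d
    by (rule planes_countable_net[of d]) blast
  then obtain D :: "nat \<Rightarrow> 'a set set" where D: "\<And>d. countable (D d)" "\<And>d. D d \<subseteq> planes_near d"
    "\<And>d V \<epsilon>. V \<in> planes_near d \<Longrightarrow> 0 < \<epsilon> \<Longrightarrow> \<exists>V'\<in>D d. \<forall>\<psi>. lip_test 1 1 \<psi> \<longrightarrow>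
       \<bar>integral\<^sup>L (flat_measure d V) \<psi> - integral\<^sup>L (flat_measure d V') \<psi>\<bar> \<le> \<epsilon>" by metis
  define J where "J d V \<psi> = (integral\<^sup>L (flat_measure d V) \<psi> :: real)" for d and V :: "'a set" and \<psi>
  define w where "w d V p = (SUP \<psi>\<in>lip_tests. ennreal \<bar>blowup_integral (fst p) (snd p) \<psi> - J d V \<psi>\<bar>)" for d V p
  define G where "G p = (INF d\<in>{0..DIM('a)}. INF V\<in>D d. w d V p)" for p
  have wm: "w d V \<in> borel_measurable borel" for d V
    unfolding w_def
  proof (rule borel_measurable_SUP[OF lip_tests(1)])
    fix \<psi> :: "'a \<Rightarrow> real" assume "\<psi> \<in> lip_tests"
    then have [measurable]: "(\<lambda>p. blowup_integral (fst p) (snd p) \<psi>) \<in> borel_measurable (borel :: ('a \<times> real) measure)"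
      by (intro blowup_integral_measurable lip_tests(2))
    show "(\<lambda>p. ennreal \<bar>blowup_integral (fst p) (snd p) \<psi> - J d V \<psi>\<bar>) \<in> borel_measurable borel"
      by measurable
  qed
  show ?thesis
  proof (rule that[of G])
    show "G \<in> borel_measurable borel"
      unfolding G_def by (intro borel_measurable_INF wm D(1)) (simp add: countable_finite)
    fix x and r :: real assume x: "x \<in> \<Sigma>" and r: "0 < r"
    have W: "wasserstein1 (blowup \<mu> x r) (flat_measure d V) = w d V (x, r)" if V: "V \<in> planes_near d" for d V
    proof (rule antisym)
      show "w d V (x, r) \<le> wasserstein1 (blowup \<mu> x r) (flat_measure d V)"
        unfolding w_def wasserstein1_def
      proof (rule SUP_mono)
        fix \<psi> :: "'a \<Rightarrow> real" assume "\<psi> \<in> lip_tests"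
        then have \<psi>: "lip_test 1 1 \<psi>" by (rule lip_tests(2))
        show "\<exists>\<phi>\<in>{\<psi>. 1-lipschitz_on UNIV \<psi> \<and> (\<forall>y. y \<notin> ball 0 1 \<longrightarrow> \<psi> y = 0)}.
            ennreal \<bar>blowup_integral (fst (x, r)) (snd (x, r)) \<psi> - J d V \<psi>\<bar>
            \<le> ennreal \<bar>integral\<^sup>L (blowup \<mu> x r) \<phi> - integral\<^sup>L (flat_measure d V) \<phi>\<bar>"
          using \<psi> by (intro bexI[of _ \<psi>]) (auto simp: blowup_integral_eq[OF x r \<psi>] J_def lip_test_def)
      qed
      show "wasserstein1 (blowup \<mu> x r) (flat_measure d V) \<le> w d V (x, r)"
        unfolding wasserstein1_def
      proof (rule SUP_least, rule ennreal_le_epsilon)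
        fix \<psi> :: "'a \<Rightarrow> real" and e :: real
        assume "\<psi> \<in> {\<psi>. 1-lipschitz_on UNIV \<psi> \<and> (\<forall>y. y \<notin> ball 0 1 \<longrightarrow> \<psi> y = 0)}" and e: "0 < e"
        then have \<psi>: "lip_test 1 1 \<psi>" by (auto simp: lip_test_def)
        obtain \<phi> where \<phi>: "\<phi> \<in> lip_tests" "\<And>y. \<bar>\<psi> y - \<phi> y\<bar> \<le> e/2" using lip_tests(3)[OF \<psi>, of "e/2"] e by auto
        have l\<phi>: "lip_test 1 1 \<phi>" by (rule lip_tests(2)[OF \<phi>(1)])
        have "\<bar>blowup_integral x r \<psi> - J d V \<psi>\<bar> \<le> \<bar>blowup_integral x r \<phi> - J d V \<phi>\<bar> + e"
          using blowup_integral_diff[OF x r \<psi> l\<phi> \<phi>(2)] flat_integral_diff[OF V \<psi> l\<phi> \<phi>(2)] unfolding J_def by linarith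
        then have "ennreal \<bar>blowup_integral x r \<psi> - J d V \<psi>\<bar> \<le> ennreal (\<bar>blowup_integral x r \<phi> - J d V \<phi>\<bar> + e)"
          by (rule ennreal_leI)
        also have "\<dots> = ennreal \<bar>blowup_integral x r \<phi> - J d V \<phi>\<bar> + ennreal e" using e by (intro ennreal_plus) auto
        also have "\<dots> \<le> w d V (x, r) + ennreal e"
          unfolding w_def using \<phi>(1) by (intro add_right_mono SUP_upper2[of \<phi>]) auto
        finally show "ennreal \<bar>integral\<^sup>L (blowup \<mu> x r) \<psi> - integral\<^sup>L (flat_measure d V) \<psi>\<bar> \<le> w d V (x, r) + ennreal e"
          by (simp add: blowup_integral_eq[OF x r \<psi>] J_def)
      qed
    qed
    have AD: "alpha_dim \<mu> d x r = (INF V\<in>D d. w d V (x, r))" for d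
    proof (rule antisym)
      show "alpha_dim \<mu> d x r \<le> (INF V\<in>D d. w d V (x, r))"
        unfolding alpha_dim_def
      proof (rule INF_mono)
        show "\<exists>V'\<in>planes_near d. wasserstein1 (blowup \<mu> x r) (flat_measure d V') \<le> w d V (x, r)" if "V \<in> D d" for V
          using that D(2)[of d] W[of V d] by (intro bexI[of _ V]) auto
      qed
      show "(INF V\<in>D d. w d V (x, r)) \<le> alpha_dim \<mu> d x r"
        unfolding alpha_dim_def
      proof (rule INF_greatest, rule ennreal_le_epsilon)
        fix V :: "'a set" and e :: real assume V: "V \<in> planes_near d" and e: "0 < e"
        obtain V' where V': "V' \<in> D d" "\<And>\<psi>. lip_test 1 1 \<psi> \<Longrightarrow> \<bar>J d V \<psi> - J d V' \<psi>\<bar> \<le> e"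
          using D(3)[OF V e] unfolding J_def by blast
        have "(INF V\<in>D d. w d V (x, r)) \<le> w d V' (x, r)" by (rule INF_lower[OF V'(1)])
        also have "\<dots> \<le> w d V (x, r) + ennreal e"
          unfolding w_def[of d V']
        proof (rule SUP_least)
          fix \<psi> :: "'a \<Rightarrow> real" assume \<psi>: "\<psi> \<in> lip_tests"
          have "\<bar>blowup_integral x r \<psi> - J d V' \<psi>\<bar> \<le> \<bar>blowup_integral x r \<psi> - J d V \<psi>\<bar> + e"
            using V'(2)[OF lip_tests(2)[OF \<psi>]] by linarith
          then have "ennreal \<bar>blowup_integral x r \<psi> - J d V' \<psi>\<bar> \<le> ennreal (\<bar>blowup_integral x r \<psi> - J d V \<psi>\<bar> + e)"
            by (rule ennreal_leI)
          also have "\<dots> = ennreal \<bar>blowup_integral x r \<psi> - J d V \<psi>\<bar> + ennreal e" using e by (intro ennreal_plus) auto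
          also have "\<dots> \<le> w d V (x, r) + ennreal e"
            unfolding w_def using \<psi> by (intro add_right_mono SUP_upper2[of \<psi>]) auto
          finally show "ennreal \<bar>blowup_integral (fst (x, r)) (snd (x, r)) \<psi> - J d V' \<psi>\<bar> \<le> w d V (x, r) + ennreal e" by simp
        qed
        finally show "(INF V\<in>D d. w d V (x, r)) \<le> wasserstein1 (blowup \<mu> x r) (flat_measure d V) + ennreal e"
          by (simp add: W[OF V])
      qed
    qed
    show "alpha \<mu> x r = G (x, r)"
      unfolding alpha_def G_def AD by (rule Min_Inf) auto
  qed
qed

lemma Sigma0_borel: "Sigma0 \<mu> \<in> sets borel"
proof -
  obtain G :: "'a \<times> real \<Rightarrow> ennreal" where G: "G \<in> borel_measurable borel"
    "\<And>x r. x \<in> \<Sigma> \<Longrightarrow> 0 < r \<Longrightarrow> alpha \<mu> x r = G (x, r)"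
    using alpha_measurable_version by blast
  have G'[measurable]: "G \<in> borel_measurable (borel \<Otimes>\<^sub>M borel)" using G(1) by (simp add: borel_prod)
  define g where "g x = (\<integral>\<^sup>+r. G (x, r) / ennreal r * indicator {0<..1} r \<partial>lborel)" for x
  have [measurable]: "g \<in> borel_measurable borel"
    unfolding g_def by measurable
  have "(\<integral>\<^sup>+r\<in>{0<..1}. (alpha \<mu> x r / ennreal r) \<partial>lborel) = g x" if "x \<in> \<Sigma>" for x
    unfolding g_def by (rule nn_integral_cong) (use G(2)[OF that] in \<open>auto simp: indicator_def\<close>)
  then have "Sigma0 \<mu> = \<Sigma> \<inter> {x \<in> space borel. g x < \<infinity>}" by (auto simp: Sigma0_def)
  moreover have "{x \<in> space borel. g x < \<infinity>} \<in> sets borel" by measurable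
  ultimately show ?thesis using sets.Int[OF borel_closed[OF msupport_closed]] by metis
qed

text \<open>At radii up to s the blow-up acts on test functions like a Dirac mass at 0, a flat
  measure of dimension 0, so \<alpha> vanishes there. At larger radii the trivial bound 2 keeps the
  integrand below 2/s.\<close>

lemma atom_in_Sigma0:
  assumes a: "0 < emeasure \<mu> {x}"
  shows "x \<in> Sigma0 \<mu>"
proof -
  have ma: "0 < measure \<mu> {x}" using a radon_emeasure_eq_measure[OF radon, of "{x}"] by simp
  have x: "x \<in> \<Sigma>"
    unfolding msupport_def
  proof (intro CollectI allI impI)
    fix r :: real assume "0 < r"
    then have "emeasure \<mu> {x} \<le> emeasure \<mu> (ball x r)" using sets_mu by (intro emeasure_mono) auto
    then show "0 < emeasure \<mu> (ball x r)" using a by (rule less_le_trans[rotated])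
  qed
  obtain s where s: "0 < s" "\<And>r. 0 < r \<Longrightarrow> r \<le> s \<Longrightarrow> emeasure \<mu> (ball x r - {x}) = 0"
    using atom_isolated[OF a] by metis
  let ?V = "{0::'a}"
  have dV: "dplane 0 ?V" by (simp add: dplane_def)
  have V: "?V \<in> planes_near 0" by (simp add: planes_near_def)
  have h: "measure (plane_measure 0 ?V) (ball 0 1) = 1" using measure_plane_ball[OF dV, of 0 1] by simp
  have flat: "integral\<^sup>L (flat_measure 0 ?V) \<psi> = \<psi> 0" if \<psi>: "lip_test 1 1 \<psi>" for \<psi> :: "'a \<Rightarrow> real"
  proof -
    have "integral\<^sup>L (flat_measure 0 ?V) \<psi> = integral\<^sup>L (plane_measure 0 ?V) \<psi>"
      unfolding flat_measure_eq(3)[OF V] h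
      using integral_scale_measure[of 1 \<psi> "plane_measure 0 ?V"] lip_test_measurable[OF \<psi>] by simp
    also have "\<dots> = (\<integral>p. \<psi> 0 * indicator (ball 0 1) p \<partial>plane_measure 0 ?V)"
    proof (rule integral_cong_AE)
      have "AE p in plane_measure 0 ?V. p \<in> ?V" by (rule AE_measure_on) simp
      then show "AE p in plane_measure 0 ?V. \<psi> p = \<psi> 0 * indicator (ball 0 1) p" by eventually_elim simp
      show "(\<lambda>p. \<psi> 0 * indicator (ball 0 1) p) \<in> borel_measurable (plane_measure 0 ?V)"
        by (intro radon_borel_measurable[OF radon_plane_measure[OF dV]] borel_measurable_times
            borel_measurable_const borel_measurable_indicator borel_open open_ball)
    qed (use lip_test_measurable[OF \<psi>] in simp)
    also have "\<dots> = \<psi> 0" using h by simp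
    finally show ?thesis .
  qed
  have small: "alpha \<mu> x r \<le> 0" if r: "0 < r" "r \<le> s" for r
  proof -
    have "alpha \<mu> x r \<le> alpha_dim \<mu> 0 x r" unfolding alpha_def by (rule Min_le) auto
    also have "\<dots> \<le> wasserstein1 (blowup \<mu> x r) (flat_measure 0 ?V)"
      unfolding alpha_dim_def by (rule INF_lower[OF V])
    also have "\<dots> \<le> 0"
      unfolding wasserstein1_def
    proof (rule SUP_least)
      fix \<psi> :: "'a \<Rightarrow> real" assume "\<psi> \<in> {\<psi>. 1-lipschitz_on UNIV \<psi> \<and> (\<forall>y. y \<notin> ball 0 1 \<longrightarrow> \<psi> y = 0)}"
      then have \<psi>: "lip_test 1 1 \<psi>" by (auto simp: lip_test_def)
      have "centered_integral x (\<lambda>z. \<psi> ((1/r) *\<^sub>R z)) = (\<integral>y. \<psi> 0 * indicator (ball x r) y \<partial>\<mu>)"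
        unfolding centered_integral_def
      proof (rule integral_cong_AE)
        show "(\<lambda>y. \<psi> ((1/r) *\<^sub>R (y - x))) \<in> borel_measurable \<mu>"
          using lip_test_measurable[OF lip_test_shift[OF lip_test_scale[OF \<psi> r(1)] order_refl, of x]]
          by (rule radon_borel_measurable[OF radon])
        show "(\<lambda>y. \<psi> 0 * indicator (ball x r) y) \<in> borel_measurable \<mu>"
          by (intro radon_borel_measurable[OF radon] borel_measurable_times
              borel_measurable_const borel_measurable_indicator borel_open open_ball)
        have "ball x r - {x} \<in> null_sets \<mu>" using s(2)[OF r] sets_mu by (simp add: null_sets_def)
        then have "AE y in \<mu>. y \<notin> ball x r - {x}" by (rule AE_not_in)
        then show "AE y in \<mu>. \<psi> ((1/r) *\<^sub>R (y - x)) = \<psi> 0 * indicator (ball x r) y"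
        proof eventually_elim
          case (elim y)
          show ?case
          proof (cases "y = x")
            case True
            then show ?thesis using r by simp
          next
            case False
            then have y: "y \<notin> ball x r" using elim by simp
            then have "1 \<le> norm ((1/r) *\<^sub>R (y - x))" using r by (simp add: dist_norm norm_minus_commute)
            then have "\<psi> ((1/r) *\<^sub>R (y - x)) = 0" by (rule lip_test_zero[OF \<psi>])
            then show ?thesis using y by simp
          qed
        qed
      qed
      also have "\<dots> = \<psi> 0 * measure \<mu> (ball x r)" using sets_mu space_mu by simp
      finally have "blowup_integral x r \<psi> = \<psi> 0"
        using measure_ball_pos[OF x r(1)] by (simp add: blowup_integral_def)
      then show "ennreal \<bar>integral\<^sup>L (blowup \<mu> x r) \<psi> - integral\<^sup>L (flat_measure 0 ?V) \<psi>\<bar> \<le> 0"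
        by (simp add: blowup_integral_eq[OF x r(1) \<psi>] flat[OF \<psi>])
    qed
    finally show ?thesis .
  qed
  have large: "alpha \<mu> x r \<le> ennreal 2" if r: "0 < r" for r
  proof -
    have "alpha \<mu> x r \<le> alpha_dim \<mu> 0 x r" unfolding alpha_def by (rule Min_le) auto
    also have "\<dots> \<le> wasserstein1 (blowup \<mu> x r) (flat_measure 0 ?V)"
      unfolding alpha_dim_def by (rule INF_lower[OF V])
    also have "\<dots> \<le> ennreal 2"
      unfolding wasserstein1_def
    proof (rule SUP_least)
      fix \<psi> :: "'a \<Rightarrow> real" assume "\<psi> \<in> {\<psi>. 1-lipschitz_on UNIV \<psi> \<and> (\<forall>y. y \<notin> ball 0 1 \<longrightarrow> \<psi> y = 0)}"
      then have \<psi>: "lip_test 1 1 \<psi>" by (auto simp: lip_test_def)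
      have z: "lip_test 1 1 (\<lambda>_::'a. 0)" by (rule lip_testI) auto
      have "\<bar>blowup_integral x r \<psi> - blowup_integral x r (\<lambda>_. 0)\<bar> \<le> 1"
        by (rule blowup_integral_diff[OF x r \<psi> z]) (use lip_test_bound[OF \<psi>] in simp)
      moreover have "blowup_integral x r (\<lambda>_. 0) = 0" by (simp add: blowup_integral_def centered_integral_def)
      ultimately have "\<bar>blowup_integral x r \<psi>\<bar> \<le> 1" by simp
      moreover have "\<bar>\<psi> 0\<bar> \<le> 1" using lip_test_bound[OF \<psi>, of 0] by simp
      ultimately show "ennreal \<bar>integral\<^sup>L (blowup \<mu> x r) \<psi> - integral\<^sup>L (flat_measure 0 ?V) \<psi>\<bar> \<le> ennreal 2"
        unfolding blowup_integral_eq[OF x r \<psi>] flat[OF \<psi>] by (intro ennreal_leI) linarith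
    qed
    finally show ?thesis .
  qed
  have "(\<integral>\<^sup>+r\<in>{0<..1}. (alpha \<mu> x r / ennreal r) \<partial>lborel) \<le> (\<integral>\<^sup>+r. ennreal (2 / s) * indicator {0<..1::real} r \<partial>lborel)"
  proof (rule nn_integral_mono)
    fix r :: real
    show "alpha \<mu> x r / ennreal r * indicator {0<..1} r \<le> ennreal (2 / s) * indicator {0<..1} r"
    proof (cases "r \<in> {0<..1}")
      case True
      then have r: "0 < r" by simp
      have "alpha \<mu> x r / ennreal r \<le> ennreal (2 / s)"
      proof (cases "r \<le> s")
        case True
        then show ?thesis using small[OF r True] by simp
      next
        case False
        have "alpha \<mu> x r / ennreal r \<le> ennreal 2 / ennreal r" by (rule divide_right_mono_ennreal[OF large[OF r]])
        also have "\<dots> = ennreal (2 / r)" using r by (intro divide_ennreal) auto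
        also have "\<dots> \<le> ennreal (2 / s)" using False s r by (intro ennreal_leI divide_left_mono) auto
        finally show ?thesis .
      qed
      then show ?thesis using True by simp
    qed simp
  qed
  also have "\<dots> = ennreal (2 / s) * emeasure lborel {0<..1::real}" by (rule nn_integral_cmult_indicator) simp
  also have "\<dots> < \<infinity>" by (simp add: ennreal_mult_less_top)
  finally show ?thesis using x by (simp add: Sigma0_def)
qed

end

subsection \<open>Comparison of measures by covering\<close>

text \<open>Restriction to a bounded Borel set makes a Radon measure finite, which gives access to
  the regularity of finite Borel measures.\<close>

lemma radon_restrict_bounded:
  fixes N :: "'a::euclidean_space measure"
  assumes N: "radon_measure N" and B: "B \<in> sets borel" "bounded B"
  shows "sets (measure_on N B) = sets borel" "emeasure (measure_on N B) (space (measure_on N B)) \<noteq> \<infinity>"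
    "X \<in> sets borel \<Longrightarrow> emeasure (measure_on N B) X = emeasure N (X \<inter> B)"
proof -
  show s: "sets (measure_on N B) = sets borel" using radon_sets[OF N] by simp
  show X: "emeasure (measure_on N B) X = emeasure N (X \<inter> B)" if "X \<in> sets borel" for X
    using that B radon_sets[OF N] by (simp add: emeasure_measure_on)
  show "emeasure (measure_on N B) (space (measure_on N B)) \<noteq> \<infinity>"
    using X[of UNIV] radon_emeasure_bounded_finite[OF N B(2)] radon_space[OF N] by simp
qed

lemma radon_outer_regular:
  fixes N :: "'a::euclidean_space measure"
  assumes N: "radon_measure N" and X: "X \<in> sets borel" "bounded X" and \<epsilon>: "0 < \<epsilon>"
  obtains U where "open U" "bounded U" "X \<subseteq> U" "emeasure N U < emeasure N X + ennreal \<epsilon>"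
proof -
  obtain R where R: "X \<subseteq> ball 0 R" using X(2) bounded_subset_ballD by blast
  let ?B = "ball (0::'a) R"
  note M = radon_restrict_bounded[OF N, of ?B]
  have XB: "emeasure (measure_on N ?B) X = emeasure N X" using M(3)[OF _ _ X(1)] R by (simp add: Int_absorb2)
  have "emeasure N X < emeasure N X + ennreal \<epsilon>"
    using radon_emeasure_bounded_finite[OF N X(2)] \<epsilon>
    by (simp add: ennreal_add_left_cancel_less[of _ 0, simplified])
  moreover have "(INF U\<in>{U. X \<subseteq> U \<and> open U}. emeasure (measure_on N ?B) U) = emeasure N X"
    using outer_regular[OF M(1) M(2) X(1)] XB by simp
  ultimately have "(INF U\<in>{U. X \<subseteq> U \<and> open U}. emeasure (measure_on N ?B) U) < emeasure N X + ennreal \<epsilon>"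
    by simp
  then obtain U where U: "X \<subseteq> U" "open U" "emeasure (measure_on N ?B) U < emeasure N X + ennreal \<epsilon>"
    unfolding INF_less_iff by blast
  show ?thesis
  proof (rule that[of "U \<inter> ?B"])
    show "emeasure N (U \<inter> ?B) < emeasure N X + ennreal \<epsilon>" using U(2,3) M(3)[of U] by simp
    show "bounded (U \<inter> ?B)" by (rule bounded_subset[OF bounded_ball]) auto
  qed (use U R in auto)
qed

lemma radon_inner_regular:
  fixes N :: "'a::euclidean_space measure"
  assumes N: "radon_measure N" and X: "X \<in> sets borel" "bounded X"
  shows "emeasure N X = (SUP K\<in>{K. K \<subseteq> X \<and> compact K}. emeasure N K)"
proof -
  note M = radon_restrict_bounded[OF N X]
  have "emeasure (measure_on N X) K = emeasure N K" if "K \<in> {K. K \<subseteq> X \<and> compact K}" for K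
    using M(3)[of K] that by (simp add: Int_absorb2 borel_compact)
  then show ?thesis using inner_regular[OF M(1) M(2) X(1)] M(3)[OF X(1)] by simp
qed

text \<open>The constant in an a priori bound \<open>\<nu>\<^sub>1 \<le> (t + q) \<nu>\<^sub>2\<close> improves itself: a Vitali family of balls
  on which the ratio is at most \<open>t\<close> covers a fixed fraction \<open>1/D\<close> of the set.\<close>

lemma measure_le_of_ball_ratios:
  fixes \<nu>1 \<nu>2 :: "'a::euclidean_space measure"
  assumes s1: "sets \<nu>1 = sets borel" and N2: "radon_measure \<nu>2" and A: "A \<in> sets borel" "bounded A"
    and K: "0 \<le> K" "\<And>X. X \<in> sets borel \<Longrightarrow> X \<subseteq> A \<Longrightarrow> emeasure \<nu>1 X \<le> ennreal K * emeasure \<nu>2 X"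
    and t: "0 \<le> t" and D: "1 \<le> D" and \<delta>: "0 < \<delta>"
    and ratio: "\<And>x r. x \<in> A \<Longrightarrow> 0 < r \<Longrightarrow> r < \<delta> \<Longrightarrow> emeasure \<nu>1 (ball x r) \<le> ennreal t * emeasure \<nu>2 (ball x r)"
    and doubl: "\<And>x r. x \<in> A \<Longrightarrow> 0 < r \<Longrightarrow> r < \<delta> \<Longrightarrow> emeasure \<nu>2 (ball x (5 * r)) \<le> ennreal D * emeasure \<nu>2 (ball x r)"
  shows "emeasure \<nu>1 A \<le> ennreal t * emeasure \<nu>2 A"
proof -
  note s2 = radon_sets[OF N2]
  have em: "emeasure \<nu>2 B = ennreal (measure \<nu>2 B)" if "bounded B" for B
    by (rule radon_emeasure_eq_measure[OF N2 that])
  have step: "emeasure \<nu>1 X \<le> ennreal ((t + q * (1 - 1/D)) * measure \<nu>2 X)"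
    if q: "0 \<le> q" and Q: "\<And>X. X \<in> sets borel \<Longrightarrow> X \<subseteq> A \<Longrightarrow> emeasure \<nu>1 X \<le> ennreal ((t + q) * measure \<nu>2 X)"
      and X: "X \<in> sets borel" "X \<subseteq> A" for q X
  proof (rule ennreal_le_epsilon)
    fix e :: real assume e: "0 < e"
    \<comment> \<open>The excess mass of U is charged with the old constant t + q and must stay
      below e; the summand 1 keeps the denominator positive.\<close>
    define \<epsilon> where "\<epsilon> = e / (t + q + 1)"
    have \<epsilon>: "0 < \<epsilon>" "(t + q) * \<epsilon> \<le> e"
      using e t q by (auto simp: \<epsilon>_def field_simps)
    have Xb: "bounded X" using bounded_subset[OF A(2) X(2)] .
    obtain U where U: "open U" "bounded U" "X \<subseteq> U" "emeasure \<nu>2 U < emeasure \<nu>2 X + ennreal \<epsilon>"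
      using radon_outer_regular[OF N2 X(1) Xb \<epsilon>(1)] .
    have Um: "measure \<nu>2 U \<le> measure \<nu>2 X + \<epsilon>"
      using U(4) \<epsilon>(1) unfolding em[OF U(2)] em[OF Xb] by (simp add: ennreal_plus[symmetric] ennreal_less_iff del: ennreal_plus)
    have "\<exists>\<rho>. x \<in> X \<longrightarrow> (0 < \<rho> \<and> \<rho> < \<delta> \<and> ball x \<rho> \<subseteq> U)" for x
    proof (cases "x \<in> X")
      case True
      then obtain e where e: "e > 0" "ball x e \<subseteq> U" using U openE by blast
      have "ball x (min e (\<delta>/2)) \<subseteq> ball x e" by (rule subset_ball) simp
      then show ?thesis using e \<delta> by (intro exI[of _ "min e (\<delta>/2)"]) auto
    qed simp
    then obtain \<rho> where \<rho>: "\<And>x. x \<in> X \<Longrightarrow> 0 < \<rho> x" "\<And>x. x \<in> X \<Longrightarrow> \<rho> x < \<delta>" "\<And>x. x \<in> X \<Longrightarrow> ball x (\<rho> x) \<subseteq> U"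
      by metis
    obtain a :: "nat \<Rightarrow> 'a" and R :: "nat \<Rightarrow> real"
      where aR: "\<And>i. R i = 0 \<or> (a i \<in> X \<and> R i = \<rho> (a i))"
        and disj: "disjoint_family (\<lambda>i. ball (a i) (R i))" and cover: "X \<subseteq> (\<Union>i. ball (a i) (5 * R i))"
    proof (rule Vitali_covering_sequence[of X \<rho> \<delta>])
      show "0 < \<rho> x \<and> \<rho> x \<le> \<delta>" if "x \<in> X" for x using \<rho>(1,2)[OF that] by simp
    qed blast
    have ri: "emeasure \<nu>1 (ball (a i) (R i)) \<le> ennreal t * emeasure \<nu>2 (ball (a i) (R i))"
      and di: "emeasure \<nu>2 (ball (a i) (5 * R i)) \<le> ennreal D * emeasure \<nu>2 (ball (a i) (R i))"
      and si: "ball (a i) (R i) \<subseteq> U" for i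
    proof -
      consider "R i = 0" | "a i \<in> X" "R i = \<rho> (a i)" using aR[of i] by blast
      then have "emeasure \<nu>1 (ball (a i) (R i)) \<le> ennreal t * emeasure \<nu>2 (ball (a i) (R i)) \<and>
        emeasure \<nu>2 (ball (a i) (5 * R i)) \<le> ennreal D * emeasure \<nu>2 (ball (a i) (R i)) \<and> ball (a i) (R i) \<subseteq> U"
      proof cases
        case 1
        then show ?thesis by simp
      next
        case 2
        then have "a i \<in> A" using X(2) by blast
        then show ?thesis using 2 \<rho>[OF 2(1)] ratio[of "a i" "R i"] doubl[of "a i" "R i"] by simp
      qed
      then show "emeasure \<nu>1 (ball (a i) (R i)) \<le> ennreal t * emeasure \<nu>2 (ball (a i) (R i))"
        "emeasure \<nu>2 (ball (a i) (5 * R i)) \<le> ennreal D * emeasure \<nu>2 (ball (a i) (R i))"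
        "ball (a i) (R i) \<subseteq> U" by auto
    qed
    let ?S = "\<Union>i. ball (a i) (R i)"
    have So: "open ?S" by auto
    have SU: "?S \<subseteq> U" using si by blast
    have Sb: "bounded ?S" using bounded_subset[OF U(2) SU] .
    have r1: "range (\<lambda>i. ball (a i) (R i)) \<subseteq> sets \<nu>1" and r2: "range (\<lambda>i. ball (a i) (R i)) \<subseteq> sets \<nu>2"
      and r3: "range (\<lambda>i. ball (a i) (5 * R i)) \<subseteq> sets \<nu>2"
      unfolding s1 s2 by (simp_all add: image_subset_iff)
    have S2: "(\<Sum>i. emeasure \<nu>2 (ball (a i) (R i))) = emeasure \<nu>2 ?S" by (rule suminf_emeasure[OF r2 disj])
    have "emeasure \<nu>1 ?S = (\<Sum>i. emeasure \<nu>1 (ball (a i) (R i)))" by (rule suminf_emeasure[OF r1 disj, symmetric])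
    also have "\<dots> \<le> (\<Sum>i. ennreal t * emeasure \<nu>2 (ball (a i) (R i)))" by (intro suminf_le ri) auto
    also have "\<dots> = ennreal t * emeasure \<nu>2 ?S" unfolding ennreal_suminf_cmult S2 ..
    finally have S1: "emeasure \<nu>1 ?S \<le> ennreal (t * measure \<nu>2 ?S)" using t by (simp add: em[OF Sb] ennreal_mult)
    have "emeasure \<nu>2 X \<le> emeasure \<nu>2 (\<Union>i. ball (a i) (5 * R i))"
      using cover s2 by (intro emeasure_mono) auto
    also have "\<dots> \<le> (\<Sum>i. emeasure \<nu>2 (ball (a i) (5 * R i)))" by (rule emeasure_subadditive_countably[OF r3])
    also have "\<dots> \<le> (\<Sum>i. ennreal D * emeasure \<nu>2 (ball (a i) (R i)))" by (intro suminf_le di) auto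
    also have "\<dots> = ennreal D * emeasure \<nu>2 ?S" unfolding ennreal_suminf_cmult S2 ..
    finally have "ennreal (measure \<nu>2 X) \<le> ennreal (D * measure \<nu>2 ?S)"
      using D by (simp add: em[OF Sb] em[OF Xb] ennreal_mult)
    \<comment> \<open>The disjoint balls carry at least the fraction 1/D of the mass of X. On them
      the constant t holds, and only outside them is the old constant t + q used.\<close>
    then have XS: "measure \<nu>2 X / D \<le> measure \<nu>2 ?S" using D by (simp add: divide_le_eq mult.commute)
    have XSb: "X - ?S \<in> sets borel" "X - ?S \<subseteq> A" using X So by auto
    have "emeasure \<nu>1 X \<le> emeasure \<nu>1 (?S \<union> (X - ?S))" using X s1 So by (intro emeasure_mono) auto
    also have "\<dots> \<le> emeasure \<nu>1 ?S + emeasure \<nu>1 (X - ?S)"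
      using s1 So XSb by (intro emeasure_subadditive) auto
    also have "\<dots> \<le> ennreal (t * measure \<nu>2 ?S) + ennreal ((t + q) * measure \<nu>2 (X - ?S))"
      by (intro add_mono S1 Q XSb)
    also have "\<dots> = ennreal (t * measure \<nu>2 ?S + (t + q) * measure \<nu>2 (X - ?S))"
      using t q by (intro ennreal_plus[symmetric]) auto
    also have "\<dots> \<le> ennreal ((t + q * (1 - 1/D)) * measure \<nu>2 X + e)"
    proof (rule ennreal_leI)
      have "measure \<nu>2 (X - ?S) \<le> measure \<nu>2 (U - ?S)"
        using U So by (intro radon_measure_mono[OF N2]) (auto intro: bounded_subset[OF U(2)])
      also have "\<dots> = measure \<nu>2 U - measure \<nu>2 ?S"
        using s2 U(1) So SU em[OF U(2)] by (intro measure_Diff) auto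
      finally have 1: "measure \<nu>2 (X - ?S) \<le> measure \<nu>2 U - measure \<nu>2 ?S" .
      have "t * measure \<nu>2 ?S + (t + q) * measure \<nu>2 (X - ?S) \<le> t * measure \<nu>2 ?S + (t + q) * (measure \<nu>2 U - measure \<nu>2 ?S)"
        using 1 t q by (intro add_left_mono mult_left_mono) auto
      also have "\<dots> = (t + q) * measure \<nu>2 U - q * measure \<nu>2 ?S" by (simp add: algebra_simps)
      also have "\<dots> \<le> (t + q) * (measure \<nu>2 X + \<epsilon>) - q * (measure \<nu>2 X / D)"
        using Um XS t q by (intro diff_mono mult_left_mono) auto
      also have "\<dots> = (t + q * (1 - 1/D)) * measure \<nu>2 X + (t + q) * \<epsilon>" by (simp add: algebra_simps)
      also have "\<dots> \<le> (t + q * (1 - 1/D)) * measure \<nu>2 X + e" using \<epsilon>(2) by simp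
      finally show "t * measure \<nu>2 ?S + (t + q) * measure \<nu>2 (X - ?S) \<le> (t + q * (1 - 1/D)) * measure \<nu>2 X + e" .
    qed
    also have "\<dots> = ennreal ((t + q * (1 - 1/D)) * measure \<nu>2 X) + ennreal e"
      using t q D e by (intro ennreal_plus) (auto intro!: mult_nonneg_nonneg add_nonneg_nonneg)
    finally show "emeasure \<nu>1 X \<le> ennreal ((t + q * (1 - 1/D)) * measure \<nu>2 X) + ennreal e" .
  qed
  define k where "k = 1 - 1/D"
  have k: "0 \<le> k" "k < 1" using D by (auto simp: k_def)
  \<comment> \<open>Each round multiplies the excess over t by 1 - 1/D, starting from the a priori
    bound K. The claim ranges over all Borel subsets of A because a round applies it to the
    uncovered part of X.\<close>
  have iter: "\<forall>X. X \<in> sets borel \<longrightarrow> X \<subseteq> A \<longrightarrow> emeasure \<nu>1 X \<le> ennreal ((t + K * k ^ n) * measure \<nu>2 X)" for n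
  proof (induction n)
    case 0
    show ?case
    proof (intro allI impI)
      fix X :: "'a set" assume X: "X \<in> sets borel" "X \<subseteq> A"
      have "emeasure \<nu>1 X \<le> ennreal (K * measure \<nu>2 X)"
        using K(2)[OF X] K(1) em[OF bounded_subset[OF A(2) X(2)]] by (simp add: ennreal_mult)
      also have "\<dots> \<le> ennreal ((t + K * k ^ 0) * measure \<nu>2 X)"
        using t by (intro ennreal_leI mult_right_mono) auto
      finally show "emeasure \<nu>1 X \<le> ennreal ((t + K * k ^ 0) * measure \<nu>2 X)" .
    qed
  next
    case (Suc n)
    show ?case
      using step[of "K * k ^ n"] Suc K(1) k by (simp add: k_def mult_ac)
  qed
  have "(\<lambda>n. ennreal ((t + K * k ^ n) * measure \<nu>2 A)) \<longlonglongrightarrow> ennreal ((t + K * 0) * measure \<nu>2 A)"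
    using k by (intro tendsto_ennrealI tendsto_intros LIMSEQ_power_zero) auto
  then have "emeasure \<nu>1 A \<le> ennreal ((t + K * 0) * measure \<nu>2 A)"
    by (rule LIMSEQ_le_const) (use iter A(1) in blast)
  then show ?thesis using t em[OF A(2)] by (simp add: ennreal_mult)
qed

subsection \<open>Projections, cones and Lipschitz graphs\<close>

lemma subspace_projection:
  fixes L :: "'a::euclidean_space set"
  assumes L: "subspace L"
  obtains pr where "linear pr" "\<And>x. pr x \<in> L" "\<And>x. x \<in> L \<Longrightarrow> pr x = x" "\<And>x y. y \<in> L \<Longrightarrow> (x - pr x) \<bullet> y = 0"
    "\<And>x. norm (pr x) \<le> norm x" "\<And>x. norm (x - pr x) \<le> norm x" "\<And>x. (norm x)\<^sup>2 = (norm (pr x))\<^sup>2 + (norm (x - pr x))\<^sup>2"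
    "\<And>x. infdist x L = norm (x - pr x)"
proof -
  obtain B where B: "B \<subseteq> L" "pairwise orthogonal B" "\<And>x. x \<in> B \<Longrightarrow> norm x = 1"
      "independent B" "card B = dim L" "span B = L"
    using orthonormal_basis_subspace[OF L] by metis
  have finB: "finite B" using B(4) by (rule independent_imp_finite)
  define pr where "pr x = (\<Sum>b\<in>B. (x \<bullet> b) *\<^sub>R b)" for x
  have lin: "linear pr"
    unfolding pr_def by (rule linearI) (simp_all add: inner_add_left scaleR_add_left sum.distrib scaleR_sum_right)
  have prL: "pr x \<in> L" for x unfolding pr_def B(6)[symmetric] by (intro span_sum span_scale span_base)
  have fix': "pr x = x" if "x \<in> L" for x
    unfolding pr_def using orthonormal_basis_expand[OF B(2,3) _ finB] that B(6) by auto
  have prb: "pr x \<bullet> b = x \<bullet> b" if b: "b \<in> B" for x b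
  proof -
    have "pr x \<bullet> b = (\<Sum>c\<in>B. (x \<bullet> c) * (c \<bullet> b))" by (simp add: pr_def inner_sum_left)
    also have "\<dots> = (\<Sum>c\<in>B. if c = b then x \<bullet> b else 0)"
    proof (rule sum.cong[OF refl])
      fix c assume c: "c \<in> B"
      show "(x \<bullet> c) * (c \<bullet> b) = (if c = b then x \<bullet> b else 0)"
        using B(2) B(3)[OF b] c b by (auto simp: pairwise_def orthogonal_def norm_eq_1)
    qed
    finally show ?thesis using finB b by simp
  qed
  have orth: "(x - pr x) \<bullet> y = 0" if "y \<in> L" for x y
  proof -
    have "y \<in> span B" using that B(6) by simp
    then show ?thesis
    proof (induction rule: span_induct_alt)
      case (step c b y)
      then show ?case using prb[of b x] by (simp add: inner_add_right inner_diff_left)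
    qed simp
  qed
  have pyth: "(norm x)\<^sup>2 = (norm (pr x))\<^sup>2 + (norm (x - pr x))\<^sup>2" for x
  proof -
    have "(norm (pr x + (x - pr x)))\<^sup>2 = (norm (pr x))\<^sup>2 + (norm (x - pr x))\<^sup>2"
      using orth[OF prL, of x x] by (intro norm_add_Pythagorean) (simp add: orthogonal_def inner_commute)
    then show ?thesis by simp
  qed
  have n1: "norm (pr x) \<le> norm x" for x
    by (rule power2_le_imp_le) (use pyth[of x] in auto)
  have n2: "norm (x - pr x) \<le> norm x" for x
    by (rule power2_le_imp_le) (use pyth[of x] in auto)
  have "infdist x L = norm (x - pr x)" for x
  proof (rule antisym)
    show "infdist x L \<le> norm (x - pr x)" using infdist_le[OF prL, of x x] by (simp add: dist_norm)
    have "norm (x - pr x) \<le> dist x y" if "y \<in> L" for y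
    proof -
      have "pr (x - y) = pr x - y" using linear_diff[OF lin] fix'[OF that] by simp
      then show ?thesis using n2[of "x - y"] by (simp add: dist_norm)
    qed
    then show "norm (x - pr x) \<le> infdist x L"
      using subspace_0[OF L] by (subst infdist_notempty) (auto intro!: cINF_greatest)
  qed
  then show ?thesis using that[OF lin prL fix' orth n1 n2 pyth] by blast
qed

lemma lipschitz_extension_real:
  fixes f :: "'a::euclidean_space \<Rightarrow> real"
  assumes S: "S \<noteq> {}" and f: "\<And>x y. x \<in> S \<Longrightarrow> y \<in> S \<Longrightarrow> \<bar>f x - f y\<bar> \<le> norm (x - y)"
  obtains g where "\<And>x. x \<in> S \<Longrightarrow> g x = f x" "\<And>x y. \<bar>g x - g y\<bar> \<le> norm (x - y)"
proof -
  define g where "g x = (INF z\<in>S. f z + norm (x - z))" for x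
  obtain s where s: "s \<in> S" using S by blast
  have bd: "bdd_below ((\<lambda>z. f z + norm (x - z)) ` S)" for x
  proof (rule bdd_belowI2)
    fix z assume z: "z \<in> S"
    have "norm (s - z) \<le> norm (s - x) + norm (x - z)" using norm_triangle_ineq[of "s - x" "x - z"] by simp
    then show "f s - norm (s - x) \<le> f z + norm (x - z)" using f[OF s z] by linarith
  qed
  have low: "g x \<le> f z + norm (x - z)" if "z \<in> S" for x z
    unfolding g_def by (rule cINF_lower[OF bd that])
  have half: "g x - norm (x - y) \<le> g y" for x y
    unfolding g_def[of y]
  proof (rule cINF_greatest[OF S])
    fix z assume z: "z \<in> S"
    have "norm (x - z) \<le> norm (x - y) + norm (y - z)" using norm_triangle_ineq[of "x - y" "y - z"] by simp
    then show "g x - norm (x - y) \<le> f z + norm (y - z)" using low[OF z, of x] by linarith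
  qed
  show ?thesis
  proof (rule that[of g])
    show "g x = f x" if "x \<in> S" for x
    proof (rule antisym)
      show "g x \<le> f x" using low[OF that, of x] by simp
      show "f x \<le> g x" unfolding g_def using f[OF that] by (intro cINF_greatest[OF S]) (force simp: abs_le_iff)
    qed
    show "\<bar>g x - g y\<bar> \<le> norm (x - y)" for x y
      using half[of x y] half[of y x] by (simp add: norm_minus_commute abs_le_iff)
  qed
qed

text \<open>By Pythagoras the projection keeps at least the fraction 1 - \<eta>^2 of the squared
  norm, and 1 - \<eta>^2 \<ge> (1 - \<eta>)^2.\<close>

lemma cone_projection:
  fixes F :: "'a::euclidean_space set"
  assumes lin: "linear pr" and pyth: "\<And>x. (norm x)\<^sup>2 = (norm (pr x))\<^sup>2 + (norm (x - pr x))\<^sup>2"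
    and \<eta>: "0 \<le> \<eta>" "\<eta> < 1" and z: "norm (z - pr z) \<le> \<eta> * norm z"
  shows "(1 - \<eta>) * norm z \<le> norm (pr z)"
proof (rule power2_le_imp_le)
  have "(norm (z - pr z))\<^sup>2 \<le> \<eta>\<^sup>2 * (norm z)\<^sup>2"
    using power_mono[OF z, of 2] by (simp add: power_mult_distrib)
  then have "(1 - \<eta>\<^sup>2) * (norm z)\<^sup>2 \<le> (norm (pr z))\<^sup>2" using pyth[of z] by (simp add: algebra_simps)
  moreover have "(1 - \<eta>)\<^sup>2 \<le> 1 - \<eta>\<^sup>2"
  proof -
    have "0 \<le> 2 * \<eta> * (1 - \<eta>)" using \<eta> by simp
    then show ?thesis by (simp add: power2_eq_square algebra_simps)
  qed
  ultimately show "((1 - \<eta>) * norm z)\<^sup>2 \<le> (norm (pr z))\<^sup>2"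
    using mult_right_mono[of "(1 - \<eta>)\<^sup>2" "1 - \<eta>\<^sup>2" "(norm z)\<^sup>2"] by (simp add: power_mult_distrib)
qed simp

lemma cone_lipschitz_graph:
  fixes F :: "'a::euclidean_space set"
  assumes L: "subspace L" "dim L = d" and \<eta>: "0 \<le> \<eta>" "\<eta> \<le> 1/2"
    and cone: "\<And>x y. x \<in> F \<Longrightarrow> y \<in> F \<Longrightarrow> infdist (y - x) L \<le> \<eta> * norm (y - x)"
  obtains G where "lipschitz_graph d G" "F \<subseteq> G"
proof -
  obtain pr where lin: "linear pr" and prL: "\<And>x. pr x \<in> L" and prfix: "\<And>x. x \<in> L \<Longrightarrow> pr x = x"
    and orth: "\<And>x y. y \<in> L \<Longrightarrow> (x - pr x) \<bullet> y = 0" and n2: "\<And>x. norm (x - pr x) \<le> norm x"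
    and pyth: "\<And>x. (norm x)\<^sup>2 = (norm (pr x))\<^sup>2 + (norm (x - pr x))\<^sup>2"
    and inf: "\<And>x. infdist x L = norm (x - pr x)"
    by (rule subspace_projection[OF L(1)]) (rule that; assumption)
  have bil: "norm (y - x) \<le> 2 * norm (pr y - pr x)" if "x \<in> F" "y \<in> F" for x y
  proof -
    have "(1 - \<eta>) * norm (y - x) \<le> norm (pr (y - x))"
      using cone[OF that] \<eta> by (intro cone_projection[OF lin pyth]) (auto simp: inf)
    moreover have "(1/2) * norm (y - x) \<le> (1 - \<eta>) * norm (y - x)" using \<eta> by (intro mult_right_mono) auto
    ultimately show ?thesis by (simp add: linear_diff[OF lin])
  qed
  have inj: "inj_on pr F"
    using bil by (intro inj_onI) (metis eq_iff_diff_eq_0 norm_le_zero_iff norm_zero mult_zero_right)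
  \<comment> \<open>The height of F over the plane. The cone condition makes the projection
    injective on F, and with \<eta> \<le> 1/2 the height is 1-Lipschitz in the projected
    point.\<close>
  define f0 where "f0 p = inv_into F pr p - p" for p
  have f0: "f0 (pr x) = x - pr x" if "x \<in> F" for x
    unfolding f0_def using inv_into_f_f[OF inj that] by simp
  have f0lip: "norm (f0 p - f0 q) \<le> norm (p - q)" if pq: "p \<in> pr ` F" "q \<in> pr ` F" for p q
  proof -
    obtain x y where xy: "x \<in> F" "y \<in> F" "p = pr x" "q = pr y" using pq by auto
    have "norm (f0 p - f0 q) = norm ((x - y) - pr (x - y))"
      by (simp add: xy f0 linear_diff[OF lin] algebra_simps)
    also have "\<dots> \<le> \<eta> * norm (x - y)" using cone[OF xy(2,1)] by (simp add: inf)
    also have "\<dots> \<le> (1/2) * (2 * norm (pr x - pr y))" using \<eta> bil[OF xy(2,1)] by (intro mult_mono) auto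
    finally show ?thesis by (simp add: xy)
  qed
  \<comment> \<open>The extension is done for each coordinate separately, which costs a factor of
    the dimension in the Lipschitz constant.\<close>
  have "\<exists>g. \<forall>b\<in>Basis. (\<forall>p\<in>pr ` F. g b p = f0 p \<bullet> b) \<and> (\<forall>p q. \<bar>g b p - g b q\<bar> \<le> norm (p - q))"
  proof (cases "F = {}")
    case True
    then show ?thesis by (intro exI[of _ "\<lambda>_ _. 0"]) auto
  next
    case False
    have exh: "\<exists>h. (\<forall>p\<in>pr ` F. h p = f0 p \<bullet> b) \<and> (\<forall>p q. \<bar>h p - h q\<bar> \<le> norm (p - q))" if b: "b \<in> Basis" for b
    proof -
      have lip: "\<bar>f0 p \<bullet> b - f0 q \<bullet> b\<bar> \<le> norm (p - q)" if "p \<in> pr ` F" "q \<in> pr ` F" for p q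
        using Basis_le_norm[OF b, of "f0 p - f0 q"] f0lip[OF that] by (simp add: inner_diff_left)
      have ne: "pr ` F \<noteq> {}" using False by simp
      show ?thesis
        by (rule lipschitz_extension_real[of "pr ` F" "\<lambda>p. f0 p \<bullet> b", OF ne lip]) blast+
    qed
    have "\<forall>b\<in>Basis. \<exists>h. (\<forall>p\<in>pr ` F. h p = f0 p \<bullet> b) \<and> (\<forall>p q. \<bar>h p - h q\<bar> \<le> norm (p - q))"
      by (rule ballI, rule exh)
    from bchoice[OF this] show ?thesis .
  qed
  then obtain g where g0: "\<forall>b\<in>Basis. (\<forall>p\<in>pr ` F. g b p = f0 p \<bullet> b) \<and> (\<forall>p q. \<bar>g b p - g b q\<bar> \<le> norm (p - q))" ..
  have g: "b \<in> Basis \<Longrightarrow> p \<in> pr ` F \<Longrightarrow> g b p = f0 p \<bullet> b"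
    "b \<in> Basis \<Longrightarrow> \<bar>g b p - g b q\<bar> \<le> norm (p - q)" for b p q
    using g0 by (simp_all only: Ball_def)
  define h where "h p = (\<Sum>b\<in>Basis. g b p *\<^sub>R b)" for p
  \<comment> \<open>The coordinatewise extension may leave the orthogonal complement of L.
    Subtracting the projection repairs this and changes nothing over the projection of F, where the
    values are already orthogonal to L.\<close>
  define f where "f p = h p - pr (h p)" for p
  have hlip: "norm (h p - h q) \<le> real DIM('a) * norm (p - q)" for p q
  proof -
    have "norm (h p - h q) = norm (\<Sum>b\<in>Basis. (g b p - g b q) *\<^sub>R b)"
      by (simp add: h_def sum_subtractf scaleR_diff_left)
    also have "\<dots> \<le> (\<Sum>b\<in>(Basis::'a set). norm (p - q))" using g(2) by (intro sum_norm_le) simp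
    finally show ?thesis by simp
  qed
  have flip: "norm (f p - f q) \<le> real DIM('a) * norm (p - q)" for p q
  proof -
    have "f p - f q = (h p - h q) - pr (h p - h q)" by (simp add: f_def linear_diff[OF lin])
    then show ?thesis using n2[of "h p - h q"] hlip[of p q] by simp
  qed
  have fF: "f (pr x) = x - pr x" if x: "x \<in> F" for x
  proof -
    have "h (pr x) = f0 (pr x)" unfolding h_def using g(1) x by (simp add: euclidean_representation)
    then show ?thesis using f0[OF x] prfix[OF prL] by (simp add: f_def linear_diff[OF lin])
  qed
  show ?thesis
  proof (rule that[of "(\<lambda>p. p + f p) ` L"])
    have "(real DIM('a))-lipschitz_on L f" using flip by (intro lipschitz_onI) (auto simp: dist_norm)
    moreover have "f ` L \<subseteq> orthogonal_comp L"
      using orth by (auto simp: orthogonal_comp_def orthogonal_def f_def inner_commute)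
    ultimately show "lipschitz_graph d ((\<lambda>p. p + f p) ` L)" unfolding lipschitz_graph_def using L by blast
    show "F \<subseteq> (\<lambda>p. p + f p) ` L"
    proof
      fix x assume "x \<in> F"
      then show "x \<in> (\<lambda>p. p + f p) ` L" using fF prL by (intro image_eqI[of _ _ "pr x"]) auto
    qed
  qed
qed

text \<open>Closeness is stated through distances to the subspaces, the form in which a cone around
  W passes to a slightly wider cone around L. Subspaces are probed by the coordinates of the images
  of an orthonormal basis.\<close>

lemma subspaces_countable_net:
  assumes d: "d \<le> DIM('a::euclidean_space)"
  obtains \<L> :: "'a::euclidean_space set set" where "countable \<L>" "\<L> \<noteq> {}" "\<And>L. L \<in> \<L> \<Longrightarrow> subspace L \<and> dim L = d"
    "\<And>W \<epsilon>. subspace W \<Longrightarrow> dim W = d \<Longrightarrow> 0 < \<epsilon> \<Longrightarrow> \<exists>L\<in>\<L>. \<forall>v. infdist v L \<le> infdist v W + \<epsilon> * norm v"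
proof -
  let ?P = "model_subspace d :: 'a set"
  note P = model_subspace[where 'a = 'a, OF d]
  define X where "X = {W :: 'a set. subspace W \<and> dim W = d}"
  define A :: "'a set \<Rightarrow> 'a \<Rightarrow>\<^sub>L 'a"
    where "A W = (SOME A. (\<forall>p\<in>?P. norm (blinfun_apply A p) = norm p) \<and> blinfun_apply A ` ?P = W)" for W
  have "(\<forall>p\<in>?P. norm (blinfun_apply (A W) p) = norm p) \<and> blinfun_apply (A W) ` ?P = W" if "W \<in> X" for W
    unfolding A_def
  proof (rule someI_ex)
    have W: "subspace W" "dim ?P = dim W" using that P(2) by (auto simp: X_def)
    show "\<exists>A :: 'a \<Rightarrow>\<^sub>L 'a. (\<forall>p\<in>?P. norm (blinfun_apply A p) = norm p) \<and> blinfun_apply A ` ?P = W"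
      by (rule subspace_isometric_param[OF P(1) W]) blast
  qed
  then have A: "W \<in> X \<Longrightarrow> p \<in> ?P \<Longrightarrow> norm (blinfun_apply (A W) p) = norm p"
    "W \<in> X \<Longrightarrow> blinfun_apply (A W) ` ?P = W" for W p by auto
  obtain B where B: "B \<subseteq> ?P" "pairwise orthogonal B" "\<And>x. x \<in> B \<Longrightarrow> norm x = 1"
      "independent B" "card B = dim ?P" "span B = ?P"
    using orthonormal_basis_subspace[OF P(1)] by metis
  have finB: "finite B" using B(4) by (rule independent_imp_finite)
  \<comment> \<open>The error sums over all coordinates and over d basis vectors; the summand 1
    keeps N positive for d = 0.\<close>
  define N where "N = real DIM('a) * (real d + 1)"
  have N: "0 < N" by (simp add: N_def)
  have net: "\<exists>F. finite F \<and> F \<subseteq> X \<and> (\<forall>W\<in>X. \<exists>L\<in>F. \<forall>v. infdist v L \<le> infdist v W + \<epsilon> * norm v)" if \<epsilon>: "0 < \<epsilon>" for \<epsilon>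
  proof -
    obtain F where F: "finite F" "F \<subseteq> X"
      "\<And>W. W \<in> X \<Longrightarrow> \<exists>L\<in>F. \<forall>q\<in>B \<times> (Basis :: 'a set). \<bar>blinfun_apply (A W) (fst q) \<bullet> snd q - blinfun_apply (A L) (fst q) \<bullet> snd q\<bar> \<le> \<epsilon> / N"
    proof (rule finite_net_of_probes[of "B \<times> (Basis :: 'a set)" X "\<lambda>W q. blinfun_apply (A W) (fst q) \<bullet> snd q" 1 "\<epsilon> / N"])
      show "finite (B \<times> (Basis :: 'a set))" using finB by simp
      show "\<bar>blinfun_apply (A W) (fst q) \<bullet> snd q\<bar> \<le> 1" if "W \<in> X" "q \<in> B \<times> (Basis :: 'a set)" for W q
        using Basis_le_norm[of "snd q" "blinfun_apply (A W) (fst q)"] A(1)[OF that(1), of "fst q"] B(1,3) that(2) by auto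
      show "0 < \<epsilon> / N" using \<epsilon> N by simp
    qed blast
    have "\<exists>L\<in>F. \<forall>v. infdist v L \<le> infdist v W + \<epsilon> * norm v" if W: "W \<in> X" for W
    proof -
      obtain L where L: "L \<in> F" and close: "\<And>b e. b \<in> B \<Longrightarrow> e \<in> Basis \<Longrightarrow> \<bar>blinfun_apply (A W) b \<bullet> e - blinfun_apply (A L) b \<bullet> e\<bar> \<le> \<epsilon> / N"
        using F(3)[OF W] by auto
      have LX: "L \<in> X" using L F(2) by blast
      have bd: "norm (blinfun_apply (A W - A L) b) \<le> real DIM('a) * (\<epsilon> / N)" if "b \<in> B" for b
      proof -
        have "norm (blinfun_apply (A W - A L) b) \<le> (\<Sum>e\<in>Basis. \<bar>blinfun_apply (A W - A L) b \<bullet> e\<bar>)" by (rule norm_le_l1)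
        also have "\<dots> \<le> (\<Sum>e\<in>(Basis::'a set). \<epsilon> / N)"
          using close[OF that] by (intro sum_mono) (simp add: blinfun.diff_left inner_diff_left)
        finally show ?thesis by simp
      qed
      have pd: "norm (blinfun_apply (A W) p - blinfun_apply (A L) p) \<le> \<epsilon> * norm p" if p: "p \<in> ?P" for p
      proof -
        have "p = (\<Sum>b\<in>B. (p \<bullet> b) *\<^sub>R b)" using orthonormal_basis_expand[OF B(2,3) _ finB, of p] p B(6) by simp
        then have "blinfun_apply (A W - A L) p = (\<Sum>b\<in>B. (p \<bullet> b) *\<^sub>R blinfun_apply (A W - A L) b)"
          by (metis (no_types, lifting) blinfun.scaleR_right blinfun.sum_right sum.cong)
        also have "norm \<dots> \<le> (\<Sum>b\<in>B. norm p * (real DIM('a) * (\<epsilon> / N)))"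
        proof (rule sum_norm_le)
          fix b assume b: "b \<in> B"
          have "\<bar>p \<bullet> b\<bar> \<le> norm p" using Cauchy_Schwarz_ineq2[of p b] B(3)[OF b] by simp
          then show "norm ((p \<bullet> b) *\<^sub>R blinfun_apply (A W - A L) b) \<le> norm p * (real DIM('a) * (\<epsilon> / N))"
            unfolding norm_scaleR using bd[OF b] by (intro mult_mono) auto
        qed
        also have "\<dots> = (real d * real DIM('a) / N) * (\<epsilon> * norm p)" using B(5) P(2) by simp
        also have "\<dots> \<le> 1 * (\<epsilon> * norm p)"
          using \<epsilon> N by (intro mult_right_mono) (auto simp: N_def divide_le_eq)
        finally show ?thesis by (simp add: blinfun.diff_left)
      qed
      have "infdist v L \<le> infdist v W + \<epsilon> * norm v" for v
      proof -
        have sW: "subspace W" using W by (simp add: X_def)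
        obtain pr where pr: "\<And>x. pr x \<in> W" "\<And>x. norm (pr x) \<le> norm x" "\<And>x. infdist x W = norm (x - pr x)"
          by (rule subspace_projection[OF sW]) (rule that; assumption)
        obtain p where p: "p \<in> ?P" "pr v = blinfun_apply (A W) p" using A(2)[OF W] pr(1)[of v] by (metis imageE)
        have "norm p \<le> norm v" using A(1)[OF W p(1)] pr(2)[of v] p(2) by simp
        then have "norm (pr v - blinfun_apply (A L) p) \<le> \<epsilon> * norm v"
          using order_trans[OF pd[OF p(1)] mult_left_mono[of "norm p" "norm v" \<epsilon>]] \<epsilon> p(2) by simp
        moreover have "blinfun_apply (A L) p \<in> L" using A(2)[OF LX] p(1) by blast
        then have "infdist v L \<le> norm (v - blinfun_apply (A L) p)" by (metis infdist_le dist_norm)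
        ultimately show ?thesis
          using norm_triangle_ineq[of "v - pr v" "pr v - blinfun_apply (A L) p"] pr(3)[of v] by simp
      qed
      then show ?thesis using L by blast
    qed
    then show ?thesis using F(1,2) by blast
  qed
  have "\<exists>F. finite F \<and> F \<subseteq> X \<and> (\<forall>W\<in>X. \<exists>L\<in>F. \<forall>v. infdist v L \<le> infdist v W + (1 / real (Suc m)) * norm v)" for m
    by (rule net) simp
  then obtain F where F: "\<And>m. finite (F m)" "\<And>m. F m \<subseteq> X"
    "\<And>m W. W \<in> X \<Longrightarrow> \<exists>L\<in>F m. \<forall>v. infdist v L \<le> infdist v W + (1 / real (Suc m)) * norm v" by metis
  have PX: "?P \<in> X" using P by (simp add: X_def)
  show ?thesis
  proof (rule that[of "\<Union>(range F)"])
    show "countable (\<Union>(range F))" using F(1) by (auto intro: countable_finite)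
    show "\<Union>(range F) \<noteq> {}" using F(3)[OF PX, of 0] by blast
    show "subspace L \<and> dim L = d" if "L \<in> \<Union>(range F)" for L using that F(2) by (auto simp: X_def)
    fix W :: "'a set" and \<epsilon> :: real assume W: "subspace W" "dim W = d" and \<epsilon>: "0 < \<epsilon>"
    obtain m where m: "1 / real (Suc m) < \<epsilon>" using nat_approx_posE[OF \<epsilon>] .
    obtain L where L: "L \<in> F m" "\<And>v. infdist v L \<le> infdist v W + (1 / real (Suc m)) * norm v"
      using F(3)[of W m] W by (auto simp: X_def)
    have "infdist v L \<le> infdist v W + \<epsilon> * norm v" for v
      using L(2)[of v] mult_right_mono[OF less_imp_le[OF m], of "norm v"] by simp
    then show "\<exists>L\<in>\<Union>(range F). \<forall>v. infdist v L \<le> infdist v W + \<epsilon> * norm v" using L(1) by blast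
  qed
qed

subsection \<open>The density layers\<close>

lemma hausdorff_const_real:
  assumes "d \<le> DIM('a::euclidean_space)"
  obtains k where "0 < k" "hausdorff_const TYPE('a) d = ennreal k"
    "\<And>A :: 'a set. hausdorff_outer d A = ennreal (1/k) * hausdorff_unnormalized d A"
    "\<And>A :: 'a set. hausdorff_unnormalized d A = ennreal k * hausdorff_outer d A"
proof -
  obtain k where k: "0 \<le> k" "hausdorff_const TYPE('a) d = ennreal k"
    using hausdorff_const(2)[OF assms] by (cases "hausdorff_const TYPE('a) d") auto
  have k0: "0 < k" using hausdorff_const(1)[OF assms] k by simp
  have o: "hausdorff_outer d A = ennreal (1/k) * hausdorff_unnormalized d A" for A :: "'a set"
    unfolding hausdorff_outer_eq k(2) using k0 by (simp add: inverse_ennreal inverse_eq_divide mult.commute)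
  have "hausdorff_unnormalized d A = ennreal k * hausdorff_outer d A" for A :: "'a set"
    unfolding o using k0 by (simp add: mult.assoc[symmetric] ennreal_mult[symmetric])
  then show ?thesis using that k0 k(2) o by blast
qed

text \<open>The pieces may overlap, so they are made disjoint first; this is why the inequality is
  assumed for every Borel subset of a piece that lies in A.\<close>

lemma measure_le_by_pieces:
  fixes N1 N2 :: "'a::euclidean_space measure"
  assumes s: "sets N1 = sets borel" "sets N2 = sets borel" and \<F>: "countable \<F>" "\<And>F. F \<in> \<F> \<Longrightarrow> F \<in> sets borel"
    and A: "A \<in> sets borel" "A \<subseteq> \<Union>\<F>"
    and le: "\<And>F X. F \<in> \<F> \<Longrightarrow> X \<in> sets borel \<Longrightarrow> X \<subseteq> F \<Longrightarrow> X \<subseteq> A \<Longrightarrow> emeasure N1 X \<le> c * emeasure N2 X"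
  shows "emeasure N1 A \<le> c * emeasure N2 A"
proof (cases "\<F> = {}")
  case True
  then have "A = {}" using A(2) by auto
  then show ?thesis by simp
next
  case False
  define F where "F = from_nat_into \<F>"
  have F: "range F = \<F>" unfolding F_def using False \<F>(1) by (rule range_from_nat_into)
  define D where "D i = A \<inter> disjointed F i" for i
  have Fs: "range F \<subseteq> sets borel" using F \<F>(2) by blast
  have Ds: "D i \<in> sets borel" for i
    unfolding D_def using A(1) sets.range_disjointed_sets[OF Fs] by auto
  have disj: "disjoint_family D"
    using disjoint_family_disjointed[of F] unfolding D_def disjoint_family_on_def by blast
  have UD: "(\<Union>i. D i) = A"
    using A(2) UN_disjointed_eq[of F] F unfolding D_def by auto
  have DF: "D i \<subseteq> F i" "F i \<in> \<F>" "D i \<subseteq> A" for i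
    using disjointed_subset[of F i] F unfolding D_def by auto
  have "emeasure N1 A = (\<Sum>i. emeasure N1 (D i))"
    unfolding UD[symmetric] using Ds s disj by (intro suminf_emeasure[symmetric]) (simp_all add: image_subset_iff)
  also have "\<dots> \<le> (\<Sum>i. c * emeasure N2 (D i))" by (intro suminf_le le[OF DF(2) Ds DF(1,3)]) auto
  also have "\<dots> = c * (\<Sum>i. emeasure N2 (D i))" by simp
  also have "(\<Sum>i. emeasure N2 (D i)) = emeasure N2 A"
    unfolding UD[symmetric] using Ds s disj by (intro suminf_emeasure) (simp_all add: image_subset_iff)
  finally show ?thesis .
qed

section \<open>Cones at flat points and comparison of measures on one piece\<close>

context doubling_radon begin

lemma tangent_flat_cone:
  assumes F: "tangent_flat x d \<theta> W" and x: "x \<in> \<Sigma>" and \<eta>: "0 < \<eta>"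
  obtains \<rho> where "0 < \<rho>" "\<And>y. y \<in> \<Sigma> \<Longrightarrow> dist x y < \<rho> \<Longrightarrow> infdist (y - x) W \<le> \<eta> * norm (y - x)"
proof -
  note W = tangent_flatD[OF F]
  let ?V = "(+) x ` W"
  have "((\<lambda>r. (1/r) * (SUP y\<in>\<Sigma> \<inter> ball x r. infdist y ?V)) \<longlongrightarrow> 0) (at_right 0)"
    using tangent_flat_tangent_plane[OF F x] by (simp add: tangent_plane_def)
  then have "\<forall>\<^sub>F r in at_right 0. (1/r) * (SUP y\<in>\<Sigma> \<inter> ball x r. infdist y ?V) < \<eta>/2"
    using \<eta> by (intro order_tendstoD) auto
  then obtain b where b: "0 < b" "\<And>r. 0 < r \<Longrightarrow> r < b \<Longrightarrow> (1/r) * (SUP y\<in>\<Sigma> \<inter> ball x r. infdist y ?V) < \<eta>/2"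
    by (auto simp: eventually_at_right_field)
  show ?thesis
  proof (rule that[of "b/2"])
    show "0 < b/2" using b by simp
    fix y assume y: "y \<in> \<Sigma>" "dist x y < b/2"
    show "infdist (y - x) W \<le> \<eta> * norm (y - x)"
    proof (cases "y = x")
      case True
      then show ?thesis using subspace_0[OF W(1)] by simp
    next
      case False
      \<comment> \<open>Twice the distance, so that the open ball contains y; the factor 2 is
        absorbed by the bound \<eta>/2 for the tangent plane.\<close>
      define r where "r = 2 * norm (y - x)"
      have r: "0 < r" "r < b" using False y(2) by (auto simp: r_def dist_norm norm_minus_commute)
      have yr: "y \<in> \<Sigma> \<inter> ball x r" using y(1) False by (simp add: r_def dist_norm norm_minus_commute)
      have xV: "x \<in> ?V" using subspace_0[OF W(1)] by force
      have "infdist y ?V \<le> (SUP y\<in>\<Sigma> \<inter> ball x r. infdist y ?V)"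
      proof (rule cSUP_upper[OF yr bdd_aboveI2])
        show "infdist z ?V \<le> r" if "z \<in> \<Sigma> \<inter> ball x r" for z
          using infdist_le[OF xV, of z] that by (simp add: dist_commute)
      qed
      also have "\<dots> \<le> (\<eta>/2) * r" using b(2)[OF r] r(1) by (simp add: field_simps)
      also have "\<dots> = \<eta> * norm (y - x)" by (simp add: r_def)
      finally have 1: "infdist y ?V \<le> \<eta> * norm (y - x)" .
      have cl: "closed ?V" "?V \<noteq> {}"
        using dplane_translate[OF W(1,2), of x] xV by (auto simp: dplane_def affine_closed)
      obtain v where v: "v \<in> ?V" "infdist y ?V = dist y v" using infdist_attains_inf[OF cl] by metis
      then obtain w where w: "w \<in> W" "v = x + w" by blast
      have "infdist (y - x) W \<le> dist (y - x) w" by (rule infdist_le[OF w(1)])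
      also have "\<dots> = dist y v" using w(2) by (simp add: dist_norm algebra_simps)
      finally show ?thesis using 1 v(2) by simp
    qed
  qed
qed

text \<open>\<open>measure_le_of_ball_ratios\<close> needs the dominating measure to double.
  Hausdorff measure on A is therefore compared with \<mu> directly, whereas for the reverse bound
  \<mu> is pushed to L, where Hausdorff measure of balls is exact. The projection is 1-Lipschitz
  with inverse constant 1/(1-\<eta>), which is the only loss besides a and b.\<close>

lemma piece_comparison:
  assumes L: "subspace L" "dim L = d" and \<eta>: "0 \<le> \<eta>" "\<eta> \<le> 1/2" and F: "F \<subseteq> \<Sigma>" "bounded F"
    and cone: "\<And>x y. x \<in> F \<Longrightarrow> y \<in> F \<Longrightarrow> infdist (y - x) L \<le> \<eta> * norm (y - x)"
    and ab: "0 < a" "0 < b" and \<delta>: "0 < \<delta>"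
    and dens: "\<And>x r. x \<in> F \<Longrightarrow> 0 < r \<Longrightarrow> r < \<delta> \<Longrightarrow> a * r ^ d \<le> measure \<mu> (ball x r)"
      "\<And>x r. x \<in> F \<Longrightarrow> 0 < r \<Longrightarrow> r < \<delta> \<Longrightarrow> measure \<mu> (ball x r) \<le> b * r ^ d"
    and A: "A \<in> sets borel" "A \<subseteq> F"
  shows "hausdorff_outer d A \<le> ennreal ((1/(1-\<eta>)) ^ d / a) * emeasure \<mu> A"
    and "emeasure \<mu> A \<le> ennreal (b * (1/(1-\<eta>)) ^ d) * hausdorff_outer d A"
proof -
  have d: "d \<le> DIM('a)" using L(2) dim_subset_UNIV[of L] by simp
  have dL: "dplane d L" by (rule dplane_subspace[OF L])
  obtain k where k: "0 < k" "\<And>A :: 'a set. hausdorff_outer d A = ennreal (1/k) * hausdorff_unnormalized d A"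
    "\<And>A :: 'a set. hausdorff_unnormalized d A = ennreal k * hausdorff_outer d A"
    by (rule hausdorff_const_real[OF d]) (rule that; assumption)
  obtain pr where lin: "linear pr" and prL: "\<And>x. pr x \<in> L" and n1: "\<And>x. norm (pr x) \<le> norm x"
    and pyth: "\<And>x. (norm x)\<^sup>2 = (norm (pr x))\<^sup>2 + (norm (x - pr x))\<^sup>2"
    and inf: "\<And>x. infdist x L = norm (x - pr x)"
    by (rule subspace_projection[OF L(1)]) (rule that; assumption)
  define q where "q = 1/(1-\<eta>)"
  have q: "0 < q" "1 \<le> q" "q \<le> 2" using \<eta> by (auto simp: q_def field_simps)
  have bil: "norm (y - x) \<le> q * norm (pr y - pr x)" if "x \<in> F" "y \<in> F" for x y
  proof -
    have "(1 - \<eta>) * norm (y - x) \<le> norm (pr (y - x))"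
      using cone[OF that] \<eta> by (intro cone_projection[OF lin pyth]) (auto simp: inf)
    then show ?thesis using \<eta> by (simp add: q_def linear_diff[OF lin] field_simps)
  qed
  have inj: "inj_on pr F"
    using bil by (intro inj_onI) (metis eq_iff_diff_eq_0 norm_le_zero_iff norm_zero mult_zero_right)
  have Hpr: "hausdorff_outer d Y \<le> ennreal (q ^ d) * hausdorff_outer d (pr ` Y)" if Y: "Y \<subseteq> F" for Y
  proof -
    have "inv_into F pr ` pr ` Y = Y" using inv_into_image_cancel[OF inj Y] .
    moreover have "hausdorff_outer d (inv_into F pr ` pr ` Y) \<le> ennreal (q ^ d) * hausdorff_outer d (pr ` Y)"
    proof (rule hausdorff_outer_lipschitz_image[OF _ q(1)])
      fix u v assume "u \<in> pr ` Y" "v \<in> pr ` Y"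
      then obtain x y where xy: "x \<in> Y" "y \<in> Y" "u = pr x" "v = pr y" by blast
      then have "x \<in> F" "y \<in> F" using Y by auto
      then show "dist (inv_into F pr u) (inv_into F pr v) \<le> q * dist u v"
        using bil[of y x] by (simp add: xy inv_into_f_f[OF inj] dist_norm)
    qed
    ultimately show ?thesis by simp
  qed
  have prlip: "norm (pr y - pr x) \<le> norm (y - x)" for x y
    using n1[of "y - x"] by (simp add: linear_diff[OF lin])
  have Ab: "bounded A" using bounded_subset[OF F(2) A(2)] .
  have Hm: "emeasure (measure_on (hausdorff_measure d) A) X = hausdorff_outer d (X \<inter> A)" if "X \<in> sets borel" for X
    using that A(1) by (simp add: emeasure_measure_on emeasure_hausdorff_measure)
  have "emeasure (measure_on (hausdorff_measure d) A) A \<le> ennreal (q ^ d / a) * emeasure \<mu> A"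
  \<comment> \<open>The a priori constant is the crude density bound divided by the normalization k;
    \<open>C ^ 3\<close> suffices because 5 \<le> 2^3.\<close>
  proof (rule measure_le_of_ball_ratios[OF _ radon A(1) Ab, where K = "(1/k) * (10 ^ d / a)" and D = "C ^ 3" and \<delta> = \<delta>])
    show "emeasure (measure_on (hausdorff_measure d) A) X \<le> ennreal ((1/k) * (10 ^ d / a)) * emeasure \<mu> X"
      if X: "X \<in> sets borel" "X \<subseteq> A" for X
    proof -
      have "hausdorff_unnormalized d X \<le> ennreal (10 ^ d / a) * emeasure \<mu> X"
      proof (rule ennreal_le_epsilon)
        fix e :: real assume e: "0 < e"
        obtain U where U: "open U" "bounded U" "X \<subseteq> U" "emeasure \<mu> U < emeasure \<mu> X + ennreal (e / (10 ^ d / a))"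
          using radon_outer_regular[OF radon X(1) bounded_subset[OF Ab X(2)], of "e / (10 ^ d / a)"] e ab by auto
        have "hausdorff_unnormalized d X \<le> ennreal (10 ^ d / a) * emeasure \<mu> U"
        proof (rule hausdorff_unnormalized_density_bound[OF sets_mu U(1,3) ab(1) \<delta>])
          show "ennreal (a * r ^ d) \<le> emeasure \<mu> (ball x r)" if "x \<in> X" "0 < r" "r < \<delta>" for x r
            unfolding emeasure_ball using that X(2) A(2) by (intro ennreal_leI dens(1)) auto
        qed
        also have "\<dots> \<le> ennreal (10 ^ d / a) * (emeasure \<mu> X + ennreal (e / (10 ^ d / a)))"
          by (rule mult_left_mono[OF less_imp_le[OF U(4)]]) simp
        also have "\<dots> = ennreal (10 ^ d / a) * emeasure \<mu> X + ennreal e"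
          using e ab by (simp add: distrib_left ennreal_mult[symmetric])
        finally show "hausdorff_unnormalized d X \<le> ennreal (10 ^ d / a) * emeasure \<mu> X + ennreal e" .
      qed
      then have "ennreal (1/k) * hausdorff_unnormalized d X \<le> ennreal (1/k) * (ennreal (10 ^ d / a) * emeasure \<mu> X)"
        by (rule mult_left_mono) simp
      also have "\<dots> = ennreal ((1/k) * (10 ^ d / a)) * emeasure \<mu> X"
        using k(1) ab by (subst ennreal_mult) (auto simp: mult.assoc)
      finally show ?thesis using X by (simp add: Hm Int_absorb2 k(2)[symmetric])
    qed
    show "emeasure (measure_on (hausdorff_measure d) A) (ball x r) \<le> ennreal (q ^ d / a) * emeasure \<mu> (ball x r)"
      if x: "x \<in> A" and r: "0 < r" "r < \<delta>" for x r
    proof -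
      have "hausdorff_outer d (ball x r \<inter> A) \<le> ennreal (q ^ d) * hausdorff_outer d (pr ` (ball x r \<inter> A))"
        using A(2) by (intro Hpr) auto
      also have "\<dots> \<le> ennreal (q ^ d) * hausdorff_outer d (L \<inter> ball (pr x) r)"
      proof (intro mult_left_mono hausdorff_outer_mono subsetI)
        fix p assume "p \<in> pr ` (ball x r \<inter> A)"
        then obtain y where "y \<in> ball x r" "p = pr y" by blast
        then have "norm (y - x) < r" "p = pr y" by (auto simp: dist_norm norm_minus_commute)
        then show "p \<in> L \<inter> ball (pr x) r"
          using prL prlip[of y x] by (simp add: dist_norm norm_minus_commute)
      qed simp
      also have "hausdorff_outer d (L \<inter> ball (pr x) r) = ennreal (r ^ d)"
        using dL prL r(1) by (intro hausdorff_outer_affine_ball) (auto simp: dplane_def)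
      also have "ennreal (q ^ d) * ennreal (r ^ d) = ennreal (q ^ d / a) * ennreal (a * r ^ d)"
        using ab q r by (simp add: ennreal_mult[symmetric])
      also have "\<dots> \<le> ennreal (q ^ d / a) * emeasure \<mu> (ball x r)"
        unfolding emeasure_ball using x A(2) r by (intro mult_left_mono ennreal_leI dens(1)) auto
      finally show ?thesis by (simp add: Hm)
    qed
    show "emeasure \<mu> (ball x (5 * r)) \<le> ennreal (C ^ 3) * emeasure \<mu> (ball x r)" if "x \<in> A" "0 < r" for x r
    proof -
      have "measure \<mu> (ball x (5 * r)) \<le> measure \<mu> (ball x (2 ^ 3 * r))" using that by (intro measure_ball_mono) auto
      also have "\<dots> \<le> C ^ 3 * measure \<mu> (ball x r)" using that A(2) F(1) by (intro doubling_iterate) auto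
      finally have "ennreal (measure \<mu> (ball x (5 * r))) \<le> ennreal (C ^ 3 * measure \<mu> (ball x r))" by (rule ennreal_leI)
      then show ?thesis unfolding emeasure_ball using C by (simp add: ennreal_mult)
    qed
  qed (use k ab q C \<delta> in auto)
  then show "hausdorff_outer d A \<le> ennreal ((1/(1-\<eta>)) ^ d / a) * emeasure \<mu> A"
    using A(1) by (simp add: Hm q_def)
  define t where "t = b * q ^ d"
  have t: "0 \<le> t" using ab q by (simp add: t_def)
  \<comment> \<open>Projections of compact sets are compact, hence Borel; inner regularity of \<mu>
    extends the bound to Borel sets at the end.\<close>
  have compact_case: "emeasure \<mu> K \<le> ennreal t * hausdorff_outer d K" if K: "compact K" "K \<subseteq> F" for K
  proof -
    have Kb: "K \<in> sets borel" using K(1) by (rule borel_compact)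
    have cpr: "continuous_on UNIV pr" using lin by (simp add: linear_continuous_on linear_conv_bounded_linear)
    have mpr: "pr \<in> borel_measurable borel" using cpr by (rule borel_measurable_continuous_onI)
    let ?\<nu> = "distr (measure_on \<mu> K) borel pr"
    have sK: "sets (measure_on \<mu> K) = sets borel" using sets_mu by simp
    have \<nu>: "emeasure ?\<nu> X = emeasure \<mu> (pr -` X \<inter> K)" if "X \<in> sets borel" for X
    proof -
      have pX: "pr -` X \<in> sets borel" using measurable_sets_borel[OF mpr that] .
      have "emeasure ?\<nu> X = emeasure (measure_on \<mu> K) (pr -` X \<inter> space (measure_on \<mu> K))"
        using mpr that measurable_cong_sets[OF sK refl] by (intro emeasure_distr) auto
      also have "\<dots> = emeasure \<mu> (pr -` X \<inter> K)"
        using pX Kb sets_mu space_mu by (simp add: emeasure_measure_on)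
      finally show ?thesis .
    qed
    have prK: "compact (pr ` K)" using K(1) cpr by (intro compact_continuous_image) (auto intro: continuous_on_subset)
    have prKb: "pr ` K \<in> sets borel" "bounded (pr ` K)" using prK by (auto intro: borel_compact compact_imp_bounded)
    have "emeasure ?\<nu> (pr ` K) \<le> ennreal t * emeasure (plane_measure d L) (pr ` K)"
    \<comment> \<open>The a priori constant combines the mass distribution principle, the
      normalization k and the Lipschitz constant q of the inverse projection. Radii stay below
      \<delta>/2 because a ball of radius r pulls back into one of radius q r, and q \<le>
      2.\<close>
    proof (rule measure_le_of_ball_ratios[OF _ radon_plane_measure[OF dL] prKb, where K = "b * 2 ^ d * k * q ^ d" and D = "5 ^ d" and \<delta> = "\<delta>/2"])
      show "emeasure ?\<nu> X \<le> ennreal (b * 2 ^ d * k * q ^ d) * emeasure (plane_measure d L) X"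
        if X: "X \<in> sets borel" "X \<subseteq> pr ` K" for X
      proof -
        let ?Y = "pr -` X \<inter> K"
        have Y: "?Y \<in> sets borel" using measurable_sets_borel[OF mpr X(1)] Kb by auto
        have "emeasure \<mu> ?Y \<le> ennreal (b * 2 ^ d) * hausdorff_unnormalized d ?Y"
        proof (rule mass_distribution_principle[OF sets_mu Y ab(2) \<delta>])
          show "emeasure \<mu> (ball x r) \<le> ennreal (b * r ^ d)" if "x \<in> ?Y" "0 < r" "r < \<delta>" for x r
            unfolding emeasure_ball using that K(2) by (intro ennreal_leI dens(2)) auto
        qed
        also have "\<dots> = ennreal (b * 2 ^ d) * (ennreal k * hausdorff_outer d ?Y)" by (simp only: k(3))
        also have "\<dots> \<le> ennreal (b * 2 ^ d) * (ennreal k * (ennreal (q ^ d) * hausdorff_outer d (pr ` ?Y)))"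
          using K(2) by (intro mult_left_mono Hpr) auto
        also have "\<dots> \<le> ennreal (b * 2 ^ d) * (ennreal k * (ennreal (q ^ d) * hausdorff_outer d (X \<inter> L)))"
          using prL by (intro mult_left_mono hausdorff_outer_mono) auto
        also have "\<dots> = ennreal (b * 2 ^ d * k * q ^ d) * emeasure (plane_measure d L) X"
          using ab k(1) q X(1) by (simp add: emeasure_plane_measure[OF dL] ennreal_mult mult.assoc)
        finally show ?thesis by (simp add: \<nu>[OF X(1)])
      qed
      show "emeasure ?\<nu> (ball p r) \<le> ennreal t * emeasure (plane_measure d L) (ball p r)"
        if p: "p \<in> pr ` K" and r: "0 < r" "r < \<delta>/2" for p r
      proof -
        obtain x where x: "x \<in> K" "p = pr x" using p by blast
        have "q * r \<le> 2 * r" using q r by (intro mult_right_mono) auto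
        with r have "q * r < \<delta>" by linarith
        moreover have "0 < q * r" using q(1) r(1) by (rule mult_pos_pos)
        ultimately have qr: "0 < q * r" "q * r < \<delta>" by blast+
        have "emeasure ?\<nu> (ball p r) = emeasure \<mu> (pr -` ball p r \<inter> K)" by (rule \<nu>) simp
        also have "\<dots> \<le> emeasure \<mu> (ball x (q * r))"
        proof (rule emeasure_mono)
          show "pr -` ball p r \<inter> K \<subseteq> ball x (q * r)"
          proof
            fix y assume y: "y \<in> pr -` ball p r \<inter> K"
            have "norm (y - x) \<le> q * norm (pr y - pr x)" using y x K(2) by (intro bil) auto
            also have "\<dots> < q * r" using y x q by (intro mult_strict_left_mono) (auto simp: dist_norm norm_minus_commute)
            finally show "y \<in> ball x (q * r)" by (simp add: dist_norm norm_minus_commute)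
          qed
        qed (use sets_mu in auto)
        also have "\<dots> \<le> ennreal (b * (q * r) ^ d)"
          unfolding emeasure_ball using x(1) K(2) qr by (intro ennreal_leI dens(2)) auto
        also have "\<dots> = ennreal t * ennreal (r ^ d)"
          using t r by (simp add: ennreal_mult[symmetric] t_def power_mult_distrib mult.assoc)
        also have "ennreal (r ^ d) = emeasure (plane_measure d L) (ball p r)"
          using emeasure_plane_ball[OF dL, of p r] x prL r by simp
        finally show ?thesis .
      qed
      show "emeasure (plane_measure d L) (ball p (5 * r)) \<le> ennreal (5 ^ d) * emeasure (plane_measure d L) (ball p r)"
        if p: "p \<in> pr ` K" and r: "0 < r" for p r
      proof -
        have pL: "p \<in> L" using p prL by auto
        show ?thesis
          using emeasure_plane_ball[OF dL pL r] emeasure_plane_ball[OF dL pL, of "5 * r"] r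
          by (simp add: ennreal_mult[symmetric] power_mult_distrib)
      qed
    qed (use ab k(1) q t \<delta> in auto)
    also have "emeasure (plane_measure d L) (pr ` K) = hausdorff_outer d (pr ` K)"
      using prL prKb(1) by (subst emeasure_plane_measure[OF dL]) (auto intro!: arg_cong[where f = "hausdorff_outer d"])
    also have "\<dots> \<le> ennreal (1 ^ d) * hausdorff_outer d K"
      using prlip by (intro hausdorff_outer_lipschitz_image) (auto simp: dist_norm)
    finally have "emeasure ?\<nu> (pr ` K) \<le> ennreal t * (ennreal (1 ^ d) * hausdorff_outer d K)"
      by (meson mult_left_mono order_trans zero_le)
    moreover have "emeasure ?\<nu> (pr ` K) = emeasure \<mu> K"
      by (subst \<nu>[OF prKb(1)]) (auto intro!: arg_cong[where f = "emeasure \<mu>"])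
    ultimately show ?thesis by simp
  qed
  have "emeasure \<mu> A \<le> ennreal t * hausdorff_outer d A"
    unfolding radon_inner_regular[OF radon A(1) Ab]
  proof (rule SUP_least)
    fix K assume K: "K \<in> {K. K \<subseteq> A \<and> compact K}"
    then have "emeasure \<mu> K \<le> ennreal t * hausdorff_outer d K" using A(2) by (intro compact_case) auto
    also have "\<dots> \<le> ennreal t * hausdorff_outer d A" using K by (intro mult_left_mono hausdorff_outer_mono) auto
    finally show "emeasure \<mu> K \<le> ennreal t * hausdorff_outer d A" .
  qed
  then show "emeasure \<mu> A \<le> ennreal (b * (1/(1-\<eta>)) ^ d) * hausdorff_outer d A" by (simp add: t_def q_def)
qed

end

section \<open>Cutting a layer into pieces, rectifiability and the density formula\<close>

context doubling_radon begin

lemma layer_pieces: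
  assumes d: "d \<le> DIM('a)" and E: "E \<in> sets borel" "E \<subseteq> \<Sigma>" and \<theta>m: "\<theta> \<in> borel_measurable borel"
    and flat: "\<And>x. x \<in> E \<Longrightarrow> \<exists>W. tangent_flat x d (\<theta> x) W"
    and \<kappa>: "0 < \<kappa>" "\<And>x. x \<in> E \<Longrightarrow> \<kappa> \<le> \<theta> x" and \<eta>: "0 < \<eta>" "\<eta> \<le> 1/2"
  obtains \<F> where "countable \<F>" "\<F> \<noteq> {}" "E \<subseteq> \<Union>\<F>"
    "\<And>F. F \<in> \<F> \<Longrightarrow> F \<in> sets borel \<and> bounded F \<and> F \<subseteq> E"
    "\<And>F. F \<in> \<F> \<Longrightarrow> \<exists>L t \<delta>. subspace L \<and> dim L = d \<and> 0 < t \<and> 0 < \<delta> \<and>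
      (\<forall>x\<in>F. \<forall>y\<in>F. infdist (y - x) L \<le> \<eta> * norm (y - x)) \<and>
      (\<forall>x\<in>F. t \<le> \<theta> x \<and> \<theta> x \<le> (1 + \<eta>) * t) \<and>
      (\<forall>x\<in>F. \<forall>r. 0 < r \<longrightarrow> r < \<delta> \<longrightarrow>
         (1 - \<eta>) * t * r ^ d \<le> measure \<mu> (ball x r) \<and> measure \<mu> (ball x r) \<le> (1 + \<eta>)\<^sup>2 * t * r ^ d)"
proof -
  obtain \<L> :: "'a set set" where \<L>: "countable \<L>" "\<L> \<noteq> {}" "\<And>L. L \<in> \<L> \<Longrightarrow> subspace L \<and> dim L = d"
    "\<And>W \<epsilon>. subspace W \<Longrightarrow> dim W = d \<Longrightarrow> 0 < \<epsilon> \<Longrightarrow> \<exists>L\<in>\<L>. \<forall>v. infdist v L \<le> infdist v W + \<epsilon> * norm v"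
    by (rule subspaces_countable_net[OF d]) (rule that; assumption)
  obtain Q :: "'a set" where Q: "countable Q" "\<And>X. open X \<Longrightarrow> X \<noteq> {} \<Longrightarrow> \<exists>q\<in>Q. q \<in> X"
    using countable_dense_exists by blast
  have Qne: "Q \<noteq> {}" using Q(2)[of UNIV] by auto
  define s where "s j = 1 / real (Suc j)" for j
  have s: "0 < s j" for j by (simp add: s_def)
  \<comment> \<open>A geometric grid from the lower bound \<kappa>: on each of its cells \<theta>
    varies by a factor of at most 1 + \<eta>.\<close>
  define t where "t m = \<kappa> * (1 + \<eta>) ^ m" for m :: nat
  have t: "0 < t m" for m using \<kappa>(1) \<eta> by (simp add: t_def)
  \<comment> \<open>The cone condition is imposed against all support points within
    \<open>s j\<close>, so it does not refer to the piece and is closed in x. A piece lies in a ball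
    of radius \<open>s j / 2\<close>, so any two of its points are close enough for it to
    apply.\<close>
  define C1 where "C1 L j = {x. \<forall>y\<in>\<Sigma>. dist x y < s j \<longrightarrow> infdist (y - x) L \<le> \<eta> * dist x y}" for L j
  define C2 where "C2 m = {x. t m \<le> \<theta> x \<and> \<theta> x \<le> (1 + \<eta>) * t m}" for m
  \<comment> \<open>Rational radii make this a countable intersection of Borel sets; monotonicity of
    the ball masses recovers all radii in \<open>C3r\<close>.\<close>
  define C3 where "C3 j = {x. \<forall>r\<in>\<rat>. 0 < r \<longrightarrow> r < s j \<longrightarrow>
      (1 - \<eta>) * \<theta> x * r ^ d \<le> measure \<mu> (ball x r) \<and> measure \<mu> (ball x r) \<le> (1 + \<eta>) * \<theta> x * r ^ d}" for j
  define piece where "piece = (\<lambda>(L, j, m, q). E \<inter> ball q (s j / 2) \<inter> C1 L j \<inter> C2 m \<inter> C3 j)"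
  define \<F> where "\<F> = piece ` (\<L> \<times> UNIV \<times> UNIV \<times> Q)"
  have C1c: "closed (C1 L j)" for L j
  proof -
    have "C1 L j = (\<Inter>y\<in>\<Sigma>. {x. s j \<le> dist x y} \<union> {x. infdist (y - x) L \<le> \<eta> * dist x y})"
      by (auto simp: C1_def) (meson not_le)
    also have "closed \<dots>"
      by (intro closed_INT ballI closed_Un closed_Collect_le continuous_intros)
    finally show ?thesis .
  qed
  have C2m: "C2 m \<in> sets borel" for m
  proof -
    have "{x \<in> space borel. t m \<le> \<theta> x \<and> \<theta> x \<le> (1 + \<eta>) * t m} \<in> sets borel" using \<theta>m by measurable
    then show ?thesis by (simp add: C2_def)
  qed
  have C3m: "C3 j \<in> sets borel" for j
  proof -
    have "C3 j = (\<Inter>r\<in>\<rat>. {x \<in> space borel. 0 < r \<longrightarrow> r < s j \<longrightarrow>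
      (1 - \<eta>) * \<theta> x * r ^ d \<le> measure \<mu> (ball x r) \<and> measure \<mu> (ball x r) \<le> (1 + \<eta>) * \<theta> x * r ^ d})"
      by (auto simp: C3_def)
    also have "\<dots> \<in> sets borel"
    proof (rule sets.countable_INT'')
      show "countable (\<rat> :: real set)" by (rule countable_rat)
      fix r :: real
      note [measurable] = \<theta>m measure_ball_measurable[of r]
      show "{x \<in> space borel. 0 < r \<longrightarrow> r < s j \<longrightarrow>
        (1 - \<eta>) * \<theta> x * r ^ d \<le> measure \<mu> (ball x r) \<and> measure \<mu> (ball x r) \<le> (1 + \<eta>) * \<theta> x * r ^ d} \<in> sets borel"
        by measurable
    qed simp
    finally show ?thesis .
  qed
  have C3r: "(1 - \<eta>) * \<theta> x * r ^ d \<le> measure \<mu> (ball x r) \<and> measure \<mu> (ball x r) \<le> (1 + \<eta>) * \<theta> x * r ^ d"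
    if x: "x \<in> C3 j" and r: "0 < r" "r < s j" for x r j
  proof
    have lim: "((\<lambda>u. c * u ^ d) \<longlongrightarrow> c * r ^ d) (at_left r)" "((\<lambda>u. c * u ^ d) \<longlongrightarrow> c * r ^ d) (at_right r)" for c
      by (intro tendsto_intros)+
    show "(1 - \<eta>) * \<theta> x * r ^ d \<le> measure \<mu> (ball x r)"
    proof (rule tendsto_upperbound[OF lim(1)])
      show "\<forall>\<^sub>F u in at_left r. (1 - \<eta>) * \<theta> x * u ^ d \<le> measure \<mu> (ball x r)"
        unfolding eventually_at_left_field
      proof (intro exI[of _ 0] conjI allI impI r)
        fix u assume u: "0 < u" "u < r"
        show "(1 - \<eta>) * \<theta> x * u ^ d \<le> measure \<mu> (ball x r)"
        \<comment> \<open>Off E the function \<theta> is an arbitrary Borel function and may be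
          negative.\<close>
        proof (cases "0 \<le> \<theta> x")
          case True
          obtain v where v: "v \<in> \<rat>" "u < v" "v < r" using Rats_dense_in_real[OF u(2)] by blast
          have "(1 - \<eta>) * \<theta> x * u ^ d \<le> (1 - \<eta>) * \<theta> x * v ^ d"
            using True \<eta> u v by (intro mult_left_mono power_mono) auto
          also have "\<dots> \<le> measure \<mu> (ball x v)" using x v u r by (auto simp: C3_def)
          also have "\<dots> \<le> measure \<mu> (ball x r)" using v by (intro measure_ball_mono) auto
          finally show ?thesis .
        next
          case False
          then have "(1 - \<eta>) * \<theta> x * u ^ d \<le> 0" using \<eta> u by (simp add: mult_nonneg_nonpos mult_nonpos_nonneg)
          then show ?thesis by (rule order_trans) simp
        qed
      qed
    qed simp
    show "measure \<mu> (ball x r) \<le> (1 + \<eta>) * \<theta> x * r ^ d"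
    proof (rule tendsto_lowerbound[OF lim(2)])
      show "\<forall>\<^sub>F u in at_right r. measure \<mu> (ball x r) \<le> (1 + \<eta>) * \<theta> x * u ^ d"
        unfolding eventually_at_right_field
      proof (intro exI[of _ "s j"] conjI allI impI r)
        fix u assume u: "r < u" "u < s j"
        obtain v where v: "v \<in> \<rat>" "r < v" "v < u" using Rats_dense_in_real[OF u(1)] by blast
        \<comment> \<open>The sign follows from the upper density inequality itself, whose left side
          is a measure.\<close>
        have th: "0 \<le> \<theta> x"
        proof -
          have "0 \<le> (1 + \<eta>) * \<theta> x * v ^ d"
            using x v u r by (auto simp: C3_def intro: order_trans[OF measure_nonneg])
          moreover have "0 < (1 + \<eta>) * v ^ d" using v r \<eta> by simp
          ultimately show ?thesis by (metis mult.assoc mult.commute zero_le_mult_iff not_less)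
        qed
        have "measure \<mu> (ball x r) \<le> measure \<mu> (ball x v)" using v by (intro measure_ball_mono) auto
        also have "\<dots> \<le> (1 + \<eta>) * \<theta> x * v ^ d" using x v u r by (auto simp: C3_def)
        also have "\<dots> \<le> (1 + \<eta>) * \<theta> x * u ^ d"
          using th \<eta> v r by (intro mult_left_mono power_mono) auto
        finally show "measure \<mu> (ball x r) \<le> (1 + \<eta>) * \<theta> x * u ^ d" .
      qed
    qed simp
  qed
  show ?thesis
  proof (rule that[of \<F>])
    show "countable \<F>" unfolding \<F>_def using \<L>(1) Q(1) by (intro countable_image countable_SIGMA) auto
    show "\<F> \<noteq> {}" unfolding \<F>_def using \<L>(2) Qne by auto
    show "F \<in> sets borel \<and> bounded F \<and> F \<subseteq> E" if F: "F \<in> \<F>" for F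
    proof -
      obtain L j m q where F: "F = E \<inter> ball q (s j / 2) \<inter> C1 L j \<inter> C2 m \<inter> C3 j"
        using F unfolding \<F>_def piece_def by auto
      have "F \<in> sets borel"
        unfolding F by (intro sets.Int E(1) C2m C3m borel_closed[OF C1c] borel_open open_ball)
      moreover have "bounded F" unfolding F by (rule bounded_subset[OF bounded_ball[of q "s j / 2"]]) auto
      ultimately show ?thesis unfolding F by auto
    qed
    show "\<exists>L t \<delta>. subspace L \<and> dim L = d \<and> 0 < t \<and> 0 < \<delta> \<and>
      (\<forall>x\<in>F. \<forall>y\<in>F. infdist (y - x) L \<le> \<eta> * norm (y - x)) \<and>
      (\<forall>x\<in>F. t \<le> \<theta> x \<and> \<theta> x \<le> (1 + \<eta>) * t) \<and>
      (\<forall>x\<in>F. \<forall>r. 0 < r \<longrightarrow> r < \<delta> \<longrightarrow>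
         (1 - \<eta>) * t * r ^ d \<le> measure \<mu> (ball x r) \<and> measure \<mu> (ball x r) \<le> (1 + \<eta>)\<^sup>2 * t * r ^ d)"
      if F: "F \<in> \<F>" for F
    proof -
      obtain L j m q where L: "L \<in> \<L>" and F: "F = E \<inter> ball q (s j / 2) \<inter> C1 L j \<inter> C2 m \<inter> C3 j"
        using F unfolding \<F>_def piece_def by auto
      show ?thesis
      proof (rule exI[of _ L], rule exI[of _ "t m"], rule exI[of _ "s j"], intro conjI ballI allI impI s t)
        show "subspace L" "dim L = d" using \<L>(3)[OF L] by auto
        show "infdist (y - x) L \<le> \<eta> * norm (y - x)" if "x \<in> F" "y \<in> F" for x y
        proof -
          have "dist x q < s j / 2" "dist y q < s j / 2" using that by (auto simp: F dist_commute)
          then have "dist x y < s j" using dist_triangle_half_l[of x q "s j" y] by simp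
          then show ?thesis using that E(2) by (auto simp: F C1_def dist_norm norm_minus_commute)
        qed
        have th: "t m \<le> \<theta> x" "\<theta> x \<le> (1 + \<eta>) * t m" if "x \<in> F" for x
          using that by (auto simp: F C2_def)
        fix x assume x: "x \<in> F"
        show "t m \<le> \<theta> x" by (rule th[OF x])
        show "\<theta> x \<le> (1 + \<eta>) * t m" by (rule th[OF x])
        note th = th[OF x]
        fix r assume r: "0 < r" "r < s j"
        have x3: "x \<in> C3 j" using x by (simp add: F)
        have "(1 - \<eta>) * t m * r ^ d \<le> (1 - \<eta>) * \<theta> x * r ^ d"
          using th \<eta> r by (intro mult_right_mono mult_left_mono) auto
        then show "(1 - \<eta>) * t m * r ^ d \<le> measure \<mu> (ball x r)" using C3r[OF x3 r] by linarith
        have "(1 + \<eta>) * \<theta> x * r ^ d \<le> (1 + \<eta>) * ((1 + \<eta>) * t m) * r ^ d"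
          using th \<eta> r by (intro mult_right_mono mult_left_mono) auto
        then show "measure \<mu> (ball x r) \<le> (1 + \<eta>)\<^sup>2 * t m * r ^ d"
          using C3r[OF x3 r] by (simp add: power2_eq_square mult.assoc)
      qed
    qed
    show "E \<subseteq> \<Union>\<F>"
    proof
      fix x assume x: "x \<in> E"
      have xS: "x \<in> \<Sigma>" using x E(2) by blast
      obtain W where W: "tangent_flat x d (\<theta> x) W" using flat[OF x] by blast
      have th: "0 < \<theta> x" using \<kappa> x by (meson less_le_trans)
      obtain \<rho> where \<rho>: "0 < \<rho>" "\<And>y. y \<in> \<Sigma> \<Longrightarrow> dist x y < \<rho> \<Longrightarrow> infdist (y - x) W \<le> \<eta>/2 * norm (y - x)"
        by (rule tangent_flat_cone[OF W xS half_gt_zero[OF \<eta>(1)]]) blast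
      obtain L where L: "L \<in> \<L>" "\<And>v. infdist v L \<le> infdist v W + \<eta>/2 * norm v"
        using \<L>(4)[OF tangent_flatD(1,2)[OF W] half_gt_zero[OF \<eta>(1)]] by blast
      have "\<forall>\<^sub>F r in at_right 0. (1 - \<eta>) * \<theta> x < measure \<mu> (ball x r) / r ^ d \<and> measure \<mu> (ball x r) / r ^ d < (1 + \<eta>) * \<theta> x"
        using th \<eta> by (intro eventually_conj order_tendstoD[OF tangent_flat_density[OF W]]) auto
      then obtain b where b: "0 < b" "\<And>r. 0 < r \<Longrightarrow> r < b \<Longrightarrow>
          (1 - \<eta>) * \<theta> x < measure \<mu> (ball x r) / r ^ d \<and> measure \<mu> (ball x r) / r ^ d < (1 + \<eta>) * \<theta> x"
        by (auto simp: eventually_at_right_field)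
      obtain j where j: "s j < min b \<rho>" unfolding s_def using nat_approx_posE[of "min b \<rho>"] b(1) \<rho>(1) by auto
      obtain N where N: "\<theta> x / \<kappa> < (1 + \<eta>) ^ N" using real_arch_pow[of "1 + \<eta>"] \<eta> by auto
      have P0: "\<theta> x < t N" using N \<kappa>(1) by (simp add: t_def divide_less_eq mult.commute)
      \<comment> \<open>The first grid value above \<theta> x. It is not the initial one, since
        \<theta> x \<ge> \<kappa>, so its predecessor gives the cell of x.\<close>
      define n where "n = (LEAST n. \<theta> x < t n)"
      have n1: "\<theta> x < t n" unfolding n_def using P0 by (rule LeastI)
      have "n \<noteq> 0"
      proof
        assume "n = 0"
        then show False using n1 \<kappa>(2)[OF x] by (simp add: t_def)
      qed
      then obtain m where m: "n = Suc m" by (cases n) auto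
      have "\<not> \<theta> x < t m" using not_less_Least[of m "\<lambda>n. \<theta> x < t n"] m unfolding n_def by auto
      then have xC2: "x \<in> C2 m" using n1 m by (simp add: C2_def t_def mult_ac)
      obtain q where q: "q \<in> Q" "q \<in> ball x (s j / 2)" using Q(2)[of "ball x (s j / 2)"] s[of j] by auto
      have xC1: "x \<in> C1 L j"
        unfolding C1_def
      proof (intro CollectI ballI impI)
        fix y assume y: "y \<in> \<Sigma>" "dist x y < s j"
        have "infdist (y - x) W \<le> \<eta>/2 * norm (y - x)" using \<rho>(2)[OF y(1)] y(2) j by auto
        then show "infdist (y - x) L \<le> \<eta> * dist x y"
          using L(2)[of "y - x"] by (simp add: dist_norm norm_minus_commute)
      qed
      have xC3: "x \<in> C3 j"
        unfolding C3_def
      proof (intro CollectI ballI impI)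
        fix r assume r: "0 < r" "r < s j"
        have "(1 - \<eta>) * \<theta> x < measure \<mu> (ball x r) / r ^ d" "measure \<mu> (ball x r) / r ^ d < (1 + \<eta>) * \<theta> x"
          using b(2)[of r] r j by auto
        then show "(1 - \<eta>) * \<theta> x * r ^ d \<le> measure \<mu> (ball x r) \<and> measure \<mu> (ball x r) \<le> (1 + \<eta>) * \<theta> x * r ^ d"
          using r(1) by (simp add: pos_less_divide_eq pos_divide_less_eq)
      qed
      have "x \<in> piece (L, j, m, q)"
        using x q(2) xC1 xC2 xC3 by (simp add: piece_def dist_commute)
      then show "x \<in> \<Union>\<F>" unfolding \<F>_def using L(1) q(1) by blast
    qed
  qed
qed

text \<open>Aperture 1/2 is already narrow enough for \<open>cone_lipschitz_graph\<close>, so the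
  countably many graphs cover all of E and the exceptional set is empty.\<close>

lemma layer_rectifiable:
  assumes d: "d \<le> DIM('a)" and E: "E \<in> sets borel" "E \<subseteq> \<Sigma>" and \<theta>m: "\<theta> \<in> borel_measurable borel"
    and flat: "\<And>x. x \<in> E \<Longrightarrow> \<exists>W. tangent_flat x d (\<theta> x) W"
    and \<kappa>: "0 < \<kappa>" "\<And>x. x \<in> E \<Longrightarrow> \<kappa> \<le> \<theta> x"
  shows "rectifiable d E"
proof -
  obtain \<F> where \<F>: "countable \<F>" "\<F> \<noteq> {}" "E \<subseteq> \<Union>\<F>"
    and P: "\<And>F. F \<in> \<F> \<Longrightarrow> \<exists>L t \<delta>. subspace L \<and> dim L = d \<and> 0 < t \<and> 0 < \<delta> \<and>
      (\<forall>x\<in>F. \<forall>y\<in>F. infdist (y - x) L \<le> 1/2 * norm (y - x)) \<and>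
      (\<forall>x\<in>F. t \<le> \<theta> x \<and> \<theta> x \<le> (1 + 1/2) * t) \<and>
      (\<forall>x\<in>F. \<forall>r. 0 < r \<longrightarrow> r < \<delta> \<longrightarrow>
         (1 - 1/2) * t * r ^ d \<le> measure \<mu> (ball x r) \<and> measure \<mu> (ball x r) \<le> (1 + 1/2)\<^sup>2 * t * r ^ d)"
    by (rule layer_pieces[OF d E \<theta>m flat \<kappa>, of "1/2"]) (assumption, assumption, simp, simp, (rule that; assumption))
  have "\<exists>G. lipschitz_graph d G \<and> F \<subseteq> G" if "F \<in> \<F>" for F
  proof -
    obtain L where L: "subspace L" "dim L = d" "\<And>x y. x \<in> F \<Longrightarrow> y \<in> F \<Longrightarrow> infdist (y - x) L \<le> 1/2 * norm (y - x)"
      using P[OF \<open>F \<in> \<F>\<close>] by blast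
    show ?thesis by (rule cone_lipschitz_graph[OF L(1,2) _ _ L(3)]) auto
  qed
  then obtain G where G: "\<And>F. F \<in> \<F> \<Longrightarrow> lipschitz_graph d (G F) \<and> F \<subseteq> G F" by metis
  have fr: "from_nat_into \<F> i \<in> \<F>" for i using \<F>(2) by (rule from_nat_into)
  have "E \<subseteq> (\<Union>i. G (from_nat_into \<F> i))"
  proof
    fix x assume "x \<in> E"
    then obtain F where F: "F \<in> \<F>" "x \<in> F" using \<F>(3) by blast
    then obtain i where "from_nat_into \<F> i = F" using from_nat_into_surj[OF \<F>(1)] by blast
    then show "x \<in> (\<Union>i. G (from_nat_into \<F> i))" using G[OF F(1)] F(2) by blast
  qed
  then have "E - (\<Union>i. G (from_nat_into \<F> i)) = {}" by blast
  then have "hausdorff_outer d (E - (\<Union>i. G (from_nat_into \<F> i))) = 0"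
    by (simp only: hausdorff_outer_empty)
  moreover have "\<forall>i. lipschitz_graph d (G (from_nat_into \<F> i))" using G[OF fr] by blast
  ultimately show ?thesis
    unfolding rectifiable_def by (intro exI[of _ "\<lambda>i. G (from_nat_into \<F> i)"] conjI)
qed

lemma layer_measure:
  assumes d: "d \<le> DIM('a)" and E: "E \<in> sets borel" "E \<subseteq> \<Sigma>" and \<theta>m: "\<theta> \<in> borel_measurable borel"
    and flat: "\<And>x. x \<in> E \<Longrightarrow> \<exists>W. tangent_flat x d (\<theta> x) W"
    and \<kappa>: "0 < \<kappa>" "\<And>x. x \<in> E \<Longrightarrow> \<kappa> \<le> \<theta> x"
    and A: "A \<in> sets borel" "A \<subseteq> E"
  shows "emeasure \<mu> A = (\<integral>\<^sup>+x\<in>A. ennreal (\<theta> x) \<partial>hausdorff_measure d)"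
proof -
  define N where "N = density (hausdorff_measure d) (\<lambda>x. ennreal (\<theta> x))"
  have Ns: "sets N = sets borel" by (simp add: N_def)
  have \<theta>m': "(\<lambda>x. ennreal (\<theta> x)) \<in> borel_measurable (hausdorff_measure d)" using \<theta>m by simp
  have N: "emeasure N X = (\<integral>\<^sup>+x\<in>X. ennreal (\<theta> x) \<partial>hausdorff_measure d)" if "X \<in> sets borel" for X
    unfolding N_def using \<theta>m' that by (intro emeasure_density) auto
  \<comment> \<open>It dominates the factors of both inequalities: the first has exponent d with the
    square of 1 + \<eta>, the second exponent d + 1 with one factor 1 + \<eta>. It tends to 1 with
    \<eta>.\<close>
  define G where "G \<eta> = (1 + \<eta>)\<^sup>2 * (1/(1-\<eta>)) ^ (d + 1)" for \<eta> :: real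
  have both: "emeasure \<mu> A \<le> ennreal (G \<eta>) * emeasure N A \<and> emeasure N A \<le> ennreal (G \<eta>) * emeasure \<mu> A"
    if \<eta>: "0 < \<eta>" "\<eta> \<le> 1/2" for \<eta>
  proof -
    obtain \<F> where \<F>: "countable \<F>" "\<F> \<noteq> {}" "E \<subseteq> \<Union>\<F>" "\<And>F. F \<in> \<F> \<Longrightarrow> F \<in> sets borel \<and> bounded F \<and> F \<subseteq> E"
      and P: "\<And>F. F \<in> \<F> \<Longrightarrow> \<exists>L t \<delta>. subspace L \<and> dim L = d \<and> 0 < t \<and> 0 < \<delta> \<and>
        (\<forall>x\<in>F. \<forall>y\<in>F. infdist (y - x) L \<le> \<eta> * norm (y - x)) \<and>
        (\<forall>x\<in>F. t \<le> \<theta> x \<and> \<theta> x \<le> (1 + \<eta>) * t) \<and>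
        (\<forall>x\<in>F. \<forall>r. 0 < r \<longrightarrow> r < \<delta> \<longrightarrow>
           (1 - \<eta>) * t * r ^ d \<le> measure \<mu> (ball x r) \<and> measure \<mu> (ball x r) \<le> (1 + \<eta>)\<^sup>2 * t * r ^ d)"
      by (rule layer_pieces[OF d E \<theta>m flat \<kappa> \<eta>]) (assumption, assumption, (rule that; assumption))
    have pc: "emeasure \<mu> X \<le> ennreal (G \<eta>) * emeasure N X \<and> emeasure N X \<le> ennreal (G \<eta>) * emeasure \<mu> X"
      if F: "F \<in> \<F>" and X: "X \<in> sets borel" "X \<subseteq> F" for F X
    proof -
      obtain L t \<delta> where L: "subspace L" "dim L = d" and t: "0 < t" and \<delta>: "0 < \<delta>"
        and cone: "\<And>x y. x \<in> F \<Longrightarrow> y \<in> F \<Longrightarrow> infdist (y - x) L \<le> \<eta> * norm (y - x)"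
        and th: "\<And>x. x \<in> F \<Longrightarrow> t \<le> \<theta> x \<and> \<theta> x \<le> (1 + \<eta>) * t"
        and dens: "\<And>x r. x \<in> F \<Longrightarrow> 0 < r \<Longrightarrow> r < \<delta> \<Longrightarrow>
           (1 - \<eta>) * t * r ^ d \<le> measure \<mu> (ball x r) \<and> measure \<mu> (ball x r) \<le> (1 + \<eta>)\<^sup>2 * t * r ^ d"
        using P[OF F] by metis
      have FS: "F \<subseteq> \<Sigma>" "bounded F" using \<F>(4)[OF F] E(2) by auto
      have ab: "0 < (1 - \<eta>) * t" "0 < (1 + \<eta>)\<^sup>2 * t" using \<eta> t by auto
      have p1: "hausdorff_outer d X \<le> ennreal ((1/(1-\<eta>)) ^ d / ((1 - \<eta>) * t)) * emeasure \<mu> X"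
        by (rule piece_comparison(1)[OF L _ _ FS cone ab \<delta> _ _ X]) (use \<eta> dens in auto)
      have p2: "emeasure \<mu> X \<le> ennreal (((1 + \<eta>)\<^sup>2 * t) * (1/(1-\<eta>)) ^ d) * hausdorff_outer d X"
        by (rule piece_comparison(2)[OF L _ _ FS cone ab \<delta> _ _ X]) (use \<eta> dens in auto)
      have H: "hausdorff_outer d X = emeasure (hausdorff_measure d) X" using emeasure_hausdorff_measure[OF X(1)] ..
      have cm: "(\<integral>\<^sup>+x\<in>X. ennreal c \<partial>hausdorff_measure d) = ennreal c * hausdorff_outer d X" for c
        unfolding H using X(1) by (intro nn_integral_cmult_indicator) simp
      have lo: "ennreal t * hausdorff_outer d X \<le> emeasure N X"
        unfolding N[OF X(1)] cm[symmetric]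
        using th X(2) by (intro nn_integral_mono) (auto simp: indicator_def intro!: ennreal_leI)
      have up: "emeasure N X \<le> ennreal ((1 + \<eta>) * t) * hausdorff_outer d X"
        unfolding N[OF X(1)] cm[symmetric]
        using th X(2) by (intro nn_integral_mono) (auto simp: indicator_def intro!: ennreal_leI)
      have q: "1 \<le> 1/(1-\<eta>)" using \<eta> by simp
      have "emeasure \<mu> X \<le> ennreal ((1 + \<eta>)\<^sup>2 * (1/(1-\<eta>)) ^ d) * (ennreal t * hausdorff_outer d X)"
        using p2 t \<eta> by (simp add: ennreal_mult mult_ac)
      also have "\<dots> \<le> ennreal (G \<eta>) * emeasure N X"
        unfolding G_def using q \<eta> by (intro mult_mono lo ennreal_leI mult_left_mono power_increasing) auto
      finally have 1: "emeasure \<mu> X \<le> ennreal (G \<eta>) * emeasure N X" .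
      have "emeasure N X \<le> ennreal ((1 + \<eta>) * t) * (ennreal ((1/(1-\<eta>)) ^ d / ((1 - \<eta>) * t)) * emeasure \<mu> X)"
        using up p1 by (meson mult_left_mono order_trans zero_le)
      also have "\<dots> = ennreal (((1 + \<eta>) * t) * ((1/(1-\<eta>)) ^ d / ((1 - \<eta>) * t))) * emeasure \<mu> X"
        using \<eta> t by (subst ennreal_mult) (auto simp: mult.assoc)
      also have "((1 + \<eta>) * t) * ((1/(1-\<eta>)) ^ d / ((1 - \<eta>) * t)) = (1 + \<eta>) * (1/(1-\<eta>)) ^ (d + 1)"
        using t by simp
      also have "ennreal \<dots> * emeasure \<mu> X \<le> ennreal (G \<eta>) * emeasure \<mu> X"
        unfolding G_def using \<eta>
        by (intro mult_right_mono ennreal_leI) (auto simp: power2_eq_square intro!: divide_right_mono)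
      finally show ?thesis using 1 by blast
    qed
    have AF: "A \<subseteq> \<Union>\<F>" using A(2) \<F>(3) by blast
    show ?thesis
    proof
      show "emeasure \<mu> A \<le> ennreal (G \<eta>) * emeasure N A"
        by (rule measure_le_by_pieces[OF sets_mu Ns \<F>(1) _ A(1) AF]) (use \<F>(4) pc in blast)+
      show "emeasure N A \<le> ennreal (G \<eta>) * emeasure \<mu> A"
        by (rule measure_le_by_pieces[OF Ns sets_mu \<F>(1) _ A(1) AF]) (use \<F>(4) pc in blast)+
    qed
  qed
  have Glim: "(G \<longlongrightarrow> (1 + 0)\<^sup>2 * (1/(1-0)) ^ (d + 1)) (at_right 0)"
    unfolding G_def by (intro tendsto_intros) auto
  \<comment> \<open>The pieces depend on \<eta> but the two measures of A do not, so \<eta> may tend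
    to 0 at the end. An infinite right side is split off because the limit is taken in real
    numbers.\<close>
  have lim: "a \<le> b" if le: "\<And>\<eta>. 0 < \<eta> \<Longrightarrow> \<eta> \<le> 1/2 \<Longrightarrow> a \<le> ennreal (G \<eta>) * b" for a b
  proof (cases "b = \<infinity>")
    case False
    then obtain m where m: "0 \<le> m" "b = ennreal m" by (cases b) auto
    have "((\<lambda>\<eta>. ennreal (G \<eta> * m)) \<longlongrightarrow> ennreal (((1 + 0)\<^sup>2 * (1/(1-0)) ^ (d + 1)) * m)) (at_right 0)"
      by (intro tendsto_ennrealI tendsto_mult Glim tendsto_const)
    moreover have "\<forall>\<^sub>F \<eta> in at_right 0. a \<le> ennreal (G \<eta> * m)"
      unfolding eventually_at_right_field
    proof (intro exI[of _ "1/2"] conjI allI impI)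
      fix \<eta> :: real assume \<eta>: "0 < \<eta>" "\<eta> < 1/2"
      have "0 \<le> G \<eta>" using \<eta> by (simp add: G_def)
      then show "a \<le> ennreal (G \<eta> * m)" using le[of \<eta>] \<eta> m by (simp add: ennreal_mult)
    qed simp
    ultimately have "a \<le> ennreal (((1 + 0)\<^sup>2 * (1/(1-0)) ^ (d + 1)) * m)"
      by (rule tendsto_lowerbound) simp
    then show ?thesis using m by simp
  qed simp
  have "emeasure \<mu> A = emeasure N A"
    by (rule antisym; rule lim) (use both in blast)+
  then show ?thesis using N[OF A(1)] by simp
qed

end

subsection \<open>The decomposition\<close>

context doubling_radon begin

definition flat_points :: "nat \<Rightarrow> 'a set" where
  "flat_points d = {x \<in> Sigma0 \<mu>.
     (\<lambda>k. measure \<mu> (ball x ((1/2) ^ Suc k)) / measure \<mu> (ball x ((1/2) ^ k))) \<longlonglongrightarrow> (1/2) ^ d}"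

lemma flat_points_subset: "flat_points d \<subseteq> \<Sigma>"
  by (auto simp: flat_points_def Sigma0_def)

lemma flat_points_disjoint: "disjoint_family_on flat_points A"
  unfolding disjoint_family_on_def
proof (intro ballI impI)
  fix m n :: nat assume "m \<noteq> n"
  then have "(1/2::real) ^ m \<noteq> (1/2) ^ n" by (simp add: power_one_over)
  then show "flat_points m \<inter> flat_points n = {}"
    unfolding flat_points_def using LIMSEQ_unique by blast
qed

lemma flat_points_union: "Sigma0 \<mu> = (\<Union>d\<in>{0..DIM('a)}. flat_points d)"
proof
  show "Sigma0 \<mu> \<subseteq> (\<Union>d\<in>{0..DIM('a)}. flat_points d)"
  proof
    fix x assume x: "x \<in> Sigma0 \<mu>"
    obtain d \<theta> W where F: "d \<le> DIM('a)" "tangent_flat x d \<theta> W" by (rule tangent_flat_exists[OF x])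
    have "x \<in> flat_points d" unfolding flat_points_def using x tangent_flat_ratio[OF F(2)] by simp
    then show "x \<in> (\<Union>d\<in>{0..DIM('a)}. flat_points d)" using F(1) by auto
  qed
qed (auto simp: flat_points_def)

text \<open>The point has some tangent dimension e by \<open>tangent_flat_exists\<close>; the limit
  of its dyadic ratios forces e = d, and uniqueness of limits identifies the density with
  \<open>theta\<close>.\<close>

lemma flat_points_tangent_flat:
  assumes x: "x \<in> flat_points d"
  obtains W where "tangent_flat x d (theta \<mu> d x) W"
proof -
  have x0: "x \<in> Sigma0 \<mu>" using x by (simp add: flat_points_def)
  obtain e \<theta> W where F: "e \<le> DIM('a)" "tangent_flat x e \<theta> W" by (rule tangent_flat_exists[OF x0])
  have "(1/2::real) ^ d = (1/2) ^ e"
    using x tangent_flat_ratio[OF F(2)] unfolding flat_points_def by (blast intro: LIMSEQ_unique)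
  then have e: "e = d" by (simp add: power_one_over)
  have "theta \<mu> d x = \<theta>"
    unfolding theta_def using tangent_flat_density[OF F(2)] e by (intro tendsto_Lim) auto
  then show thesis using that F(2) e by simp
qed

lemma flat_points_borel: "flat_points d \<in> sets borel"
proof -
  define f where "f k x = measure \<mu> (ball x ((1/2) ^ Suc k)) / measure \<mu> (ball x ((1/2) ^ k))" for k x
  have f: "f k \<in> borel_measurable borel" for k
    unfolding f_def by (intro borel_measurable_divide measure_ball_measurable)
  \<comment> \<open>Tolerances 1/(m+1) turn convergence to a given value into countably many
    conditions, each Borel in x.\<close>
  have lim: "(\<lambda>k. f k x) \<longlonglongrightarrow> c \<longleftrightarrow> (\<forall>m. \<exists>N. \<forall>k\<ge>N. dist (f k x) c < 1 / real (Suc m))" for x c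
  proof
    assume L: "(\<lambda>k. f k x) \<longlonglongrightarrow> c"
    show "\<forall>m. \<exists>N. \<forall>k\<ge>N. dist (f k x) c < 1 / real (Suc m)"
    proof
      fix m
      have "0 < 1 / real (Suc m)" by simp
      then show "\<exists>N. \<forall>k\<ge>N. dist (f k x) c < 1 / real (Suc m)"
        using L unfolding lim_sequentially by blast
    qed
  next
    assume R: "\<forall>m. \<exists>N. \<forall>k\<ge>N. dist (f k x) c < 1 / real (Suc m)"
    show "(\<lambda>k. f k x) \<longlonglongrightarrow> c"
      unfolding lim_sequentially
    proof (intro allI impI)
      fix e :: real assume e: "0 < e"
      obtain m where "1 / real (Suc m) < e" using nat_approx_posE[OF e] by blast
      then show "\<exists>N. \<forall>k\<ge>N. dist (f k x) c < e" using R by (meson less_trans)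
    qed
  qed
  have "flat_points d = Sigma0 \<mu> \<inter> {x. (\<lambda>k. f k x) \<longlonglongrightarrow> (1/2) ^ d}"
    by (auto simp: flat_points_def f_def)
  also have "{x. (\<lambda>k. f k x) \<longlonglongrightarrow> (1/2) ^ d} =
      (\<Inter>m. \<Union>N. \<Inter>k\<in>{N..}. f k -` ball ((1/2) ^ d) (1 / real (Suc m)))"
    unfolding lim
    by (simp only: set_eq_iff mem_Collect_eq INT_iff UN_iff UNIV_I simp_thms ball_simps bex_simps atLeast_iff
        vimage_eq mem_ball dist_commute Ball_def)
  also have "Sigma0 \<mu> \<inter> \<dots> \<in> sets borel"
  proof (intro sets.Int Sigma0_borel sets.countable_INT'' sets.countable_UN'')
    show "f k -` ball ((1/2) ^ d) (1 / real (Suc m)) \<in> sets borel" for k m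
      by (rule measurable_sets_borel[OF f]) simp
  qed auto
  finally show ?thesis .
qed

lemma flat_points_0: "flat_points 0 = {x \<in> \<Sigma>. emeasure \<mu> {x} > 0}"
proof
  show "flat_points 0 \<subseteq> {x \<in> \<Sigma>. emeasure \<mu> {x} > 0}"
  proof
    fix x assume x: "x \<in> flat_points 0"
    obtain W where "tangent_flat x 0 (theta \<mu> 0 x) W" by (rule flat_points_tangent_flat[OF x])
    then show "x \<in> {x \<in> \<Sigma>. emeasure \<mu> {x} > 0}" using tangent_flat_atom flat_points_subset x by blast
  qed
  show "{x \<in> \<Sigma>. emeasure \<mu> {x} > 0} \<subseteq> flat_points 0"
  proof
    fix x assume "x \<in> {x \<in> \<Sigma>. emeasure \<mu> {x} > 0}"
    then have a: "0 < emeasure \<mu> {x}" by simp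
    have m: "measure \<mu> {x} \<noteq> 0" using a radon_emeasure_eq_measure[OF radon, of "{x}"] by auto
    have "(\<lambda>k. measure \<mu> (ball x ((1/2) ^ Suc k)) / measure \<mu> (ball x ((1/2) ^ k)))
        \<longlonglongrightarrow> measure \<mu> {x} / measure \<mu> {x}"
      by (rule tendsto_divide[OF LIMSEQ_Suc[OF measure_singleton_limit] measure_singleton_limit m])
    then show "x \<in> flat_points 0"
      unfolding flat_points_def using atom_in_Sigma0[OF a] m by simp
  qed
qed

lemma atoms_countable: "countable {x. emeasure \<mu> {x} > 0}"
proof -
  have c: "countable {x. emeasure \<mu> {x} > 0 \<and> x \<in> ball 0 (real n)}" for n
  proof -
    let ?M = "measure_on \<mu> (ball 0 (real n))"
    have e: "emeasure ?M X = emeasure \<mu> (X \<inter> ball 0 (real n))" if "X \<in> sets borel" for X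
      using that by (intro emeasure_measure_on) (simp_all add: sets_mu)
    have "emeasure ?M (space ?M) \<noteq> \<infinity>" using e[of UNIV] by (simp add: space_mu emeasure_ball)
    then have "finite_measure ?M" by (rule finite_measureI)
    then have cs: "countable {x. measure ?M {x} \<noteq> 0}" by (rule finite_measure.countable_support)
    have "measure ?M {x} \<noteq> 0" if x: "emeasure \<mu> {x} > 0" "x \<in> ball 0 (real n)" for x
    proof -
      have "emeasure ?M {x} = emeasure \<mu> {x}" using e[of "{x}"] x(2) by (simp add: Int_absorb2)
      then have "measure ?M {x} = measure \<mu> {x}" by (simp add: measure_def)
      then show ?thesis using x(1) radon_emeasure_eq_measure[OF radon, of "{x}"] by auto
    qed
    then show ?thesis by (intro countable_subset[OF _ cs]) auto
  qed
  have "{x. emeasure \<mu> {x} > 0} = (\<Union>n. {x. emeasure \<mu> {x} > 0 \<and> x \<in> ball 0 (real n)})"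
    using reals_Archimedean2 by auto
  then show ?thesis using c by simp
qed

text \<open>\<open>theta\<close> is a limit over a continuum of radii. The limit along dyadic radii
  is a Borel function on the whole space and has the same value wherever the full limit
  exists.\<close>

lemma density_layer_borel_version:
  obtains \<theta> where "\<theta> \<in> borel_measurable borel" "\<And>x. x \<in> flat_points d \<Longrightarrow> \<theta> x = theta \<mu> d x"
proof (rule that[of "\<lambda>x. lim (\<lambda>k. measure \<mu> (ball x ((1/2) ^ k)) / ((1/2) ^ k) ^ d)"])
  show "(\<lambda>x. lim (\<lambda>k. measure \<mu> (ball x ((1/2) ^ k)) / ((1/2) ^ k) ^ d)) \<in> borel_measurable borel"
    by (intro borel_measurable_lim_metric borel_measurable_divide measure_ball_measurable borel_measurable_const)
  fix x assume x: "x \<in> flat_points d"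
  obtain W where "tangent_flat x d (theta \<mu> d x) W" by (rule flat_points_tangent_flat[OF x])
  from filterlim_compose[OF tangent_flat_density[OF this] dyadic_at_right]
  show "lim (\<lambda>k. measure \<mu> (ball x ((1/2) ^ k)) / ((1/2) ^ k) ^ d) = theta \<mu> d x" by (rule limI)
qed

lemma density_layer_properties:
  fixes k :: int
  assumes d: "d \<le> DIM('a)"
  defines "E \<equiv> density_layer \<mu> d (flat_points d) k"
  shows "rectifiable d E"
    and "\<forall>R>0. hausdorff_outer d (E \<inter> ball 0 R) < \<infinity>"
    and "absolutely_continuous (measure_on \<mu> E) (measure_on (hausdorff_measure d) E)"
    and "absolutely_continuous (measure_on (hausdorff_measure d) E) (measure_on \<mu> E)"
    and "\<forall>A\<in>sets borel. A \<subseteq> E \<longrightarrow> emeasure \<mu> A = (\<integral>\<^sup>+x\<in>A. ennreal (theta \<mu> d x) \<partial>hausdorff_measure d)"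
proof -
  let ?H = "hausdorff_measure d :: 'a measure"
  let ?\<kappa> = "2 powi k :: real"
  obtain \<theta> where \<theta>: "\<theta> \<in> borel_measurable borel" "\<And>x. x \<in> flat_points d \<Longrightarrow> \<theta> x = theta \<mu> d x"
    by (rule density_layer_borel_version[of d]) (rule that; assumption)
  have EF: "E \<subseteq> flat_points d" by (auto simp: E_def density_layer_def)
  have ES: "E \<subseteq> \<Sigma>" using EF flat_points_subset by blast
  have Eeq: "E = flat_points d \<inter> \<theta> -` {?\<kappa>..<2 powi (k + 1)}"
    by (auto simp: E_def density_layer_def \<theta>(2))
  have Eb: "E \<in> sets borel"
    unfolding Eeq by (intro sets.Int flat_points_borel measurable_sets_borel[OF \<theta>(1)]) simp
  have flat: "\<exists>W. tangent_flat x d (\<theta> x) W" if "x \<in> E" for x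
    using flat_points_tangent_flat[of x d] EF that \<theta>(2)[of x] by (metis subsetD)
  have \<kappa>: "0 < ?\<kappa>" "\<And>x. x \<in> E \<Longrightarrow> ?\<kappa> \<le> \<theta> x" by (auto simp: Eeq)
  show "rectifiable d E" by (rule layer_rectifiable[OF d Eb ES \<theta>(1) flat \<kappa>])
  have M: "emeasure \<mu> A = (\<integral>\<^sup>+x\<in>A. ennreal (theta \<mu> d x) \<partial>?H)" if A: "A \<in> sets borel" "A \<subseteq> E" for A
  proof -
    have "emeasure \<mu> A = (\<integral>\<^sup>+x\<in>A. ennreal (\<theta> x) \<partial>?H)" by (rule layer_measure[OF d Eb ES \<theta>(1) flat \<kappa> A])
    also have "\<dots> = (\<integral>\<^sup>+x\<in>A. ennreal (theta \<mu> d x) \<partial>?H)"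
      using A(2) EF \<theta>(2) by (intro nn_integral_cong) (auto simp: indicator_def)
    finally show ?thesis .
  qed
  then show "\<forall>A\<in>sets borel. A \<subseteq> E \<longrightarrow> emeasure \<mu> A = (\<integral>\<^sup>+x\<in>A. ennreal (theta \<mu> d x) \<partial>?H)" by blast
  \<comment> \<open>The lower bound \<open>2 powi k\<close> for the density yields both the local
    finiteness of Hausdorff measure on E and its vanishing on the \<mu>-null subsets of E.\<close>
  have lower: "ennreal ?\<kappa> * emeasure ?H A \<le> emeasure \<mu> A" if A: "A \<in> sets borel" "A \<subseteq> E" for A
  proof -
    have "ennreal ?\<kappa> * emeasure ?H A = (\<integral>\<^sup>+x\<in>A. ennreal ?\<kappa> \<partial>?H)"
      using A(1) by (intro nn_integral_cmult_indicator[symmetric]) simp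
    also have "\<dots> \<le> (\<integral>\<^sup>+x\<in>A. ennreal (theta \<mu> d x) \<partial>?H)"
      using A(2) by (intro nn_integral_mono) (auto simp: indicator_def E_def density_layer_def intro!: ennreal_leI)
    finally show ?thesis using M[OF A] by simp
  qed
  have \<kappa>0: "ennreal ?\<kappa> \<noteq> 0" using \<kappa>(1) by (simp add: ennreal_eq_0_iff not_le)
  show "\<forall>R>0. hausdorff_outer d (E \<inter> ball 0 R) < \<infinity>"
  proof (intro allI impI)
    fix R :: real
    have B: "E \<inter> ball 0 R \<in> sets borel" "E \<inter> ball 0 R \<subseteq> E" using Eb by auto
    have "ennreal ?\<kappa> * emeasure ?H (E \<inter> ball 0 R) \<le> emeasure \<mu> (ball 0 R)"
      by (rule order_trans[OF lower[OF B] emeasure_mono]) (auto simp: sets_mu)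
    also have "\<dots> < \<infinity>" by (simp add: emeasure_ball)
    finally have "emeasure ?H (E \<inter> ball 0 R) \<noteq> \<infinity>" using \<kappa>0 by (auto simp: ennreal_mult_top)
    then show "hausdorff_outer d (E \<inter> ball 0 R) < \<infinity>"
      using emeasure_hausdorff_measure[OF B(1), of d] by (simp add: less_top)
  qed
  have null_mu: "A \<in> null_sets (measure_on \<mu> E) \<longleftrightarrow> A \<in> sets borel \<and> emeasure \<mu> (A \<inter> E) = 0" for A
    using emeasure_measure_on[of E \<mu> A] Eb by (auto simp: null_sets_def sets_mu)
  have null_H: "A \<in> null_sets (measure_on ?H E) \<longleftrightarrow> A \<in> sets borel \<and> emeasure ?H (A \<inter> E) = 0" for A
    using emeasure_measure_on[of E ?H A] Eb by (auto simp: null_sets_def)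
  show "absolutely_continuous (measure_on \<mu> E) (measure_on ?H E)"
    unfolding absolutely_continuous_def
  proof
    fix A assume "A \<in> null_sets (measure_on \<mu> E)"
    then have A: "A \<in> sets borel" "emeasure \<mu> (A \<inter> E) = 0" by (auto simp: null_mu)
    then have "ennreal ?\<kappa> * emeasure ?H (A \<inter> E) \<le> 0" using lower[of "A \<inter> E"] Eb by auto
    then show "A \<in> null_sets (measure_on ?H E)" unfolding null_H using A(1) \<kappa>0 by simp
  qed
  show "absolutely_continuous (measure_on ?H E) (measure_on \<mu> E)"
    unfolding absolutely_continuous_def
  proof
    fix A assume "A \<in> null_sets (measure_on ?H E)"
    then have A: "A \<in> sets borel" "emeasure ?H (A \<inter> E) = 0" by (auto simp: null_H)
    have AE: "A \<inter> E \<in> sets borel" "A \<inter> E \<subseteq> E" using A(1) Eb by auto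
    have "A \<inter> E \<in> null_sets ?H" using A(2) AE by (intro null_setsI) auto
    then have "emeasure \<mu> (A \<inter> E) = 0" unfolding M[OF AE] by (rule nn_integral_null_set)
    then show "A \<in> null_sets (measure_on \<mu> E)" unfolding null_mu using A(1) by simp
  qed
qed

end

section \<open>Assembly of the statement\<close>

lemma doubling_radonI:
  assumes "radon_measure \<mu>" "doubling_measure \<mu>"
  obtains C where "doubling_radon \<mu> C"
proof -
  obtain C where C: "0 < C" "\<And>x r. x \<in> msupport \<mu> \<Longrightarrow> 0 < r \<Longrightarrow>
      emeasure \<mu> (ball x (2 * r)) \<le> ennreal C * emeasure \<mu> (ball x r)"
    using assms(2) unfolding doubling_measure_def by blast
  have "doubling_radon \<mu> (max 1 C)"
  proof
    fix x r assume x: "x \<in> msupport \<mu>" "(0::real) < r"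
    have "ennreal (measure \<mu> (ball x (2 * r))) \<le> ennreal (C * measure \<mu> (ball x r))"
      using C(2)[OF x] C(1)
        radon_emeasure_eq_measure[OF assms(1) bounded_ball, of x r] radon_emeasure_eq_measure[OF assms(1) bounded_ball, of x "2 * r"]
      by (simp add: ennreal_mult)
    then have "measure \<mu> (ball x (2 * r)) \<le> C * measure \<mu> (ball x r)"
      using C(1) by (simp add: ennreal_le_iff)
    also have "\<dots> \<le> max 1 C * measure \<mu> (ball x r)" by (intro mult_right_mono) auto
    finally show "measure \<mu> (ball x (2 * r)) \<le> max 1 C * measure \<mu> (ball x r)" .
  qed (use assms(1) in auto)
  then show thesis by (rule that)
qed

theorem theorem1p5:
  fixes \<mu> :: "'a::euclidean_space measure"
  assumes "radon_measure \<mu>" and "doubling_measure \<mu>"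
  shows "\<exists>S :: nat \<Rightarrow> 'a set.
    (\<forall>d\<le>DIM('a). S d \<in> sets borel \<and> S d \<subseteq> msupport \<mu>) \<and>
    disjoint_family_on S {0..DIM('a)} \<and>
    Sigma0 \<mu> = (\<Union>d\<in>{0..DIM('a)}. S d) \<and>
    \<comment> \<open>(1)\<close>
    (S 0 = {x \<in> msupport \<mu>. emeasure \<mu> {x} > 0} \<and>
     countable (S 0) \<and>
     (\<forall>x\<in>S 0. x isolated_in (msupport \<mu>))) \<and>
    \<comment> \<open>(2)\<close>
    (\<forall>d\<in>{1..DIM('a)}. \<forall>x\<in>S d.
       ((\<lambda>r. measure \<mu> (ball x r) / r ^ d) \<longlongrightarrow> theta \<mu> d x) (at_right 0) \<and>
       0 < theta \<mu> d x) \<and>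
    \<comment> \<open>(3)\<close>
    (\<forall>d\<in>{1..DIM('a)}. \<forall>x\<in>S d. \<exists>W.
       tangent_plane d (msupport \<mu>) x W \<and>
       (let W' = (\<lambda>w. w - x) ` W in
          tangent_measures \<mu> x =
            {scale_measure (ennreal c) (measure_on (hausdorff_measure d) W') | c::real. c \<ge> 0} \<and>
          weakly_converges (blowup \<mu> x) (measure_on (hausdorff_measure d) W') (at_right 0))) \<and>
    \<comment> \<open>(4)\<close>
    (\<forall>d\<in>{1..DIM('a)}. \<forall>k::int.
       let E = density_layer \<mu> d (S d) k in
         rectifiable d E \<and>
         (\<forall>R>0. hausdorff_outer d (E \<inter> ball 0 R) < \<infinity>) \<and>
         absolutely_continuous (measure_on \<mu> E) (measure_on (hausdorff_measure d) E) \<and>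
         absolutely_continuous (measure_on (hausdorff_measure d) E) (measure_on \<mu> E) \<and>
         (\<forall>A\<in>sets borel. A \<subseteq> E \<longrightarrow>
            emeasure \<mu> A = (\<integral>\<^sup>+ x \<in> A. ennreal (theta \<mu> d x) \<partial>hausdorff_measure d)))"
proof -
  obtain C where "doubling_radon \<mu> C" by (rule doubling_radonI[OF assms])
  then interpret doubling_radon \<mu> C .
  show ?thesis
  proof (rule exI[of _ flat_points], intro conjI allI ballI impI)
    fix d
    show "flat_points d \<in> sets borel" "flat_points d \<subseteq> msupport \<mu>"
      by (rule flat_points_borel flat_points_subset)+
  next
    show "disjoint_family_on flat_points {0..DIM('a)}" by (rule flat_points_disjoint)
    show "Sigma0 \<mu> = (\<Union>d\<in>{0..DIM('a)}. flat_points d)" by (rule flat_points_union)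
    show "flat_points 0 = {x \<in> msupport \<mu>. emeasure \<mu> {x} > 0}" by (rule flat_points_0)
    show "countable (flat_points 0)"
      unfolding flat_points_0 by (rule countable_subset[OF _ atoms_countable]) auto
  next
    fix x assume "x \<in> flat_points 0"
    then have x: "x \<in> msupport \<mu>" "0 < emeasure \<mu> {x}" by (auto simp: flat_points_0)
    obtain s where s: "0 < s" "msupport \<mu> \<inter> ball x s \<subseteq> {x}"
      by (rule atom_isolated[OF x(2)])
    have "ball x s \<inter> msupport \<mu> = {x}" using s x(1) by auto
    then show "x isolated_in (msupport \<mu>)"
      unfolding isolated_in_def using x(1) by (intro conjI exI[of _ "ball x s"]) auto
  next
    fix d x assume x: "x \<in> flat_points d"
    obtain W where F: "tangent_flat x d (theta \<mu> d x) W" by (rule flat_points_tangent_flat[OF x])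
    show "((\<lambda>r. measure \<mu> (ball x r) / r ^ d) \<longlongrightarrow> theta \<mu> d x) (at_right 0)"
      by (rule tangent_flat_density[OF F])
    show "0 < theta \<mu> d x" by (rule tangent_flatD(3)[OF F])
  next
    fix d x assume x: "x \<in> flat_points d"
    have xS: "x \<in> msupport \<mu>" using x flat_points_subset by blast
    obtain W where F: "tangent_flat x d (theta \<mu> d x) W" by (rule flat_points_tangent_flat[OF x])
    \<comment> \<open>The witness is the translate of the vector space W to x; subtracting x gives W
      back, as the clauses on blow-ups require.\<close>
    have "(\<lambda>w. w - x) ` (+) x ` W = W" by (simp add: image_image)
    then show "\<exists>W. tangent_plane d (msupport \<mu>) x W \<and>
       (let W' = (\<lambda>w. w - x) ` W in
          tangent_measures \<mu> x =
            {scale_measure (ennreal c) (measure_on (hausdorff_measure d) W') | c::real. c \<ge> 0} \<and>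
          weakly_converges (blowup \<mu> x) (measure_on (hausdorff_measure d) W') (at_right 0))"
      unfolding Let_def
      using tangent_flat_tangent_plane[OF F xS] tangent_flat_tangent_measures[OF F] tangent_flat_blowup[OF F xS]
      by (intro exI[of _ "(+) x ` W"]) simp
  next
    fix d and k :: int assume "d \<in> {1..DIM('a)}"
    then have d: "d \<le> DIM('a)" by simp
    show "let E = density_layer \<mu> d (flat_points d) k in
         rectifiable d E \<and>
         (\<forall>R>0. hausdorff_outer d (E \<inter> ball 0 R) < \<infinity>) \<and>
         absolutely_continuous (measure_on \<mu> E) (measure_on (hausdorff_measure d) E) \<and>
         absolutely_continuous (measure_on (hausdorff_measure d) E) (measure_on \<mu> E) \<and>
         (\<forall>A\<in>sets borel. A \<subseteq> E \<longrightarrow>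
            emeasure \<mu> A = (\<integral>\<^sup>+ x \<in> A. ennreal (theta \<mu> d x) \<partial>hausdorff_measure d))"
      unfolding Let_def using density_layer_properties[OF d, of k] by blast
  qed
qed

end
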